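(* Let $k\in\mathbb{Z}^+$, and let $u_0\in Z_{s,r}$ with $s>s_0$, $r\in\mathbb{Z}^+$ and $r>s$. Then the solution $u\in C([-T,T]:Z_{s,s})$ of the initial value problem $\partial_t u+\partial_x^3u+u^k\,\partial_x u=0$, $u(x,0)=u_0(x)$, also satisfies that for any $b>0$ $$\int_b^{\infty}(\partial_x^ru(x,t))^2\,dx<\infty\qquad\text{for any } t\in(0,T],$$ and $$\int_{-\infty}^{-b}(\partial_x^ru(x,t))^2\,dx<\infty\qquad\text{for any } t\in[-T,0).$$
   Context: $\mathbb{Z}^+=\{1,2,3,\dots\}$. All functions are real-valued. $H^s(\mathbb{R})=(1-\partial_x^2)^{-s/2}L^2(\mathbb{R})$ is the usual Sobolev space, and $Z_{s,r}=H^s(\mathbb{R})\cap L^2(|x|^r\,dx)$. Derivatives of rough functions are taken in the sense of distributions; for a distribution $f$, $\int_I f^2dx<\infty$ means that the restriction of $f$ to $I$ belongs to $L^2(I)$. $s_0$ denotes a fixed real number $s_0>3/4$ (written $3/4^+$ in the paper). The power $k$ is fixed. The notion of solution comes from the following known well-posedness result: if $u_0\in H^{s_0}(\mathbb{R})$, then there exist $T=T(\|u_0\|_{H^{s_0}};k)>0$ and a unique solution $u$ of $$\partial_t u+\partial_x^3u+u^k\partial_x u=0,\qquad u(x,0)=u_0(x),$$ such that, with $J=(1-\partial_x^2)^{1/2}$: (i) $u\in C([-T,T]:H^{s_0}(\mathbb{R}))$; (ii) $\partial_x u\in L^4([-T,T]:L^\infty(\mathbb{R}))$; (iii) $\sup_x\int_{-T}^T|J^\rho\partial_xu(x,t)|^2\,dt<\infty$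 for $\rho\in[0,s_0]$; (iv) $\int_{-\infty}^\infty\sup_{-T\le t\le T}|u(x,t)|^2\,dx<\infty$. Moreover, the map $u_0\mapsto u$ is locally continuous from $H^{s_0}(\mathbb{R})$ into the class defined by (i)--(iv). It is also known that for data in $Z_{s,s}$ (in particular for data in $Z_{s,r}$ with $r>s$) this solution belongs to $C([-T,T]:Z_{s,s})$. *)

theory Defs
  imports "HOL-Probability.Probability"
begin

section \<open>Smooth functions, test functions, Schwartz functions\<close>

text \<open>Directional derivative; for functions on the reals \<open>pd 1\<close> is the ordinary derivative, and
  for functions of \<open>(t, x)\<close> the operators \<open>pd (1, 0)\<close> and \<open>pd (0, 1)\<close> are the partial derivatives
  in \<open>t\<close> and in \<open>x\<close>.\<close>

definition pd :: "'a::euclidean_space \<Rightarrow> ('a \<Rightarrow> 'b::real_normed_vector) \<Rightarrow> 'a \<Rightarrow> 'b" where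
  "pd v f = (\<lambda>p. frechet_derivative f (at p) v)"

primrec Ck :: "nat \<Rightarrow> ('a::euclidean_space \<Rightarrow> 'b::real_normed_vector) \<Rightarrow> bool" where
  "Ck 0 f \<longleftrightarrow> continuous_on UNIV f"
| "Ck (Suc n) f \<longleftrightarrow> (\<forall>p. f differentiable (at p)) \<and> (\<forall>v. Ck n (pd v f))"

definition smooth :: "('a::euclidean_space \<Rightarrow> 'b::real_normed_vector) \<Rightarrow> bool" where
  "smooth f \<longleftrightarrow> (\<forall>n. Ck n f)"

definition test_function :: "'a::euclidean_space set \<Rightarrow> ('a \<Rightarrow> real) \<Rightarrow> bool" where
  "test_function S \<phi> \<longleftrightarrow>
     smooth \<phi> \<and> (\<exists>K. compact K \<and> K \<subseteq> S \<and> (\<forall>p. p \<notin> K \<longrightarrow> \<phi> p = 0))"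

definition schwartz :: "(real \<Rightarrow> complex) \<Rightarrow> bool" where
  "schwartz \<phi> \<longleftrightarrow>
     smooth \<phi> \<and> (\<forall>m n. \<exists>C. \<forall>x. \<bar>x\<bar> ^ m * norm ((pd 1 ^^ n) \<phi> x) \<le> C)"

section \<open>Square integrability and weak derivatives\<close>

text \<open>Elements of \<open>L\<^sup>2\<close> and of the spaces below are represented by functions; all notions are
  invariant under changes on null sets unless said otherwise.\<close>

definition sq_integrable :: "'a measure \<Rightarrow> ('a \<Rightarrow> real) \<Rightarrow> bool" where
  "sq_integrable M f \<longleftrightarrow> f \<in> borel_measurable M \<and> integrable M (\<lambda>x. (f x)\<^sup>2)"

definition L2_norm :: "'a measure \<Rightarrow> ('a \<Rightarrow> real) \<Rightarrow> real" where
  "L2_norm M f = sqrt (LINT x|M. (f x)\<^sup>2)"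

definition locally_integrable_on :: "real set \<Rightarrow> (real \<Rightarrow> real) \<Rightarrow> bool" where
  "locally_integrable_on S f \<longleftrightarrow> (\<forall>K. compact K \<and> K \<subseteq> S \<longrightarrow> set_integrable lebesgue K f)"

text \<open>On the open set \<open>S\<close>, the distributional derivative of order \<open>n\<close> of \<open>f\<close> is the function
  \<open>g\<close>.\<close>

definition has_weak_deriv :: "real set \<Rightarrow> nat \<Rightarrow> (real \<Rightarrow> real) \<Rightarrow> (real \<Rightarrow> real) \<Rightarrow> bool" where
  "has_weak_deriv S n f g \<longleftrightarrow>
     locally_integrable_on S f \<and> locally_integrable_on S g \<and>
     (\<forall>\<phi>. test_function S \<phi> \<longrightarrow>
        (LINT x|lebesgue. g x * \<phi> x) = (-1) ^ n * (LINT x|lebesgue. f x * (pd 1 ^^ n) \<phi> x))"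

text \<open>The meaning of \<open>\<integral>\<^sub>S (\<partial>\<^sub>x\<^sup>n f)\<^sup>2 dx < \<infinity>\<close>.\<close>

definition weak_deriv_sq_integrable_on :: "real set \<Rightarrow> nat \<Rightarrow> (real \<Rightarrow> real) \<Rightarrow> bool" where
  "weak_deriv_sq_integrable_on S n f \<longleftrightarrow>
     (\<exists>g. has_weak_deriv S n f g \<and> sq_integrable (lebesgue_on S) g)"

section \<open>Bessel potentials and the spaces \<open>H\<^sup>s\<close>, \<open>Z\<^sub>s\<^sub>,\<^sub>r\<close>\<close>

definition fourier :: "(real \<Rightarrow> complex) \<Rightarrow> real \<Rightarrow> complex" where
  "fourier \<phi> \<xi> = (LINT x|lebesgue. \<phi> x * exp (- \<i> * of_real (x * \<xi>)))"

text \<open>The operator \<open>J\<^sup>\<sigma> = (1 - \<partial>\<^sub>x\<^sup>2)\<^bsup>\<sigma>/2\<^esup>\<close> on Schwartz functions, as a Fourier multiplier.\<close>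

definition bessel :: "real \<Rightarrow> (real \<Rightarrow> complex) \<Rightarrow> real \<Rightarrow> complex" where
  "bessel \<sigma> \<phi> x = 1 / of_real (2 * pi) *
     (LINT \<xi>|lebesgue. of_real ((1 + \<xi>\<^sup>2) powr (\<sigma> / 2)) * fourier \<phi> \<xi> * exp (\<i> * of_real (x * \<xi>)))"

text \<open>\<open>J\<^sup>\<sigma> \<partial>\<^sub>x\<^sup>n f = g\<close> as tempered distributions: \<open>J\<^sup>\<sigma>\<close> is symmetric and \<open>\<partial>\<^sub>x\<close> antisymmetric for
  the bilinear pairing with Schwartz functions. The functions \<open>f\<close> and \<open>g\<close> are real because the
  symbol of \<open>J\<^sup>\<sigma>\<close> is real and even.\<close>

definition bessel_deriv_eq :: "real \<Rightarrow> nat \<Rightarrow> (real \<Rightarrow> real) \<Rightarrow> (real \<Rightarrow> real) \<Rightarrow> bool" where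
  "bessel_deriv_eq \<sigma> n f g \<longleftrightarrow>
     (\<forall>\<phi>. schwartz \<phi> \<longrightarrow>
        integrable lebesgue (\<lambda>x. f x *\<^sub>R \<phi> x) \<and> integrable lebesgue (\<lambda>x. g x *\<^sub>R \<phi> x) \<and>
        (LINT x|lebesgue. g x *\<^sub>R \<phi> x) =
          (-1) ^ n * (LINT x|lebesgue. f x *\<^sub>R (pd 1 ^^ n) (bessel \<sigma> \<phi>) x))"

text \<open>\<open>H\<^sup>s = J\<^bsup>-s\<^esup> L\<^sup>2\<close>, for \<open>s \<ge> 0\<close> only: for negative \<open>s\<close> this would be just the part of \<open>H\<^sup>s\<close>
  consisting of functions.\<close>

definition Hs :: "real \<Rightarrow> (real \<Rightarrow> real) set" where
  "Hs s = {f. \<exists>g. sq_integrable lebesgue g \<and> bessel_deriv_eq (- s) 0 g f}"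

text \<open>The function \<open>g\<close> with \<open>f = J\<^bsup>-s\<^esup> g\<close> is unique up to null sets.\<close>

definition Hs_norm :: "real \<Rightarrow> (real \<Rightarrow> real) \<Rightarrow> real" where
  "Hs_norm s f =
     L2_norm lebesgue (SOME g. sq_integrable lebesgue g \<and> bessel_deriv_eq (- s) 0 g f)"

definition Z :: "real \<Rightarrow> real \<Rightarrow> (real \<Rightarrow> real) set" where
  "Z s r = {f. f \<in> Hs s \<and> integrable lebesgue (\<lambda>x. \<bar>x\<bar> powr r * (f x)\<^sup>2)}"

definition Z_norm :: "real \<Rightarrow> real \<Rightarrow> (real \<Rightarrow> real) \<Rightarrow> real" where
  "Z_norm s r f = Hs_norm s f + sqrt (LINT x|lebesgue. \<bar>x\<bar> powr r * (f x)\<^sup>2)"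

text \<open>\<open>u \<in> C([-T, T] : X)\<close>, where \<open>N\<close> is the norm of \<open>X\<close>. Functions of time and space are
  written \<open>u t x\<close>.\<close>

definition continuous_curve ::
  "(real \<Rightarrow> real) set \<Rightarrow> ((real \<Rightarrow> real) \<Rightarrow> real) \<Rightarrow> real \<Rightarrow> (real \<Rightarrow> real \<Rightarrow> real) \<Rightarrow> bool" where
  "continuous_curve X N T u \<longleftrightarrow>
     (\<forall>t\<in>{-T..T}. u t \<in> X) \<and>
     (\<forall>t\<in>{-T..T}. ((\<lambda>t'. N (\<lambda>x. u t' x - u t x)) \<longlongrightarrow> 0) (at t within {-T..T}))"

section \<open>Solutions of the k-generalized KdV equation\<close>

text \<open>\<open>\<partial>\<^sub>t u + \<partial>\<^sub>x\<^sup>3 u + u\<^sup>k v = 0\<close> in the sense of distributions on \<open>(-T, T) \<times> \<real>\<close>; used with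
  \<open>v = \<partial>\<^sub>x u\<close>. The integrals are iterated since \<open>u\<close>, being given as a curve of equivalence classes,
  need not be jointly measurable.\<close>

definition gkdv_equation ::
  "nat \<Rightarrow> real \<Rightarrow> (real \<Rightarrow> real \<Rightarrow> real) \<Rightarrow> (real \<Rightarrow> real \<Rightarrow> real) \<Rightarrow> bool" where
  "gkdv_equation k T u v \<longleftrightarrow>
     (\<forall>\<phi> :: real \<times> real \<Rightarrow> real. test_function ({-T<..<T} \<times> UNIV) \<phi> \<longrightarrow>
        (LINT t|lebesgue. LINT x|lebesgue.
           - u t x * pd (1, 0) \<phi> (t, x) - u t x * (pd (0, 1) ^^ 3) \<phi> (t, x)
           + (u t x) ^ k * v t x * \<phi> (t, x)) = 0)"

text \<open>\<open>u\<close> is the solution on \<open>[-T, T]\<close> with datum \<open>u\<^sub>0\<close> in the class of the well-posedness theory in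
  \<open>H\<^bsup>s0\<^esup>\<close>. In the last clause \<open>w t\<close> is the continuous representative of \<open>u t\<close> (recall
  \<open>s0 > 1/2\<close>), so that the pointwise supremum over \<open>t\<close> makes sense.\<close>

definition gkdv_solution ::
  "nat \<Rightarrow> real \<Rightarrow> real \<Rightarrow> (real \<Rightarrow> real) \<Rightarrow> (real \<Rightarrow> real \<Rightarrow> real) \<Rightarrow> bool" where
  "gkdv_solution k s0 T u0 u \<longleftrightarrow>
     (AE x in lebesgue. u 0 x = u0 x) \<and>
     continuous_curve (Hs s0) (Hs_norm s0) T u \<and>
     (\<exists>v. (\<lambda>(t, x). v t x) \<in> borel_measurable borel \<and>
          (AE t in lebesgue. t \<in> {-T..T} \<longrightarrow> has_weak_deriv UNIV 1 (u t) (v t)) \<and>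
          (\<integral>\<^sup>+t\<in>{-T..T}. (esssup lebesgue (\<lambda>x. ennreal \<bar>v t x\<bar>)) ^ 4 \<partial>lebesgue) < \<infinity> \<and>
          gkdv_equation k T u v) \<and>
     (\<forall>\<rho>\<in>{0..s0}. \<exists>w. (\<lambda>(t, x). w t x) \<in> borel_measurable borel \<and>
          (AE t in lebesgue. t \<in> {-T..T} \<longrightarrow> bessel_deriv_eq \<rho> 1 (u t) (w t)) \<and>
          (SUP x. \<integral>\<^sup>+t\<in>{-T..T}. ennreal ((w t x)\<^sup>2) \<partial>lebesgue) < \<infinity>) \<and>
     (\<exists>w. (\<forall>t\<in>{-T..T}. continuous_on UNIV (w t) \<and> (AE x in lebesgue. w t x = u t x)) \<and>
          (\<integral>\<^sup>+x. (SUP t\<in>{-T..T}. ennreal ((w t x)\<^sup>2)) \<partial>lebesgue) < \<infinity>)"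

end

theory Submission
  imports Defs "HOL-Computational_Algebra.Polynomial"
begin

text \<open>
  Kato's smoothing effect on the right half-line, iterated. The Sobolev embedding makes \<open>u\<close> a
  bounded continuous function of \<open>(t, x)\<close>, and the bound on \<open>\<partial>\<^sub>x u\<close> in \<open>L\<^sup>4\<^sub>t L\<^sup>\<infinity>\<^sub>x\<close> makes \<open>u(t)\<close>
  Lipschitz with a constant \<open>a(t)\<close> in \<open>L\<^sup>4\<close>. For a nondecreasing weight \<open>\<chi>\<close> that vanishes near 0 and
  grows like \<open>x\<^sup>n\<close>, the energy identity for \<open>v = \<partial>\<^sub>x\<^sup>j u\<close>,
  \<open>d/dt \<integral> v\<^sup>2 \<chi> = - 3 \<integral> (\<partial>\<^sub>x v)\<^sup>2 \<chi>' + \<integral> v\<^sup>2 \<chi>''' - 2 \<integral> v \<chi> \<partial>\<^sub>x\<^sup>j (u\<^sup>k \<partial>\<^sub>x u)\<close>,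
  shows that a weighted bound of order \<open>n\<close> at level \<open>j\<close> yields a bound of order \<open>n - 1\<close> for
  \<open>\<integral> (\<partial>\<^bsup>j+1\<^esup>\<^sub>x u)\<^sup>2\<close>, integrated in time; starting from a time where the latter is finite, one moves
  on to level \<open>j + 1\<close>. The weight \<open>x\<^sup>r\<close> of the datum thus pays for \<open>r\<close> derivatives. At level 0 the
  energy is closed by Gronwall's lemma.

  As \<open>u\<close> has no derivatives to start with, everything is done for mollifications of \<open>u\<close> in \<open>x\<close>, with
  bounds uniform in the scale \<open>e\<close>. The mollified nonlinearity differs from \<open>U\<^sup>k \<partial>\<^sub>x\<^bsup>j+1\<^esup> U\<close> by a commutator
  and by lower order monomials; the Lipschitz bound controls the commutator by \<open>a(t)\<close> times
  \<open>\<partial>\<^sub>x\<^sup>j u\<close>. The uniform bounds say that \<open>\<phi> \<mapsto> \<integral> u \<partial>\<^sub>x\<^sup>r \<phi>\<close> is bounded on \<open>L\<^sup>2(b, \<infinity>)\<close>, and Riesz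
  representation gives the weak derivative. Negative times follow from the symmetry
  \<open>(t, x) \<mapsto> (-t, -x)\<close> of the equation.
\<close>

section \<open>Smooth functions\<close>

text \<open>The fourth power of 1 + a(t) has this origin: for k \<ge> 2, level 2 contains a product
  of three factors u_x; two are bounded by a, one stays in L^2, so the square of the remainder costs
  (1 + a)^4. From level 3 on, Sobolev's inequality with the norms of earlier levels takes over the
  role of a. Young's inequality puts (1 + a)^(-4) on the squared remainder and (1 + a)^4 / \<kappa>
  on the energy; the L^4 bound makes the latter integrable in time, and a large \<kappa> lets it be
  absorbed. Three parameters must disappear: the scale e, the inner scale d and the truncation
  radius R of the weight. For fixed e and R all energies are trivially finite, which justifies
  suprema and exchanges of integrals, but no bound that is kept may contain them. Each level spends
  part of the half-line and of the time interval, since mollification widens supports and the energy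
  of a level j \<ge> 1 may be infinite at t = 0. Hence intermediate bounds are stated for every b >
  0 and every starting time \<tau> > 0, and only the exponent of the weight is counted.\<close>

abbreviation D :: "nat \<Rightarrow> (real \<Rightarrow> 'b::real_normed_vector) \<Rightarrow> real \<Rightarrow> 'b" where
  "D n f \<equiv> (pd 1 ^^ n) f"

lemma pd_has_derivative: "(f has_derivative f') (at x) \<Longrightarrow> pd v f x = f' v"
  by (simp add: pd_def frechet_derivative_at[symmetric])

lemma pd_has_vector_derivative:
  fixes f :: "real \<Rightarrow> 'b::real_normed_vector"
  shows "(f has_vector_derivative f') (at x) \<Longrightarrow> pd v f x = v *\<^sub>R f'"
  by (simp add: has_vector_derivative_def pd_has_derivative)

text \<open>Presenting a function together with its candidate derivatives \<open>f n\<close> is how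
  the concrete smooth functions below are handled. As \<open>pd v\<close> on the reals also
  multiplies by v, the induction for \<open>Ck\<close> runs over all scalar multiples of all members
  of the sequence.\<close>

lemma smooth_sequence:
  fixes f :: "nat \<Rightarrow> real \<Rightarrow> 'b::real_normed_vector"
  assumes d: "\<And>n x. (f n has_vector_derivative f (Suc n) x) (at x)"
  shows "smooth (f 0)" "D n (f 0) = f n"
proof -
  have pd: "pd v (\<lambda>x. c *\<^sub>R f m x) = (\<lambda>x. (v * c) *\<^sub>R f (Suc m) x)" for c v m
    by (rule ext, subst pd_has_vector_derivative[where f'="c *\<^sub>R f (Suc m) x" for x])
      (auto intro!: derivative_eq_intros d)
  have dd: "((\<lambda>x. c *\<^sub>R f m x) has_vector_derivative c *\<^sub>R f (Suc m) x) (at x)" for c m x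
    by (auto intro!: derivative_eq_intros d)
  have "Ck n (\<lambda>x. c *\<^sub>R f m x)" for n c m
  proof (induction n arbitrary: c m)
    case 0
    then show ?case
      using dd by (auto intro!: continuous_at_imp_continuous_on has_vector_derivative_continuous)
  next
    case (Suc n)
    then show ?case
      using dd[unfolded has_vector_derivative_def, THEN differentiableI] by (auto simp: pd)
  qed
  from this[of _ 1 0] show "smooth (f 0)" by (simp add: smooth_def)
  show "D n (f 0) = f n"
  proof (induction n)
    case (Suc n)
    then show ?case using pd[of 1 1 n] by simp
  qed simp
qed

lemma Ck_pd: "Ck (n + m) f \<Longrightarrow> Ck m ((pd v ^^ n) f)"
proof (induction n arbitrary: m)
  case (Suc n)
  from Suc.IH[of "Suc m"] Suc.prems show ?case by simp
qed simp

lemma smooth_pd: "smooth f \<Longrightarrow> smooth ((pd v ^^ n) f)"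
  using Ck_pd unfolding smooth_def by blast

lemma smooth_has_derivative: "smooth f \<Longrightarrow> (f has_derivative (\<lambda>v. pd v f x)) (at x)"
proof -
  assume "smooth f"
  then have "Ck (Suc 0) f" by (simp only: smooth_def)
  then have "f differentiable (at x)" by simp
  then show ?thesis by (simp add: frechet_derivative_works pd_def)
qed

lemma smooth_D:
  fixes f :: "real \<Rightarrow> 'b::real_normed_vector"
  assumes "smooth f"
  shows "(D n f has_vector_derivative D (Suc n) f x) (at x)"
proof -
  have d: "(D n f has_derivative (\<lambda>v. pd v (D n f) x)) (at x)"
    by (intro smooth_has_derivative smooth_pd assms)
  then interpret l: linear "\<lambda>v. pd v (D n f) x" by (rule has_derivative_linear)
  have eq: "(\<lambda>v. pd v (D n f) x) = (\<lambda>v. v *\<^sub>R D (Suc n) f x)"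
  proof
    fix v show "pd v (D n f) x = v *\<^sub>R D (Suc n) f x"
      using l.scale[of v 1] by simp
  qed
  show ?thesis unfolding has_vector_derivative_def by (rule d[unfolded eq])
qed

lemma smooth_D_real:
  fixes f :: "real \<Rightarrow> real"
  assumes "smooth f"
  shows "(D n f has_real_derivative D (Suc n) f x) (at x)"
  using smooth_D[OF assms] by (simp only: has_real_derivative_iff_has_vector_derivative)

lemma smooth_D_continuous:
  fixes f :: "real \<Rightarrow> 'b::real_normed_vector"
  assumes "smooth f"
  shows "continuous_on A (D n f)"
  using smooth_D[OF assms]
  by (auto intro!: continuous_at_imp_continuous_on has_vector_derivative_continuous)

lemma D_zero_outside:
  fixes f :: "real \<Rightarrow> 'b::real_normed_vector"
  assumes "smooth f" "closed K" "\<And>x. x \<notin> K \<Longrightarrow> f x = 0" "x \<notin> K"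
  shows "D n f x = 0"
  using assms(4)
proof (induction n arbitrary: x)
  case (Suc n)
  have "((\<lambda>_. 0) has_vector_derivative D (Suc n) f x) (at x)"
    by (rule has_vector_derivative_transform_within_open[OF smooth_D[OF assms(1)], of "- K"])
      (use Suc assms(2) in auto)
  then show ?case
    using vector_derivative_unique_at[OF _ has_vector_derivative_const] by blast
qed (use assms in auto)

lemma D_affine:
  fixes f :: "real \<Rightarrow> 'b::real_normed_vector"
  assumes "smooth f"
  shows "smooth (\<lambda>x. f (c * x + d))" "D n (\<lambda>x. f (c * x + d)) = (\<lambda>x. c ^ n *\<^sub>R D n f (c * x + d))"
proof -
  let ?g = "\<lambda>n x. c ^ n *\<^sub>R D n f (c * x + d)"
  have "(?g n has_vector_derivative ?g (Suc n) x) (at x)" for n x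
  proof -
    have "((\<lambda>x. c * x + d) has_vector_derivative c) (at x)"
      by (auto intro!: derivative_eq_intros)
    from vector_diff_chain_at[OF this smooth_D[OF assms]]
    have "(D n f \<circ> (\<lambda>x. c * x + d) has_vector_derivative c *\<^sub>R D (Suc n) f (c * x + d)) (at x)" .
    from bounded_linear.has_vector_derivative[OF bounded_linear_scaleR_right this, of "c ^ n"]
    show ?thesis by (simp add: o_def mult.commute)
  qed
  from smooth_sequence[of ?g, OF this]
  show "smooth (\<lambda>x. f (c * x + d))" "D n (\<lambda>x. f (c * x + d)) = (\<lambda>x. c ^ n *\<^sub>R D n f (c * x + d))"
    by simp_all
qed

section \<open>Products and compositions with linear maps\<close>

lemma Ck_continuous: "Ck n f \<Longrightarrow> continuous_on UNIV f"
  by (cases n) (auto intro!: continuous_at_imp_continuous_on differentiable_imp_continuous_within)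

lemma Ck_add: "Ck n f \<Longrightarrow> Ck n g \<Longrightarrow> Ck n (\<lambda>x. f x + g x)"
proof (induction n arbitrary: f g)
  case (Suc n)
  have "pd v (\<lambda>x. f x + g x) = (\<lambda>x. pd v f x + pd v g x)" for v
    using Suc.prems
    by (intro ext pd_has_derivative has_derivative_add) (auto simp: pd_def simp flip: frechet_derivative_works)
  then show ?case using Suc by auto
qed (auto intro: continuous_intros)

lemma Ck_mono: "Ck (Suc n) f \<Longrightarrow> Ck n f"
proof (induction n arbitrary: f)
  case 0
  then show ?case using Ck_continuous[OF 0] by simp
qed auto

lemma Ck_mult:
  fixes f g :: "'a::euclidean_space \<Rightarrow> real"
  shows "Ck n f \<Longrightarrow> Ck n g \<Longrightarrow> Ck n (\<lambda>x. f x * g x)"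
proof (induction n arbitrary: f g)
  case (Suc n)
  have "((\<lambda>x. f x * g x) has_derivative (\<lambda>v. f x * pd v g x + pd v f x * g x)) (at x)" for x
    unfolding pd_def using Suc.prems
    by (intro has_derivative_mult) (auto simp flip: frechet_derivative_works)
  then have "pd v (\<lambda>x. f x * g x) = (\<lambda>x. f x * pd v g x + pd v f x * g x)" for v
    by (intro ext) (rule pd_has_derivative)
  moreover have "Ck n (\<lambda>x. f x * pd v g x + pd v f x * g x)" for v
    using Suc Ck_mono by (intro Ck_add Suc.IH) auto
  ultimately show ?case using Suc.prems by auto
qed (auto intro: continuous_intros)

lemma smooth_mult:
  fixes f g :: "'a::euclidean_space \<Rightarrow> real"
  shows "smooth f \<Longrightarrow> smooth g \<Longrightarrow> smooth (\<lambda>x. f x * g x)"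
  by (simp add: smooth_def Ck_mult)

lemma pd_linear_comp:
  fixes f :: "real \<Rightarrow> real" and L :: "'a::euclidean_space \<Rightarrow> real"
  assumes "smooth f" "bounded_linear L"
  shows "((\<lambda>x. f (L x)) has_derivative (\<lambda>v. L v * D 1 f (L x))) (at x)"
proof -
  have "(f has_derivative (\<lambda>v. v * D 1 f (L x))) (at (L x))"
    using smooth_D[OF assms(1), of 0 "L x"] by (simp add: has_vector_derivative_def)
  from has_derivative_compose[OF bounded_linear_imp_has_derivative[OF assms(2)] this]
  show ?thesis by simp
qed

text \<open>The multiples of \<open>D m f (L x)\<close> are closed under every \<open>pd v\<close>,
  which carries the induction. The case of interest is L = \<open>fst\<close> or \<open>snd\<close>,
  for test functions in product form.\<close>

lemma smooth_linear_comp: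
  fixes f :: "real \<Rightarrow> real" and L :: "'a::euclidean_space \<Rightarrow> real"
  assumes "smooth f" "bounded_linear L"
  shows "smooth (\<lambda>x. f (L x))"
proof -
  have dd: "((\<lambda>x. c * D m f (L x)) has_derivative (\<lambda>v. c * L v * D (Suc m) f (L x))) (at x)"
    for c m x
    using has_derivative_mult_right[OF pd_linear_comp[OF smooth_pd[OF assms(1), of m 1] assms(2)], of c]
    by (simp add: mult.assoc)
  then have pd: "pd v (\<lambda>x. c * D m f (L x)) = (\<lambda>x. c * L v * D (Suc m) f (L x))" for c m v
    by (intro ext pd_has_derivative)
  have "Ck n (\<lambda>x. c * D m f (L x))" for n c m
  proof (induction n arbitrary: c m)
    case 0
    then show ?case
      using dd by (auto intro!: continuous_at_imp_continuous_on has_derivative_continuous)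
  next
    case (Suc n)
    then show ?case using dd[THEN differentiableI] by (subst Ck.simps) (auto simp only: pd)
  qed
  from this[of _ 1 0] show ?thesis by (simp add: smooth_def)
qed

section \<open>A mollifier\<close>

text \<open>With y = 1/x, the x-derivative of p(y) exp(-y) is y^2 (p - p')(y) exp(-y). The family is
  thus closed under differentiation, and at x = 0 only a first derivative has to be
  examined.\<close>

definition flat :: "real poly \<Rightarrow> real \<Rightarrow> real" where
  "flat p x = (if x > 0 then poly p (1 / x) * exp (- 1 / x) else 0)"

lemma poly_exp_tendsto_0: "((\<lambda>y. poly p y * exp (- y)) \<longlongrightarrow> 0) at_top" for p :: "real poly"
proof (induction p)
  case (pCons a p)
  have "((\<lambda>y. a * exp (- y) + y * poly p y * exp (- y)) \<longlongrightarrow> a * 0 + 0) at_top"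
  proof (intro tendsto_intros)
    show "((\<lambda>y. exp (- y)) \<longlongrightarrow> (0::real)) at_top"
      by (rule filterlim_compose[OF exp_at_bot filterlim_uminus_at_bot_at_top])
    have "((\<lambda>y. (\<Sum>i\<le>degree p. coeff p i * (y ^ Suc i / exp y))) \<longlongrightarrow> (\<Sum>i\<le>degree p. coeff p i * 0)) at_top"
      by (intro tendsto_intros tendsto_power_div_exp_0)
    then show "((\<lambda>y. y * poly p y * exp (- y)) \<longlongrightarrow> 0) at_top"
      by (simp add: poly_altdef sum_distrib_left sum_distrib_right exp_minus field_simps)
  qed
  then show ?case by (simp add: algebra_simps)
qed simp

lemma flat_deriv:
  "(flat p has_real_derivative flat ([:0, 0, 1:] * (p - pderiv p)) x) (at x)"
proof -
  consider "x > 0" | "x < 0" | "x = 0" by linarith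
  then show ?thesis
  proof cases
    case 1
    have "((\<lambda>x. poly p (1 / x) * exp (- 1 / x)) has_real_derivative
        flat ([:0, 0, 1:] * (p - pderiv p)) x) (at x)"
      using 1 by (auto intro!: derivative_eq_intros DERIV_chain2[OF poly_DERIV]
          simp: flat_def field_simps power2_eq_square)
    then show ?thesis
      by (rule has_field_derivative_transform_within_open[where S="{0<..}"]) (use 1 in \<open>auto simp: flat_def\<close>)
  next
    case 2
    have "((\<lambda>_. 0) has_real_derivative flat ([:0, 0, 1:] * (p - pderiv p)) x) (at x)"
      using 2 by (simp add: flat_def)
    then show ?thesis
      by (rule has_field_derivative_transform_within_open[where S="{..<0}"]) (use 2 in \<open>auto simp: flat_def\<close>)
  next
    case 3
    have "((\<lambda>h. flat p h / h) \<longlongrightarrow> 0) (at 0)"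
    proof (subst filterlim_at_split, intro conjI)
      show "((\<lambda>h. flat p h / h) \<longlongrightarrow> 0) (at_left 0)"
        by (rule tendsto_eventually) (auto simp: eventually_at_left_field flat_def intro!: exI[of _ "-1"])
      \<comment> \<open>From the right the difference quotient is y p(y) exp(-y) with y = 1/h, again
        a polynomial times exp(-y).\<close>
      have "((\<lambda>h. poly ([:0, 1:] * p) (inverse h) * exp (- inverse h)) \<longlongrightarrow> 0) (at_right (0::real))"
        by (rule filterlim_compose[OF poly_exp_tendsto_0 filterlim_inverse_at_top_right])
      then show "((\<lambda>h. flat p h / h) \<longlongrightarrow> 0) (at_right 0)"
        by (rule Lim_transform_eventually)
          (auto simp: eventually_at_right_field flat_def field_simps intro!: exI[of _ "1"])
    qed
    then show ?thesis
      using 3 by (simp add: DERIV_def flat_def)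
  qed
qed

lemma smooth_flat: "smooth (flat p)"
proof -
  define q where "q = (\<lambda>n. ((\<lambda>p. [:0, 0, 1:] * (p - pderiv p)) ^^ n) p)"
  have "(flat (q n) has_vector_derivative flat (q (Suc n)) x) (at x)" for n x
    unfolding has_real_derivative_iff_has_vector_derivative[symmetric]
    using flat_deriv[of "q n" x] by (simp add: q_def)
  from smooth_sequence(1)[of "\<lambda>n. flat (q n)", OF this] show ?thesis by (simp add: q_def)
qed

definition bump :: "real \<Rightarrow> real" where
  "bump x = flat 1 (x + 1) * flat 1 (1 - x)"

lemma bump_nonneg: "bump x \<ge> 0"
  by (simp add: bump_def flat_def)

lemma bump_pos: "\<bar>x\<bar> < 1 \<Longrightarrow> bump x > 0"
  by (simp add: bump_def flat_def)

lemma bump_outside: "\<bar>x\<bar> \<ge> 1 \<Longrightarrow> bump x = 0"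
  by (auto simp: bump_def flat_def)

lemma smooth_bump: "smooth bump"
proof -
  have "smooth (\<lambda>x. flat 1 (1 * x + 1) * flat 1 ((- 1) * x + 1))"
    by (intro smooth_mult D_affine smooth_flat)
  then show ?thesis by (simp add: bump_def[abs_def])
qed

text \<open>Bridge between the two integrals in use: the Bochner integral for Fubini and limits, the
  gauge integral on a compact interval for the Leibniz rule and the fundamental theorem.\<close>

lemma compact_support_integral:
  fixes g :: "real \<Rightarrow> real"
  assumes "continuous_on UNIV g" "\<And>x. x \<notin> {a..b} \<Longrightarrow> g x = 0"
  shows "integrable lborel g" "(LINT x|lborel. g x) = integral {a..b} g"
proof -
  have "integrable lborel (\<lambda>x. indicator {a..b} x *\<^sub>R g x)"
    using assms by (intro borel_integrable_compact) (auto intro: continuous_on_subset)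
  moreover have "(\<lambda>x. indicator {a..b} x *\<^sub>R g x) = g"
    using assms(2) by (force simp: indicator_def)
  ultimately show i: "integrable lborel g" by simp
  have "integral {a..b} g = integral UNIV g"
  proof -
    have "(\<lambda>x. if x \<in> {a..b} then g x else 0) = g" using assms(2) by (auto simp: fun_eq_iff)
    with integral_restrict_UNIV[of "{a..b}" g] show ?thesis by metis
  qed
  with integral_lborel[OF i] show "(LINT x|lborel. g x) = integral {a..b} g" by simp
qed

definition rho :: "real \<Rightarrow> real" where
  "rho x = bump x / (LINT x|lborel. bump x)"

definition rh :: "nat \<Rightarrow> real \<Rightarrow> real" where
  "rh i = D i rho"

lemma rh_0: "rh 0 = rho"
  by (simp add: rh_def)

lemma bump_integral:
  shows "integrable lborel bump" "(LINT x|lborel. bump x) > 0"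
proof -
  have c: "continuous_on UNIV bump" using smooth_D_continuous[OF smooth_bump, of _ 0] by simp
  show i: "integrable lborel bump"
    by (rule compact_support_integral[OF c, of "-1" 1]) (auto intro: bump_outside)
  have "(LINT x|lborel. bump x) \<noteq> 0"
  proof
    assume "(LINT x|lborel. bump x) = 0"
    then have "AE x in lborel. bump x = 0"
      using i by (subst (asm) integral_nonneg_eq_0_iff_AE) (auto simp: bump_nonneg)
    then have "AE x in lborel. x \<notin> {-1<..<1::real}"
      by eventually_elim (use bump_pos in \<open>force simp: abs_less_iff\<close>)
    then have "emeasure lborel {-1<..<1::real} = 0"
      by (subst (asm) AE_iff_measurable[of "{-1<..<1}"]) auto
    then show False by simp
  qed
  moreover have "(LINT x|lborel. bump x) \<ge> 0" by (simp add: bump_nonneg)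
  ultimately show "(LINT x|lborel. bump x) > 0" by linarith
qed

lemma smooth_const: "smooth (\<lambda>x::real. c::real)"
proof -
  define f where "f = (\<lambda>n (x::real). if n = (0::nat) then c else 0)"
  have "(f n has_vector_derivative f (Suc n) x) (at x)" for n x
    by (cases n) (auto simp: f_def)
  from smooth_sequence(1)[of f, OF this] show ?thesis by (simp add: f_def)
qed

lemma smooth_rho: "smooth rho"
proof -
  have "rho = (\<lambda>x. (1 / (LINT x|lborel. bump x)) * bump x)"
    by (auto simp: rho_def)
  then show ?thesis using smooth_mult[OF smooth_const smooth_bump] by metis
qed

lemma rho_nonneg: "rho x \<ge> 0"
  using bump_integral(2) by (simp add: rho_def bump_nonneg)

lemma rho_integral: "(LINT x|lborel. rho x) = 1"
  using bump_integral by (simp add: rho_def)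

lemma rh_deriv: "(rh i has_real_derivative rh (Suc i) x) (at x)"
  unfolding rh_def by (rule smooth_D_real[OF smooth_rho])

lemma rh_cont [continuous_intros]: "continuous_on A (rh i)"
  unfolding rh_def by (rule smooth_D_continuous[OF smooth_rho])

lemma rh_measurable [measurable]: "rh i \<in> borel_measurable borel"
  by (intro borel_measurable_continuous_onI rh_cont)

lemma rh_outside: "x \<notin> {-1..1} \<Longrightarrow> rh i x = 0"
  unfolding rh_def by (rule D_zero_outside[OF smooth_rho, of "{-1..1}"]) (auto simp: rho_def bump_outside)

text \<open>These L^1 norms are the constants in Young's inequality for convolutions.\<close>

definition rn :: "nat \<Rightarrow> real" where
  "rn i = (LINT x|lborel. \<bar>rh i x\<bar>)"

lemma rh_integrable: "integrable lborel (rh i)"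
  by (rule compact_support_integral[of _ "-1" 1]) (auto intro: rh_cont rh_outside)

lemma rn_nonneg: "rn i \<ge> 0"
  by (simp add: rn_def)

lemma rn_0: "rn 0 = 1"
  using rho_integral by (simp add: rn_def rh_0 rho_nonneg)

lemma rn_ennreal: "(\<integral>\<^sup>+x. ennreal \<bar>rh i x\<bar> \<partial>lborel) = ennreal (rn i)"
  unfolding rn_def by (rule nn_integral_eq_integral) (auto intro: integrable_abs rh_integrable)

text \<open>With the approximate identity \<open>rho (x / e) / e\<close>, the function \<open>moll e i f\<close> is the derivative of order
  \<open>i\<close> of its convolution with \<open>f\<close>.\<close>

definition moll :: "real \<Rightarrow> nat \<Rightarrow> (real \<Rightarrow> real) \<Rightarrow> real \<Rightarrow> real" where
  "moll e i f x = (1 / e ^ i) * (LINT z|lborel. rh i z * f (x - e * z))"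

lemma cont_comp:
  fixes f :: "real \<Rightarrow> real"
  assumes "continuous_on UNIV f" "continuous_on A g"
  shows "continuous_on A (\<lambda>x. f (g x))"
  by (rule continuous_on_compose2[OF assms]) auto

lemma moll_integrable:
  assumes "continuous_on UNIV f"
  shows "integrable lborel (\<lambda>z. rh i z * f (x - e * z))"
  by (rule compact_support_integral[of _ "-1" 1])
    (auto intro!: continuous_intros cont_comp[OF assms] simp: rh_outside)

text \<open>The interval is larger than [-1, 1] so that the boundary terms at 2 and -2 in
  \<open>moll_parts\<close> vanish; at 1 and -1 \<open>rh_outside\<close> says nothing.\<close>

lemma moll_eq_integral:
  assumes "continuous_on UNIV f"
  shows "moll e i f x = (1 / e ^ i) * integral {-2..2} (\<lambda>z. rh i z * f (x - e * z))"
  unfolding moll_def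
  by (subst compact_support_integral(2)[of _ "-2" 2])
    (auto intro!: continuous_intros cont_comp[OF assms] simp: rh_outside)

text \<open>Joint continuity in (t, x) is what later yields joint measurability, and with it
  Tonelli's theorem in t and x.\<close>

lemma moll_cont2:
  fixes w :: "'a::topological_space \<Rightarrow> real \<Rightarrow> real"
  assumes "continuous_on UNIV (\<lambda>(t, x). w t x)"
  shows "continuous_on UNIV (\<lambda>(t, x). moll e i (w t) x)"
proof -
  have c: "continuous_on UNIV (w t)" for t
    using continuous_on_compose2[OF assms, of UNIV "\<lambda>x. (t, x)"] by (simp add: continuous_on_Pair)
  have "continuous_on UNIV (\<lambda>p::'a \<times> real. integral (cbox (-2) 2) (\<lambda>z. rh i z * w (fst p) (snd p - e * z)))"
    apply (rule integral_continuous_on_param)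
    unfolding split_beta
    apply (intro continuous_intros)
     apply (rule continuous_on_compose2[OF rh_cont[of UNIV]], auto intro!: continuous_intros)[1]
    apply (rule continuous_on_compose2[OF assms[unfolded split_beta], of _ "\<lambda>q. (fst (fst q), snd (fst q) - e * snd q)", simplified])
    by (auto intro!: continuous_intros)
  then show ?thesis
    unfolding split_beta moll_eq_integral[OF c] by (intro continuous_intros) auto
qed

lemma moll_cont:
  assumes "continuous_on UNIV f"
  shows "continuous_on A (moll e i f)"
proof -
  have "continuous_on UNIV (\<lambda>(t::real, x). f x)"
    unfolding split_beta by (auto intro!: continuous_intros cont_comp[OF assms])
  from moll_cont2[OF this, of e i] have "continuous_on UNIV (\<lambda>p::real \<times> real. moll e i f (snd p))"
    by (simp add: split_beta)
  from continuous_on_compose2[OF this, of A "\<lambda>x. (0, x)"] show ?thesis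
    by (simp add: continuous_on_Pair)
qed

lemma moll_deriv_inner:
  assumes d: "\<And>x. (f has_real_derivative f' x) (at x)" and c: "continuous_on UNIV f'"
  shows "(moll e i f has_real_derivative moll e i f' x) (at x)"
proof -
  have cf: "continuous_on UNIV f"
    using d by (auto intro!: continuous_at_imp_continuous_on DERIV_isCont)
  have "((\<lambda>x. integral (cbox (-2) 2) (\<lambda>z. rh i z * f (x - e * z))) has_field_derivative
     integral (cbox (-2) 2) (\<lambda>z. rh i z * f' (x - e * z))) (at x within UNIV)"
  proof (rule leibniz_rule_field_derivative)
    show "((\<lambda>x. rh i t * f (x - e * t)) has_field_derivative rh i t * f' (x - e * t)) (at x within UNIV)" for x t
      by (auto intro!: derivative_eq_intros DERIV_chain2[OF d])
    show "(\<lambda>z. rh i z * f (x - e * z)) integrable_on cbox (-2) 2" for x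
      by (intro integrable_continuous continuous_intros cont_comp[OF cf])
    show "continuous_on (UNIV \<times> cbox (-2) 2) (\<lambda>(x, t). rh i t * f' (x - e * t))"
      unfolding split_beta
      by (intro continuous_intros cont_comp[OF c] cont_comp[OF rh_cont]) 
  qed auto
  then show ?thesis
    unfolding moll_eq_integral[OF cf, abs_def] moll_eq_integral[OF c] by (intro DERIV_cmult) simp
qed

lemma moll_parts:
  assumes d: "\<And>x. (f has_real_derivative f' x) (at x)" and c: "continuous_on UNIV f'" and e: "e \<noteq> 0"
  shows "moll e (Suc i) f x = moll e i f' x"
proof -
  have cf: "continuous_on UNIV f"
    using d by (auto intro!: continuous_at_imp_continuous_on DERIV_isCont)
  have "((\<lambda>z. rh (Suc i) z * f (x - e * z) - e * (rh i z * f' (x - e * z))) has_integral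
     rh i 2 * f (x - e * 2) - rh i (-2) * f (x - e * (-2))) {-2..2}"
    by (rule fundamental_theorem_of_calculus)
      (auto intro!: derivative_eq_intros rh_deriv[THEN DERIV_subset] DERIV_chain2[OF d]
        simp flip: has_real_derivative_iff_has_vector_derivative)
  then have "integral {-2..2} (\<lambda>z. rh (Suc i) z * f (x - e * z) - e * (rh i z * f' (x - e * z))) = 0"
    by (simp add: rh_outside integral_unique)
  moreover have "integral {-2..2} (\<lambda>z. rh (Suc i) z * f (x - e * z) - e * (rh i z * f' (x - e * z)))
    = integral {-2..2} (\<lambda>z. rh (Suc i) z * f (x - e * z)) - e * integral {-2..2} (\<lambda>z. rh i z * f' (x - e * z))"
    by (subst Henstock_Kurzweil_Integration.integral_diff)
      (auto intro!: integrable_continuous_real continuous_intros cont_comp[OF cf] cont_comp[OF c])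
  ultimately show ?thesis
    unfolding moll_eq_integral[OF cf] moll_eq_integral[OF c] using e by (simp add: field_simps)
qed

text \<open>A merely continuous f cannot receive d/dx. With a primitive F of f,
  \<open>moll_parts\<close> gives \<open>moll e i f = moll e (Suc i) F\<close>, and now F can be
  differentiated under the integral.\<close>

lemma moll_deriv:
  assumes c: "continuous_on UNIV f" and e: "e \<noteq> 0"
  shows "(moll e i f has_real_derivative moll e (Suc i) f x) (at x)"
proof -
  obtain F where F: "\<And>x. (F has_real_derivative f x) (at x)"
    using einterval_antiderivative[of "-\<infinity>" "\<infinity>" f] c
    by (auto simp: continuous_on_eq_continuous_at has_real_derivative_iff_has_vector_derivative)
  have "moll e i f = moll e (Suc i) F"
    using moll_parts[OF F c e] by (simp add: fun_eq_iff)
  with moll_deriv_inner[OF F c] show ?thesis by metis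
qed

lemma moll_deriv_inner_eq:
  assumes d: "\<And>x. (f has_real_derivative f' x) (at x)" and c: "continuous_on UNIV f'" and e: "e \<noteq> 0"
  shows "moll e (Suc i) f = moll e i f'"
  using moll_parts[OF assms] by blast

lemma smooth_moll:
  assumes c: "continuous_on UNIV f" and e: "e \<noteq> 0"
  shows "smooth (moll e i f)"
proof -
  have "(moll e (n + i) f has_vector_derivative moll e (Suc n + i) f x) (at x)" for n x
    using moll_deriv[OF assms] by (simp flip: has_real_derivative_iff_has_vector_derivative)
  from smooth_sequence[of "\<lambda>n. moll e (n + i) f", OF this]
  show "smooth (moll e i f)" by simp
qed

section \<open>Mollification as a pairing with a test function\<close>

definition ker :: "real \<Rightarrow> real \<Rightarrow> real \<Rightarrow> real" where
  "ker e x y = rho ((x - y) / e) / e"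

lemma moll_eq_ker:
  assumes "e > 0" "continuous_on UNIV f"
  shows "moll e i f x = (LINT y|lborel. rh i ((x - y) / e) / e ^ Suc i * f y)"
proof -
  have "(LINT y|lborel. rh i ((x - y) / e) / e ^ Suc i * f y)
    = \<bar>- e\<bar> *\<^sub>R (LINT z|lborel. rh i ((x - (x + (- e) * z)) / e) / e ^ Suc i * f (x + (- e) * z))"
    using assms by (intro lborel_integral_real_affine) auto
  also have "\<dots> = moll e i f x"
    unfolding moll_def using assms(1)
    by (simp add: field_simps flip: integral_mult_right_zero)
  finally show ?thesis by simp
qed

lemma D_ker:
  assumes "e > 0"
  shows "smooth (ker e x)" "D n (ker e x) = (\<lambda>y. (-1) ^ n * (rh n ((x - y) / e) / e ^ Suc n))"
proof -
  let ?g = "\<lambda>n y. (-1) ^ n * (rh n ((x - y) / e) / e ^ Suc n)"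
  have "(?g n has_vector_derivative ?g (Suc n) y) (at y)" for n y
    unfolding has_real_derivative_iff_has_vector_derivative[symmetric] using assms
    by (auto intro!: derivative_eq_intros DERIV_chain2[OF rh_deriv] simp: field_simps)
  from smooth_sequence[of ?g, OF this]
  show "smooth (ker e x)" "D n (ker e x) = (\<lambda>y. (-1) ^ n * (rh n ((x - y) / e) / e ^ Suc n))"
    by (auto simp: ker_def[abs_def] rh_0)
qed

lemma ker_outside: "e > 0 \<Longrightarrow> y \<notin> {x - e..x + e} \<Longrightarrow> ker e x y = 0"
  using rh_outside[of "(x - y) / e" 0] by (auto simp: ker_def rh_0 field_simps)

text \<open>The sign appears because the kernel is differentiated in y and not in x. By this formula
  a weak statement tested with \<open>ker e x\<close> becomes a pointwise one about the mollified
  function at x.\<close>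

lemma moll_eq_D_ker:
  assumes "e > 0" "continuous_on UNIV f"
  shows "(LINT y|lborel. D n (ker e x) y * f y) = (-1) ^ n * moll e n f x"
  unfolding D_ker[OF assms(1)] moll_eq_ker[OF assms] by (simp add: mult.assoc)

lemma moll_bound:
  assumes c: "continuous_on UNIV f" and e: "e > 0"
    and B: "\<And>z. \<bar>z\<bar> \<le> 1 \<Longrightarrow> \<bar>f (x - e * z)\<bar> \<le> B"
  shows "\<bar>moll e i f x\<bar> \<le> rn i / e ^ i * B"
proof -
  have "\<bar>LINT z|lborel. rh i z * f (x - e * z)\<bar> \<le> (LINT z|lborel. \<bar>rh i z\<bar> * B)"
  proof (rule integral_abs_bound_integral)
    show "\<bar>rh i z * f (x - e * z)\<bar> \<le> \<bar>rh i z\<bar> * B" for z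
    proof (cases "\<bar>z\<bar> \<le> 1")
      case False
      then have "rh i z = 0" by (intro rh_outside) auto
      then show ?thesis by simp
    qed (use B[of z] in \<open>auto simp: abs_mult intro!: mult_left_mono\<close>)
  qed (auto intro!: moll_integrable c integrable_abs rh_integrable)
  then show ?thesis
    using e by (auto simp: moll_def abs_mult rn_def field_simps)
qed

lemma moll_diff_const:
  assumes c: "continuous_on UNIV f"
  shows "moll e 0 f x - a = moll e 0 (\<lambda>y. f y - a) x"
  unfolding moll_def using moll_integrable[OF c, of 0 x e] rho_integral[folded rh_0] rh_integrable[of 0]
  by (simp add: right_diff_distrib Bochner_Integration.integral_diff)

lemma moll_0_near:
  assumes c: "continuous_on UNIV f" and e: "e > 0"
    and B: "\<And>y. \<bar>y - x\<bar> \<le> e \<Longrightarrow> \<bar>f y - a\<bar> \<le> B"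
  shows "\<bar>moll e 0 f x - a\<bar> \<le> B"
proof -
  have "\<bar>moll e 0 (\<lambda>y. f y - a) x\<bar> \<le> rn 0 / e ^ 0 * B"
    using e by (intro moll_bound continuous_intros c B) (auto simp: abs_mult)
  then show ?thesis by (simp add: moll_diff_const[OF c] rn_0)
qed

lemma moll_tendsto:
  assumes c: "continuous_on UNIV f"
  shows "((\<lambda>e. moll e 0 f x) \<longlongrightarrow> f x) (at_right 0)"
proof (rule tendstoI)
  fix h :: real assume "h > 0"
  then obtain d where d: "d > 0" "\<And>y. dist y x < d \<Longrightarrow> dist (f y) (f x) < h / 2"
    using c unfolding continuous_on_iff by (metis UNIV_I half_gt_zero)
  have "dist (moll e 0 f x) (f x) < h" if "0 < e" "e < d" for e
  proof -
    have "\<bar>moll e 0 f x - f x\<bar> \<le> h / 2"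
      using d(2) that by (intro moll_0_near c) (auto simp: dist_real_def less_imp_le)
    then show ?thesis using \<open>h > 0\<close> by (simp add: dist_real_def)
  qed
  then show "\<forall>\<^sub>F e in at_right 0. dist (moll e 0 f x) (f x) < h"
    using d(1) by (auto simp: eventually_at_right_field)
qed

section \<open>Weighted Young inequality\<close>

text \<open>Convolution with the absolute value of the kernel. Extended nonnegative values avoid all
  integrability conditions. The factor 1 / e^i of \<open>moll\<close> is left out, so that a
  commutator can cancel it.\<close>

definition cv :: "nat \<Rightarrow> real \<Rightarrow> (real \<Rightarrow> ennreal) \<Rightarrow> real \<Rightarrow> ennreal" where
  "cv i e f x = (\<integral>\<^sup>+z. ennreal \<bar>rh i z\<bar> * f (x - e * z) \<partial>lborel)"

lemma cv_measurable [measurable]: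
  assumes [measurable]: "f \<in> borel_measurable borel"
  shows "cv i e f \<in> borel_measurable borel"
  unfolding cv_def[abs_def] by measurable

text \<open>Cauchy-Schwarz with the absolute kernel split into two square roots.\<close>

lemma cv_sq:
  assumes [measurable]: "f \<in> borel_measurable borel"
  shows "(cv i e f x)\<^sup>2 \<le> ennreal (rn i) * cv i e (\<lambda>y. (f y)\<^sup>2) x"
proof -
  let ?s = "\<lambda>z. ennreal (sqrt \<bar>rh i z\<bar>)"
  have s: "?s z * ?s z = ennreal \<bar>rh i z\<bar>" for z by (simp flip: ennreal_mult)
  have "cv i e f x = (\<integral>\<^sup>+z. ?s z * (?s z * f (x - e * z)) \<partial>lborel)"
    unfolding cv_def by (simp add: s mult.assoc[symmetric])
  then have "(cv i e f x)\<^sup>2 \<le> (\<integral>\<^sup>+z. (?s z)\<^sup>2 \<partial>lborel) * (\<integral>\<^sup>+z. (?s z * f (x - e * z))\<^sup>2 \<partial>lborel)"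
    by (simp only:) (rule Cauchy_Schwarz_nn_integral; measurable)
  also have "\<dots> = ennreal (rn i) * cv i e (\<lambda>y. (f y)\<^sup>2) x"
  proof -
    have "(?s z * f (x - e * z))\<^sup>2 = ennreal \<bar>rh i z\<bar> * (f (x - e * z))\<^sup>2" for z
      by (simp only: power_mult_distrib power2_eq_square[of "?s z"] s)
    then show ?thesis by (simp only: power2_eq_square[of "?s _"] s cv_def rn_ennreal)
  qed
  finally show ?thesis .
qed

text \<open>A weight is not translation invariant. The last hypothesis states the price of moving it
  along the support of the kernel, from W at x to W' at x - e z; after Tonelli the translation
  itself disappears.\<close>

lemma cv_weighted:
  assumes [measurable]: "f \<in> borel_measurable borel" "W \<in> borel_measurable borel" "W' \<in> borel_measurable borel"
    and W: "\<And>x z. \<bar>z\<bar> \<le> 1 \<Longrightarrow> W x \<le> W' (x - e * z)"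
  shows "(\<integral>\<^sup>+x. W x * cv i e f x \<partial>lborel) \<le> ennreal (rn i) * (\<integral>\<^sup>+x. W' x * f x \<partial>lborel)"
proof -
  have "(\<integral>\<^sup>+x. W x * cv i e f x \<partial>lborel) = (\<integral>\<^sup>+x. \<integral>\<^sup>+z. W x * (ennreal \<bar>rh i z\<bar> * f (x - e * z)) \<partial>lborel \<partial>lborel)"
    unfolding cv_def by (subst nn_integral_cmult) auto
  also have "\<dots> = (\<integral>\<^sup>+z. \<integral>\<^sup>+x. W x * (ennreal \<bar>rh i z\<bar> * f (x - e * z)) \<partial>lborel \<partial>lborel)"
    by (rule lborel_pair.Fubini') measurable
  also have "\<dots> \<le> (\<integral>\<^sup>+z. ennreal \<bar>rh i z\<bar> * (\<integral>\<^sup>+x. W' (x - e * z) * f (x - e * z) \<partial>lborel) \<partial>lborel)"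
  proof (rule nn_integral_mono)
    fix z
    have "(\<integral>\<^sup>+x. W x * (ennreal \<bar>rh i z\<bar> * f (x - e * z)) \<partial>lborel)
      \<le> (\<integral>\<^sup>+x. ennreal \<bar>rh i z\<bar> * (W' (x - e * z) * f (x - e * z)) \<partial>lborel)"
    proof (rule nn_integral_mono)
      fix x
      show "W x * (ennreal \<bar>rh i z\<bar> * f (x - e * z)) \<le> ennreal \<bar>rh i z\<bar> * (W' (x - e * z) * f (x - e * z))"
      proof (cases "\<bar>z\<bar> \<le> 1")
        case True
        have "W x * (ennreal \<bar>rh i z\<bar> * f (x - e * z)) = ennreal \<bar>rh i z\<bar> * (W x * f (x - e * z))"
          by (simp add: mult_ac)
        also have "\<dots> \<le> ennreal \<bar>rh i z\<bar> * (W' (x - e * z) * f (x - e * z))"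
          by (intro mult_left_mono mult_right_mono W True) auto
        finally show ?thesis .
      next
        case False
        then have "rh i z = 0" by (intro rh_outside) auto
        then show ?thesis by simp
      qed
    qed
    also have "\<dots> = ennreal \<bar>rh i z\<bar> * (\<integral>\<^sup>+x. W' (x - e * z) * f (x - e * z) \<partial>lborel)"
      by (rule nn_integral_cmult) measurable
    finally show "(\<integral>\<^sup>+x. W x * (ennreal \<bar>rh i z\<bar> * f (x - e * z)) \<partial>lborel) \<le>
      ennreal \<bar>rh i z\<bar> * (\<integral>\<^sup>+x. W' (x - e * z) * f (x - e * z) \<partial>lborel)" .
  qed
  also have "\<dots> = (\<integral>\<^sup>+z. ennreal \<bar>rh i z\<bar> * (\<integral>\<^sup>+x. W' x * f x \<partial>lborel) \<partial>lborel)"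
  proof (rule nn_integral_cong)
    fix z
    have "(\<integral>\<^sup>+x. W' x * f x \<partial>lborel) = ennreal \<bar>1\<bar> * (\<integral>\<^sup>+x. W' (- e * z + 1 * x) * f (- e * z + 1 * x) \<partial>lborel)"
      by (rule nn_integral_real_affine) auto
    then show "ennreal \<bar>rh i z\<bar> * (\<integral>\<^sup>+x. W' (x - e * z) * f (x - e * z) \<partial>lborel)
      = ennreal \<bar>rh i z\<bar> * (\<integral>\<^sup>+x. W' x * f x \<partial>lborel)"
      by (simp add: algebra_simps)
  qed
  also have "\<dots> = ennreal (rn i) * (\<integral>\<^sup>+x. W' x * f x \<partial>lborel)"
    by (simp add: nn_integral_multc rn_ennreal)
  finally show ?thesis .
qed

lemma cv_weighted_sq:
  assumes [measurable]: "f \<in> borel_measurable borel" "W \<in> borel_measurable borel" "W' \<in> borel_measurable borel"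
    and W: "\<And>x z. \<bar>z\<bar> \<le> 1 \<Longrightarrow> W x \<le> W' (x - e * z)"
  shows "(\<integral>\<^sup>+x. W x * (cv i e f x)\<^sup>2 \<partial>lborel) \<le> ennreal ((rn i)\<^sup>2) * (\<integral>\<^sup>+x. W' x * (f x)\<^sup>2 \<partial>lborel)"
proof -
  have "(\<integral>\<^sup>+x. W x * (cv i e f x)\<^sup>2 \<partial>lborel) \<le> (\<integral>\<^sup>+x. ennreal (rn i) * (W x * cv i e (\<lambda>y. (f y)\<^sup>2) x) \<partial>lborel)"
  proof (rule nn_integral_mono)
    fix x show "W x * (cv i e f x)\<^sup>2 \<le> ennreal (rn i) * (W x * cv i e (\<lambda>y. (f y)\<^sup>2) x)"
      using mult_left_mono[OF cv_sq[of f i e x], of "W x"] by (simp add: mult_ac)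
  qed
  also have "\<dots> = ennreal (rn i) * (\<integral>\<^sup>+x. W x * cv i e (\<lambda>y. (f y)\<^sup>2) x \<partial>lborel)"
    by (rule nn_integral_cmult) measurable
  also have "\<dots> \<le> ennreal (rn i) * (ennreal (rn i) * (\<integral>\<^sup>+x. W' x * (f x)\<^sup>2 \<partial>lborel))"
    by (intro mult_left_mono cv_weighted W) auto
  finally show ?thesis
    by (simp add: rn_nonneg ennreal_mult power2_eq_square mult.assoc)
qed

lemma moll_le_cv:
  assumes c: "continuous_on UNIV f" and e: "e > 0"
  shows "ennreal \<bar>moll e i f x\<bar> \<le> ennreal (1 / e ^ i) * cv i e (\<lambda>y. ennreal \<bar>f y\<bar>) x"
proof -
  have "ennreal \<bar>LINT z|lborel. rh i z * f (x - e * z)\<bar> \<le> (\<integral>\<^sup>+z. ennreal (norm (rh i z * f (x - e * z))) \<partial>lborel)"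
    using integral_norm_bound_ennreal[OF moll_integrable[OF c]] by simp
  also have "\<dots> = cv i e (\<lambda>y. ennreal \<bar>f y\<bar>) x"
    by (simp add: cv_def abs_mult ennreal_mult)
  finally have "ennreal (1 / e ^ i) * ennreal \<bar>LINT z|lborel. rh i z * f (x - e * z)\<bar>
      \<le> ennreal (1 / e ^ i) * cv i e (\<lambda>y. ennreal \<bar>f y\<bar>) x"
    by (rule mult_left_mono) simp
  then show ?thesis
    using e by (simp add: moll_def abs_mult flip: ennreal_mult)
qed

lemma moll_weighted:
  assumes c: "continuous_on UNIV f" and e: "e > 0"
    and [measurable]: "W \<in> borel_measurable borel" "W' \<in> borel_measurable borel"
    and W: "\<And>x z. \<bar>z\<bar> \<le> 1 \<Longrightarrow> W x \<le> W' (x - e * z)"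
  shows "(\<integral>\<^sup>+x. W x * ennreal ((moll e i f x)\<^sup>2) \<partial>lborel)
    \<le> ennreal ((rn i / e ^ i)\<^sup>2) * (\<integral>\<^sup>+x. W' x * ennreal ((f x)\<^sup>2) \<partial>lborel)"
proof -
  have [measurable]: "f \<in> borel_measurable borel" by (intro borel_measurable_continuous_onI c)
  have sq: "ennreal (a\<^sup>2) = (ennreal \<bar>a\<bar>)\<^sup>2" for a by (simp add: ennreal_power)
  have "(\<integral>\<^sup>+x. W x * ennreal ((moll e i f x)\<^sup>2) \<partial>lborel)
    \<le> (\<integral>\<^sup>+x. ennreal ((1 / e ^ i)\<^sup>2) * (W x * (cv i e (\<lambda>y. ennreal \<bar>f y\<bar>) x)\<^sup>2) \<partial>lborel)"
  proof (rule nn_integral_mono)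
    fix x
    have "ennreal ((moll e i f x)\<^sup>2) \<le> (ennreal (1 / e ^ i) * cv i e (\<lambda>y. ennreal \<bar>f y\<bar>) x)\<^sup>2"
      unfolding sq by (intro power_mono moll_le_cv c e) auto
    then have "W x * ennreal ((moll e i f x)\<^sup>2) \<le> W x * (ennreal (1 / e ^ i) * cv i e (\<lambda>y. ennreal \<bar>f y\<bar>) x)\<^sup>2"
      by (intro mult_left_mono) auto
    then show "W x * ennreal ((moll e i f x)\<^sup>2) \<le> ennreal ((1 / e ^ i)\<^sup>2) * (W x * (cv i e (\<lambda>y. ennreal \<bar>f y\<bar>) x)\<^sup>2)"
      using e by (simp add: power_mult_distrib mult_ac ennreal_power)
  qed
  also have "\<dots> = ennreal ((1 / e ^ i)\<^sup>2) * (\<integral>\<^sup>+x. W x * (cv i e (\<lambda>y. ennreal \<bar>f y\<bar>) x)\<^sup>2 \<partial>lborel)"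
    by (rule nn_integral_cmult) measurable
  also have "\<dots> \<le> ennreal ((1 / e ^ i)\<^sup>2) * (ennreal ((rn i)\<^sup>2) * (\<integral>\<^sup>+x. W' x * (ennreal \<bar>f x\<bar>)\<^sup>2 \<partial>lborel))"
    by (intro mult_left_mono cv_weighted_sq W) auto
  also have "\<dots> = ennreal ((rn i / e ^ i)\<^sup>2) * (\<integral>\<^sup>+x. W' x * (ennreal \<bar>f x\<bar>)\<^sup>2 \<partial>lborel)"
    by (simp add: mult.assoc[symmetric] power_divide flip: ennreal_mult)
  finally show ?thesis
    by (simp only: sq[of "f _"])
qed

section \<open>The energy identity\<close>

text \<open>No decay of h at infinity is assumed beyond integrability. Write h(x + 1) - h(x) as the
  integral of h'(x + s) over s in [0, 1] and integrate in x: the left side gives 0, the right side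
  the integral of h'. The integrations by parts over the whole line rest on this lemma.\<close>

lemma integral_derivative_zero:
  fixes h h' :: "real \<Rightarrow> real"
  assumes d: "\<And>x. (h has_real_derivative h' x) (at x)" and c: "continuous_on UNIV h'"
    and i: "integrable lborel h" "integrable lborel h'"
  shows "(LINT x|lborel. h' x) = 0"
proof -
  have [measurable]: "h' \<in> borel_measurable borel" by (intro borel_measurable_continuous_onI c)
  have shift: "integrable lborel (\<lambda>x. h (x + 1))" "(LINT x|lborel. h (x + 1)) = (LINT x|lborel. h x)"
    using lborel_integrable_real_affine[OF i(1), of 1 1] lborel_integral_real_affine[of 1 h 1]
    by (simp_all add: add.commute)
  have eq: "h (x + 1) - h x = (LINT s|lborel. indicator {0..1::real} s * h' (x + s))" for x
  proof -
    have "(LINT s|lborel. indicator {0..1::real} s *\<^sub>R h' (x + s)) = h (x + 1) - h (x + 0)"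
      by (rule integral_FTC_atLeastAtMost)
        (auto intro!: DERIV_shift[THEN iffD1, THEN DERIV_subset] continuous_intros cont_comp[OF c] d
          simp: add.commute simp flip: has_real_derivative_iff_has_vector_derivative)
    then show ?thesis by simp
  qed
  have aff: "(\<integral>\<^sup>+x. ennreal (norm (h' (x + s))) \<partial>lborel) = (\<integral>\<^sup>+x. ennreal (norm (h' x)) \<partial>lborel)" for s
    by (subst (2) nn_integral_real_affine[of _ 1 s]) (auto simp: add.commute)
  have fin: "(\<integral>\<^sup>+x. ennreal (norm (h' x)) \<partial>lborel) < \<infinity>"
    using i(2) by (simp add: integrable_iff_bounded)
  have int: "integrable (lborel \<Otimes>\<^sub>M lborel) (\<lambda>(s, x). indicator {0..1} s * h' (x + s))"
  proof (rule integrableI_bounded)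
    have "(\<integral>\<^sup>+p. ennreal (norm (case p of (s, x) \<Rightarrow> indicator {0..1} s * h' (x + s))) \<partial>(lborel \<Otimes>\<^sub>M lborel))
      = (\<integral>\<^sup>+s. \<integral>\<^sup>+x. indicator {0..1} s * ennreal (norm (h' (x + s))) \<partial>lborel \<partial>lborel)"
      by (subst lborel.nn_integral_fst[symmetric])
        (auto intro!: nn_integral_cong simp: abs_mult indicator_def)
    also have "\<dots> = (\<integral>\<^sup>+s. indicator {0..1::real} s * (\<integral>\<^sup>+x. ennreal (norm (h' x)) \<partial>lborel) \<partial>lborel)"
      by (subst nn_integral_cmult) (use aff in auto)
    also have "\<dots> < \<infinity>"
      using fin by (simp add: nn_integral_multc)
    finally show "(\<integral>\<^sup>+p. ennreal (norm (case p of (s, x) \<Rightarrow> indicator {0..1} s * h' (x + s))) \<partial>(lborel \<Otimes>\<^sub>M lborel)) < \<infinity>" .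
  qed simp
  have "0 = (LINT x|lborel. h (x + 1) - h x)"
    using shift i by simp
  also have "\<dots> = (LINT x|lborel. LINT s|lborel. indicator {0..1::real} s * h' (x + s))"
    by (simp add: eq)
  also have "\<dots> = (LINT s|lborel. LINT x|lborel. indicator {0..1} s * h' (x + s))"
    using lborel_pair.Fubini_integral[OF int] by simp
  also have "\<dots> = (LINT s|lborel. indicator {0..1::real} s * (LINT x|lborel. h' x))"
  proof -
    have "(LINT x|lborel. indicator {0..1} s * h' (x + s)) = indicator {0..1} s * (LINT x|lborel. h' x)" for s :: real
      using lborel_integral_real_affine[of 1 h' s] by (simp add: add.commute)
    then show ?thesis by (intro Bochner_Integration.integral_cong refl)
  qed
  also have "\<dots> = (LINT x|lborel. h' x)"
    by simp
  finally show ?thesis by simp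
qed

section \<open>Dispersive integration by parts against a weight\<close>

lemma integrable_square_mult:
  fixes f g c :: "real \<Rightarrow> real"
  assumes [measurable]: "f \<in> borel_measurable borel" "g \<in> borel_measurable borel" "c \<in> borel_measurable borel"
    and f: "integrable lborel (\<lambda>x. (f x)\<^sup>2)" and g: "integrable lborel (\<lambda>x. (g x)\<^sup>2)"
    and B: "\<And>x. \<bar>c x\<bar> \<le> B"
  shows "integrable lborel (\<lambda>x. f x * g x * c x)"
proof (rule Bochner_Integration.integrable_bound)
  show "integrable lborel (\<lambda>x. B * ((f x)\<^sup>2 + (g x)\<^sup>2))" using f g by auto
  have "norm (f x * g x * c x) \<le> norm (B * ((f x)\<^sup>2 + (g x)\<^sup>2))" for x
  proof -
    have "0 \<le> B" using B[of 0] by linarith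
    have "2 * (\<bar>f x\<bar> * \<bar>g x\<bar>) \<le> (f x)\<^sup>2 + (g x)\<^sup>2"
      using sum_squares_bound[of "\<bar>f x\<bar>" "\<bar>g x\<bar>"] by simp
    then have "\<bar>f x\<bar> * \<bar>g x\<bar> \<le> (f x)\<^sup>2 + (g x)\<^sup>2"
      using mult_nonneg_nonneg[of "\<bar>f x\<bar>" "\<bar>g x\<bar>"] by linarith
    then have "\<bar>f x\<bar> * \<bar>g x\<bar> * \<bar>c x\<bar> \<le> ((f x)\<^sup>2 + (g x)\<^sup>2) * B"
      using B[of x] by (intro mult_mono) auto
    then show ?thesis using \<open>0 \<le> B\<close> by (simp add: abs_mult mult.commute)
  qed
  then show "AE x in lborel. norm (f x * g x * c x) \<le> norm (B * ((f x)\<^sup>2 + (g x)\<^sup>2))" by simp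
qed simp

text \<open>Three derivatives, because the third derivative in the equation is moved onto the
  weight. The common bound B only guarantees that integrals exist: it grows with the truncation
  radius and must not enter any final estimate.\<close>

locale weight =
  fixes c0 c1 c2 c3 :: "real \<Rightarrow> real" and B :: real
  assumes c0: "\<And>x. (c0 has_real_derivative c1 x) (at x)"
    and c1: "\<And>x. (c1 has_real_derivative c2 x) (at x)"
    and c2: "\<And>x. (c2 has_real_derivative c3 x) (at x)"
    and c3: "continuous_on UNIV c3"
    and bounds: "\<And>x. \<bar>c0 x\<bar> \<le> B" "\<And>x. \<bar>c1 x\<bar> \<le> B" "\<And>x. \<bar>c2 x\<bar> \<le> B" "\<And>x. \<bar>c3 x\<bar> \<le> B"
    and c0_nonneg: "\<And>x. c0 x \<ge> 0" and c1_nonneg: "\<And>x. c1 x \<ge> 0"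
begin

lemma weight_cont: "continuous_on UNIV c0" "continuous_on UNIV c1" "continuous_on UNIV c2"
  using c0 c1 c2 by (auto intro!: continuous_at_imp_continuous_on DERIV_isCont)

lemma weight_meas [measurable]: "c0 \<in> borel_measurable borel" "c1 \<in> borel_measurable borel"
  "c2 \<in> borel_measurable borel" "c3 \<in> borel_measurable borel"
  by (intro borel_measurable_continuous_onI weight_cont c3)+

lemma B_nonneg: "B \<ge> 0"
  using bounds(1)[of 0] by linarith

text \<open>The first term on the right, nonnegative since c1 \<ge> 0, is the source of Kato's
  smoothing. Instead of repeated integrations by parts, a primitive \<open>?h\<close> of the
  difference of the integrands is exhibited.\<close>

lemma dispersion_identity:
  assumes d: "\<And>x. (v0 has_real_derivative v1 x) (at x)" "\<And>x. (v1 has_real_derivative v2 x) (at x)"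
      "\<And>x. (v2 has_real_derivative v3 x) (at x)"
    and c: "continuous_on UNIV v3"
    and i: "integrable lborel (\<lambda>x. (v0 x)\<^sup>2)" "integrable lborel (\<lambda>x. (v1 x)\<^sup>2)"
      "integrable lborel (\<lambda>x. (v2 x)\<^sup>2)" "integrable lborel (\<lambda>x. (v3 x)\<^sup>2)"
  shows "2 * (LINT x|lborel. v0 x * v3 x * c0 x)
    = 3 * (LINT x|lborel. (v1 x)\<^sup>2 * c1 x) - (LINT x|lborel. (v0 x)\<^sup>2 * c3 x)"
proof -
  have cont: "continuous_on UNIV v0" "continuous_on UNIV v1" "continuous_on UNIV v2"
    using d by (auto intro!: continuous_at_imp_continuous_on DERIV_isCont)
  then have [measurable]: "v0 \<in> borel_measurable borel" "v1 \<in> borel_measurable borel"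
    "v2 \<in> borel_measurable borel" "v3 \<in> borel_measurable borel"
    by (auto intro!: borel_measurable_continuous_onI c)
  note ii = integrable_square_mult[OF _ _ _ _ _ bounds(1)] integrable_square_mult[OF _ _ _ _ _ bounds(2)]
    integrable_square_mult[OF _ _ _ _ _ bounds(3)] integrable_square_mult[OF _ _ _ _ _ bounds(4)]
  let ?h = "\<lambda>x. 2 * (v0 x * v2 x * c0 x) - v1 x * v1 x * c0 x - 2 * (v0 x * v1 x * c1 x) + v0 x * v0 x * c2 x"
  let ?h' = "\<lambda>x. 2 * (v0 x * v3 x * c0 x) - 3 * (v1 x * v1 x * c1 x) + v0 x * v0 x * c3 x"
  have "(LINT x|lborel. ?h' x) = 0"
  proof (rule integral_derivative_zero)
    show "(?h has_real_derivative ?h' x) (at x)" for x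
      by (auto intro!: derivative_eq_intros d c0 c1 c2 simp: algebra_simps)
    show "continuous_on UNIV ?h'"
      by (intro continuous_intros cont c c3 weight_cont)
    show "integrable lborel ?h" "integrable lborel ?h'"
      by (intro Bochner_Integration.integrable_add Bochner_Integration.integrable_diff
          integrable_mult_right ii i; measurable)+
  qed
  moreover have "(LINT x|lborel. ?h' x) = 2 * (LINT x|lborel. v0 x * v3 x * c0 x)
    - 3 * (LINT x|lborel. v1 x * v1 x * c1 x) + (LINT x|lborel. v0 x * v0 x * c3 x)"
    by (subst Bochner_Integration.integral_add Bochner_Integration.integral_diff,
        (intro Bochner_Integration.integrable_diff integrable_mult_right ii i; measurable)+)+ simp
  ultimately show ?thesis by (simp add: power2_eq_square)
qed

end

text \<open>The solution seen from t = 0 forward in time; the locale is instantiated a second time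
  with the reflected solution. The equation enters only through moments in x and with the
  nonlinearity as the derivative of the flux w^(k+1) / (k+1), so that no derivative of w occurs. M
  \<ge> 1 makes the powers of M increase with the exponent.\<close>

locale gkdv_half =
  fixes k :: nat and T M K2 :: real and w :: "real \<Rightarrow> real \<Rightarrow> real" and a :: "real \<Rightarrow> real"
  assumes k: "k \<ge> 1" and T: "T > 0" and M: "M \<ge> 1" and K2: "K2 \<ge> 0"
    and w_cont: "continuous_on UNIV (\<lambda>(t, x). w t x)"
    and w_bound: "\<And>t x. \<bar>w t x\<bar> \<le> M"
    and w_L2: "\<And>t. (\<integral>\<^sup>+x. ennreal ((w t x)\<^sup>2) \<partial>lborel) \<le> ennreal K2"
    and equation: "\<And>\<psi> t1 t2. smooth \<psi> \<Longrightarrow> \<exists>R. \<forall>x. \<bar>x\<bar> > R \<longrightarrow> \<psi> x = 0 \<Longrightarrow> 0 \<le> t1 \<Longrightarrow> t1 \<le> t2 \<Longrightarrow> t2 \<le> T \<Longrightarrow>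
      (LINT x|lborel. \<psi> x * w t2 x) - (LINT x|lborel. \<psi> x * w t1 x) =
      integral {t1..t2} (\<lambda>t. (LINT x|lborel. D 3 \<psi> x * w t x)
        + (LINT x|lborel. D 1 \<psi> x * ((w t x) ^ Suc k / real (Suc k))))"
    and a_meas [measurable]: "a \<in> borel_measurable borel" and a_nonneg: "\<And>t. a t \<ge> 0"
    and lip: "AE t in lborel. t \<in> {0..T} \<longrightarrow> (\<forall>x y. \<bar>w t x - w t y\<bar> \<le> a t * \<bar>x - y\<bar>)"
    and a4: "(\<integral>\<^sup>+t. indicator {0..T} t * ennreal ((1 + a t) ^ 4) \<partial>lborel) < \<infinity>"
begin

definition F :: "real \<Rightarrow> real" where "F z = z ^ Suc k / real (Suc k)"

definition U :: "real \<Rightarrow> nat \<Rightarrow> real \<Rightarrow> real \<Rightarrow> real" where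
  "U e i t = moll e i (w t)"

definition N :: "real \<Rightarrow> nat \<Rightarrow> real \<Rightarrow> real \<Rightarrow> real" where
  "N e i t = moll e i (\<lambda>x. F (w t x))"

lemma w_cont1: "continuous_on UNIV (w t)"
  using continuous_on_compose2[OF w_cont, of UNIV "\<lambda>x. (t, x)"] by (simp add: continuous_on_Pair)

lemma F_cont: "continuous_on A f \<Longrightarrow> continuous_on A (\<lambda>x. F (f x))"
  unfolding F_def by (intro continuous_intros) auto

lemma Fw_cont1: "continuous_on UNIV (\<lambda>x. F (w t x))"
  by (rule F_cont[OF w_cont1])

lemma cont_meas2:
  fixes g :: "real \<Rightarrow> real \<Rightarrow> real"
  assumes "continuous_on UNIV (\<lambda>(t, x). g t x)"
    and [measurable]: "f1 \<in> borel_measurable N'" "f2 \<in> borel_measurable N'"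
  shows "(\<lambda>p. g (f1 p) (f2 p)) \<in> borel_measurable N'"
proof -
  have "(\<lambda>(t, x). g t x) \<in> borel_measurable borel"
    by (intro borel_measurable_continuous_onI assms)
  then have "(\<lambda>p. (\<lambda>(t, x). g t x) (f1 p, f2 p)) \<in> borel_measurable N'"
    by (rule measurable_compose[rotated]) (simp add: borel_prod[symmetric])
  then show ?thesis by simp
qed

lemma U_cont: "continuous_on UNIV (\<lambda>(t, x). U e i t x)"
  unfolding U_def by (rule moll_cont2[OF w_cont])

lemma N_cont: "continuous_on UNIV (\<lambda>(t, x). N e i t x)"
  unfolding N_def by (rule moll_cont2) (use F_cont[OF w_cont] in \<open>simp add: split_beta\<close>)

lemmas w_meas [measurable (raw)] = cont_meas2[OF w_cont]
lemmas U_meas [measurable (raw)] = cont_meas2[OF U_cont]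
lemmas N_meas [measurable (raw)] = cont_meas2[OF N_cont]

lemma U_cont1: "continuous_on A (U e i t)"
  unfolding U_def by (rule moll_cont[OF w_cont1])

lemma U_deriv: "e > 0 \<Longrightarrow> (U e i t has_real_derivative U e (Suc i) t x) (at x)"
  unfolding U_def by (rule moll_deriv[OF w_cont1]) simp

lemma F_bound: "\<bar>z\<bar> \<le> M \<Longrightarrow> \<bar>F z\<bar> \<le> M ^ k * \<bar>z\<bar>"
proof -
  assume z: "\<bar>z\<bar> \<le> M"
  have "\<bar>F z\<bar> \<le> \<bar>z\<bar> ^ Suc k" using mult_right_mono[of 1 "real (Suc k)" "\<bar>z\<bar> ^ Suc k"]
    by (simp add: F_def power_abs abs_mult field_simps)
  also have "\<dots> \<le> M ^ k * \<bar>z\<bar>"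
    unfolding power_Suc2 using z by (intro mult_right_mono power_mono) auto
  finally show ?thesis .
qed

text \<open>One constant serves \<open>U\<close> and \<open>N\<close>, since (M^k)^2 \<ge> 1. It may
  blow up as e tends to 0, and is used only to know that integrals and suprema are finite.\<close>

definition CU :: "real \<Rightarrow> nat \<Rightarrow> real" where
  "CU e i = (rn i / e ^ i)\<^sup>2 * (M ^ k)\<^sup>2 * K2"

lemma CU_nonneg: "CU e i \<ge> 0"
  using K2 by (simp add: CU_def)

lemma U_L2: assumes "e > 0" shows "(\<integral>\<^sup>+x. ennreal ((U e i t x)\<^sup>2) \<partial>lborel) \<le> ennreal (CU e i)"
proof -
  have "(\<integral>\<^sup>+x. 1 * ennreal ((U e i t x)\<^sup>2) \<partial>lborel)
    \<le> ennreal ((rn i / e ^ i)\<^sup>2) * (\<integral>\<^sup>+x. 1 * ennreal ((w t x)\<^sup>2) \<partial>lborel)"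
    unfolding U_def by (rule moll_weighted[OF w_cont1 assms]) auto
  also have "\<dots> \<le> ennreal ((rn i / e ^ i)\<^sup>2) * ennreal K2"
    by (intro mult_left_mono) (use w_L2 in auto)
  also have "\<dots> \<le> ennreal ((rn i / e ^ i)\<^sup>2 * (M ^ k)\<^sup>2) * ennreal K2"
    using one_le_power[OF M, of k] mult_left_mono[of 1 "(M^k)\<^sup>2" "(rn i / e ^ i)\<^sup>2"]
    by (intro mult_right_mono ennreal_leI) (auto simp: one_le_power)
  finally show ?thesis using K2 by (simp add: CU_def ennreal_mult)
qed

lemma N_L2: assumes "e > 0" shows "(\<integral>\<^sup>+x. ennreal ((N e i t x)\<^sup>2) \<partial>lborel) \<le> ennreal (CU e i)"
proof -
  have "(\<integral>\<^sup>+x. 1 * ennreal ((N e i t x)\<^sup>2) \<partial>lborel)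
    \<le> ennreal ((rn i / e ^ i)\<^sup>2) * (\<integral>\<^sup>+x. 1 * ennreal ((F (w t x))\<^sup>2) \<partial>lborel)"
    unfolding N_def by (rule moll_weighted[OF Fw_cont1 assms]) auto
  also have "(\<integral>\<^sup>+x. 1 * ennreal ((F (w t x))\<^sup>2) \<partial>lborel) \<le> (\<integral>\<^sup>+x. ennreal ((M ^ k)\<^sup>2) * ennreal ((w t x)\<^sup>2) \<partial>lborel)"
  proof (rule nn_integral_mono)
    fix x
    have "(F (w t x))\<^sup>2 \<le> (M ^ k * \<bar>w t x\<bar>)\<^sup>2"
      using F_bound[OF w_bound] M by (intro abs_le_square_iff[THEN iffD1]) (auto simp: abs_mult)
    then show "1 * ennreal ((F (w t x))\<^sup>2) \<le> ennreal ((M ^ k)\<^sup>2) * ennreal ((w t x)\<^sup>2)"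
      by (simp add: power_mult_distrib flip: ennreal_mult)
  qed
  also have "\<dots> = ennreal ((M ^ k)\<^sup>2) * (\<integral>\<^sup>+x. ennreal ((w t x)\<^sup>2) \<partial>lborel)"
    by (rule nn_integral_cmult) measurable
  also have "\<dots> \<le> ennreal ((M ^ k)\<^sup>2) * ennreal K2"
    by (intro mult_left_mono) (use w_L2 in auto)
  finally have "(\<integral>\<^sup>+x. 1 * ennreal ((N e i t x)\<^sup>2) \<partial>lborel)
      \<le> ennreal ((rn i / e ^ i)\<^sup>2) * (ennreal ((M ^ k)\<^sup>2) * ennreal K2)"
    by (simp add: mult_left_mono)
  then show ?thesis using K2 by (simp add: CU_def ennreal_mult mult.assoc)
qed

lemma U_sq_integrable: "e > 0 \<Longrightarrow> integrable lborel (\<lambda>x. (U e i t x)\<^sup>2)"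
  by (rule integrableI_bounded) (use U_L2[of e i t] in \<open>auto intro: le_less_trans\<close>)

lemma N_sq_integrable: "e > 0 \<Longrightarrow> integrable lborel (\<lambda>x. (N e i t x)\<^sup>2)"
  by (rule integrableI_bounded) (use N_L2[of e i t] in \<open>auto intro: le_less_trans\<close>)

text \<open>The equation is tested with \<open>D j (ker e x)\<close>. At each fixed x it turns into
  an identity between continuous functions of t, which can then be differentiated.\<close>

lemma U_evolution:
  assumes e: "e > 0" and t: "0 \<le> t1" "t1 \<le> t2" "t2 \<le> T"
  shows "U e j t2 x - U e j t1 x = integral {t1..t2} (\<lambda>t. - U e (j + 3) t x - N e (Suc j) t x)"
proof -
  define \<psi> where "\<psi> = D j (ker e x)"
  have s: "smooth \<psi>" unfolding \<psi>_def by (rule smooth_pd[OF D_ker(1)[OF e]])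
  have z: "\<bar>y\<bar> > \<bar>x\<bar> + e \<Longrightarrow> \<psi> y = 0" for y
    unfolding \<psi>_def by (rule D_zero_outside[OF D_ker(1)[OF e], of "{x - e..x + e}"]) (auto intro: ker_outside e)
  have DD: "D i \<psi> = D (i + j) (ker e x)" for i by (simp add: \<psi>_def funpow_add)
  have U: "(LINT y|lborel. D i (ker e x) y * w t y) = (-1) ^ i * U e i t x" for i t
    unfolding U_def by (rule moll_eq_D_ker[OF e w_cont1])
  have N: "(LINT y|lborel. D i (ker e x) y * (w t y ^ Suc k / real (Suc k))) = (-1) ^ i * N e i t x" for i t
    unfolding N_def using moll_eq_D_ker[OF e Fw_cont1] by (simp only: F_def)
  have "(-1) ^ j * U e j t2 x - (-1) ^ j * U e j t1 x =
     integral {t1..t2} (\<lambda>t. (-1) ^ (3 + j) * U e (3 + j) t x + (-1) ^ (1 + j) * N e (1 + j) t x)"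
    using equation[OF s _ t] z unfolding DD U N unfolding \<psi>_def U by blast
  also have "(\<lambda>t. (-1) ^ (3 + j) * U e (3 + j) t x + (-1) ^ (1 + j) * N e (1 + j) t x)
    = (\<lambda>t. (-1) ^ j * (- U e (j + 3) t x - N e (Suc j) t x))"
    by (auto simp: power_add algebra_simps)
  also have "integral {t1..t2} \<dots> = (-1) ^ j * integral {t1..t2} (\<lambda>t. - U e (j + 3) t x - N e (Suc j) t x)"
    by simp
  finally have "(-1) ^ j * (U e j t2 x - U e j t1 x) = (-1) ^ j * integral {t1..t2} (\<lambda>t. - U e (j + 3) t x - N e (Suc j) t x)"
    by (simp add: algebra_simps)
  then show ?thesis by simp
qed

lemma U_deriv_t:
  assumes e: "e > 0" and t: "t \<in> {0..T}"
  shows "((\<lambda>t. U e j t x) has_real_derivative - U e (j + 3) t x - N e (Suc j) t x) (at t within {0..T})"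
proof -
  let ?g = "\<lambda>t. - U e (j + 3) t x - N e (Suc j) t x"
  have c: "continuous_on UNIV ?g"
    using continuous_on_compose2[OF U_cont, of UNIV "\<lambda>t. (t, x)"] continuous_on_compose2[OF N_cont, of UNIV "\<lambda>t. (t, x)"]
    by (auto intro!: continuous_intros simp: continuous_on_Pair)
  have "((\<lambda>s. U e j 0 x + integral {0..s} ?g) has_vector_derivative 0 + ?g t) (at t within {0..T})"
    by (intro has_vector_derivative_add has_vector_derivative_const integral_has_vector_derivative t)
      (use c in \<open>auto intro: continuous_on_subset\<close>)
  then have "((\<lambda>t. U e j t x) has_vector_derivative 0 + ?g t) (at t within {0..T})"
    by (rule has_vector_derivative_transform[OF t, rotated]) (use U_evolution[OF e, of 0 _ j x] in force)
  then show ?thesis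
    by (simp add: has_real_derivative_iff_has_vector_derivative)
qed

end

section \<open>Weighted energies of the mollified solution\<close>

locale gkdv_weight = gkdv_half + weight
begin

definition E :: "real \<Rightarrow> nat \<Rightarrow> real \<Rightarrow> real" where
  "E e j t = (LINT x|lborel. (U e j t x)\<^sup>2 * c0 x)"

definition P :: "real \<Rightarrow> nat \<Rightarrow> real \<Rightarrow> real" where
  "P e j t = (LINT x|lborel. (U e (Suc j) t x)\<^sup>2 * c1 x)"

text \<open>The part of dE/dt that has no sign; the rest is -3 P, the smoothing term.\<close>

definition X :: "real \<Rightarrow> nat \<Rightarrow> real \<Rightarrow> real" where
  "X e j t = (LINT x|lborel. (U e j t x)\<^sup>2 * c3 x) - 2 * (LINT x|lborel. U e j t x * N e (Suc j) t x * c0 x)"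

lemma E_nonneg: "E e j t \<ge> 0" and P_nonneg: "P e j t \<ge> 0"
  unfolding E_def P_def using c0_nonneg c1_nonneg by simp_all

lemma sq_weight_integrable:
  assumes "e > 0" "c \<in> borel_measurable borel" "\<And>x. \<bar>c x\<bar> \<le> B"
  shows "integrable lborel (\<lambda>x. (U e j t x)\<^sup>2 * c x)"
  using integrable_square_mult[of "U e j t" "U e j t" c B] assms U_sq_integrable[OF assms(1)]
  by (simp add: power2_eq_square)

lemma P_eq: "e > 0 \<Longrightarrow> ennreal (P e j t) = (\<integral>\<^sup>+x. ennreal ((U e (Suc j) t x)\<^sup>2 * c1 x) \<partial>lborel)"
  and E_eq: "e > 0 \<Longrightarrow> ennreal (E e j t) = (\<integral>\<^sup>+x. ennreal ((U e j t x)\<^sup>2 * c0 x) \<partial>lborel)"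
  unfolding P_def E_def
  by ((subst nn_integral_eq_integral; auto intro!: sq_weight_integrable bounds simp: c0_nonneg c1_nonneg), 
      (subst nn_integral_eq_integral; auto intro!: sq_weight_integrable bounds simp: c0_nonneg c1_nonneg))

lemma energy_rate:
  assumes e: "e > 0"
  shows "(LINT x|lborel. 2 * (U e j t x * (- U e (j + 3) t x - N e (Suc j) t x)) * c0 x) = X e j t - 3 * P e j t"
proof -
  have 1: "2 * (LINT x|lborel. U e j t x * U e (j + 3) t x * c0 x)
    = 3 * P e j t - (LINT x|lborel. (U e j t x)\<^sup>2 * c3 x)"
    unfolding P_def
    by (rule dispersion_identity[of _ "U e (Suc j) t" "U e (Suc (Suc j)) t"])
      (auto intro!: U_sq_integrable e U_cont1 simp: numeral_3_eq_3 U_deriv[OF e])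
  have "(LINT x|lborel. 2 * (U e j t x * (- U e (j + 3) t x - N e (Suc j) t x)) * c0 x)
    = (LINT x|lborel. (- 2) * (U e j t x * U e (j + 3) t x * c0 x) - 2 * (U e j t x * N e (Suc j) t x * c0 x))"
    by (rule Bochner_Integration.integral_cong) (auto simp: algebra_simps)
  also have "\<dots> = (- 2) * (LINT x|lborel. U e j t x * U e (j + 3) t x * c0 x)
      - 2 * (LINT x|lborel. U e j t x * N e (Suc j) t x * c0 x)"
    by (subst Bochner_Integration.integral_diff)
      (auto intro!: integrable_square_mult[OF _ _ _ _ _ bounds(1)] U_sq_integrable N_sq_integrable e)
  finally show ?thesis using 1 by (simp add: X_def)
qed

text \<open>Differentiation under the integral is avoided: U^2 c0 is differentiated in t at each
  fixed x and integrated back over [t1, t2], then over x, and Fubini's theorem exchanges the two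
  integrals. The constant C that dominates depends on e and B, which is harmless here.\<close>

lemma energy_identity:
  assumes e: "e > 0" and t: "0 \<le> t1" "t1 \<le> t2" "t2 \<le> T"
  shows "integrable lborel (\<lambda>t. indicator {t1..t2} t * (X e j t - 3 * P e j t))"
    and "E e j t2 - E e j t1 = (LINT t|lborel. indicator {t1..t2} t * (X e j t - 3 * P e j t))"
proof -
  let ?G = "\<lambda>t x. - U e (j + 3) t x - N e (Suc j) t x"
  let ?f = "\<lambda>t x. indicator {t1..t2} t * (2 * (U e j t x * ?G t x) * c0 x)"
  define C where "C = B * (2 * CU e j + CU e (j + 3) + CU e (Suc j))"
  have f1: "(\<integral>\<^sup>+x. ennreal (norm (?f t x)) \<partial>lborel) \<le> indicator {t1..t2} t * ennreal C" for t
  proof -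
    have 1: "norm (2 * (U e j t x * ?G t x) * c0 x)
      \<le> B * (2 * (U e j t x)\<^sup>2 + (U e (j + 3) t x)\<^sup>2 + (N e (Suc j) t x)\<^sup>2)" for x
    proof -
      have "2 * \<bar>U e j t x\<bar> * \<bar>?G t x\<bar> \<le> 2 * \<bar>U e j t x\<bar> * (\<bar>U e (j + 3) t x\<bar> + \<bar>N e (Suc j) t x\<bar>)"
        by (intro mult_left_mono) auto
      also have "\<dots> \<le> 2 * (U e j t x)\<^sup>2 + (U e (j + 3) t x)\<^sup>2 + (N e (Suc j) t x)\<^sup>2"
        using sum_squares_bound[of "\<bar>U e j t x\<bar>" "\<bar>U e (j + 3) t x\<bar>"]
          sum_squares_bound[of "\<bar>U e j t x\<bar>" "\<bar>N e (Suc j) t x\<bar>"]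
        by (simp add: algebra_simps)
      finally have "2 * \<bar>U e j t x\<bar> * \<bar>?G t x\<bar> * \<bar>c0 x\<bar>
          \<le> (2 * (U e j t x)\<^sup>2 + (U e (j + 3) t x)\<^sup>2 + (N e (Suc j) t x)\<^sup>2) * B"
        by (intro mult_mono bounds) auto
      then show ?thesis
        by (simp add: abs_mult mult_ac)
    qed
    have "(\<integral>\<^sup>+x. ennreal (norm (?f t x)) \<partial>lborel)
       \<le> (\<integral>\<^sup>+x. indicator {t1..t2} t * (ennreal B * (2 * ennreal ((U e j t x)\<^sup>2) + ennreal ((U e (j + 3) t x)\<^sup>2)
          + ennreal ((N e (Suc j) t x)\<^sup>2))) \<partial>lborel)"
    proof (rule nn_integral_mono)
      fix x
      have "ennreal (norm (2 * (U e j t x * ?G t x) * c0 x)) \<le> ennreal B * (2 * ennreal ((U e j t x)\<^sup>2)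
          + ennreal ((U e (j + 3) t x)\<^sup>2) + ennreal ((N e (Suc j) t x)\<^sup>2))"
        using ennreal_leI[OF 1[of x]] B_nonneg
        by (simp add: ennreal_mult ennreal_plus flip: ennreal_numeral)
      then show "ennreal (norm (?f t x)) \<le> indicator {t1..t2} t * (ennreal B * (2 * ennreal ((U e j t x)\<^sup>2)
          + ennreal ((U e (j + 3) t x)\<^sup>2) + ennreal ((N e (Suc j) t x)\<^sup>2)))"
        by (auto simp: indicator_def)
    qed
    also have "\<dots> = indicator {t1..t2} t * (ennreal B * (2 * (\<integral>\<^sup>+x. ennreal ((U e j t x)\<^sup>2) \<partial>lborel)
       + (\<integral>\<^sup>+x. ennreal ((U e (j + 3) t x)\<^sup>2) \<partial>lborel) + (\<integral>\<^sup>+x. ennreal ((N e (Suc j) t x)\<^sup>2) \<partial>lborel)))"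
      by (simp add: nn_integral_cmult nn_integral_add)
    also have "\<dots> \<le> indicator {t1..t2} t * (ennreal B * (2 * ennreal (CU e j) + ennreal (CU e (j + 3)) + ennreal (CU e (Suc j))))"
      by (intro mult_left_mono add_mono U_L2 N_L2 e) auto
    also have "\<dots> \<le> indicator {t1..t2} t * ennreal C"
      using B_nonneg by (simp add: C_def CU_nonneg ennreal_mult ennreal_plus flip: ennreal_numeral)
    finally show ?thesis .
  qed
  have int: "integrable (lborel \<Otimes>\<^sub>M lborel) (\<lambda>(t, x). ?f t x)"
  proof (rule integrableI_bounded)
    have "(\<integral>\<^sup>+p. ennreal (norm (case p of (t, x) \<Rightarrow> ?f t x)) \<partial>(lborel \<Otimes>\<^sub>M lborel))
      = (\<integral>\<^sup>+t. \<integral>\<^sup>+x. ennreal (norm (?f t x)) \<partial>lborel \<partial>lborel)"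
      by (subst lborel.nn_integral_fst[symmetric]) auto
    also have "\<dots> \<le> (\<integral>\<^sup>+t. ennreal C * indicator {t1..t2} t \<partial>lborel)"
      by (intro nn_integral_mono) (use f1 in \<open>simp add: mult.commute\<close>)
    also have "\<dots> < \<infinity>"
      using t by (simp add: nn_integral_cmult ennreal_mult_less_top emeasure_lborel_Icc)
    finally show "(\<integral>\<^sup>+p. ennreal (norm (case p of (t, x) \<Rightarrow> ?f t x)) \<partial>(lborel \<Otimes>\<^sub>M lborel)) < \<infinity>" .
  qed (unfold split_beta, measurable)
  have inner: "(LINT x|lborel. ?f t x) = indicator {t1..t2} t * (X e j t - 3 * P e j t)" for t
    using energy_rate[OF e, of j t] by simp
  show "integrable lborel (\<lambda>t. indicator {t1..t2} t * (X e j t - 3 * P e j t))"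
    using lborel_pair.integrable_fst'[OF int] by (simp only: prod.case inner)
  have eq: "(U e j t2 x)\<^sup>2 * c0 x - (U e j t1 x)\<^sup>2 * c0 x = (LINT t|lborel. ?f t x)" for x
  proof -
    have "(LINT t|lborel. indicator {t1..t2} t *\<^sub>R (2 * (U e j t x * ?G t x) * c0 x))
      = (U e j t2 x)\<^sup>2 * c0 x - (U e j t1 x)\<^sup>2 * c0 x"
    proof (rule integral_FTC_atLeastAtMost[OF t(2)])
      fix s assume s: "t1 \<le> s" "s \<le> t2"
      have "((\<lambda>t. (U e j t x)\<^sup>2 * c0 x) has_real_derivative 2 * (U e j s x * ?G s x) * c0 x) (at s within {t1..t2})"
        by (rule derivative_eq_intros DERIV_subset[OF U_deriv_t[OF e]] refl)+ (use s t in auto)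
      then show "((\<lambda>t. (U e j t x)\<^sup>2 * c0 x) has_vector_derivative 2 * (U e j s x * ?G s x) * c0 x) (at s within {t1..t2})"
        by (simp add: has_real_derivative_iff_has_vector_derivative)
    next
      have 1: "continuous_on {t1..t2} (\<lambda>t. U e i t x)" "continuous_on {t1..t2} (\<lambda>t. N e i t x)" for i
        using continuous_on_compose2[OF U_cont, of "{t1..t2}" "\<lambda>t. (t, x)"] continuous_on_compose2[OF N_cont, of "{t1..t2}" "\<lambda>t. (t, x)"]
        by (auto simp: continuous_on_Pair)
      show "continuous_on {t1..t2} (\<lambda>t. 2 * (U e j t x * ?G t x) * c0 x)"
        by (intro continuous_intros 1)
    qed
    then show ?thesis by simp
  qed
  have "E e j t2 - E e j t1 = (LINT x|lborel. (U e j t2 x)\<^sup>2 * c0 x - (U e j t1 x)\<^sup>2 * c0 x)"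
    unfolding E_def by (subst Bochner_Integration.integral_diff) (auto intro!: sq_weight_integrable e bounds)
  also have "\<dots> = (LINT t|lborel. LINT x|lborel. ?f t x)"
    using lborel_pair.Fubini_integral[OF int] by (simp only: eq)
  finally show "E e j t2 - E e j t1 = (LINT t|lborel. indicator {t1..t2} t * (X e j t - 3 * P e j t))"
    by (simp only: inner)
qed

lemma P_meas [measurable]: "P e j \<in> borel_measurable borel"
  unfolding P_def[abs_def] by measurable

lemma sq_weight_le:
  assumes "e > 0" "c \<in> borel_measurable borel" "\<And>x. 0 \<le> c x" "\<And>x. \<bar>c x\<bar> \<le> B"
  shows "(LINT x|lborel. (U e j t x)\<^sup>2 * c x) \<le> B * CU e j"
proof -
  have "(LINT x|lborel. (U e j t x)\<^sup>2 * c x) \<le> (LINT x|lborel. B * (U e j t x)\<^sup>2)"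
  proof (rule integral_mono)
    fix x show "(U e j t x)\<^sup>2 * c x \<le> B * (U e j t x)\<^sup>2"
      using mult_left_mono[of "c x" B "(U e j t x)\<^sup>2"] assms(3)[of x] assms(4)[of x] by (simp add: mult.commute)
  qed (auto intro!: sq_weight_integrable assms integrable_mult_right U_sq_integrable)
  also have "\<dots> = B * (LINT x|lborel. (U e j t x)\<^sup>2)" by simp
  also have "\<dots> \<le> B * CU e j"
  proof (intro mult_left_mono B_nonneg)
    have "ennreal (LINT x|lborel. (U e j t x)\<^sup>2) = (\<integral>\<^sup>+x. ennreal ((U e j t x)\<^sup>2) \<partial>lborel)"
      by (subst nn_integral_eq_integral) (auto intro!: U_sq_integrable assms)
    with U_L2[OF assms(1), of j t] have "ennreal (LINT x|lborel. (U e j t x)\<^sup>2) \<le> ennreal (CU e j)" by simp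
    then show "(LINT x|lborel. (U e j t x)\<^sup>2) \<le> CU e j"
      using CU_nonneg by (simp add: ennreal_le_iff)
  qed
  finally show ?thesis .
qed

lemma E_le: "e > 0 \<Longrightarrow> E e j t \<le> B * CU e j" and P_le: "e > 0 \<Longrightarrow> P e j t \<le> B * CU e (Suc j)"
  unfolding E_def P_def using sq_weight_le[OF _ _ _ bounds(1)] sq_weight_le[OF _ _ _ bounds(2)]
    c0_nonneg c1_nonneg by auto

text \<open>The identity becomes an inequality between extended nonnegative numbers.
  \<open>ennreal (X e j t)\<close> is the positive part of X, so only an upper bound for X is asked,
  for almost every t, and q may take the value infinity.\<close>

lemma energy_inequality:
  assumes e: "e > 0" and t: "0 \<le> t1" "t1 \<le> t2" "t2 \<le> T"
    and q: "AE t in lborel. t \<in> {t1..t2} \<longrightarrow> ennreal (X e j t) \<le> q t"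
  shows "ennreal (E e j t2) + 3 * (\<integral>\<^sup>+t. indicator {t1..t2} t * ennreal (P e j t) \<partial>lborel)
    \<le> ennreal (E e j t1) + (\<integral>\<^sup>+t. indicator {t1..t2} t * q t \<partial>lborel)"
proof -
  let ?i = "indicator {t1..t2} :: real \<Rightarrow> real"
  note id = energy_identity[OF e t, of j]
  have Pi: "integrable lborel (\<lambda>t. ?i t * P e j t)"
  proof (rule Bochner_Integration.integrable_bound)
    show "integrable lborel (\<lambda>t. ?i t * (B * CU e (Suc j)))"
      by (intro integrable_mult_left integrable_real_indicator) (auto simp: emeasure_lborel_Icc_eq)
    show "AE t in lborel. norm (?i t * P e j t) \<le> norm (?i t * (B * CU e (Suc j)))"
      using P_le[OF e] P_nonneg[of e j] B_nonneg CU_nonneg by (auto simp: abs_mult indicator_def)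
  qed simp
  have Xi: "integrable lborel (\<lambda>t. ?i t * X e j t)"
    using Bochner_Integration.integrable_add[OF id(1) integrable_mult_right[OF Pi, of 3]]
    by (simp add: algebra_simps)
  have "(LINT t|lborel. ?i t * (X e j t - 3 * P e j t)) = (LINT t|lborel. ?i t * X e j t - 3 * (?i t * P e j t))"
    by (simp add: algebra_simps)
  also have "\<dots> = (LINT t|lborel. ?i t * X e j t) - 3 * (LINT t|lborel. ?i t * P e j t)"
    by (subst Bochner_Integration.integral_diff) (auto intro!: Xi Pi integrable_mult_right)
  finally have main: "E e j t2 + 3 * (LINT t|lborel. ?i t * P e j t) = E e j t1 + (LINT t|lborel. ?i t * X e j t)"
    using id(2) by simp
  have P0: "0 \<le> (LINT t|lborel. ?i t * P e j t)" using P_nonneg by simp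
  have PP: "(\<integral>\<^sup>+t. indicator {t1..t2} t * ennreal (P e j t) \<partial>lborel) = ennreal (LINT t|lborel. ?i t * P e j t)"
  proof (subst nn_integral_eq_integral[symmetric, OF Pi])
    show "AE t in lborel. 0 \<le> ?i t * P e j t" using P_nonneg by simp
  qed (auto intro!: nn_integral_cong simp: indicator_def)
  have "(LINT t|lborel. ?i t * X e j t) \<le> (LINT t|lborel. max 0 (?i t * X e j t))"
    by (intro integral_mono Xi Bochner_Integration.integrable_max) auto
  also have "ennreal \<dots> = (\<integral>\<^sup>+t. ennreal (max 0 (?i t * X e j t)) \<partial>lborel)"
    by (subst nn_integral_eq_integral) (use Xi in auto)
  also have "\<dots> \<le> (\<integral>\<^sup>+t. indicator {t1..t2} t * q t \<partial>lborel)"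
    using q by (intro nn_integral_mono_AE, eventually_elim) (auto simp: indicator_def max_def ennreal_neg)
  finally have XX: "ennreal (LINT t|lborel. ?i t * X e j t) \<le> (\<integral>\<^sup>+t. indicator {t1..t2} t * q t \<partial>lborel)"
    by (simp add: ennreal_leI)
  have "ennreal (E e j t2) + 3 * ennreal (LINT t|lborel. ?i t * P e j t) = ennreal (E e j t1 + (LINT t|lborel. ?i t * X e j t))"
    using P0 E_nonneg by (subst main[symmetric]) (simp add: ennreal_plus ennreal_mult flip: ennreal_numeral)
  also have "\<dots> \<le> ennreal (E e j t1) + ennreal (LINT t|lborel. ?i t * X e j t)"
    by (cases "(LINT t|lborel. ?i t * X e j t) \<ge> 0")
      (auto simp: ennreal_plus E_nonneg ennreal_neg intro!: ennreal_leI)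
  also have "\<dots> \<le> ennreal (E e j t1) + (\<integral>\<^sup>+t. indicator {t1..t2} t * q t \<partial>lborel)"
    by (rule add_left_mono[OF XX])
  finally show ?thesis
    by (simp only: PP)
qed

text \<open>The energy is controlled in the mean over [s0, s1], not at a given initial time, so the
  argument starts at a time t0 where it is at most c, the mean bound plus 1. As g has integral at
  most 1/4, the supremum S from t0 on satisfies S \<le> c + K1 + S/4, and L = 2 (c + K1) covers both
  claims.\<close>

lemma energy_absorb:
  assumes e: "e > 0" and t: "0 \<le> s0" "s0 < s1" "s1 \<le> T"
    and K: "K0 \<ge> 0" "K1 \<ge> 0"
    and q [measurable]: "q \<in> borel_measurable borel" and g [measurable]: "g \<in> borel_measurable borel"
    and X: "AE t in lborel. t \<in> {s0..T} \<longrightarrow> ennreal (X e j t) \<le> q t + g t * ennreal (E e j t)"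
    and q1: "(\<integral>\<^sup>+t. indicator {s0..T} t * q t \<partial>lborel) \<le> ennreal K1"
    and g1: "(\<integral>\<^sup>+t. indicator {s0..T} t * g t \<partial>lborel) \<le> ennreal (1 / 4)"
    and E0: "(\<integral>\<^sup>+t. indicator {s0..s1} t * ennreal (E e j t) \<partial>lborel) \<le> ennreal K0"
  defines "L \<equiv> 2 * (K0 / (s1 - s0) + 1 + K1)"
  shows "\<And>t. t \<in> {s1..T} \<Longrightarrow> E e j t \<le> L"
    and "(\<integral>\<^sup>+t. indicator {s1..T} t * ennreal (P e j t) \<partial>lborel) \<le> ennreal L"
proof -
  define c where "c = K0 / (s1 - s0) + 1"
  \<comment> \<open>Otherwise the integral over [s0, s1] would be at least K0 + (s1 - s0); the
    summand 1 in c makes this a contradiction even when K0 = 0.\<close>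
  have "\<exists>t0\<in>{s0..s1}. E e j t0 \<le> c"
  proof (rule ccontr)
    assume "\<not> ?thesis"
    then have "(\<integral>\<^sup>+t. indicator {s0..s1} t * ennreal c \<partial>lborel) \<le> (\<integral>\<^sup>+t. indicator {s0..s1} t * ennreal (E e j t) \<partial>lborel)"
      by (intro nn_integral_mono) (force simp: indicator_def not_le less_imp_le intro!: ennreal_leI)
    also have "\<dots> \<le> ennreal K0" by (rule E0)
    finally have "ennreal ((s1 - s0) * c) \<le> ennreal K0"
      using t K by (simp add: nn_integral_multc c_def ennreal_mult)
    then have "(s1 - s0) * c \<le> K0" using K by (simp add: ennreal_le_iff)
    moreover have "(s1 - s0) * c = K0 + (s1 - s0)" using t by (simp add: c_def distrib_left)
    ultimately show False using t by simp
  qed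
  then obtain t0 where t0: "s0 \<le> t0" "t0 \<le> s1" "E e j t0 \<le> c" by auto
  \<comment> \<open>S is finite by \<open>E_le\<close>, though with a bound that depends on e and on
    the weight; finiteness alone permits subtracting S/4.\<close>
  define S where "S = (SUP t\<in>{t0..T}. E e j t)"
  have bdd: "bdd_above (E e j ` {t0..T})" using E_le[OF e] by (auto intro!: bdd_aboveI2)
  have ES: "E e j t \<le> S" if "t \<in> {t0..T}" for t
    unfolding S_def by (rule cSUP_upper[OF that bdd])
  have S0: "S \<ge> 0" using ES[of t0] E_nonneg[of e j t0] t t0 by auto
  have step: "ennreal (E e j t) + 3 * (\<integral>\<^sup>+s. indicator {t0..t} s * ennreal (P e j s) \<partial>lborel) \<le> ennreal (c + K1 + S / 4)"
    if "t \<in> {t0..T}" for t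
  proof -
    have "ennreal (E e j t) + 3 * (\<integral>\<^sup>+s. indicator {t0..t} s * ennreal (P e j s) \<partial>lborel)
      \<le> ennreal (E e j t0) + (\<integral>\<^sup>+s. indicator {t0..t} s * (q s + g s * ennreal (E e j s)) \<partial>lborel)"
      by (rule energy_inequality) (use e that t0 t X in auto)
    also have "\<dots> \<le> ennreal c + (\<integral>\<^sup>+s. indicator {s0..T} s * q s + indicator {s0..T} s * g s * ennreal S \<partial>lborel)"
    proof (intro add_mono ennreal_leI t0 nn_integral_mono)
      fix s show "indicator {t0..t} s * (q s + g s * ennreal (E e j s))
        \<le> indicator {s0..T} s * q s + indicator {s0..T} s * g s * ennreal S"
        using ES[of s] that t0 t by (auto simp: indicator_def intro!: add_left_mono mult_left_mono ennreal_leI)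
    qed
    also have "\<dots> = ennreal c + ((\<integral>\<^sup>+s. indicator {s0..T} s * q s \<partial>lborel) + (\<integral>\<^sup>+s. indicator {s0..T} s * g s \<partial>lborel) * ennreal S)"
      by (subst nn_integral_add) (auto simp: nn_integral_multc)
    also have "\<dots> \<le> ennreal c + (ennreal K1 + ennreal (1 / 4) * ennreal S)"
      by (intro add_mono mult_mono q1 g1) auto
    also have "\<dots> = ennreal (c + K1 + S / 4)"
      using K S0 t by (simp add: c_def ennreal_plus add.assoc flip: ennreal_mult)
    finally show ?thesis .
  qed
  have pos: "0 \<le> c + K1 + S / 4" using K S0 t by (simp add: c_def)
  have "S \<le> c + K1 + S / 4"
    unfolding S_def
  proof (rule cSUP_least)
    fix t assume "t \<in> {t0..T}"
    from order_trans[OF _ step[OF this], of "ennreal (E e j t)"] pos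
    show "E e j t \<le> c + K1 + (SUP t\<in>{t0..T}. E e j t) / 4"
      by (simp add: ennreal_le_iff S_def)
  qed (use t t0 in auto)
  then have SL: "c + K1 + S / 4 \<le> L" "S \<le> L"
    using K S0 by (auto simp: L_def c_def)
  show "E e j t \<le> L" if "t \<in> {s1..T}" for t
    using ES[of t] SL that t0 by auto
  have "(\<integral>\<^sup>+t. indicator {s1..T} t * ennreal (P e j t) \<partial>lborel) \<le> 3 * (\<integral>\<^sup>+t. indicator {s1..T} t * ennreal (P e j t) \<partial>lborel)"
    using mult_right_mono[of 1 "3::ennreal"] by auto
  also have "\<dots> \<le> 3 * (\<integral>\<^sup>+t. indicator {t0..T} t * ennreal (P e j t) \<partial>lborel)"
    using t0 by (intro mult_left_mono nn_integral_mono) (auto simp: indicator_def)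
  also have "\<dots> \<le> ennreal (c + K1 + S / 4)"
    using order_trans[OF _ step[of T], of "3 * (\<integral>\<^sup>+t. indicator {t0..T} t * ennreal (P e j t) \<partial>lborel)"] t t0 by auto
  also have "\<dots> \<le> ennreal L" by (intro ennreal_leI SL)
  finally show "(\<integral>\<^sup>+t. indicator {s1..T} t * ennreal (P e j t) \<partial>lborel) \<le> ennreal L" .
qed

end

section \<open>Weights\<close>

lemma mult_unit_bounds:
  fixes z :: real
  assumes "\<bar>z\<bar> \<le> 1" "e > 0"
  shows "- e \<le> e * z" "e * z \<le> e"
  using mult_left_mono[of z 1 e] mult_left_mono[of "-z" 1 e] assms by linarith+

lemma moll_cong:
  assumes "\<And>z. \<bar>z\<bar> \<le> 1 \<Longrightarrow> f (x - e * z) = g (x - e * z)"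
  shows "moll e i f x = moll e i g x"
proof -
  have "rh i z * f (x - e * z) = rh i z * g (x - e * z)" for z
  proof (cases "\<bar>z\<bar> \<le> 1")
    case False
    then have "rh i z = 0" by (intro rh_outside) auto
    then show ?thesis by simp
  qed (use assms in auto)
  then show ?thesis unfolding moll_def by presburger
qed

lemma moll_0_mono:
  assumes "continuous_on UNIV f" "continuous_on UNIV g" "\<And>z. \<bar>z\<bar> \<le> 1 \<Longrightarrow> f (x - e * z) \<le> g (y - e * z)"
  shows "moll e 0 f x \<le> moll e 0 g y"
proof -
  have "(LINT z|lborel. rh 0 z * f (x - e * z)) \<le> (LINT z|lborel. rh 0 z * g (y - e * z))"
  proof (rule integral_mono)
    fix z show "rh 0 z * f (x - e * z) \<le> rh 0 z * g (y - e * z)"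
    proof (cases "\<bar>z\<bar> \<le> 1")
      case True
      then show ?thesis using assms(3)[of z] by (intro mult_left_mono) (auto simp: rh_0 rho_nonneg)
    next
      case False
      then have "rh 0 z = 0" by (intro rh_outside) auto
      then show ?thesis by simp
    qed
  qed (auto intro!: moll_integrable assms)
  then show ?thesis by (simp add: moll_def)
qed

lemma moll_0_const: "moll e 0 (\<lambda>x. c) x = c"
  using rho_integral by (simp add: moll_def rh_0)

lemma moll_1_nonneg:
  assumes c: "continuous_on UNIV f" and e: "e > 0" and f: "mono f"
  shows "moll e 1 f x \<ge> 0"
proof -
  have "((\<lambda>y. (moll e 0 f y - moll e 0 f x) / (y - x)) \<longlongrightarrow> moll e 1 f x) (at x)"
    using moll_deriv[OF c, of e 0 x] e by (simp add: has_field_derivative_iff)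
  then show ?thesis
  proof (rule tendsto_lowerbound)
    have "0 \<le> (moll e 0 f y - moll e 0 f x) / (y - x)" for y
    proof (cases "x \<le> y")
      case True
      have "moll e 0 f x \<le> moll e 0 f y"
        by (rule moll_0_mono[OF c c]) (use True in \<open>auto intro!: monoD[OF f]\<close>)
      then show ?thesis using True by simp
    next
      case False
      have "moll e 0 f y \<le> moll e 0 f x"
        by (rule moll_0_mono[OF c c]) (use False in \<open>auto intro!: monoD[OF f]\<close>)
      then show ?thesis using False by (simp add: divide_nonpos_neg)
    qed
    then show "\<forall>\<^sub>F y in at x. 0 \<le> (moll e 0 f y - moll e 0 f x) / (y - x)" by simp
  qed simp
qed

text \<open>The truncation at \<open>R\<close> keeps the weight bounded, so that all energies are finite a priori; it is
  removed by monotone convergence.\<close>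

definition gw :: "real \<Rightarrow> nat \<Rightarrow> real \<Rightarrow> real \<Rightarrow> real" where
  "gw b n R x = min 1 (max 0 ((x - 2 * b) / b)) * min R (max 0 x) ^ n"

context
  fixes b R :: real and n :: nat
  assumes b: "b > 0" and R: "R > 0"
begin

lemma gw_cont: "continuous_on A (gw b n R)"
  unfolding gw_def using b by (intro continuous_intros) auto

lemma gw_nonneg: "gw b n R x \<ge> 0"
  using R by (simp add: gw_def)

lemma gw_mono: "mono (gw b n R)"
proof (rule monoI)
  fix x y :: real assume "x \<le> y"
  moreover from this have "(x - 2 * b) / b \<le> (y - 2 * b) / b" using b by (intro divide_right_mono) auto
  ultimately show "gw b n R x \<le> gw b n R y"
    unfolding gw_def using R by (intro mult_mono power_mono min.mono max.mono) auto
qed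

lemma gw_zero: "x \<le> 2 * b \<Longrightarrow> gw b n R x = 0"
  using b by (simp add: gw_def divide_le_0_iff)

lemma gw_le1: "gw b n R x \<le> min R (max 0 x) ^ n"
  using R mult_right_mono[of "min 1 (max 0 ((x - 2 * b) / b))" 1 "min R (max 0 x) ^ n"] by (simp add: gw_def)

lemma gw_eq: "3 * b \<le> x \<Longrightarrow> x \<le> R \<Longrightarrow> gw b n R x = x ^ n"
  using b by (simp add: gw_def max_def min_def field_simps)

lemma gw_ge: "3 * b \<le> x \<Longrightarrow> gw b n R x = min R x ^ n"
  using b by (simp add: gw_def max_def min_def field_simps)

lemma chi_bound:
  assumes "\<And>z. \<bar>z\<bar> \<le> 1 \<Longrightarrow> gw b n R (x - b * z) \<le> C"
  shows "\<bar>moll b i (gw b n R) x\<bar> \<le> rn i / b ^ i * C"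
  by (rule moll_bound[OF gw_cont b]) (use assms gw_nonneg in auto)

text \<open>Mollification at scale b spreads the support from [2b, \<infinity>) to [b, \<infinity>),
  and there x - b z \<le> 2x. The bound does not depend on R.\<close>

lemma chi_le: "\<bar>moll b i (gw b n R) x\<bar> \<le> rn i / b ^ i * 2 ^ n * (indicator {b..} x * x ^ n)"
proof (cases "x \<ge> b")
  case True
  have "\<bar>moll b i (gw b n R) x\<bar> \<le> rn i / b ^ i * (2 * x) ^ n"
  proof (rule chi_bound)
    fix z :: real assume "\<bar>z\<bar> \<le> 1"
    then have "- (b * z) \<le> b * 1" using b mult_left_mono[of "- z" 1 b] by simp
    then have "x - b * z \<le> 2 * x" using True by simp
    then have "min R (max 0 (x - b * z)) ^ n \<le> (2 * x) ^ n"
      using True b R by (intro power_mono) auto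
    then show "gw b n R (x - b * z) \<le> (2 * x) ^ n"
      using gw_le1 order_trans by blast
  qed
  then show ?thesis using True by (simp add: power_mult_distrib mult_ac)
next
  case False
  have "\<bar>moll b i (gw b n R) x\<bar> \<le> rn i / b ^ i * 0"
  proof (rule chi_bound)
    fix z :: real assume "\<bar>z\<bar> \<le> 1"
    then have "- (b * z) \<le> b * 1" using b mult_left_mono[of "- z" 1 b] by simp
    then show "gw b n R (x - b * z) \<le> 0" using gw_zero False by simp
  qed
  then show ?thesis using False by simp
qed

lemma chi_weight:
  "weight (moll b 0 (gw b n R)) (moll b 1 (gw b n R)) (moll b 2 (gw b n R)) (moll b 3 (gw b n R))
    (\<Sum>i<4. rn i / b ^ i * R ^ n)"
proof
  have d: "(moll b i (gw b n R) has_real_derivative moll b (Suc i) (gw b n R) x) (at x)" for i x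
    using moll_deriv[OF gw_cont] b by simp
  show "(moll b 0 (gw b n R) has_real_derivative moll b 1 (gw b n R) x) (at x)"
    "(moll b 1 (gw b n R) has_real_derivative moll b 2 (gw b n R) x) (at x)"
    "(moll b 2 (gw b n R) has_real_derivative moll b 3 (gw b n R) x) (at x)" for x
    using d[of 0] d[of 1] d[of 2] by (simp_all add: numeral_2_eq_2 numeral_3_eq_3)
  show "continuous_on UNIV (moll b 3 (gw b n R))" by (intro moll_cont gw_cont)
  have *: "\<bar>moll b i (gw b n R) x\<bar> \<le> (\<Sum>i<4. rn i / b ^ i * R ^ n)" if "i < 4" for i x
  proof -
    have "\<bar>moll b i (gw b n R) x\<bar> \<le> rn i / b ^ i * R ^ n"
      by (rule chi_bound, rule order_trans[OF gw_le1]) (use R in \<open>auto intro!: power_mono\<close>)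
    also have "\<dots> \<le> (\<Sum>i<4. rn i / b ^ i * R ^ n)"
      using that b R rn_nonneg by (intro member_le_sum) auto
    finally show ?thesis .
  qed
  show "\<bar>moll b 0 (gw b n R) x\<bar> \<le> (\<Sum>i<4. rn i / b ^ i * R ^ n)"
    "\<bar>moll b 1 (gw b n R) x\<bar> \<le> (\<Sum>i<4. rn i / b ^ i * R ^ n)"
    "\<bar>moll b 2 (gw b n R) x\<bar> \<le> (\<Sum>i<4. rn i / b ^ i * R ^ n)"
    "\<bar>moll b 3 (gw b n R) x\<bar> \<le> (\<Sum>i<4. rn i / b ^ i * R ^ n)" for x
    by (rule *; simp)+
  show "0 \<le> moll b 0 (gw b n R) x" for x
    using moll_0_mono[of "\<lambda>_. 0" "gw b n R" x b x] gw_nonneg gw_cont by (simp add: moll_0_const)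
  show "0 \<le> moll b 1 (gw b n R) x" for x
    by (rule moll_1_nonneg[OF gw_cont b gw_mono])
qed

text \<open>For x \<ge> 4b the kernel sees only points \<ge> 3b, where the ramp of \<open>gw\<close>
  has already reached 1, and these points are also \<ge> x/2.\<close>

lemma chi_lower:
  assumes "4 * b \<le> x" "x \<le> R"
  shows "(x / 2) ^ n \<le> moll b 0 (gw b n R) x"
proof -
  have "moll b 0 (\<lambda>_. (x / 2) ^ n) x \<le> moll b 0 (gw b n R) x"
  proof (rule moll_0_mono)
    fix z :: real assume z: "\<bar>z\<bar> \<le> 1"
    then have *: "x - b \<le> x - b * z" using mult_unit_bounds b by simp
    then have "x / 2 \<le> x - b * z" using assms(1) b by linarith
    then have "x / 2 \<le> min R (x - b * z)" using assms b by simp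
    then have "(x / 2) ^ n \<le> min R (x - b * z) ^ n" using assms b by (intro power_mono) auto
    then show "(x / 2) ^ n \<le> gw b n R (x - b * z)" using * assms by (subst gw_ge) auto
  qed (auto intro: gw_cont)
  then show ?thesis by (simp add: moll_0_const)
qed

text \<open>Between the ramp and the truncation the weight is mollified from exactly x^n, so its
  derivative is bounded below by a power one lower. This is the exchange rate of the whole proof:
  one power of x for one derivative of u.\<close>

lemma chi'_lower:
  assumes "4 * b \<le> x" "x \<le> R - b" "n = Suc n'"
  shows "(x / 2) ^ n' \<le> moll b 1 (gw b n R) x"
proof -
  have z: "x - b \<le> x - b * z" "x - b * z \<le> x + b" if "\<bar>z\<bar> \<le> 1" for z
    using mult_unit_bounds[OF that b] by auto
  have "moll b 1 (gw b n R) x = moll b 1 (\<lambda>y. y ^ n) x"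
  proof (rule moll_cong)
    fix s :: real assume "\<bar>s\<bar> \<le> 1"
    from z[OF this] assms show "gw b n R (x - b * s) = (x - b * s) ^ n"
      by (intro gw_eq) auto
  qed
  also have "\<dots> = moll b 0 (\<lambda>y. real n * y ^ n') x"
    using b moll_parts[of "\<lambda>y. y ^ n" "\<lambda>y. real n * y ^ n'" b 0 x]
      DERIV_pow[of n] by (simp add: assms(3) continuous_intros del: power_Suc)
  also have "\<dots> \<ge> moll b 0 (\<lambda>_. (x / 2) ^ n') x"
  proof (rule moll_0_mono)
    fix s :: real assume s: "\<bar>s\<bar> \<le> 1"
    have h: "x / 2 \<le> x - b * s" using z[OF s] assms(1) b by linarith
    have "1 * (x / 2) ^ n' \<le> real n * (x - b * s) ^ n'"
      by (intro mult_mono power_mono h) (use assms b in auto)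
    then show "(x / 2) ^ n' \<le> real n * (x - b * s) ^ n'" by simp
  qed (auto intro!: continuous_intros)
  finally show ?thesis by (simp add: moll_0_const)
qed

end

section \<open>Weighted norms\<close>

definition Wn :: "real \<Rightarrow> nat \<Rightarrow> (real \<Rightarrow> real) \<Rightarrow> ennreal" where
  "Wn b n f = (\<integral>\<^sup>+x. indicator {b..} x * ennreal (x ^ n * (f x)\<^sup>2) \<partial>lborel)"

lemma nn_integral_exhaust:
  fixes f :: "real \<Rightarrow> ennreal"
  assumes [measurable]: "f \<in> borel_measurable borel"
    and le: "\<And>R. R \<ge> R0 \<Longrightarrow> (\<integral>\<^sup>+x. indicator {b..R} x * f x \<partial>lborel) \<le> L"
  shows "(\<integral>\<^sup>+x. indicator {b..} x * f x \<partial>lborel) \<le> L"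
proof -
  have "(\<integral>\<^sup>+x. indicator {b..} x * f x \<partial>lborel) = (\<integral>\<^sup>+x. (SUP k::nat. indicator {b..real k} x * f x) \<partial>lborel)"
  proof (rule nn_integral_cong)
    fix x
    obtain k0 :: nat where k0: "x \<le> real k0" using real_arch_simple by blast
    have "(SUP k::nat. indicator {b..real k} x * f x) = indicator {b..} x * f x"
    proof (rule antisym)
      show "(SUP k::nat. indicator {b..real k} x * f x) \<le> indicator {b..} x * f x"
        by (rule SUP_least) (auto simp: indicator_def)
      show "indicator {b..} x * f x \<le> (SUP k::nat. indicator {b..real k} x * f x)"
        by (rule SUP_upper2[of k0]) (use k0 in \<open>auto simp: indicator_def\<close>)
    qed
    then show "indicator {b..} x * f x = (SUP k::nat. indicator {b..real k} x * f x)" by simp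
  qed
  also have "\<dots> = (SUP k::nat. \<integral>\<^sup>+x. indicator {b..real k} x * f x \<partial>lborel)"
    by (rule nn_integral_monotone_convergence_SUP)
      (auto simp: incseq_def le_fun_def indicator_def)
  also have "\<dots> \<le> L"
  proof (rule SUP_least)
    fix k :: nat
    have "(\<integral>\<^sup>+x. indicator {b..real k} x * f x \<partial>lborel) \<le> (\<integral>\<^sup>+x. indicator {b..max R0 (real k)} x * f x \<partial>lborel)"
      by (intro nn_integral_mono) (auto simp: indicator_def)
    also have "\<dots> \<le> L" by (rule le) simp
    finally show "(\<integral>\<^sup>+x. indicator {b..real k} x * f x \<partial>lborel) \<le> L" .
  qed
  finally show ?thesis .
qed

lemma Wn_mono_exponent:
  assumes "b > 0" "n \<le> n'" "f \<in> borel_measurable borel"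
  shows "Wn b n f \<le> ennreal (1 / b ^ (n' - n)) * Wn b n' f"
proof -
  have [measurable]: "f \<in> borel_measurable borel" by fact
  have "Wn b n f \<le> (\<integral>\<^sup>+x. ennreal (1 / b ^ (n' - n)) * (indicator {b..} x * ennreal (x ^ n' * (f x)\<^sup>2)) \<partial>lborel)"
    unfolding Wn_def
  proof (rule nn_integral_mono)
    fix x
    have "x ^ n * (f x)\<^sup>2 \<le> 1 / b ^ (n' - n) * (x ^ n' * (f x)\<^sup>2)" if x: "b \<le> x"
    proof -
      have "x ^ n * b ^ (n' - n) \<le> x ^ n * x ^ (n' - n)"
        using x assms by (intro mult_left_mono power_mono) auto
      also have "\<dots> = x ^ n'" using assms by (simp flip: power_add)
      finally have "x ^ n \<le> 1 / b ^ (n' - n) * x ^ n'" using assms by (simp add: field_simps)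
      from mult_right_mono[OF this, of "(f x)\<^sup>2"] show ?thesis by (simp add: mult.assoc)
    qed
    then show "indicator {b..} x * ennreal (x ^ n * (f x)\<^sup>2)
        \<le> ennreal (1 / b ^ (n' - n)) * (indicator {b..} x * ennreal (x ^ n' * (f x)\<^sup>2))"
      using assms(1) by (auto simp: indicator_def ennreal_leI simp flip: ennreal_mult')
  qed
  also have "\<dots> = ennreal (1 / b ^ (n' - n)) * Wn b n' f"
    unfolding Wn_def by (rule nn_integral_cmult) measurable
  finally show ?thesis .
qed

lemma Wn_mono_base: "b \<le> b' \<Longrightarrow> Wn b' n f \<le> Wn b n f"
  unfolding Wn_def by (intro nn_integral_mono) (auto simp: indicator_def)

text \<open>Since e \<le> b/2, a point x \<ge> b is moved down to x/2 at most. Hence the factor 2^n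
  and the passage from b to b/2 in the estimates for mollified functions.\<close>

lemma young_weight:
  assumes "0 < b" "0 < e" "e \<le> b / 2" "\<bar>z\<bar> \<le> 1"
  shows "indicator {b..} x * ennreal (x ^ n) \<le> indicator {b/2..} (x - e * z) * ennreal (2 ^ n * (x - e * z) ^ n)"
proof (cases "b \<le> x")
  case True
  have "e * z \<le> e" using mult_unit_bounds assms by auto
  then have y: "x / 2 \<le> x - e * z" "b / 2 \<le> x - e * z" using assms True by linarith+
  have "x ^ n \<le> (2 * (x - e * z)) ^ n" using y assms True by (intro power_mono) auto
  then have "ennreal (x ^ n) \<le> ennreal (2 ^ n * (x - e * z) ^ n)"
    unfolding power_mult_distrib by (rule ennreal_leI)
  then show ?thesis using y True by simp
qed auto

lemma Wn_eq: "Wn b n f = (\<integral>\<^sup>+x. (indicator {b..} x * ennreal (x ^ n)) * ennreal ((f x)\<^sup>2) \<partial>lborel)" if "b \<ge> 0"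
  unfolding Wn_def using that by (intro nn_integral_cong) (auto simp: indicator_def ennreal_mult')

lemma Wn_cv:
  assumes c: "continuous_on UNIV f" and e: "0 < b" "0 < e" "e \<le> b / 2"
  shows "(\<integral>\<^sup>+x. (indicator {b..} x * ennreal (x ^ n)) * (cv i e (\<lambda>y. ennreal \<bar>f y\<bar>) x)\<^sup>2 \<partial>lborel)
    \<le> ennreal ((rn i)\<^sup>2 * 2 ^ n) * Wn (b / 2) n f"
proof -
  have [measurable]: "f \<in> borel_measurable borel" by (intro borel_measurable_continuous_onI c)
  have "(\<integral>\<^sup>+x. (indicator {b..} x * ennreal (x ^ n)) * (cv i e (\<lambda>y. ennreal \<bar>f y\<bar>) x)\<^sup>2 \<partial>lborel)
    \<le> ennreal ((rn i)\<^sup>2) * (\<integral>\<^sup>+x. (indicator {b/2..} x * ennreal (2 ^ n * x ^ n)) * (ennreal \<bar>f x\<bar>)\<^sup>2 \<partial>lborel)"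
    by (rule cv_weighted_sq) (auto intro!: young_weight e)
  also have "(\<integral>\<^sup>+x. (indicator {b/2..} x * ennreal (2 ^ n * x ^ n)) * (ennreal \<bar>f x\<bar>)\<^sup>2 \<partial>lborel)
     = (\<integral>\<^sup>+x. ennreal (2 ^ n) * (indicator {b/2..} x * ennreal (x ^ n) * ennreal ((f x)\<^sup>2)) \<partial>lborel)"
    using e by (intro nn_integral_cong) (auto simp: indicator_def ennreal_mult' mult_ac ennreal_power)
  also have "\<dots> = ennreal (2 ^ n) * Wn (b / 2) n f"
    using e by (subst nn_integral_cmult) (auto simp: Wn_eq)
  finally show ?thesis by (simp add: ennreal_mult' mult.assoc)
qed

section \<open>Derivatives of the nonlinearity\<close>

text \<open>A list of orders stands for the product of the corresponding derivatives of \<open>u\<close>, and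
  \<open>raise\<close> is the Leibniz rule. The list \<open>lower_terms k j\<close> collects the terms of
  \<open>\<partial>\<^sup>j (u\<^bsup>k+1\<^esup> / (k+1))\<close> other than \<open>u\<^sup>k \<partial>\<^sup>j u\<close>.\<close>

fun raise :: "nat list \<Rightarrow> nat list list" where
  "raise [] = []"
| "raise (a # as) = (Suc a # as) # map ((#) a) (raise as)"

lemma raise_props:
  assumes "bs \<in> set (raise as)" "\<forall>a\<in>set as. a \<le> c"
  shows "length bs = length as" "sum_list bs = Suc (sum_list as)" "\<forall>a\<in>set bs. a \<le> Suc c"
  using assms by (induction as arbitrary: bs) force+

definition monom_of :: "(nat \<Rightarrow> real \<Rightarrow> real) \<Rightarrow> nat list \<Rightarrow> real \<Rightarrow> real" where
  "monom_of u as x = prod_list (map (\<lambda>a. u a x) as)"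

lemma monom_of_deriv:
  assumes "\<And>i x. (u i has_real_derivative u (Suc i) x) (at x)"
  shows "(monom_of u as has_real_derivative (\<Sum>bs\<leftarrow>raise as. monom_of u bs x)) (at x)"
proof (induction as)
  case (Cons a as)
  have "((\<lambda>x. u a x * monom_of u as x) has_real_derivative
    u (Suc a) x * monom_of u as x + u a x * (\<Sum>bs\<leftarrow>raise as. monom_of u bs x)) (at x)"
    by (auto intro!: derivative_eq_intros assms Cons)
  then show ?case
    by (simp add: monom_of_def[abs_def] o_def sum_list_const_mult)
qed (simp add: monom_of_def[abs_def])

text \<open>An integer coefficient is encoded by repetition: differentiating u^k in u^k
  \<partial>^(j+1) u gives k copies of the list 1, j+1, 0, ..., 0. The other lists come from
  differentiating the lower order terms found before.\<close>

fun lower_terms :: "nat \<Rightarrow> nat \<Rightarrow> nat list list" where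
  "lower_terms k 0 = []"
| "lower_terms k (Suc 0) = []"
| "lower_terms k (Suc (Suc j)) = replicate k (1 # Suc j # replicate (k - 1) 0) @ concat (map raise (lower_terms k (Suc j)))"

lemma lower_terms_props:
  assumes "k \<ge> 1" "as \<in> set (lower_terms k (Suc j))"
  shows "length as = Suc k \<and> sum_list as = Suc j \<and> (\<forall>a\<in>set as. a \<le> j)"
  using assms(2)
proof (induction j arbitrary: as)
  case (Suc j)
  then consider "as = 1 # Suc j # replicate (k - 1) 0" | bs where "bs \<in> set (lower_terms k (Suc j))" "as \<in> set (raise bs)"
    by (auto split: if_splits)
  then show ?case
  proof cases
    case 1
    then show ?thesis using assms(1) by (auto simp: sum_list_replicate)
  next
    case 2
    from Suc.IH[OF 2(1)] raise_props[OF 2(2), of j] show ?thesis by auto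
  qed
qed simp

definition sum_monom :: "(nat \<Rightarrow> real \<Rightarrow> real) \<Rightarrow> nat list list \<Rightarrow> real \<Rightarrow> real" where
  "sum_monom u L x = (\<Sum>as\<leftarrow>L. monom_of u as x)"

lemma sum_monom_deriv:
  assumes "\<And>i x. (u i has_real_derivative u (Suc i) x) (at x)"
  shows "(sum_monom u L has_real_derivative sum_monom u (concat (map raise L)) x) (at x)"
proof (induction L)
  case (Cons as L)
  have "((\<lambda>x. monom_of u as x + sum_monom u L x) has_real_derivative
     (\<Sum>bs\<leftarrow>raise as. monom_of u bs x) + sum_monom u (concat (map raise L)) x) (at x)"
    by (intro DERIV_add monom_of_deriv assms Cons)
  then show ?case by (simp add: sum_monom_def[abs_def])
qed (simp add: sum_monom_def[abs_def])

definition power_deriv :: "nat \<Rightarrow> (nat \<Rightarrow> real \<Rightarrow> real) \<Rightarrow> nat \<Rightarrow> real \<Rightarrow> real" where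
  "power_deriv k u j x = (if j = 0 then u 0 x ^ Suc k / real (Suc k)
     else u 0 x ^ k * u j x + sum_monom u (lower_terms k j) x)"

lemma power_deriv_deriv:
  assumes d: "\<And>i x. (u i has_real_derivative u (Suc i) x) (at x)" and k: "k \<ge> 1"
  shows "(power_deriv k u j has_real_derivative power_deriv k u (Suc j) x) (at x)"
proof (cases j)
  case 0
  have "((\<lambda>x. u 0 x ^ Suc k / real (Suc k)) has_real_derivative u 0 x ^ k * u 1 x) (at x)"
    using DERIV_cdivide[OF DERIV_chain2[OF DERIV_pow[of "Suc k"] d[of 0 x]], of "real (Suc k)"]
    by (simp del: of_nat_Suc power_Suc)
  then show ?thesis by (simp add: 0 power_deriv_def[abs_def] sum_monom_def)
next
  case (Suc i)
  have "monom_of u (1 # Suc i # replicate (k - 1) 0) x = u 0 x ^ (k - 1) * u 1 x * u (Suc i) x"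
    by (simp add: monom_of_def)
  then have 1: "sum_monom u (lower_terms k (Suc (Suc i))) x =
     real k * u 0 x ^ (k - 1) * u 1 x * u (Suc i) x + sum_monom u (concat (map raise (lower_terms k (Suc i)))) x"
    by (simp add: sum_monom_def map_replicate_const sum_list_replicate mult_ac del: replicate.simps)
  have "((\<lambda>x. u 0 x ^ k * u (Suc i) x + sum_monom u (lower_terms k (Suc i)) x) has_real_derivative
     (real k * u 0 x ^ (k - 1) * u 1 x * u (Suc i) x + u 0 x ^ k * u (Suc (Suc i)) x)
      + sum_monom u (concat (map raise (lower_terms k (Suc i)))) x) (at x)"
    by (rule derivative_eq_intros d sum_monom_deriv refl)+ simp
  then show ?thesis by (simp add: Suc power_deriv_def[abs_def] 1 algebra_simps del: lower_terms.simps)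
qed

lemma monom_of_cont:
  assumes "\<And>i. continuous_on UNIV (u i)"
  shows "continuous_on UNIV (monom_of u as)"
  by (induction as) (auto simp: monom_of_def[abs_def] intro!: continuous_intros assms)

lemma sum_monom_cont:
  assumes "\<And>i. continuous_on UNIV (u i)"
  shows "continuous_on UNIV (sum_monom u L)"
  by (induction L) (auto simp: sum_monom_def[abs_def] intro!: continuous_intros monom_of_cont assms)

lemma power_deriv_cont:
  assumes "\<And>i. continuous_on UNIV (u i)"
  shows "continuous_on UNIV (power_deriv k u j)"
  unfolding power_deriv_def[abs_def]
  by (cases "j = 0") (auto intro!: continuous_intros sum_monom_cont assms simp del: of_nat_Suc)

lemma prod_list_bound:
  fixes v :: "nat \<Rightarrow> real"
  assumes "\<And>e. v e \<ge> 0" "\<forall>e\<in>set l. v e \<le> d * q ^ e" "d \<ge> 0" "q \<ge> 0"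
  shows "prod_list (map v l) \<le> d ^ length l * q ^ sum_list l"
  using assms(2)
proof (induction l)
  case (Cons e l)
  then have "v e * prod_list (map v l) \<le> (d * q ^ e) * (d ^ length l * q ^ sum_list l)"
    using assms by (intro mult_mono) (auto intro!: prod_list_nonneg)
  then show ?case by (simp add: power_add mult_ac)
qed simp

text \<open>Let a be the largest order among factors of total order j + 1. If a = j, the other
  factors have total order 1; if a = j - 1, they have total order 2; otherwise every order is at
  most j - 2 and the bound d suffices. The factor of order a is kept for an L^2 norm; the others are
  bounded pointwise, at the price s1 or s^2.\<close>

lemma monomial_bound:
  fixes v :: "nat \<Rightarrow> real"
  assumes v: "\<And>e. v e \<ge> 0" and d: "d \<ge> 1" "s1 \<ge> 1" "s \<ge> 1"
    and j: "j \<ge> 2"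
    and h1: "\<And>e. e \<le> 1 \<Longrightarrow> v e \<le> d * s1 ^ e"
    and h2: "\<And>e. e \<le> 2 \<Longrightarrow> e < j \<Longrightarrow> v e \<le> d * s ^ e"
    and h3: "\<And>e. e + 2 \<le> j \<Longrightarrow> v e \<le> d"
    and as: "length as = Suc k" "sum_list as = Suc j" "\<forall>a\<in>set as. a \<le> j"
  shows "prod_list (map v as) \<le> d ^ k * (s1 * v j + s\<^sup>2 * (\<Sum>i=1..<j. v i))"
proof -
  define a where "a = Max (set as)"
  have ne: "as \<noteq> []" using as by auto
  then have a_in: "a \<in> set as" unfolding a_def by (intro Max_in) auto
  have a_max: "\<And>e. e \<in> set as \<Longrightarrow> e \<le> a" unfolding a_def by (intro Max_ge) auto
  have a1: "a \<ge> 1"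
  proof (rule ccontr)
    assume "\<not> a \<ge> 1"
    then have "\<forall>e\<in>set as. e = 0" using a_max by force
    then have "sum_list as = 0" by (simp add: sum_list_eq_0_iff)
    then show False using as by simp
  qed
  have aj: "a \<le> j" using a_in as by auto
  define l where "l = remove1 a as"
  have l: "length l = k" "\<And>e. e \<in> set l \<Longrightarrow> e \<in> set as"
    using as a_in set_remove1_subset[of a as] by (auto simp: l_def length_remove1)
  have mset: "mset as = add_mset a (mset l)" using a_in by (simp add: l_def)
  have sl: "a + sum_list l = Suc j"
    using as(2) mset by (metis sum_mset.add_mset sum_mset_sum_list)
  have pl: "prod_list (map v as) = v a * prod_list (map v l)"
    using mset by (metis (no_types, lifting) mset_map prod_mset.add_mset prod_mset_prod_list image_mset_add_mset)
  have el: "e \<le> sum_list l" if "e \<in> set l" for e using that by (intro member_le_sum_list) auto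
  have dk: "d ^ k \<ge> 0" using d by simp
  have sn: "(\<Sum>i=1..<j. v i) \<ge> 0" by (intro sum_nonneg v)
  have s2: "s\<^sup>2 \<ge> 1" using d by (simp add: one_le_power)
  show ?thesis
  proof (cases "a = j")
    case True
    have "prod_list (map v l) \<le> d ^ length l * s1 ^ sum_list l"
      using el sl True d by (intro prod_list_bound v ballI h1) force+
    then have "prod_list (map v as) \<le> v j * (d ^ k * s1)"
      using sl True l v[of j] by (simp add: pl mult_left_mono)
    also have "\<dots> \<le> d ^ k * (s1 * v j + s\<^sup>2 * (\<Sum>i=1..<j. v i))"
      using dk sn s2 by (simp add: distrib_left mult_ac)
    finally show ?thesis .
  next
    case False
    have "prod_list (map v l) \<le> d ^ k * s\<^sup>2"
    proof (cases "Suc a = j")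
      case True
      have "prod_list (map v l) \<le> d ^ length l * s ^ sum_list l"
      proof (intro prod_list_bound v ballI h2)
        fix e assume "e \<in> set l"
        then show "e \<le> 2" "e < j" using el[of e] sl True a_max l(2)[of e] by force+
      qed (use d in auto)
      moreover have "sum_list l = 2" using sl True by simp
      ultimately show ?thesis by (simp add: l)
    next
      case nn: False
      have "prod_list (map v l) \<le> d ^ length l * 1 ^ sum_list l"
      proof (intro prod_list_bound v ballI)
        fix e assume "e \<in> set l"
        then have "e + 2 \<le> j" using a_max l(2)[of e] aj False nn by force
        then show "v e \<le> d * 1 ^ e" using h3 by simp
      qed (use d in auto)
      also have "\<dots> \<le> d ^ k * s\<^sup>2" using dk s2 l mult_left_mono[of 1 "s\<^sup>2" "d ^ k"] by simp
      finally show ?thesis .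
    qed
    then have "prod_list (map v as) \<le> v a * (d ^ k * s\<^sup>2)"
      by (simp add: pl mult_left_mono v)
    also have "\<dots> \<le> (\<Sum>i=1..<j. v i) * (d ^ k * s\<^sup>2)"
      using a1 aj False dk s2 by (intro mult_right_mono member_le_sum) (auto intro: v)
    also have "\<dots> \<le> d ^ k * (s1 * v j + s\<^sup>2 * (\<Sum>i=1..<j. v i))"
      using dk d v[of j] by (simp add: distrib_left mult_ac)
    finally show ?thesis .
  qed
qed

section \<open>Mollifiers, products and Lipschitz functions\<close>

lemma moll_power_deriv:
  assumes d: "\<And>i x. (u i has_real_derivative u (Suc i) x) (at x)" and k: "k \<ge> 1" and e: "e > 0"
    and c: "\<And>i. continuous_on UNIV (u i)"
  shows "moll e (i + j) (power_deriv k u 0) = moll e i (power_deriv k u j)"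
proof (induction j arbitrary: i)
  case (Suc j)
  have "moll e (i + Suc j) (power_deriv k u 0) = moll e (Suc i) (power_deriv k u j)"
    using Suc[of "Suc i"] by simp
  also have "\<dots> = moll e i (power_deriv k u (Suc j))"
    by (rule moll_deriv_inner_eq) (use power_deriv_deriv[where u=u, OF d k] power_deriv_cont[of u, OF c] e in auto)
  finally show ?case .
qed simp

lemma moll_add:
  assumes "continuous_on UNIV f" "continuous_on UNIV g"
  shows "moll e i (\<lambda>x. f x + g x) x = moll e i f x + moll e i g x"
  unfolding moll_def distrib_left
  by (subst Bochner_Integration.integral_add) (auto intro!: moll_integrable assms simp: add_divide_distrib)

lemma moll_cmult: "moll e i (\<lambda>x. c * f x) x = c * moll e i f x"
proof -
  have "(\<lambda>z. rh i z * (c * f (x - e * z))) = (\<lambda>z. c * (rh i z * f (x - e * z)))" by (auto simp: fun_eq_iff)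
  then show ?thesis by (simp add: moll_def)
qed

text \<open>Friedrichs' commutator estimate with a frozen coefficient c: the derivative on the
  kernel costs 1/e, and the deviation of g from c, at most B e on the support, pays for it. The
  bound contains f but no derivative of f.\<close>

lemma commutator_bound:
  assumes f: "continuous_on UNIV f" and g: "continuous_on UNIV g" and e: "e > 0"
    and B: "\<And>z. \<bar>z\<bar> \<le> 1 \<Longrightarrow> \<bar>g (x - e * z) - c\<bar> \<le> B * e"
  shows "ennreal \<bar>moll e 1 (\<lambda>y. g y * f y) x - c * moll e 1 f x\<bar> \<le> ennreal B * cv 1 e (\<lambda>y. ennreal \<bar>f y\<bar>) x"
proof -
  have "0 \<le> B * e" using B[of 0] by simp
  then have B0: "B \<ge> 0" using e by (simp add: zero_le_mult_iff)
  have c: "continuous_on UNIV (\<lambda>y. (g y - c) * f y)" by (intro continuous_intros f g)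
  have "moll e 1 (\<lambda>y. g y * f y) x = moll e 1 (\<lambda>y. (g y - c) * f y + c * f y) x"
    by (simp add: algebra_simps)
  also have "\<dots> = moll e 1 (\<lambda>y. (g y - c) * f y) x + c * moll e 1 f x"
    using f by (subst moll_add[OF c]) (auto simp: moll_cmult intro!: continuous_intros)
  finally have "ennreal \<bar>moll e 1 (\<lambda>y. g y * f y) x - c * moll e 1 f x\<bar> \<le> ennreal (1 / e ^ 1) * cv 1 e (\<lambda>y. ennreal \<bar>(g y - c) * f y\<bar>) x"
    using moll_le_cv[OF c e, of 1 x] by simp
  also have "cv 1 e (\<lambda>y. ennreal \<bar>(g y - c) * f y\<bar>) x \<le> ennreal (B * e) * cv 1 e (\<lambda>y. ennreal \<bar>f y\<bar>) x"
  proof -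
    have [measurable]: "f \<in> borel_measurable borel" by (intro borel_measurable_continuous_onI f)
    have "cv 1 e (\<lambda>y. ennreal \<bar>(g y - c) * f y\<bar>) x \<le> (\<integral>\<^sup>+z. ennreal (B * e) * (ennreal \<bar>rh 1 z\<bar> * ennreal \<bar>f (x - e * z)\<bar>) \<partial>lborel)"
      unfolding cv_def
    proof (rule nn_integral_mono)
      fix z
      show "ennreal \<bar>rh 1 z\<bar> * ennreal \<bar>(g (x - e * z) - c) * f (x - e * z)\<bar>
        \<le> ennreal (B * e) * (ennreal \<bar>rh 1 z\<bar> * ennreal \<bar>f (x - e * z)\<bar>)"
      proof (cases "\<bar>z\<bar> \<le> 1")
        case True
        have "\<bar>rh 1 z\<bar> * \<bar>(g (x - e * z) - c) * f (x - e * z)\<bar> \<le> B * e * (\<bar>rh 1 z\<bar> * \<bar>f (x - e * z)\<bar>)"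
          using mult_right_mono[OF B[OF True], of "\<bar>rh 1 z\<bar> * \<bar>f (x - e * z)\<bar>"] by (simp add: abs_mult mult_ac)
        then show ?thesis using B0 e by (simp add: ennreal_leI flip: ennreal_mult)
      next
        case False
        then have "rh 1 z = 0" by (intro rh_outside) auto
        then show ?thesis by simp
      qed
    qed
    also have "\<dots> = ennreal (B * e) * cv 1 e (\<lambda>y. ennreal \<bar>f y\<bar>) x"
      unfolding cv_def by (rule nn_integral_cmult) measurable
    finally show ?thesis .
  qed
  also have "ennreal (1 / e ^ 1) * (ennreal (B * e) * cv 1 e (\<lambda>y. ennreal \<bar>f y\<bar>) x) = ennreal B * cv 1 e (\<lambda>y. ennreal \<bar>f y\<bar>) x"
    using e B0 by (simp add: mult.assoc[symmetric] flip: ennreal_mult)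
  finally show ?thesis by (simp add: mult_left_mono)
qed

lemma power_diff_bound:
  fixes x y :: real
  assumes "\<bar>x\<bar> \<le> M" "\<bar>y\<bar> \<le> M" "M \<ge> 1"
  shows "\<bar>x ^ k - y ^ k\<bar> \<le> real k * M ^ k * \<bar>x - y\<bar>"
proof -
  \<comment> \<open>\<open>norm_power_diff\<close> is a statement about the unit ball, hence the
    rescaling by M.\<close>
  have "norm ((x / M) ^ k - (y / M) ^ k) \<le> real k * norm (x / M - y / M)"
    using assms by (intro norm_power_diff) auto
  then have "\<bar>x ^ k - y ^ k\<bar> / M ^ k \<le> real k * (\<bar>x - y\<bar> / M)"
    using assms by (simp add: power_divide diff_divide_distrib[symmetric])
  then have "\<bar>x ^ k - y ^ k\<bar> \<le> real k * (\<bar>x - y\<bar> / M) * M ^ k"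
    using assms by (simp add: divide_simps)
  also have "\<dots> \<le> real k * (\<bar>x - y\<bar> / 1) * M ^ k"
    using assms by (intro mult_right_mono mult_left_mono divide_left_mono) auto
  finally show ?thesis by (simp add: mult_ac)
qed

lemma lipschitz_moll:
  assumes c: "continuous_on UNIV f" and e: "e > 0" and L: "\<And>x y. \<bar>f x - f y\<bar> \<le> A * \<bar>x - y\<bar>"
  shows "\<bar>moll e 0 f x - f x\<bar> \<le> A * e" "\<bar>moll e 1 f x\<bar> \<le> A"
proof -
  have A: "A \<ge> 0" using L[of 1 0] by simp
  show "\<bar>moll e 0 f x - f x\<bar> \<le> A * e"
  proof (rule moll_0_near[OF c e])
    fix y assume "\<bar>y - x\<bar> \<le> e"
    then show "\<bar>f y - f x\<bar> \<le> A * e" using L[of y x] mult_left_mono[OF _ A, of "\<bar>y - x\<bar>" e] by linarith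
  qed
  have half: "moll e 0 f y - moll e 0 f x \<le> A * \<bar>y - x\<bar>" for x y
  proof -
    have "moll e 0 f y \<le> moll e 0 (\<lambda>s. f s + A * \<bar>y - x\<bar>) x"
    proof (rule moll_0_mono[OF c])
      fix z show "f (y - e * z) \<le> f (x - e * z) + A * \<bar>y - x\<bar>"
        using L[of "y - e * z" "x - e * z"] by simp
    qed (intro continuous_intros c)
    also have "\<dots> = moll e 0 f x + A * \<bar>y - x\<bar>"
      by (subst moll_add[OF c]) (auto simp: moll_0_const)
    finally show ?thesis by simp
  qed
  have "((\<lambda>y. \<bar>(moll e 0 f y - moll e 0 f x) / (y - x)\<bar>) \<longlongrightarrow> \<bar>moll e 1 f x\<bar>) (at x)"
    using moll_deriv[OF c, of e 0 x] e by (intro tendsto_rabs) (simp add: has_field_derivative_iff)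
  then show "\<bar>moll e 1 f x\<bar> \<le> A"
  proof (rule tendsto_upperbound)
    have "\<bar>moll e 0 f y - moll e 0 f x\<bar> \<le> A * \<bar>y - x\<bar>" for y
      using half[of y x] half[of x y] by (simp add: abs_le_iff abs_minus_commute)
    then have "\<bar>(moll e 0 f y - moll e 0 f x) / (y - x)\<bar> \<le> A" if "y \<noteq> x" for y
      using that by (simp add: divide_simps)
    then show "\<forall>\<^sub>F y in at x. \<bar>(moll e 0 f y - moll e 0 f x) / (y - x)\<bar> \<le> A"
      by (auto simp: eventually_at_filter)
  qed simp
qed

text \<open>f(x)^2 and f(y)^2 differ by an integral of 2 f f'. Averaging over y in [x, x + 1], and
  not around x, keeps everything to the right of b.\<close>

lemma sobolev_half_line:
  assumes d: "\<And>x. (f has_real_derivative f' x) (at x)" and c: "continuous_on UNIV f'" and x: "x \<ge> b"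
  shows "ennreal ((f x)\<^sup>2) \<le> 2 * (Wn b 0 f + Wn b 0 f')"
proof -
  have cf: "continuous_on UNIV f"
    using d by (auto intro!: continuous_at_imp_continuous_on DERIV_isCont)
  have [measurable]: "f \<in> borel_measurable borel" "f' \<in> borel_measurable borel"
    by (intro borel_measurable_continuous_onI cf c)+
  have pt: "ennreal ((f x)\<^sup>2) \<le> ennreal ((f y)\<^sup>2) + (Wn b 0 f + Wn b 0 f')" if y: "y \<in> {x..x + 1}" for y
  proof -
    have "(LINT s|lborel. indicator {x..y} s *\<^sub>R (2 * f s * f' s)) = (f y)\<^sup>2 - (f x)\<^sup>2"
    proof (rule integral_FTC_atLeastAtMost)
      fix s show "((\<lambda>s. (f s)\<^sup>2) has_vector_derivative 2 * f s * f' s) (at s within {x..y})"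
        by (auto intro!: derivative_eq_intros DERIV_subset[OF d] simp flip: has_real_derivative_iff_has_vector_derivative)
    qed (use y in \<open>auto intro!: continuous_intros continuous_on_subset[OF cf] continuous_on_subset[OF c]\<close>)
    then have "(f x)\<^sup>2 \<le> (f y)\<^sup>2 + norm (LINT s|lborel. indicator {x..y} s *\<^sub>R (2 * f s * f' s))" by auto
    then have "ennreal ((f x)\<^sup>2) \<le> ennreal ((f y)\<^sup>2) + ennreal (norm (LINT s|lborel. indicator {x..y} s *\<^sub>R (2 * f s * f' s)))"
      by (simp add: ennreal_leI flip: ennreal_plus)
    also have "ennreal (norm (LINT s|lborel. indicator {x..y} s *\<^sub>R (2 * f s * f' s)))
       \<le> (\<integral>\<^sup>+s. ennreal (norm (indicator {x..y} s *\<^sub>R (2 * f s * f' s))) \<partial>lborel)"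
      by (intro integral_norm_bound_ennreal borel_integrable_compact continuous_intros
          continuous_on_subset[OF cf] continuous_on_subset[OF c]) auto
    also have "\<dots> \<le> (\<integral>\<^sup>+s. indicator {b..} s * ennreal (s ^ 0 * (f s)\<^sup>2) + indicator {b..} s * ennreal (s ^ 0 * (f' s)\<^sup>2) \<partial>lborel)"
    proof (rule nn_integral_mono)
      fix s
      have "2 * \<bar>f s\<bar> * \<bar>f' s\<bar> \<le> (f s)\<^sup>2 + (f' s)\<^sup>2"
        using sum_squares_bound[of "\<bar>f s\<bar>" "\<bar>f' s\<bar>"] by simp
      then show "ennreal (norm (indicator {x..y} s *\<^sub>R (2 * f s * f' s)))
        \<le> indicator {b..} s * ennreal (s ^ 0 * (f s)\<^sup>2) + indicator {b..} s * ennreal (s ^ 0 * (f' s)\<^sup>2)"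
        using x by (auto simp: indicator_def abs_mult ennreal_leI simp flip: ennreal_plus)
    qed
    also have "\<dots> = Wn b 0 f + Wn b 0 f'" unfolding Wn_def by (rule nn_integral_add) measurable
    finally show ?thesis by (simp add: add_left_mono)
  qed
  have "ennreal ((f x)\<^sup>2) = (\<integral>\<^sup>+y. indicator {x..x + 1} y * ennreal ((f x)\<^sup>2) \<partial>lborel)"
    by (simp add: nn_integral_multc)
  also have "\<dots> \<le> (\<integral>\<^sup>+y. indicator {b..} y * ennreal (y ^ 0 * (f y)\<^sup>2) + indicator {x..x + 1} y * (Wn b 0 f + Wn b 0 f') \<partial>lborel)"
    using pt x by (intro nn_integral_mono) (auto simp: indicator_def)
  also have "\<dots> = Wn b 0 f + (Wn b 0 f + Wn b 0 f')"
    unfolding Wn_def[of b 0 f] by (subst nn_integral_add) (auto simp: nn_integral_multc)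
  also have "\<dots> \<le> 2 * (Wn b 0 f + Wn b 0 f')"
    by (simp add: mult_2 distrib_left add_ac add_left_mono)
  finally show ?thesis .
qed

lemma ennreal_sq_add_le: "(x + y)\<^sup>2 \<le> 2 * x\<^sup>2 + 2 * y\<^sup>2" for x y :: ennreal
proof (cases "x = \<top> \<or> y = \<top>")
  case True
  then show ?thesis by (auto simp: power2_eq_square)
next
  case False
  then obtain u v where uv: "x = ennreal u" "u \<ge> 0" "y = ennreal v" "v \<ge> 0"
    by (cases x; cases y) auto
  have "(u + v)\<^sup>2 \<le> 2 * u\<^sup>2 + 2 * v\<^sup>2" using sum_squares_bound[of u v] by (simp add: power2_sum)
  then have "ennreal ((u + v)\<^sup>2) \<le> ennreal (2 * u\<^sup>2 + 2 * v\<^sup>2)" by (rule ennreal_leI)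
  then show ?thesis
    using uv by (simp add: ennreal_plus ennreal_mult flip: ennreal_power)
qed

lemma sum_square_le_card:
  fixes f :: "nat \<Rightarrow> real"
  shows "(\<Sum>i\<in>I. f i)\<^sup>2 \<le> real (card I) * (\<Sum>i\<in>I. (f i)\<^sup>2)"
  using sum_squared_le_sum_of_squares[of f I] by (simp add: mult.commute)

lemma moll_dominated:
  fixes f :: "nat \<Rightarrow> real \<Rightarrow> real"
  assumes c: "\<And>m. continuous_on UNIV (f m)" "continuous_on UNIV g"
    and lim: "\<And>x. (\<lambda>m. f m x) \<longlonglongrightarrow> g x" and B: "\<And>m x. \<bar>f m x\<bar> \<le> B"
  shows "(\<lambda>m. moll e i (f m) x) \<longlonglongrightarrow> moll e i g x"
proof -
  have "(\<lambda>m. LINT z|lborel. rh i z * f m (x - e * z)) \<longlonglongrightarrow> (LINT z|lborel. rh i z * g (x - e * z))"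
  proof (rule integral_dominated_convergence)
    show "(\<lambda>z. rh i z * g (x - e * z)) \<in> borel_measurable lborel" "(\<lambda>z. rh i z * f m (x - e * z)) \<in> borel_measurable lborel" for m
      using moll_integrable[OF c(2), of i x e] moll_integrable[OF c(1), of i m x e] by auto
    show "integrable lborel (\<lambda>z. \<bar>rh i z\<bar> * B)"
      by (intro integrable_mult_left integrable_abs rh_integrable)
    show "AE z in lborel. (\<lambda>m. rh i z * f m (x - e * z)) \<longlonglongrightarrow> rh i z * g (x - e * z)"
      by (auto intro!: tendsto_intros lim)
    show "AE z in lborel. norm (rh i z * f m (x - e * z)) \<le> \<bar>rh i z\<bar> * B" for m
      using B by (auto simp: abs_mult intro!: mult_left_mono)
  qed
  then show ?thesis unfolding moll_def by (intro tendsto_intros)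
qed

lemma sum_monom_bound:
  assumes "\<And>as. as \<in> set L \<Longrightarrow> \<bar>monom_of u as x\<bar> \<le> B"
  shows "\<bar>sum_monom u L x\<bar> \<le> real (length L) * B"
  using assms
proof (induction L)
  case (Cons as L)
  then have "\<bar>monom_of u as x\<bar> \<le> B" "\<bar>sum_monom u L x\<bar> \<le> real (length L) * B" by auto
  then show ?case by (simp add: sum_monom_def algebra_simps)
qed (simp add: sum_monom_def)

section \<open>The nonlinear remainder\<close>

context gkdv_half
begin

lemma U0_bound: "e > 0 \<Longrightarrow> \<bar>U e 0 t x\<bar> \<le> M"
  using moll_0_near[OF w_cont1[of t], of e x 0 M] w_bound by (simp add: U_def)

text \<open>The lower order terms of \<partial>^j of the flux, differentiated once more. What else
  \<partial>^(j+1) of the flux contains is the derivative of u^k \<partial>^j u, which is left to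
  the commutator estimate. The list is empty for j \<le> 1.\<close>

definition dN :: "nat \<Rightarrow> nat list list" where
  "dN j = concat (map raise (lower_terms k j))"

lemma dN_props:
  assumes "as \<in> set (dN j)"
  shows "length as = Suc k \<and> sum_list as = Suc j \<and> (\<forall>a\<in>set as. a \<le> j) \<and> j \<ge> 2"
proof -
  obtain bs where bs: "bs \<in> set (lower_terms k j)" "as \<in> set (raise bs)"
    using assms by (auto simp: dN_def)
  then obtain i where i: "j = Suc i" by (cases j) auto
  then have "i \<noteq> 0" using bs by (cases i) auto
  then show ?thesis
    using lower_terms_props[OF k bs(1)[unfolded i]] raise_props[OF bs(2), of i] i by auto
qed

text \<open>The remainder \<open>Rm\<close> is the nonlinear term without its top-order part. The chain rule needs a second
  regularisation of \<open>w\<close>, at scale \<open>d\<close>; estimates for \<open>Rd\<close> uniform in \<open>d\<close> carry over to \<open>Rm\<close>.\<close>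

definition Rd :: "real \<Rightarrow> real \<Rightarrow> nat \<Rightarrow> real \<Rightarrow> real \<Rightarrow> real" where
  "Rd d e j t x = moll e (Suc j) (\<lambda>x. F (U d 0 t x)) x - U e 0 t x ^ k * moll e 1 (U d j t) x"

definition Rm :: "real \<Rightarrow> nat \<Rightarrow> real \<Rightarrow> real \<Rightarrow> real" where
  "Rm e j t x = N e (Suc j) t x - U e 0 t x ^ k * U e (Suc j) t x"

lemma Rd_cont: "continuous_on UNIV (\<lambda>(t, x). Rd d e j t x)"
proof -
  have "continuous_on UNIV (\<lambda>(t, x). F (U d 0 t x))"
    using F_cont[OF U_cont[of d 0]] by (simp add: split_beta)
  from moll_cont2[OF this, of e "Suc j"] moll_cont2[OF U_cont, of e 1 d j] U_cont[of e 0]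
  show ?thesis unfolding Rd_def split_beta by (intro continuous_intros)
qed

lemma Rm_cont: "continuous_on UNIV (\<lambda>(t, x). Rm e j t x)"
  using N_cont[of e "Suc j"] U_cont[of e 0] U_cont[of e "Suc j"]
  unfolding Rm_def split_beta by (intro continuous_intros)

lemmas Rd_meas [measurable (raw)] = cont_meas2[OF Rd_cont]
lemmas Rm_meas [measurable (raw)] = cont_meas2[OF Rm_cont]

lemma moll_U_shift: "d > 0 \<Longrightarrow> e > 0 \<Longrightarrow> moll e (i + j) (U d 0 t) = moll e i (U d j t)"
proof (induction j arbitrary: i)
  case (Suc j)
  have "moll e (i + Suc j) (U d 0 t) = moll e (Suc i) (U d j t)"
    using Suc.IH[of "Suc i"] Suc.prems by simp
  also have "\<dots> = moll e i (U d (Suc j) t)"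
    by (rule moll_deriv_inner_eq) (use Suc.prems in \<open>auto intro: U_deriv U_cont1\<close>)
  finally show ?case .
qed simp

lemma Rd_tendsto:
  assumes e: "e > 0" and d: "\<And>m. d m > 0" "d \<longlonglongrightarrow> 0"
  shows "(\<lambda>m. Rd (d m) e j t x) \<longlonglongrightarrow> Rm e j t x"
proof -
  have U0: "(\<lambda>m. U (d m) 0 t x) \<longlonglongrightarrow> w t x" for x
  proof -
    have "filterlim d (at_right 0) sequentially"
      using d by (auto simp: filterlim_at less_imp_neq[symmetric])
    from filterlim_compose[OF moll_tendsto[OF w_cont1, of t x] this] show ?thesis by (simp add: U_def)
  qed
  have "(\<lambda>m. moll e (Suc j) (\<lambda>x. F (U (d m) 0 t x)) x) \<longlonglongrightarrow> N e (Suc j) t x"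
    unfolding N_def
  proof (rule moll_dominated)
    show "(\<lambda>m. F (U (d m) 0 t x)) \<longlonglongrightarrow> F (w t x)" for x
      unfolding F_def by (intro tendsto_intros U0) auto
    show "\<bar>F (U (d m) 0 t x)\<bar> \<le> M ^ k * M" for m x
      using F_bound[OF U0_bound[OF d(1)]] mult_left_mono[OF U0_bound[OF d(1)], of "M ^ k"] M
      by (meson order_trans zero_le_power zero_le_one)
  qed (auto intro!: F_cont U_cont1 w_cont1)
  moreover have "(\<lambda>m. moll e (Suc j) (U (d m) 0 t) x) \<longlonglongrightarrow> U e (Suc j) t x"
    unfolding U_def[of e]
    by (rule moll_dominated[where B=M]) (auto intro!: U0 w_cont1 U_cont1 U0_bound d)
  moreover have "moll e (Suc j) (U (d m) 0 t) = moll e 1 (U (d m) j t)" for m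
    using moll_U_shift[OF d(1) e, of 1 j] by simp
  ultimately show ?thesis unfolding Rd_def Rm_def by (intro tendsto_intros) simp_all
qed

text \<open>The remainder is the sum of a commutator with u^k, which costs A, and of the mollified
  monomials of \<open>dN j\<close>, which cost s1 or s^2. The condition d \<le> e keeps the error of
  the inner mollification of size A e, as the commutator estimate requires. The pointwise hypotheses
  speak of j \<ge> 2 because \<open>dN 1\<close> is empty.\<close>

lemma Rd_bound:
  assumes e: "0 < d" "d \<le> e" "0 < b" "e \<le> b / 2" and j: "j \<ge> 1" and n: "n \<ge> (0::nat)"
    and lip: "\<And>x y. \<bar>w t x - w t y\<bar> \<le> A * \<bar>x - y\<bar>"
    and cD: "cD \<ge> 1" "s1 \<ge> 1" "s \<ge> 1"
    and h1: "\<And>i x. j \<ge> 2 \<Longrightarrow> x \<ge> b / 2 \<Longrightarrow> i \<le> 1 \<Longrightarrow> \<bar>U d i t x\<bar> \<le> cD * s1 ^ i"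
    and h2: "\<And>i x. j \<ge> 2 \<Longrightarrow> x \<ge> b / 2 \<Longrightarrow> i \<le> 2 \<Longrightarrow> i < j \<Longrightarrow> \<bar>U d i t x\<bar> \<le> cD * s ^ i"
    and h3: "\<And>i x. j \<ge> 2 \<Longrightarrow> x \<ge> b / 2 \<Longrightarrow> i + 2 \<le> j \<Longrightarrow> \<bar>U d i t x\<bar> \<le> cD"
  defines "C \<equiv> 2 * ((3 * real k * M ^ k)\<^sup>2 * (rn 1)\<^sup>2 + (real (length (dN j)) * cD ^ k)\<^sup>2 * real j) * 2 ^ n"
  shows "Wn b n (Rd d e j t) \<le> ennreal C *
    (ennreal (A\<^sup>2 + s1\<^sup>2) * Wn (b / 2) n (U d j t) + ennreal (s ^ 4) * (\<Sum>i=1..<j. Wn (b / 2) n (U d i t)))"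
proof -
  let ?u = "\<lambda>i. U d i t"
  have e0: "e > 0" using e by simp
  have A: "A \<ge> 0" using lip[of 1 0] by simp
  have ud: "\<And>i x. (?u i has_real_derivative ?u (Suc i) x) (at x)" by (rule U_deriv[OF e(1)])
  have uc: "\<And>i. continuous_on UNIV (?u i)" by (rule U_cont1)
  define G where "G = sum_monom ?u (dN j)"
  have Gc: "continuous_on UNIV G" unfolding G_def by (rule sum_monom_cont[OF uc])
  have Gm [measurable]: "G \<in> borel_measurable borel" by (intro borel_measurable_continuous_onI Gc)
  have F0: "(\<lambda>x. F (?u 0 x)) = power_deriv k ?u 0" by (simp add: power_deriv_def F_def fun_eq_iff)
  have pj: "power_deriv k ?u j = (\<lambda>x. ?u 0 x ^ k * ?u j x + sum_monom ?u (lower_terms k j) x)"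
    using j by (auto simp: power_deriv_def)
  have "moll e (1 + j) (power_deriv k ?u 0) = moll e 1 (power_deriv k ?u j)"
    by (rule moll_power_deriv[where u="?u", OF ud k e0 uc])
  moreover have "moll e (Suc 0) (sum_monom ?u (lower_terms k j)) = moll e 0 G"
    unfolding G_def dN_def by (rule moll_deriv_inner_eq)
      (use sum_monom_deriv[where u="?u", OF ud] sum_monom_cont[of ?u, OF uc] e0 in auto)
  moreover have "moll e 1 (power_deriv k ?u j) x = moll e 1 (\<lambda>x. ?u 0 x ^ k * ?u j x) x + moll e 1 (sum_monom ?u (lower_terms k j)) x" for x
    unfolding pj by (rule moll_add) (intro continuous_intros uc sum_monom_cont)+
  ultimately have Rd: "Rd d e j t x = (moll e 1 (\<lambda>x. ?u 0 x ^ k * ?u j x) x - U e 0 t x ^ k * moll e 1 (?u j) x) + moll e 0 G x" for x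
    by (simp add: Rd_def F0)
  \<comment> \<open>The factor 3 counts three errors of size at most A e: inner mollification at x -
    e z, shift by e z, outer mollification at x. The rest is the Lipschitz constant of the k-th
    power.\<close>
  define c1 where "c1 = 3 * real k * M ^ k * A"
  have c1: "c1 \<ge> 0" using A M by (simp add: c1_def)
  have near: "\<bar>?u 0 (x - e * z) ^ k - U e 0 t x ^ k\<bar> \<le> c1 * e" if z: "\<bar>z\<bar> \<le> 1" for x z
  proof -
    have "\<bar>?u 0 (x - e * z) - U e 0 t x\<bar> \<le> \<bar>?u 0 (x - e * z) - w t (x - e * z)\<bar> + \<bar>w t (x - e * z) - w t x\<bar> + \<bar>U e 0 t x - w t x\<bar>"
      by linarith
    also have "\<dots> \<le> A * d + A * e + A * e"
    proof (intro add_mono)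
      show "\<bar>?u 0 (x - e * z) - w t (x - e * z)\<bar> \<le> A * d" "\<bar>U e 0 t x - w t x\<bar> \<le> A * e"
        unfolding U_def by (intro lipschitz_moll w_cont1 e0 e(1) lip)+
      have "\<bar>w t (x - e * z) - w t x\<bar> \<le> A * \<bar>e * z\<bar>" using lip[of "x - e * z" x] by simp
      also have "\<dots> \<le> A * e" using z e0 mult_left_mono[of "\<bar>z\<bar>" 1 e] A by (intro mult_left_mono) (auto simp: abs_mult)
      finally show "\<bar>w t (x - e * z) - w t x\<bar> \<le> A * e" .
    qed
    also have "\<dots> \<le> 3 * A * e" using mult_left_mono[OF e(2) A] by linarith
    finally have "real k * M ^ k * \<bar>?u 0 (x - e * z) - U e 0 t x\<bar> \<le> real k * M ^ k * (3 * A * e)"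
      using M by (intro mult_left_mono) auto
    with power_diff_bound[OF U0_bound[OF e(1), of t "x - e * z"] U0_bound[OF e0, of t x] M, of k]
    show ?thesis by (simp add: c1_def mult_ac)
  qed
  have pt: "ennreal ((Rd d e j t x)\<^sup>2) \<le> 2 * (ennreal (c1\<^sup>2) * (cv 1 e (\<lambda>y. ennreal \<bar>?u j y\<bar>) x)\<^sup>2)
      + 2 * (cv 0 e (\<lambda>y. ennreal \<bar>G y\<bar>) x)\<^sup>2" for x
  proof -
    have "ennreal \<bar>Rd d e j t x\<bar> \<le> ennreal \<bar>moll e 1 (\<lambda>x. ?u 0 x ^ k * ?u j x) x - U e 0 t x ^ k * moll e 1 (?u j) x\<bar> + ennreal \<bar>moll e 0 G x\<bar>"
      unfolding Rd by (simp add: ennreal_leI abs_triangle_ineq flip: ennreal_plus)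
    also have "\<dots> \<le> ennreal c1 * cv 1 e (\<lambda>y. ennreal \<bar>?u j y\<bar>) x + ennreal (1 / e ^ 0) * cv 0 e (\<lambda>y. ennreal \<bar>G y\<bar>) x"
      by (intro add_mono commutator_bound moll_le_cv uc Gc e0 continuous_intros near)
    finally have "(ennreal \<bar>Rd d e j t x\<bar>)\<^sup>2 \<le> (ennreal c1 * cv 1 e (\<lambda>y. ennreal \<bar>?u j y\<bar>) x + cv 0 e (\<lambda>y. ennreal \<bar>G y\<bar>) x)\<^sup>2"
      by (intro power_mono) auto
    also note ennreal_sq_add_le
    finally show ?thesis using c1 by (simp add: power_mult_distrib ennreal_power)
  qed
  let ?W = "\<lambda>x. indicator {b..} x * ennreal (x ^ n)"
  have [measurable]: "?u j \<in> borel_measurable borel" by (intro borel_measurable_continuous_onI uc)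
  have "Wn b n (Rd d e j t) \<le> (\<integral>\<^sup>+x. (2 * ennreal (c1\<^sup>2)) * (?W x * (cv 1 e (\<lambda>y. ennreal \<bar>?u j y\<bar>) x)\<^sup>2)
       + 2 * (?W x * (cv 0 e (\<lambda>y. ennreal \<bar>G y\<bar>) x)\<^sup>2) \<partial>lborel)"
    unfolding Wn_eq[OF less_imp_le[OF e(3)]]
  proof (rule nn_integral_mono)
    fix x
    show "?W x * ennreal ((Rd d e j t x)\<^sup>2) \<le> (2 * ennreal (c1\<^sup>2)) * (?W x * (cv 1 e (\<lambda>y. ennreal \<bar>?u j y\<bar>) x)\<^sup>2)
       + 2 * (?W x * (cv 0 e (\<lambda>y. ennreal \<bar>G y\<bar>) x)\<^sup>2)"
      using mult_left_mono[OF pt[of x], of "?W x"] by (simp add: distrib_left mult_ac)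
  qed
  also have "\<dots> = (2 * ennreal (c1\<^sup>2)) * (\<integral>\<^sup>+x. ?W x * (cv 1 e (\<lambda>y. ennreal \<bar>?u j y\<bar>) x)\<^sup>2 \<partial>lborel)
       + 2 * (\<integral>\<^sup>+x. ?W x * (cv 0 e (\<lambda>y. ennreal \<bar>G y\<bar>) x)\<^sup>2 \<partial>lborel)"
    by (subst nn_integral_add) (auto simp: nn_integral_cmult)
  also have "\<dots> \<le> (2 * ennreal (c1\<^sup>2)) * (ennreal ((rn 1)\<^sup>2 * 2 ^ n) * Wn (b / 2) n (?u j))
       + 2 * (ennreal ((rn 0)\<^sup>2 * 2 ^ n) * Wn (b / 2) n G)"
    by (intro add_mono mult_left_mono Wn_cv uc Gc e e0) auto
  also have "Wn (b / 2) n G \<le> ennreal ((real (length (dN j)) * cD ^ k)\<^sup>2 * real j) *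
      (ennreal (s1\<^sup>2) * Wn (b / 2) n (?u j) + ennreal (s ^ 4) * (\<Sum>i=1..<j. Wn (b / 2) n (?u i)))"
  proof -
    define c2 where "c2 = (real (length (dN j)) * cD ^ k)\<^sup>2 * real j"
    have c2: "c2 \<ge> 0" by (simp add: c2_def)
    have G: "(G x)\<^sup>2 \<le> c2 * (s1\<^sup>2 * (?u j x)\<^sup>2 + s ^ 4 * (\<Sum>i=1..<j. (?u i x)\<^sup>2))" if x: "x \<ge> b / 2" for x
    proof -
      let ?v = "\<lambda>i. \<bar>?u i x\<bar>"
      let ?B = "s1 * ?v j + s\<^sup>2 * (\<Sum>i=1..<j. ?v i)"
      have B0: "0 \<le> cD ^ k * ?B" using cD by (auto intro!: mult_nonneg_nonneg add_nonneg_nonneg sum_nonneg)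
      have "\<bar>G x\<bar> \<le> real (length (dN j)) * (cD ^ k * ?B)"
        unfolding G_def
      proof (rule sum_monom_bound)
        fix as assume "as \<in> set (dN j)"
        note p = dN_props[OF this]
        have "\<bar>monom_of ?u as x\<bar> = prod_list (map ?v as)"
          unfolding monom_of_def by (induction as) (auto simp: abs_mult)
        also have "\<dots> \<le> cD ^ k * ?B"
          by (rule monomial_bound) (use p cD h1 h2 h3 x in auto)
        finally show "\<bar>monom_of ?u as x\<bar> \<le> cD ^ k * ?B" .
      qed
      then have "(G x)\<^sup>2 \<le> (real (length (dN j)) * (cD ^ k * ?B))\<^sup>2"
        using power_mono[of "\<bar>G x\<bar>" _ 2] by simp
      also have "\<dots> = (real (length (dN j)) * cD ^ k)\<^sup>2 * ?B\<^sup>2" by (simp add: power_mult_distrib mult_ac)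
      also have "?B\<^sup>2 \<le> real j * (s1\<^sup>2 * (?u j x)\<^sup>2 + s ^ 4 * (\<Sum>i=1..<j. (?u i x)\<^sup>2))"
      proof -
        \<comment> \<open>\<open>?B\<close> is written as a sum of j terms, so that Cauchy-Schwarz
          gives the factor j.\<close>
        let ?f = "\<lambda>i. if i = j then s1 * ?v j else s\<^sup>2 * ?v i"
        have J: "{1..j} = insert j {1..<j}" using j by auto
        have "?B = (\<Sum>i=1..j. ?f i)"
          unfolding J by (subst sum.insert) (auto simp: sum_distrib_left intro!: sum.cong)
        then have "?B\<^sup>2 \<le> real j * (\<Sum>i=1..j. (?f i)\<^sup>2)"
          using sum_square_le_card[of ?f "{1..j}"] by simp
        also have "(\<Sum>i=1..j. (?f i)\<^sup>2) = s1\<^sup>2 * (?u j x)\<^sup>2 + s ^ 4 * (\<Sum>i=1..<j. (?u i x)\<^sup>2)"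
          unfolding J by (subst sum.insert) (auto simp: sum_distrib_left power_mult_distrib intro!: sum.cong)
        finally show ?thesis .
      qed
      finally show ?thesis by (simp add: c2_def mult_left_mono mult.assoc)
    qed
    have "Wn (b / 2) n G \<le> (\<integral>\<^sup>+x. ennreal c2 * (ennreal (s1\<^sup>2) * (indicator {b / 2..} x * ennreal (x ^ n * (?u j x)\<^sup>2))
        + ennreal (s ^ 4) * (\<Sum>i=1..<j. indicator {b / 2..} x * ennreal (x ^ n * (?u i x)\<^sup>2))) \<partial>lborel)"
      unfolding Wn_def
    proof (rule nn_integral_mono)
      fix x
      have "ennreal (x ^ n * (G x)\<^sup>2) \<le> ennreal c2 * (ennreal (s1\<^sup>2) * ennreal (x ^ n * (?u j x)\<^sup>2)
        + ennreal (s ^ 4) * (\<Sum>i=1..<j. ennreal (x ^ n * (?u i x)\<^sup>2)))" if x: "x \<ge> b / 2"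
      proof -
        have xn: "x ^ n \<ge> 0" using x e by simp
        have "x ^ n * (G x)\<^sup>2 \<le> x ^ n * (c2 * (s1\<^sup>2 * (?u j x)\<^sup>2 + s ^ 4 * (\<Sum>i=1..<j. (?u i x)\<^sup>2)))"
          by (rule mult_left_mono[OF G[OF x] xn])
        also have "\<dots> = c2 * (s1\<^sup>2 * (x ^ n * (?u j x)\<^sup>2) + s ^ 4 * (\<Sum>i=1..<j. x ^ n * (?u i x)\<^sup>2))"
          by (simp add: distrib_left sum_distrib_left mult_ac)
        finally show ?thesis
          using c2 xn by (simp add: ennreal_leI sum_nonneg flip: ennreal_mult ennreal_plus)
      qed
      then show "indicator {b / 2..} x * ennreal (x ^ n * (G x)\<^sup>2) \<le> ennreal c2 * (ennreal (s1\<^sup>2) * (indicator {b / 2..} x * ennreal (x ^ n * (?u j x)\<^sup>2))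
        + ennreal (s ^ 4) * (\<Sum>i=1..<j. indicator {b / 2..} x * ennreal (x ^ n * (?u i x)\<^sup>2)))"
        by (auto simp: indicator_def)
    qed
    also have "\<dots> = ennreal c2 * (ennreal (s1\<^sup>2) * Wn (b / 2) n (?u j) + ennreal (s ^ 4) * (\<Sum>i=1..<j. Wn (b / 2) n (?u i)))"
    proof -
      have [measurable]: "\<And>i. ?u i \<in> borel_measurable borel" by (intro borel_measurable_continuous_onI uc)
      define h where "h = (\<lambda>i x. indicator {b / 2..} x * ennreal (x ^ n * (?u i x)\<^sup>2))"
      have [measurable]: "\<And>i. h i \<in> borel_measurable borel" unfolding h_def by measurable
      have W: "Wn (b / 2) n (?u i) = (\<integral>\<^sup>+x. h i x \<partial>lborel)" for i by (simp add: Wn_def h_def)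
      have "(\<integral>\<^sup>+x. ennreal c2 * (ennreal (s1\<^sup>2) * h j x + ennreal (s ^ 4) * (\<Sum>i=1..<j. h i x)) \<partial>lborel)
        = ennreal c2 * (ennreal (s1\<^sup>2) * (\<integral>\<^sup>+x. h j x \<partial>lborel) + ennreal (s ^ 4) * (\<Sum>i=1..<j. \<integral>\<^sup>+x. h i x \<partial>lborel))"
        by (simp add: nn_integral_cmult nn_integral_add nn_integral_sum)
      then show ?thesis unfolding W by (simp only: h_def)
    qed
    finally show ?thesis by (simp add: c2_def)
  qed
  also have "(2 * ennreal (c1\<^sup>2)) * (ennreal ((rn 1)\<^sup>2 * 2 ^ n) * Wn (b / 2) n (?u j))
       + 2 * (ennreal ((rn 0)\<^sup>2 * 2 ^ n) * (ennreal ((real (length (dN j)) * cD ^ k)\<^sup>2 * real j) *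
      (ennreal (s1\<^sup>2) * Wn (b / 2) n (?u j) + ennreal (s ^ 4) * (\<Sum>i=1..<j. Wn (b / 2) n (?u i)))))
    \<le> ennreal C * (ennreal (A\<^sup>2) * Wn (b / 2) n (U d j t)) + ennreal C *
      (ennreal (s1\<^sup>2) * Wn (b / 2) n (?u j) + ennreal (s ^ 4) * (\<Sum>i=1..<j. Wn (b / 2) n (?u i)))"
  proof (rule add_mono)
    have "2 * c1\<^sup>2 * ((rn 1)\<^sup>2 * 2 ^ n) \<le> C * A\<^sup>2"
      unfolding C_def c1_def by (simp add: power_mult_distrib algebra_simps)
    then have "ennreal (2 * c1\<^sup>2 * ((rn 1)\<^sup>2 * 2 ^ n)) * Wn (b / 2) n (?u j) \<le> ennreal (C * A\<^sup>2) * Wn (b / 2) n (?u j)"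
      by (intro mult_right_mono ennreal_leI) auto
    then show "(2 * ennreal (c1\<^sup>2)) * (ennreal ((rn 1)\<^sup>2 * 2 ^ n) * Wn (b / 2) n (?u j)) \<le> ennreal C * (ennreal (A\<^sup>2) * Wn (b / 2) n (?u j))"
      by (simp add: ennreal_mult'' mult.assoc)
    have "2 * ((rn 0)\<^sup>2 * 2 ^ n) * ((real (length (dN j)) * cD ^ k)\<^sup>2 * real j) \<le> C"
      unfolding C_def rn_0 by (simp add: algebra_simps)
    then have "ennreal (2 * ((rn 0)\<^sup>2 * 2 ^ n) * ((real (length (dN j)) * cD ^ k)\<^sup>2 * real j)) * Q \<le> ennreal C * Q" for Q
      by (intro mult_right_mono ennreal_leI) auto
    then show "2 * (ennreal ((rn 0)\<^sup>2 * 2 ^ n) * (ennreal ((real (length (dN j)) * cD ^ k)\<^sup>2 * real j) * Q)) \<le> ennreal C * Q" for Q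
      by (simp add: ennreal_mult'' mult.assoc)
  qed
  also have "\<dots> = ennreal C * (ennreal (A\<^sup>2 + s1\<^sup>2) * Wn (b / 2) n (U d j t) + ennreal (s ^ 4) * (\<Sum>i=1..<j. Wn (b / 2) n (U d i t)))"
    by (simp add: ennreal_plus distrib_left distrib_right add.assoc)
  finally show ?thesis by (simp add: mult_left_mono add_left_mono)
qed

end

lemma integral_le_nn_integral:
  fixes f :: "'a \<Rightarrow> real"
  assumes "integrable N f"
  shows "ennreal (LINT x|N. f x) \<le> (\<integral>\<^sup>+x. ennreal (f x) \<partial>N)"
proof -
  have "(LINT x|N. f x) \<le> (LINT x|N. max 0 (f x))"
    by (intro integral_mono assms Bochner_Integration.integrable_max) auto
  then have "ennreal (LINT x|N. f x) \<le> ennreal (LINT x|N. max 0 (f x))" by (rule ennreal_leI)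
  also have "\<dots> = (\<integral>\<^sup>+x. ennreal (max 0 (f x)) \<partial>N)"
    by (subst nn_integral_eq_integral) (auto intro!: assms Bochner_Integration.integrable_max)
  also have "\<dots> = (\<integral>\<^sup>+x. ennreal (f x) \<partial>N)"
    by (intro nn_integral_cong) (auto simp: max_def ennreal_neg)
  finally show ?thesis .
qed

section \<open>Bounds for the remainder, uniform in the inner scale\<close>

context gkdv_half
begin

lemma Wn_U_meas [measurable]: "(\<lambda>t. Wn b n (U e j t)) \<in> borel_measurable borel"
  unfolding Wn_def by measurable

lemma Wn_Rm_meas [measurable]: "(\<lambda>t. Wn b n (Rm e j t)) \<in> borel_measurable borel"
  unfolding Wn_def by measurable

lemma Wn_0_finite: "e > 0 \<Longrightarrow> Wn b 0 (U e j t) < \<infinity>"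
proof -
  assume "e > 0"
  have "Wn b 0 (U e j t) \<le> (\<integral>\<^sup>+x. ennreal ((U e j t x)\<^sup>2) \<partial>lborel)"
    unfolding Wn_def by (intro nn_integral_mono) (auto simp: indicator_def)
  also have "\<dots> < \<infinity>" by (rule le_less_trans[OF U_L2[OF \<open>e > 0\<close>]]) simp
  finally show ?thesis .
qed

lemma U_sup_bound:
  assumes "e > 0" "x \<ge> b"
  shows "ennreal ((U e i t x)\<^sup>2) \<le> 2 * (Wn b 0 (U e i t) + Wn b 0 (U e (Suc i) t))"
  by (rule sobolev_half_line[OF U_deriv U_cont1]) (use assms in auto)

text \<open>The factor (1 + a)^(-4) makes the bound independent of a. For j \<le> 2 derivatives of
  order at most 1 are bounded by M and a, so s1 = s = 1 + a works and s^4 is exactly compensated.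
  For j \<ge> 3 the orders up to j - 2 are bounded through the lower levels, so s1 = 1, and order j
  - 1 is bounded by Sobolev's inequality in such a way that the top norm enters linearly.\<close>

lemma Rd_level:
  assumes j: "j \<ge> 1" and b: "b > 0" and K: "K \<ge> 0"
    and lower: "\<And>i d t. i < j \<Longrightarrow> 0 < d \<Longrightarrow> d < e0 \<Longrightarrow> t \<in> {\<tau>..T} \<Longrightarrow> Wn (b / 2) n (U d i t) \<le> ennreal K"
  shows "\<exists>C\<ge>0. \<forall>d e t. 0 < d \<and> d \<le> e \<and> d < e0 \<and> e \<le> b / 2 \<and> t \<in> {\<tau>..T} \<and> (\<forall>x y. \<bar>w t x - w t y\<bar> \<le> a t * \<bar>x - y\<bar>) \<longrightarrow>
    ennreal (1 / (1 + a t) ^ 4) * Wn b n (Rd d e j t) \<le> ennreal C * (1 + Wn (b / 2) n (U d j t))"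
proof -
  \<comment> \<open>\<open>\<kappa>\<close> is the cost of dropping the weight x^n on [b/2,
    \<infinity>). In \<open>cD\<close> below, 4 \<kappa> K is what \<open>U_sup_bound\<close> gives
    when both of its norms are at most \<kappa> K.\<close>
  define \<kappa> where "\<kappa> = 1 / (b / 2) ^ n"
  have \<kappa>: "\<kappa> > 0" using b by (simp add: \<kappa>_def)
  define cD where "cD = max M (sqrt (4 * \<kappa> * K))"
  have cD: "cD \<ge> 1" "cD \<ge> M" "cD \<ge> sqrt (4 * \<kappa> * K)" using M by (auto simp: cD_def)
  define C0 where "C0 = 2 * ((3 * real k * M ^ k)\<^sup>2 * (rn 1)\<^sup>2 + (real (length (dN j)) * cD ^ k)\<^sup>2 * real j) * 2 ^ n"
  have C0: "C0 \<ge> 0" by (simp add: C0_def)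
  define C where "C = C0 * (2 + 4 * \<kappa> * (real j * K) + (2 + 4 * \<kappa> * K) * (real j * K))"
  have C: "C \<ge> 0" using C0 \<kappa> K by (simp add: C_def)
  have base: "Wn (b / 2) 0 (U d i t) \<le> ennreal \<kappa> * Wn (b / 2) n (U d i t)" for d i t
    using Wn_mono_exponent[of "b / 2" 0 n "U d i t"] b by (simp add: \<kappa>_def)
  show ?thesis
  proof (intro exI[of _ C] conjI C allI impI, elim conjE)
    fix d e t
    assume d: "0 < d" "d \<le> e" "d < e0" "e \<le> b / 2" and t: "t \<in> {\<tau>..T}"
      and lip: "\<forall>x y. \<bar>w t x - w t y\<bar> \<le> a t * \<bar>x - y\<bar>"
    define A where "A = a t"
    have A: "A \<ge> 0" using a_nonneg by (simp add: A_def)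
    have lipA: "\<And>x y. \<bar>w t x - w t y\<bar> \<le> A * \<bar>x - y\<bar>" using lip by (simp add: A_def)
    define W where "W = Wn (b / 2) n (U d j t)"
    define q where "q = 1 / (1 + A) ^ 4"
    have A1: "(1 + A) ^ 4 \<ge> 1" using A by (simp add: one_le_power)
    have q: "q > 0" "q \<le> 1" using A A1 by (auto simp: q_def)
    have small: "\<bar>U d i t x\<bar> \<le> cD" if "i + 2 \<le> j" "x \<ge> b / 2" for i x
    proof -
      have "ennreal ((U d i t x)\<^sup>2) \<le> 2 * (Wn (b / 2) 0 (U d i t) + Wn (b / 2) 0 (U d (Suc i) t))"
        by (rule U_sup_bound) (use d that in auto)
      also have "\<dots> \<le> 2 * (ennreal \<kappa> * ennreal K + ennreal \<kappa> * ennreal K)"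
        using that d t by (intro mult_left_mono add_mono order_trans[OF base] lower) auto
      also have "\<dots> = ennreal (4 * \<kappa> * K)"
        using \<kappa> K by (simp flip: ennreal_mult ennreal_plus ennreal_numeral)
      finally have "(U d i t x)\<^sup>2 \<le> 4 * \<kappa> * K" using \<kappa> K by (simp add: ennreal_le_iff)
      then have "\<bar>U d i t x\<bar> \<le> sqrt (4 * \<kappa> * K)" using real_sqrt_le_mono by fastforce
      then show ?thesis using cD by linarith
    qed
    have "\<exists>s1\<ge>1. \<exists>s\<ge>1. q * (A\<^sup>2 + s1\<^sup>2) \<le> 2 \<and> ennreal (q * s ^ 4) \<le> ennreal (2 + 4 * \<kappa> * K) + ennreal (4 * \<kappa>) * W \<and>
      (j \<ge> 2 \<longrightarrow> (\<forall>x i. x \<ge> b / 2 \<longrightarrow> (i \<le> 1 \<longrightarrow> \<bar>U d i t x\<bar> \<le> cD * s1 ^ i) \<and> (i \<le> 2 \<longrightarrow> i < j \<longrightarrow> \<bar>U d i t x\<bar> \<le> cD * s ^ i)))"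
    proof (cases "j \<ge> 3")
      case True
      define v where "v = Wn (b / 2) 0 (U d (j - 1) t) + Wn (b / 2) 0 (U d j t)"
      have "v < \<infinity>" using Wn_0_finite d by (simp add: v_def)
      then obtain \<beta> where \<beta>: "v = ennreal \<beta>" "\<beta> \<ge> 0" by (cases v) auto
      have v_le: "v \<le> ennreal (\<kappa> * K) + ennreal \<kappa> * W"
        unfolding v_def W_def using j d t \<kappa>
        by (intro add_mono base order_trans[OF base]) (auto simp: ennreal_mult' intro!: mult_left_mono lower)
      have sup: "\<bar>U d (j - 1) t x\<bar> \<le> 1 + sqrt (2 * \<beta>)" if "x \<ge> b / 2" for x
      proof -
        have "ennreal ((U d (j - 1) t x)\<^sup>2) \<le> 2 * (Wn (b / 2) 0 (U d (j - 1) t) + Wn (b / 2) 0 (U d (Suc (j - 1)) t))"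
          by (rule U_sup_bound) (use d that in auto)
        also have "\<dots> = ennreal (2 * \<beta>)" using \<beta> j by (simp add: v_def ennreal_mult')
        finally have "(U d (j - 1) t x)\<^sup>2 \<le> 2 * \<beta>" using \<beta> by (simp add: ennreal_le_iff)
        then have "\<bar>U d (j - 1) t x\<bar> \<le> sqrt (2 * \<beta>)" using real_sqrt_le_mono by fastforce
        then show ?thesis by simp
      qed
      \<comment> \<open>Chosen so that s^2 bounds order j - 1 while s^4 is at most linear in
        \<beta>; the top norm W then appears only to the first power.\<close>
      define s where "s = sqrt (1 + sqrt (2 * \<beta>))"
      have s: "s \<ge> 1" "s\<^sup>2 = 1 + sqrt (2 * \<beta>)" using \<beta> by (auto simp: s_def)
      have s4: "s ^ 4 \<le> 2 + 4 * \<beta>"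
      proof -
        have "s ^ 4 = (s\<^sup>2)\<^sup>2" by simp
        also have "\<dots> = 1 + 2 * sqrt (2 * \<beta>) + 2 * \<beta>" unfolding s(2) using \<beta> by (simp add: power2_sum)
        also have "\<dots> \<le> 2 + 4 * \<beta>" using sum_squares_bound[of 1 "sqrt (2 * \<beta>)"] \<beta> by simp
        finally show ?thesis .
      qed
      have "A\<^sup>2 + 1 \<le> 2 * (1 + A) ^ 4"
      proof -
        have "A\<^sup>2 + 1 \<le> (1 + A)\<^sup>2" using A by (simp add: power2_sum)
        also have "\<dots> \<le> (1 + A) ^ 4" using A by (intro power_increasing) auto
        finally show ?thesis using A1 by linarith
      qed
      then have 1: "q * (A\<^sup>2 + 1\<^sup>2) \<le> 2" using A by (simp add: q_def divide_simps)
      have "q * s ^ 4 \<le> 2 + 4 * \<beta>" using mult_mono[of q 1 "s ^ 4" "2 + 4 * \<beta>"] q s4 s by simp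
      then have "ennreal (q * s ^ 4) \<le> ennreal (2 + 4 * \<beta>)" by (rule ennreal_leI)
      also have "\<dots> = 2 + 4 * v" using \<beta> by (simp add: ennreal_mult ennreal_plus)
      also have "\<dots> \<le> 2 + 4 * (ennreal (\<kappa> * K) + ennreal \<kappa> * W)" by (intro add_mono mult_left_mono v_le) auto
      also have "\<dots> = ennreal (2 + 4 * \<kappa> * K) + ennreal (4 * \<kappa>) * W"
        using \<kappa> K by (simp add: distrib_left ennreal_plus ennreal_mult' mult.assoc add.assoc)
      finally have 2: "ennreal (q * s ^ 4) \<le> ennreal (2 + 4 * \<kappa> * K) + ennreal (4 * \<kappa>) * W" .
      have 3: "\<bar>U d i t x\<bar> \<le> cD * s ^ i" if "x \<ge> b / 2" "i \<le> 2" "i < j" for x i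
      proof (cases "i + 2 \<le> j")
        case True
        have "cD * 1 \<le> cD * s ^ i" using cD s by (intro mult_left_mono) (auto simp: one_le_power)
        with small[OF True that(1)] show ?thesis by linarith
      next
        case False
        then have i: "i = 2" "j - 1 = 2" using that True by auto
        have "\<bar>U d (j - 1) t x\<bar> \<le> 1 * s\<^sup>2" using sup[OF that(1)] s(2) by simp
        also have "\<dots> \<le> cD * s\<^sup>2" using cD by (intro mult_right_mono) auto
        finally show ?thesis by (simp only: i)
      qed
      have 4: "\<bar>U d i t x\<bar> \<le> cD * 1 ^ i" if "x \<ge> b / 2" "i \<le> 1" for x i
        using small[of i x] that True by simp
      show ?thesis
        by (rule exI[of _ 1], simp, rule exI[of _ s]) (use 1 2 3 4 s in auto)
    next
      case False
      \<comment> \<open>Here j \<le> 2, so i < j means i \<le> 1 and the Lipschitz bound is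
        enough.\<close>
      have 1: "q * (A\<^sup>2 + (1 + A)\<^sup>2) \<le> 2"
      proof -
        have "A\<^sup>2 \<le> (1 + A)\<^sup>2" using A by (simp add: power2_sum)
        moreover have "(1 + A)\<^sup>2 \<le> (1 + A) ^ 4" using A by (intro power_increasing) auto
        ultimately have "A\<^sup>2 + (1 + A)\<^sup>2 \<le> 2 * (1 + A) ^ 4" by linarith
        then show ?thesis using A by (simp add: q_def divide_simps)
      qed
      have "q * (1 + A) ^ 4 = 1" using A by (simp add: q_def)
      moreover have "1 \<le> 2 + 4 * \<kappa> * K" using \<kappa> K by simp
      ultimately have "ennreal (q * (1 + A) ^ 4) \<le> ennreal (2 + 4 * \<kappa> * K)" by (metis ennreal_leI)
      also have "\<dots> \<le> ennreal (2 + 4 * \<kappa> * K) + ennreal (4 * \<kappa>) * W" by simp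
      finally have 2: "ennreal (q * (1 + A) ^ 4) \<le> ennreal (2 + 4 * \<kappa> * K) + ennreal (4 * \<kappa>) * W" .
      have 3: "\<bar>U d i t x\<bar> \<le> cD * (1 + A) ^ i" if "i \<le> 1" for x i
      proof (cases "i = 0")
        case True
        then show ?thesis using U0_bound[OF d(1), of t x] cD by simp
      next
        case False
        then have i: "i = 1" using that by simp
        have "\<bar>U d 1 t x\<bar> \<le> A" unfolding U_def by (rule lipschitz_moll(2)[OF w_cont1 d(1) lipA])
        also have "\<dots> \<le> 1 * (1 + A)" by simp
        also have "\<dots> \<le> cD * (1 + A)" using cD A by (intro mult_right_mono) auto
        finally show ?thesis by (simp add: i)
      qed
      show ?thesis
        by (rule exI[of _ "1 + A"], rule conjI, use A in simp, rule exI[of _ "1 + A"]) (use 1 2 3 False A in auto)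
    qed
    then obtain s1 s where s: "s1 \<ge> 1" "s \<ge> 1" "q * (A\<^sup>2 + s1\<^sup>2) \<le> 2"
        "ennreal (q * s ^ 4) \<le> ennreal (2 + 4 * \<kappa> * K) + ennreal (4 * \<kappa>) * W"
      and h: "\<And>i x. j \<ge> 2 \<Longrightarrow> x \<ge> b / 2 \<Longrightarrow> i \<le> 1 \<Longrightarrow> \<bar>U d i t x\<bar> \<le> cD * s1 ^ i"
        "\<And>i x. j \<ge> 2 \<Longrightarrow> x \<ge> b / 2 \<Longrightarrow> i \<le> 2 \<Longrightarrow> i < j \<Longrightarrow> \<bar>U d i t x\<bar> \<le> cD * s ^ i"
      by blast
    have "Wn b n (Rd d e j t) \<le> ennreal C0 *
      (ennreal (A\<^sup>2 + s1\<^sup>2) * W + ennreal (s ^ 4) * (\<Sum>i=1..<j. Wn (b / 2) n (U d i t)))"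
      unfolding C0_def W_def by (rule Rd_bound[OF d(1,2) b d(4) j _ lipA cD(1) s(1,2) h small]) auto
    also have "\<dots> \<le> ennreal C0 * (ennreal (A\<^sup>2 + s1\<^sup>2) * W + ennreal (s ^ 4) * ennreal (real j * K))"
    proof (intro mult_left_mono add_mono)
      have "(\<Sum>i=1..<j. Wn (b / 2) n (U d i t)) \<le> (\<Sum>i=1..<j. ennreal K)"
        by (intro sum_mono lower) (use d t in auto)
      also have "\<dots> = ennreal (real (j - 1) * K)" using K by (simp add: ennreal_mult' flip: ennreal_of_nat_eq_real_of_nat)
      also have "\<dots> \<le> ennreal (real j * K)" using K by (intro ennreal_leI mult_right_mono) auto
      finally show "(\<Sum>i=1..<j. Wn (b / 2) n (U d i t)) \<le> ennreal (real j * K)" .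
    qed auto
    finally have "ennreal q * Wn b n (Rd d e j t) \<le> ennreal q * (ennreal C0 * (ennreal (A\<^sup>2 + s1\<^sup>2) * W + ennreal (s ^ 4) * ennreal (real j * K)))"
      by (rule mult_left_mono) simp
    also have "\<dots> = ennreal C0 * (ennreal (q * (A\<^sup>2 + s1\<^sup>2)) * W + ennreal (q * s ^ 4) * ennreal (real j * K))"
      using q by (simp add: ennreal_mult' distrib_left mult_ac)
    also have "\<dots> \<le> ennreal C0 * (ennreal 2 * W + (ennreal (2 + 4 * \<kappa> * K) + ennreal (4 * \<kappa>) * W) * ennreal (real j * K))"
      by (intro mult_left_mono add_mono mult_right_mono s ennreal_leI) auto
    also have "\<dots> = ennreal (C0 * ((2 + 4 * \<kappa> * K) * (real j * K))) + ennreal (C0 * (2 + 4 * \<kappa> * (real j * K))) * W"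
    proof -
      have "ennreal (2 + 4 * \<kappa> * (real j * K)) = ennreal 2 + ennreal (4 * \<kappa>) * ennreal (real j * K)"
        using \<kappa> K by (simp add: ennreal_plus ennreal_mult')
      then show ?thesis using C0 \<kappa> K by (simp add: ennreal_mult' distrib_left distrib_right mult_ac add_ac)
    qed
    also have "\<dots> \<le> ennreal C + ennreal C * W"
      using C0 \<kappa> K by (intro add_mono mult_right_mono ennreal_leI) (auto simp: C_def intro!: mult_left_mono)
    finally show "ennreal (1 / (1 + a t) ^ 4) * Wn b n (Rd d e j t) \<le> ennreal C * (1 + Wn (b / 2) n (U d j t))"
      by (simp add: q_def A_def W_def distrib_left)
  qed
qed

text \<open>Fatou's lemma, in x and then in t, as the inner scale d = e / (m + 1) tends to 0 with e
  fixed. The estimate of \<open>Rd_level\<close> is uniform in d, and the limit \<open>Rm\<close> no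
  longer contains d.\<close>

lemma R_time:
  assumes j: "j \<ge> 1" and b: "b > 0" and K: "K \<ge> 0" and \<tau>: "0 \<le> \<tau>" "\<tau> \<le> T" and e0: "e0 > 0"
    and lower: "\<And>i d t. i < j \<Longrightarrow> 0 < d \<Longrightarrow> d < e0 \<Longrightarrow> t \<in> {\<tau>..T} \<Longrightarrow> Wn (b / 2) n (U d i t) \<le> ennreal K"
    and top: "\<And>d. 0 < d \<Longrightarrow> d < e0 \<Longrightarrow> (\<integral>\<^sup>+t. indicator {\<tau>..T} t * Wn (b / 2) n (U d j t) \<partial>lborel) \<le> ennreal K"
  shows "\<exists>K'\<ge>0. \<forall>e. 0 < e \<and> e < e0 \<and> e \<le> b / 2 \<longrightarrow>
    (\<integral>\<^sup>+t. indicator {\<tau>..T} t * (ennreal (1 / (1 + a t) ^ 4) * Wn b n (Rm e j t)) \<partial>lborel) \<le> ennreal K'"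
proof -
  obtain C where C: "C \<ge> 0" and CC: "\<And>d e t. 0 < d \<Longrightarrow> d \<le> e \<Longrightarrow> d < e0 \<Longrightarrow> e \<le> b / 2 \<Longrightarrow> t \<in> {\<tau>..T} \<Longrightarrow>
     (\<forall>x y. \<bar>w t x - w t y\<bar> \<le> a t * \<bar>x - y\<bar>) \<Longrightarrow>
    ennreal (1 / (1 + a t) ^ 4) * Wn b n (Rd d e j t) \<le> ennreal C * (1 + Wn (b / 2) n (U d j t))"
  proof -
    have "\<exists>C\<ge>0. \<forall>d e t. 0 < d \<and> d \<le> e \<and> d < e0 \<and> e \<le> b / 2 \<and> t \<in> {\<tau>..T} \<and> (\<forall>x y. \<bar>w t x - w t y\<bar> \<le> a t * \<bar>x - y\<bar>) \<longrightarrow>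
        ennreal (1 / (1 + a t) ^ 4) * Wn b n (Rd d e j t) \<le> ennreal C * (1 + Wn (b / 2) n (U d j t))"
      by (rule Rd_level[OF j b K]) (rule lower)
    then show ?thesis using that by meson
  qed
  show ?thesis
  proof (intro exI[of _ "C * (T + K)"] conjI allI impI, goal_cases)
    case 1
    then show ?case using C T K by simp
  next
    case (2 e)
    then have e: "0 < e" "e < e0" "e \<le> b / 2" by auto
    define d where "d m = e / real (Suc m)" for m
    have d: "d m > 0" "d m \<le> e" for m using e by (auto simp: d_def divide_simps)
    have dlim: "d \<longlonglongrightarrow> 0" unfolding d_def by real_asymp
    let ?h = "\<lambda>r t x. indicator {\<tau>..T} t * (ennreal (1 / (1 + a t) ^ 4) * (indicator {b..} x * ennreal (x ^ n * (r t x)\<^sup>2)))"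
    have eq: "indicator {\<tau>..T} t * (ennreal (1 / (1 + a t) ^ 4) * Wn b n (r t)) = (\<integral>\<^sup>+x. ?h r t x \<partial>lborel)"
      if "r t \<in> borel_measurable borel" for r t
    proof -
      have [measurable]: "r t \<in> borel_measurable borel" by fact
      show ?thesis unfolding Wn_def by (simp add: nn_integral_cmult)
    qed
    have bound: "(\<integral>\<^sup>+t. \<integral>\<^sup>+x. ?h (Rd (d m) e j) t x \<partial>lborel \<partial>lborel) \<le> ennreal (C * (T + K))" for m
    proof -
      have "(\<integral>\<^sup>+t. \<integral>\<^sup>+x. ?h (Rd (d m) e j) t x \<partial>lborel \<partial>lborel) = (\<integral>\<^sup>+t. indicator {\<tau>..T} t * (ennreal (1 / (1 + a t) ^ 4) * Wn b n (Rd (d m) e j t)) \<partial>lborel)"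
        by (subst eq) auto
      also have "\<dots> \<le> (\<integral>\<^sup>+t. ennreal C * (indicator {\<tau>..T} t + indicator {\<tau>..T} t * Wn (b / 2) n (U (d m) j t)) \<partial>lborel)"
      proof (rule nn_integral_mono_AE)
        show "AE t in lborel. indicator {\<tau>..T} t * (ennreal (1 / (1 + a t) ^ 4) * Wn b n (Rd (d m) e j t))
          \<le> ennreal C * (indicator {\<tau>..T} t + indicator {\<tau>..T} t * Wn (b / 2) n (U (d m) j t))"
          using lip
        proof eventually_elim
          case (elim t)
          show ?case
          proof (cases "t \<in> {\<tau>..T}")
            case True
            have "ennreal (1 / (1 + a t) ^ 4) * Wn b n (Rd (d m) e j t) \<le> ennreal C * (1 + Wn (b / 2) n (U (d m) j t))"
              by (rule CC) (use d[of m] e True elim \<tau> in auto)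
            then show ?thesis using True by simp
          qed simp
        qed
      qed
      also have "\<dots> = ennreal C * (ennreal (T - \<tau>) + (\<integral>\<^sup>+t. indicator {\<tau>..T} t * Wn (b / 2) n (U (d m) j t) \<partial>lborel))"
        using \<tau> by (simp add: nn_integral_cmult nn_integral_add)
      also have "\<dots> \<le> ennreal C * (ennreal T + ennreal K)"
        using \<tau> d[of m] e by (intro mult_left_mono add_mono top ennreal_leI) auto
      also have "\<dots> = ennreal (C * (T + K))" using C T K by (simp add: ennreal_mult' ennreal_plus)
      finally show ?thesis .
    qed
    have "(\<integral>\<^sup>+t. indicator {\<tau>..T} t * (ennreal (1 / (1 + a t) ^ 4) * Wn b n (Rm e j t)) \<partial>lborel)
      = (\<integral>\<^sup>+t. \<integral>\<^sup>+x. ?h (Rm e j) t x \<partial>lborel \<partial>lborel)"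
      by (subst eq) auto
    also have "\<dots> = (\<integral>\<^sup>+t. \<integral>\<^sup>+x. liminf (\<lambda>m. ?h (Rd (d m) e j) t x) \<partial>lborel \<partial>lborel)"
    proof (intro nn_integral_cong)
      fix t x
      have "(\<lambda>m. ?h (Rd (d m) e j) t x) \<longlonglongrightarrow> ?h (Rm e j) t x"
        by (cases "t \<in> {\<tau>..T}"; cases "x \<in> {b..}")
          (auto intro!: ennreal_tendsto_cmult tendsto_ennrealI tendsto_intros Rd_tendsto e d dlim)
      from lim_imp_Liminf[OF _ this] show "?h (Rm e j) t x = liminf (\<lambda>m. ?h (Rd (d m) e j) t x)" by simp
    qed
    also have "\<dots> \<le> (\<integral>\<^sup>+t. liminf (\<lambda>m. \<integral>\<^sup>+x. ?h (Rd (d m) e j) t x \<partial>lborel) \<partial>lborel)"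
      by (intro nn_integral_mono nn_integral_liminf) measurable
    also have "\<dots> \<le> liminf (\<lambda>m. \<integral>\<^sup>+t. \<integral>\<^sup>+x. ?h (Rd (d m) e j) t x \<partial>lborel \<partial>lborel)"
      by (rule nn_integral_liminf) measurable
    also have "\<dots> \<le> liminf (\<lambda>m::nat. ennreal (C * (T + K)))"
      by (rule Liminf_mono) (use bound in auto)
    also have "\<dots> = ennreal (C * (T + K))" by (simp add: Liminf_const)
    finally show ?case .
  qed
qed

end

section \<open>The rate of change of the energy at a level j\<close>

context gkdv_weight
begin

text \<open>In the top order part 2 V V' U^k c0, with V the derivative of order j, the factor 2 V V'
  is the derivative of V^2. Integration by parts removes the derivative of order j + 1 and puts it
  on U^k c0, which produces the terms with \<open>U e 1\<close> and with c1.\<close>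

lemma nonlinear_identity:
  assumes e: "e > 0"
  shows "X e j t = (LINT x|lborel. (U e j t x)\<^sup>2 * c3 x
     + (U e j t x)\<^sup>2 * (real k * U e 0 t x ^ (k - 1) * U e 1 t x * c0 x + U e 0 t x ^ k * c1 x) - 2 * (U e j t x * Rm e j t x * c0 x))" (is "_ = ?I")
    and "integrable lborel (\<lambda>x. (U e j t x)\<^sup>2 * c3 x
     + (U e j t x)\<^sup>2 * (real k * U e 0 t x ^ (k - 1) * U e 1 t x * c0 x + U e 0 t x ^ k * c1 x) - 2 * (U e j t x * Rm e j t x * c0 x))"
proof -
  let ?V = "U e j t" and ?V1 = "U e (Suc j) t" and ?p = "\<lambda>x. U e 0 t x ^ k"
  let ?m = "\<lambda>x. real k * U e 0 t x ^ (k - 1) * U e 1 t x * c0 x + U e 0 t x ^ k * c1 x"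
  have U1: "\<bar>U e 1 t x\<bar> \<le> rn 1 / e ^ 1 * M" for x
    unfolding U_def by (rule moll_bound[OF w_cont1 e w_bound])
  have p: "\<bar>?p x\<bar> \<le> M ^ k" for x using power_mono[OF U0_bound[OF e, of t x], of k] by (simp add: power_abs)
  have p1: "\<bar>U e 0 t x ^ (k - 1)\<bar> \<le> M ^ (k - 1)" for x
    using power_mono[OF U0_bound[OF e, of t x], of "k - 1"] by (simp add: power_abs)
  have pc: "\<bar>?p x * c0 x\<bar> \<le> M ^ k * B" "\<bar>?p x * c1 x\<bar> \<le> M ^ k * B" for x
    unfolding abs_mult using M by (intro mult_mono p bounds; simp)+
  have mb: "\<bar>?m x\<bar> \<le> real k * M ^ (k - 1) * (rn 1 / e ^ 1 * M) * B + M ^ k * B" for x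
  proof -
    have "\<bar>real k * U e 0 t x ^ (k - 1) * U e 1 t x * c0 x\<bar> \<le> real k * M ^ (k - 1) * (rn 1 / e ^ 1 * M) * B"
      unfolding abs_mult using M e rn_nonneg[of 1] by (intro mult_mono U1 bounds p1) (auto intro!: mult_nonneg_nonneg)
    with pc(2)[of x] show ?thesis by linarith
  qed
  have pdm: "((\<lambda>x. ?p x) has_real_derivative real k * U e 0 t x ^ (k - 1) * U e 1 t x) (at x)" for x
    by (auto intro!: derivative_eq_intros U_deriv e)
  note sq = U_sq_integrable[OF e]
  have i1: "integrable lborel (\<lambda>x. (?V x)\<^sup>2 * c3 x)" by (rule sq_weight_integrable[OF e _ bounds(4)]) measurable
  have i2: "integrable lborel (\<lambda>x. (?V x)\<^sup>2 * ?m x)"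
    using integrable_square_mult[OF _ _ _ sq sq mb, of j t j] by (simp add: power2_eq_square)
  have i3: "integrable lborel (\<lambda>x. ?V x * ?V1 x * (?p x * c0 x))"
    by (rule integrable_square_mult[OF _ _ _ sq sq pc(1)]) auto
  have i4: "integrable lborel (\<lambda>x. ?V x * N e (Suc j) t x * c0 x)"
    by (rule integrable_square_mult[OF _ _ _ sq N_sq_integrable[OF e] bounds(1)]) auto
  have Req: "?V x * Rm e j t x * c0 x = ?V x * N e (Suc j) t x * c0 x - ?V x * ?V1 x * (?p x * c0 x)" for x
    by (simp add: Rm_def algebra_simps)
  have i5: "integrable lborel (\<lambda>x. ?V x * Rm e j t x * c0 x)"
    unfolding Req by (intro Bochner_Integration.integrable_diff i3 i4)
  show "integrable lborel (\<lambda>x. (?V x)\<^sup>2 * c3 x + (?V x)\<^sup>2 * ?m x - 2 * (?V x * Rm e j t x * c0 x))"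
    by (intro Bochner_Integration.integrable_diff Bochner_Integration.integrable_add i1 i2 i5 integrable_mult_right)
  have i6: "integrable lborel (\<lambda>x. ?V x * ?V x * (?p x * c0 x))"
    by (rule integrable_square_mult[OF _ _ _ sq sq pc(1)]) auto
  have "(LINT x|lborel. 2 * (?V x * ?V1 x * (?p x * c0 x)) + (?V x)\<^sup>2 * ?m x) = 0"
  proof (rule integral_derivative_zero)
    show "((\<lambda>x. ?V x * ?V x * (?p x * c0 x)) has_real_derivative 2 * (?V x * ?V1 x * (?p x * c0 x)) + (?V x)\<^sup>2 * ?m x) (at x)" for x
      by (rule derivative_eq_intros U_deriv[OF e] pdm c0 refl)+ (simp add: algebra_simps power2_eq_square)
    show "continuous_on UNIV (\<lambda>x. 2 * (?V x * ?V1 x * (?p x * c0 x)) + (?V x)\<^sup>2 * ?m x)"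
      by (intro continuous_intros U_cont1 weight_cont)
  qed (intro i6 Bochner_Integration.integrable_add i2 i3 integrable_mult_right)+
  then have "2 * (LINT x|lborel. ?V x * ?V1 x * (?p x * c0 x)) = - (LINT x|lborel. (?V x)\<^sup>2 * ?m x)"
    by (subst (asm) Bochner_Integration.integral_add[OF integrable_mult_right[OF i3] i2]) simp
  moreover have "(LINT x|lborel. ?V x * Rm e j t x * c0 x) = (LINT x|lborel. ?V x * N e (Suc j) t x * c0 x) - (LINT x|lborel. ?V x * ?V1 x * (?p x * c0 x))"
    unfolding Req by (rule Bochner_Integration.integral_diff[OF i4 i3])
  moreover have "?I = (LINT x|lborel. (?V x)\<^sup>2 * c3 x) + (LINT x|lborel. (?V x)\<^sup>2 * ?m x) - 2 * (LINT x|lborel. ?V x * Rm e j t x * c0 x)"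
    by (subst Bochner_Integration.integral_diff,
        (intro Bochner_Integration.integrable_add i1 i2 i5 integrable_mult_right)+,
        subst Bochner_Integration.integral_add[OF i1 i2]) simp
  ultimately show "X e j t = ?I" by (simp add: X_def)
qed

text \<open>Three kinds of terms: the weighted norm of level j, integrable in time by the smoothing
  of the level before; the remainder, damped by (1 + a)^(-4); and the energy times (1 + a)^4 /
  \<kappa>. A large \<kappa> makes the last one absorbable at the cost of larger constants in the
  other two.\<close>

lemma X_estimate:
  assumes e: "e > 0" and lip: "\<forall>x y. \<bar>w t x - w t y\<bar> \<le> a t * \<bar>x - y\<bar>" and \<beta>: "\<beta> \<ge> 0" and C: "C \<ge> 0" and \<kappa>: "\<kappa> > 0"
    and c: "\<And>x. \<bar>c0 x\<bar> \<le> C * (indicator {\<beta>..} x * x ^ n)" "\<And>x. \<bar>c1 x\<bar> \<le> C * (indicator {\<beta>..} x * x ^ n)"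
      "\<And>x. \<bar>c3 x\<bar> \<le> C * (indicator {\<beta>..} x * x ^ n)"
  shows "ennreal (X e j t) \<le> ennreal (C * (1 + M ^ k + real k * M ^ k * \<kappa>)) * Wn \<beta> n (U e j t)
     + ennreal (\<kappa> * C) * (ennreal (1 / (1 + a t) ^ 4) * Wn \<beta> n (Rm e j t))
     + ennreal ((real k * M ^ k + 1) / \<kappa>) * ennreal ((1 + a t) ^ 4) * ennreal (E e j t)"
proof -
  define A where "A = a t"
  have A: "A \<ge> 0" using a_nonneg by (simp add: A_def)
  define Q where "Q = C * (1 + M ^ k + real k * M ^ k * \<kappa>)"
  define q where "q = (1 + A) ^ 4"
  have q: "q > 0" using A by (simp add: q_def)
  define g where "g = (real k * M ^ k + 1) / \<kappa> * q"
  have Q: "Q \<ge> 0" and g: "g \<ge> 0" using C M \<kappa> q by (auto simp: Q_def g_def)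
  let ?V = "U e j t"
  let ?f = "\<lambda>x. (U e j t x)\<^sup>2 * c3 x
     + (U e j t x)\<^sup>2 * (real k * U e 0 t x ^ (k - 1) * U e 1 t x * c0 x + U e 0 t x ^ k * c1 x) - 2 * (U e j t x * Rm e j t x * c0 x)"
  have pt: "?f x \<le> Q * (indicator {\<beta>..} x * (x ^ n * (?V x)\<^sup>2)) + \<kappa> * C * (1 / q * (indicator {\<beta>..} x * (x ^ n * (Rm e j t x)\<^sup>2))) + g * ((?V x)\<^sup>2 * c0 x)" for x
  proof -
    define Y where "Y = indicator {\<beta>..} x * x ^ n"
    have cY: "c0 x \<le> C * Y" "\<bar>c1 x\<bar> \<le> C * Y" "\<bar>c3 x\<bar> \<le> C * Y" using c[of x] by (auto simp: Y_def)
    have p: "\<bar>U e 0 t x ^ k\<bar> \<le> M ^ k" using power_mono[OF U0_bound[OF e, of t x], of k] by (simp add: power_abs)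
    have "\<bar>U e 0 t x ^ (k - 1)\<bar> \<le> M ^ (k - 1)"
      using power_mono[OF U0_bound[OF e, of t x], of "k - 1"] by (simp add: power_abs)
    also have "\<dots> \<le> M ^ k" using M by (intro power_increasing) auto
    finally have p1: "\<bar>U e 0 t x ^ (k - 1)\<bar> \<le> M ^ k" .
    have U1: "\<bar>U e 1 t x\<bar> \<le> A"
      unfolding U_def by (rule lipschitz_moll(2)[OF w_cont1 e]) (use lip in \<open>simp add: A_def\<close>)
    \<comment> \<open>A \<le> (1 + A)^2 and 2 (1 + A)^2 \<le> \<kappa> + (1 + A)^4 / \<kappa>. The
      large part of A is thus charged to the energy with the same factor q / \<kappa> as in
      t4.\<close>
    have AA: "A \<le> \<kappa> + q / \<kappa>"
    proof -
      have "A \<le> (1 + A)\<^sup>2" using A by (simp add: power2_sum)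
      moreover have "2 * (1 + A)\<^sup>2 \<le> \<kappa> + ((1 + A)\<^sup>2)\<^sup>2 / \<kappa>"
        using \<kappa> sum_squares_bound[of \<kappa> "(1 + A)\<^sup>2"] by (simp add: field_simps power2_eq_square)
      ultimately show ?thesis using A \<kappa> by (simp add: q_def)
    qed
    have kMnn: "0 \<le> real k * M ^ k" using M by simp
    have t1: "(?V x)\<^sup>2 * c3 x \<le> (?V x)\<^sup>2 * (C * Y)" using cY by (intro mult_left_mono) auto
    have t2: "(?V x)\<^sup>2 * (U e 0 t x ^ k * c1 x) \<le> (?V x)\<^sup>2 * (M ^ k * (C * Y))"
    proof (rule mult_left_mono)
      have "\<bar>U e 0 t x ^ k * c1 x\<bar> \<le> M ^ k * (C * Y)" unfolding abs_mult[of "U e 0 t x ^ k"] using M by (intro mult_mono p cY) auto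
      then show "U e 0 t x ^ k * c1 x \<le> M ^ k * (C * Y)" by linarith
    qed simp
    have t3: "(?V x)\<^sup>2 * (real k * U e 0 t x ^ (k - 1) * U e 1 t x * c0 x) \<le> (?V x)\<^sup>2 * (real k * M ^ k * \<kappa> * (C * Y) + real k * M ^ k * (q / \<kappa>) * c0 x)"
    proof (rule mult_left_mono)
      have "\<bar>real k * U e 0 t x ^ (k - 1) * U e 1 t x * c0 x\<bar> \<le> real k * M ^ k * A * c0 x"
        unfolding abs_mult using M A c0_nonneg[of x] by (intro mult_mono p1 U1) auto
      also have "\<dots> \<le> real k * M ^ k * (\<kappa> + q / \<kappa>) * c0 x"
        using M c0_nonneg[of x] by (intro mult_right_mono mult_left_mono AA) auto
      also have "\<dots> = real k * M ^ k * \<kappa> * c0 x + real k * M ^ k * (q / \<kappa>) * c0 x" by (simp add: algebra_simps)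
      also have "\<dots> \<le> real k * M ^ k * \<kappa> * (C * Y) + real k * M ^ k * (q / \<kappa>) * c0 x"
        using M \<kappa> q cY by (intro add_mono mult_left_mono) auto
      finally show "real k * U e 0 t x ^ (k - 1) * U e 1 t x * c0 x \<le> real k * M ^ k * \<kappa> * (C * Y) + real k * M ^ k * (q / \<kappa>) * c0 x" by linarith
    qed simp
    have t4: "- 2 * (?V x * Rm e j t x * c0 x) \<le> \<kappa> / q * (Rm e j t x)\<^sup>2 * (C * Y) + q / \<kappa> * (?V x)\<^sup>2 * c0 x"
    proof -
      have am: "- 2 * (v * r) \<le> \<kappa> / q * r\<^sup>2 + q / \<kappa> * v\<^sup>2" for v r :: real
      proof -
        have "0 \<le> (\<kappa> * r + q * v)\<^sup>2 / (\<kappa> * q)" using \<kappa> q by simp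
        also have "\<dots> = \<kappa> / q * r\<^sup>2 + q / \<kappa> * v\<^sup>2 + 2 * (v * r)"
          using \<kappa> q by (simp add: power2_sum field_simps) (simp add: power2_eq_square)
        finally show ?thesis by linarith
      qed
      have "- 2 * (?V x * Rm e j t x) * c0 x \<le> (\<kappa> / q * (Rm e j t x)\<^sup>2 + q / \<kappa> * (?V x)\<^sup>2) * c0 x"
        by (intro mult_right_mono am c0_nonneg)
      also have "\<dots> = \<kappa> / q * (Rm e j t x)\<^sup>2 * c0 x + q / \<kappa> * (?V x)\<^sup>2 * c0 x" by (simp add: distrib_right)
      also have "\<dots> \<le> \<kappa> / q * (Rm e j t x)\<^sup>2 * (C * Y) + q / \<kappa> * (?V x)\<^sup>2 * c0 x"
        using \<kappa> q cY by (intro add_mono mult_left_mono) auto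
      finally show ?thesis by (simp add: mult.assoc)
    qed
    have "?f x \<le> (?V x)\<^sup>2 * (C * Y) + (?V x)\<^sup>2 * (M ^ k * (C * Y)) + (?V x)\<^sup>2 * (real k * M ^ k * \<kappa> * (C * Y) + real k * M ^ k * (q / \<kappa>) * c0 x)
       + (\<kappa> / q * (Rm e j t x)\<^sup>2 * (C * Y) + q / \<kappa> * (?V x)\<^sup>2 * c0 x)"
      using t1 t2 t3 t4 unfolding distrib_left by linarith
    also have "\<dots> = Q * (Y * (?V x)\<^sup>2) + \<kappa> * C * (1 / q * (Y * (Rm e j t x)\<^sup>2)) + g * ((?V x)\<^sup>2 * c0 x)"
      unfolding Q_def g_def using \<kappa> q by (simp add: field_simps)
    finally show ?thesis by (simp add: Y_def mult.assoc)
  qed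
  have "ennreal (X e j t) \<le> (\<integral>\<^sup>+x. ennreal (?f x) \<partial>lborel)"
    unfolding nonlinear_identity(1)[OF e] by (rule integral_le_nn_integral[OF nonlinear_identity(2)[OF e]])
  also have "\<dots> \<le> (\<integral>\<^sup>+x. ennreal Q * (indicator {\<beta>..} x * ennreal (x ^ n * (?V x)\<^sup>2))
     + ennreal (\<kappa> * C) * (ennreal (1 / q) * (indicator {\<beta>..} x * ennreal (x ^ n * (Rm e j t x)\<^sup>2)))
     + ennreal g * ennreal ((?V x)\<^sup>2 * c0 x) \<partial>lborel)"
  proof (rule nn_integral_mono)
    fix x
    have ind: "ennreal (indicator {\<beta>..} x * (x ^ n * y\<^sup>2)) = indicator {\<beta>..} x * ennreal (x ^ n * y\<^sup>2)"
      "0 \<le> indicator {\<beta>..} x * (x ^ n * y\<^sup>2)" for y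
      using \<beta> by (auto simp: indicator_def)
    show "ennreal (?f x) \<le> ennreal Q * (indicator {\<beta>..} x * ennreal (x ^ n * (?V x)\<^sup>2))
     + ennreal (\<kappa> * C) * (ennreal (1 / q) * (indicator {\<beta>..} x * ennreal (x ^ n * (Rm e j t x)\<^sup>2)))
     + ennreal g * ennreal ((?V x)\<^sup>2 * c0 x)"
    proof -
      note ennreal_leI[OF pt[of x]]
      also have "ennreal (Q * (indicator {\<beta>..} x * (x ^ n * (?V x)\<^sup>2)) + \<kappa> * C * (1 / q * (indicator {\<beta>..} x * (x ^ n * (Rm e j t x)\<^sup>2))) + g * ((?V x)\<^sup>2 * c0 x))
         = ennreal (Q * (indicator {\<beta>..} x * (x ^ n * (?V x)\<^sup>2))) + ennreal (\<kappa> * C * (1 / q * (indicator {\<beta>..} x * (x ^ n * (Rm e j t x)\<^sup>2)))) + ennreal (g * ((?V x)\<^sup>2 * c0 x))"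
        using Q g \<kappa> C q c0_nonneg[of x] ind(2)[of "?V x"] ind(2)[of "Rm e j t x"]
        by (subst ennreal_plus; auto intro!: mult_nonneg_nonneg add_nonneg_nonneg)+
      also have "\<dots> = ennreal Q * (indicator {\<beta>..} x * ennreal (x ^ n * (?V x)\<^sup>2))
         + ennreal (\<kappa> * C) * (ennreal (1 / q) * (indicator {\<beta>..} x * ennreal (x ^ n * (Rm e j t x)\<^sup>2)))
         + ennreal g * ennreal ((?V x)\<^sup>2 * c0 x)"
        unfolding ind(1)[symmetric] using Q g \<kappa> C q
        by (simp only: ennreal_mult' mult_nonneg_nonneg less_imp_le zero_le_divide_1_iff)
      finally show ?thesis .
    qed
  qed
  also have "\<dots> = ennreal Q * Wn \<beta> n ?V + ennreal (\<kappa> * C) * (ennreal (1 / q) * Wn \<beta> n (Rm e j t)) + ennreal g * ennreal (E e j t)"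
    unfolding Wn_def E_eq[OF e] by (simp add: nn_integral_add nn_integral_cmult)
  also have "ennreal g = ennreal ((real k * M ^ k + 1) / \<kappa>) * ennreal ((1 + a t) ^ 4)"
    unfolding g_def q_def A_def using M \<kappa> by (intro ennreal_mult) (auto intro!: add_nonneg_nonneg a_nonneg)
  finally show ?thesis by (simp add: Q_def q_def A_def)
qed

end

section \<open>Gain of one derivative\<close>

context gkdv_half
begin

lemma exhaust_energy:
  assumes \<beta>: "\<beta> > 0" and R0: "R0 > 0" and f [measurable]: "f \<in> borel_measurable borel" and L: "L \<ge> 0"
    and le: "\<And>R. R \<ge> R0 \<Longrightarrow> (\<integral>\<^sup>+x. ennreal ((f x)\<^sup>2 * moll \<beta> 0 (gw \<beta> n R) x) \<partial>lborel) \<le> ennreal L"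
  shows "Wn (4 * \<beta>) n f \<le> ennreal (2 ^ n * L)"
  unfolding Wn_def
proof (rule nn_integral_exhaust[of _ R0])
  fix R assume R: "R \<ge> R0"
  then have Rp: "R > 0" using R0 by simp
  interpret weight "moll \<beta> 0 (gw \<beta> n R)" "moll \<beta> 1 (gw \<beta> n R)" "moll \<beta> 2 (gw \<beta> n R)" "moll \<beta> 3 (gw \<beta> n R)"
      "\<Sum>i<4. rn i / \<beta> ^ i * R ^ n"
    by (rule chi_weight[OF \<beta> Rp])
  have "(\<integral>\<^sup>+x. indicator {4 * \<beta>..R} x * ennreal (x ^ n * (f x)\<^sup>2) \<partial>lborel)
    \<le> (\<integral>\<^sup>+x. ennreal (2 ^ n) * ennreal ((f x)\<^sup>2 * moll \<beta> 0 (gw \<beta> n R) x) \<partial>lborel)"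
  proof (rule nn_integral_mono)
    fix x
    have "x ^ n * (f x)\<^sup>2 \<le> 2 ^ n * ((f x)\<^sup>2 * moll \<beta> 0 (gw \<beta> n R) x)" if "4 * \<beta> \<le> x" "x \<le> R"
      using mult_left_mono[OF chi_lower[OF \<beta> Rp that, of n], of "2 ^ n * (f x)\<^sup>2"]
      by (simp add: power_divide mult_ac)
    then show "indicator {4 * \<beta>..R} x * ennreal (x ^ n * (f x)\<^sup>2) \<le> ennreal (2 ^ n) * ennreal ((f x)\<^sup>2 * moll \<beta> 0 (gw \<beta> n R) x)"
      using c0_nonneg[of x] by (auto simp: indicator_def ennreal_leI simp flip: ennreal_mult)
  qed
  also have "\<dots> = ennreal (2 ^ n) * (\<integral>\<^sup>+x. ennreal ((f x)\<^sup>2 * moll \<beta> 0 (gw \<beta> n R) x) \<partial>lborel)"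
    by (rule nn_integral_cmult) measurable
  also have "\<dots> \<le> ennreal (2 ^ n) * ennreal L" by (intro mult_left_mono le R) auto
  finally show "(\<integral>\<^sup>+x. indicator {4 * \<beta>..R} x * ennreal (x ^ n * (f x)\<^sup>2) \<partial>lborel) \<le> ennreal (2 ^ n * L)"
    using L by (simp add: ennreal_mult)
qed measurable

text \<open>The truncation is removed by a limit in x, so Tonelli first moves the time integral
  inside (\<open>G\<close>). By \<open>chi'_lower\<close> the exponent drops from Suc n to
  n.\<close>

lemma exhaust_smoothing:
  assumes \<beta>: "\<beta> > 0" and R0: "R0 > 0" and L: "L \<ge> 0"
    and le: "\<And>R. R \<ge> R0 \<Longrightarrow> (\<integral>\<^sup>+t. indicator {\<tau>..T} t * (\<integral>\<^sup>+x. ennreal ((U e j t x)\<^sup>2 * moll \<beta> 1 (gw \<beta> (Suc n) R) x) \<partial>lborel) \<partial>lborel) \<le> ennreal L"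
  shows "(\<integral>\<^sup>+t. indicator {\<tau>..T} t * Wn (4 * \<beta>) n (U e j t) \<partial>lborel) \<le> ennreal (2 ^ n * L)"
proof -
  define G where "G x = (\<integral>\<^sup>+t. indicator {\<tau>..T} t * ennreal (x ^ n * (U e j t x)\<^sup>2) \<partial>lborel)" for x
  have [measurable]: "G \<in> borel_measurable borel" unfolding G_def[abs_def] by measurable
  have sw: "(\<integral>\<^sup>+t. indicator {\<tau>..T} t * (\<integral>\<^sup>+x. indicator A x * ennreal (x ^ n * (U e j t x)\<^sup>2) \<partial>lborel) \<partial>lborel)
    = (\<integral>\<^sup>+x. indicator A x * G x \<partial>lborel)" if [measurable]: "A \<in> sets borel" for A
  proof -
    have "(\<integral>\<^sup>+t. indicator {\<tau>..T} t * (\<integral>\<^sup>+x. indicator A x * ennreal (x ^ n * (U e j t x)\<^sup>2) \<partial>lborel) \<partial>lborel)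
      = (\<integral>\<^sup>+t. \<integral>\<^sup>+x. indicator {\<tau>..T} t * (indicator A x * ennreal (x ^ n * (U e j t x)\<^sup>2)) \<partial>lborel \<partial>lborel)"
      by (intro nn_integral_cong nn_integral_cmult[symmetric]) measurable
    also have "\<dots> = (\<integral>\<^sup>+x. \<integral>\<^sup>+t. indicator {\<tau>..T} t * (indicator A x * ennreal (x ^ n * (U e j t x)\<^sup>2)) \<partial>lborel \<partial>lborel)"
      by (rule lborel_pair.Fubini') measurable
    also have "\<dots> = (\<integral>\<^sup>+x. indicator A x * G x \<partial>lborel)"
      unfolding G_def by (intro nn_integral_cong, subst nn_integral_cmult[symmetric]) (auto simp: mult_ac)
    finally show ?thesis .
  qed
  have "(\<integral>\<^sup>+x. indicator {4 * \<beta>..} x * G x \<partial>lborel) \<le> ennreal (2 ^ n * L)"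
  proof (rule nn_integral_exhaust[of _ R0])
    fix R assume R: "R \<ge> R0"
    \<comment> \<open>\<open>chi'_lower\<close> holds only up to a distance \<beta> before the
      truncation, hence the radius R + \<beta>.\<close>
    have Rp: "R + \<beta> > 0" using R R0 \<beta> by simp
    interpret weight "moll \<beta> 0 (gw \<beta> (Suc n) (R + \<beta>))" "moll \<beta> 1 (gw \<beta> (Suc n) (R + \<beta>))"
        "moll \<beta> 2 (gw \<beta> (Suc n) (R + \<beta>))" "moll \<beta> 3 (gw \<beta> (Suc n) (R + \<beta>))"
        "\<Sum>i<4. rn i / \<beta> ^ i * (R + \<beta>) ^ Suc n"
      by (rule chi_weight[OF \<beta> Rp])
    have "(\<integral>\<^sup>+x. indicator {4 * \<beta>..R} x * G x \<partial>lborel)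
      = (\<integral>\<^sup>+t. indicator {\<tau>..T} t * (\<integral>\<^sup>+x. indicator {4 * \<beta>..R} x * ennreal (x ^ n * (U e j t x)\<^sup>2) \<partial>lborel) \<partial>lborel)"
      by (rule sw[symmetric]) simp
    also have "\<dots> \<le> (\<integral>\<^sup>+t. ennreal (2 ^ n) * (indicator {\<tau>..T} t * (\<integral>\<^sup>+x. ennreal ((U e j t x)\<^sup>2 * moll \<beta> 1 (gw \<beta> (Suc n) (R + \<beta>)) x) \<partial>lborel)) \<partial>lborel)"
    proof (rule nn_integral_mono)
      fix t
      have "(\<integral>\<^sup>+x. indicator {4 * \<beta>..R} x * ennreal (x ^ n * (U e j t x)\<^sup>2) \<partial>lborel)
        \<le> (\<integral>\<^sup>+x. ennreal (2 ^ n) * ennreal ((U e j t x)\<^sup>2 * moll \<beta> 1 (gw \<beta> (Suc n) (R + \<beta>)) x) \<partial>lborel)"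
      proof (rule nn_integral_mono)
        fix x
        have "x ^ n * (U e j t x)\<^sup>2 \<le> 2 ^ n * ((U e j t x)\<^sup>2 * moll \<beta> 1 (gw \<beta> (Suc n) (R + \<beta>)) x)" if "4 * \<beta> \<le> x" "x \<le> R"
          using mult_left_mono[OF chi'_lower[where n="Suc n" and n'=n, OF \<beta> Rp that(1) _ refl], of "2 ^ n * (U e j t x)\<^sup>2"] that
          by (simp add: power_divide mult_ac)
        then show "indicator {4 * \<beta>..R} x * ennreal (x ^ n * (U e j t x)\<^sup>2) \<le> ennreal (2 ^ n) * ennreal ((U e j t x)\<^sup>2 * moll \<beta> 1 (gw \<beta> (Suc n) (R + \<beta>)) x)"
          using c1_nonneg[of x] by (auto simp: indicator_def ennreal_leI simp flip: ennreal_mult)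
      qed
      also have "\<dots> = ennreal (2 ^ n) * (\<integral>\<^sup>+x. ennreal ((U e j t x)\<^sup>2 * moll \<beta> 1 (gw \<beta> (Suc n) (R + \<beta>)) x) \<partial>lborel)"
        by (rule nn_integral_cmult) measurable
      finally show "indicator {\<tau>..T} t * (\<integral>\<^sup>+x. indicator {4 * \<beta>..R} x * ennreal (x ^ n * (U e j t x)\<^sup>2) \<partial>lborel)
        \<le> ennreal (2 ^ n) * (indicator {\<tau>..T} t * (\<integral>\<^sup>+x. ennreal ((U e j t x)\<^sup>2 * moll \<beta> 1 (gw \<beta> (Suc n) (R + \<beta>)) x) \<partial>lborel))"
        by (auto simp: indicator_def)
    qed
    also have "\<dots> = ennreal (2 ^ n) * (\<integral>\<^sup>+t. indicator {\<tau>..T} t * (\<integral>\<^sup>+x. ennreal ((U e j t x)\<^sup>2 * moll \<beta> 1 (gw \<beta> (Suc n) (R + \<beta>)) x) \<partial>lborel) \<partial>lborel)"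
      by (rule nn_integral_cmult) measurable
    also have "\<dots> \<le> ennreal (2 ^ n) * ennreal L" using R \<beta> by (intro mult_left_mono le) auto
    finally show "(\<integral>\<^sup>+x. indicator {4 * \<beta>..R} x * G x \<partial>lborel) \<le> ennreal (2 ^ n * L)"
      using L by (simp add: ennreal_mult)
  qed measurable
  then show ?thesis unfolding Wn_def by (subst sw) auto
qed

definition Ia :: real where
  "Ia = enn2real (\<integral>\<^sup>+t. indicator {0..T} t * ennreal ((1 + a t) ^ 4) \<partial>lborel)"

lemma Ia: "Ia \<ge> 0" "(\<integral>\<^sup>+t. indicator {0..T} t * ennreal ((1 + a t) ^ 4) \<partial>lborel) = ennreal Ia"
  using a4 by (simp_all add: Ia_def less_top)

text \<open>Hypotheses from b/8 and \<tau>/2 on, conclusions from b and \<tau> on. The weight at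
  scale b/4 dominates x^n only from b on, up to a constant, and is supported from b/4; the remainder
  there sees \<open>U\<close> from b/8; and the starting time is picked in
  [\<tau>/2, \<tau>].\<close>

lemma level_core:
  assumes j: "j \<ge> 1" and b: "b > 0" and \<tau>: "0 < \<tau>" "\<tau> < T" and K: "K \<ge> 0" and e0: "e0 > 0"
    and lower: "\<And>i d t. i < j \<Longrightarrow> 0 < d \<Longrightarrow> d < e0 \<Longrightarrow> t \<in> {\<tau> / 2..T} \<Longrightarrow> Wn (b / 8) n (U d i t) \<le> ennreal K"
    and top: "\<And>d. 0 < d \<Longrightarrow> d < e0 \<Longrightarrow> (\<integral>\<^sup>+t. indicator {\<tau> / 2..T} t * Wn (b / 8) n (U d j t) \<partial>lborel) \<le> ennreal K"
  shows "\<exists>L\<ge>0. \<forall>e. 0 < e \<and> e < e0 \<and> e \<le> b / 8 \<longrightarrow> (\<forall>t\<in>{\<tau>..T}. Wn b n (U e j t) \<le> ennreal L) \<and>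
    (\<forall>n'. n = Suc n' \<longrightarrow> (\<integral>\<^sup>+t. indicator {\<tau>..T} t * Wn b n' (U e (Suc j) t) \<partial>lborel) \<le> ennreal L)"
proof -
  define \<beta> where "\<beta> = b / 4"
  have \<beta>: "\<beta> > 0" using b by (simp add: \<beta>_def)
  have "\<exists>K'\<ge>0. \<forall>e. 0 < e \<and> e < e0 \<and> e \<le> \<beta> / 2 \<longrightarrow>
    (\<integral>\<^sup>+t. indicator {\<tau> / 2..T} t * (ennreal (1 / (1 + a t) ^ 4) * Wn \<beta> n (Rm e j t)) \<partial>lborel) \<le> ennreal K'"
    by (rule R_time[OF j \<beta> K _ _ e0]) (use \<tau> lower top in \<open>auto simp: \<beta>_def\<close>)
  then obtain K' where K': "K' \<ge> 0" and RK: "\<And>e. 0 < e \<Longrightarrow> e < e0 \<Longrightarrow> e \<le> \<beta> / 2 \<Longrightarrow>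
    (\<integral>\<^sup>+t. indicator {\<tau> / 2..T} t * (ennreal (1 / (1 + a t) ^ 4) * Wn \<beta> n (Rm e j t)) \<partial>lborel) \<le> ennreal K'"
    by meson
  define C where "C = (\<Sum>i<4. rn i / \<beta> ^ i * 2 ^ n)"
  have C: "C \<ge> 0" unfolding C_def using \<beta> rn_nonneg by (intro sum_nonneg) auto
  have chiC: "\<bar>moll \<beta> i (gw \<beta> n R) x\<bar> \<le> C * (indicator {\<beta>..} x * x ^ n)" if "R > 0" "i < 4" for i R x
  proof -
    have "rn i / \<beta> ^ i * 2 ^ n \<le> C"
      unfolding C_def using that \<beta> rn_nonneg by (intro member_le_sum) auto
    then have "rn i / \<beta> ^ i * 2 ^ n * (indicator {\<beta>..} x * x ^ n) \<le> C * (indicator {\<beta>..} x * x ^ n)"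
      using \<beta> by (intro mult_right_mono) (auto simp: indicator_def)
    with chi_le[OF \<beta> that(1), of i n x] show ?thesis by linarith
  qed
  define m where "m = real k * M ^ k + 1"
  have m: "m > 0" using M by (simp add: m_def add_nonneg_pos)
  \<comment> \<open>Makes (m / \<kappa>) Ia at most 1/4, as \<open>energy_absorb\<close> demands; Ia
    + 1 instead of Ia keeps \<kappa> positive.\<close>
  define \<kappa> where "\<kappa> = 4 * m * (Ia + 1)"
  have \<kappa>: "\<kappa> > 0" using m Ia by (simp add: \<kappa>_def)
  define Q where "Q = C * (1 + M ^ k + real k * M ^ k * \<kappa>)"
  have Q: "Q \<ge> 0" using C M \<kappa> by (simp add: Q_def)
  define K1 where "K1 = Q * K + \<kappa> * C * K'"
  have K1: "K1 \<ge> 0" using Q K \<kappa> C K' by (simp add: K1_def)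
  \<comment> \<open>The constant of \<open>energy_absorb\<close> for s0 = \<tau>/2, s1 = \<tau> and
    K0 = C K. Neither e nor R occurs in it.\<close>
  define L where "L = 2 * (C * K / (\<tau> - \<tau> / 2) + 1 + K1)"
  have L: "L \<ge> 0" using C K \<tau> K1 by (simp add: L_def)
  have WnW: "Wn \<beta> n f \<le> Wn (b / 8) n f" for f using b by (intro Wn_mono_base) (simp add: \<beta>_def)
  show ?thesis
  proof (rule exI[of _ "2 ^ n * L"], rule conjI[OF _ allI[OF impI]])
    show "0 \<le> 2 ^ n * L" using L by simp
  next
    fix e assume "0 < e \<and> e < e0 \<and> e \<le> b / 8"
    then have e: "0 < e" "e < e0" "e \<le> \<beta> / 2" by (auto simp: \<beta>_def)
    have main: "(\<forall>t\<in>{\<tau>..T}. (\<integral>\<^sup>+x. ennreal ((U e j t x)\<^sup>2 * moll \<beta> 0 (gw \<beta> n R) x) \<partial>lborel) \<le> ennreal L) \<and>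
      (\<integral>\<^sup>+t. indicator {\<tau>..T} t * (\<integral>\<^sup>+x. ennreal ((U e (Suc j) t x)\<^sup>2 * moll \<beta> 1 (gw \<beta> n R) x) \<partial>lborel) \<partial>lborel) \<le> ennreal L"
      if R: "R \<ge> 1" for R
    proof -
      have Rp: "R > 0" using R by simp
      interpret we: weight "moll \<beta> 0 (gw \<beta> n R)" "moll \<beta> 1 (gw \<beta> n R)" "moll \<beta> 2 (gw \<beta> n R)" "moll \<beta> 3 (gw \<beta> n R)"
          "\<Sum>i<4. rn i / \<beta> ^ i * R ^ n"
        by (rule chi_weight[OF \<beta> Rp])
      interpret gw: gkdv_weight k T M K2 w a "moll \<beta> 0 (gw \<beta> n R)" "moll \<beta> 1 (gw \<beta> n R)" "moll \<beta> 2 (gw \<beta> n R)" "moll \<beta> 3 (gw \<beta> n R)"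
          "\<Sum>i<4. rn i / \<beta> ^ i * R ^ n" ..
      let ?q = "\<lambda>t. ennreal Q * Wn \<beta> n (U e j t) + ennreal (\<kappa> * C) * (ennreal (1 / (1 + a t) ^ 4) * Wn \<beta> n (Rm e j t))"
      let ?g = "\<lambda>t. ennreal (m / \<kappa>) * ennreal ((1 + a t) ^ 4)"
      have EW: "ennreal (gw.E e j t) \<le> ennreal C * Wn \<beta> n (U e j t)" for t
      proof -
        have "ennreal (gw.E e j t) \<le> (\<integral>\<^sup>+x. ennreal C * (indicator {\<beta>..} x * ennreal (x ^ n * (U e j t x)\<^sup>2)) \<partial>lborel)"
          unfolding gw.E_eq[OF e(1)]
        proof (rule nn_integral_mono)
          fix x
          have "(U e j t x)\<^sup>2 * moll \<beta> 0 (gw \<beta> n R) x \<le> (U e j t x)\<^sup>2 * (C * (indicator {\<beta>..} x * x ^ n))"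
            using chiC[OF Rp, of 0 x] by (intro mult_left_mono) auto
          then have "ennreal ((U e j t x)\<^sup>2 * moll \<beta> 0 (gw \<beta> n R) x) \<le> ennreal (C * (indicator {\<beta>..} x * (x ^ n * (U e j t x)\<^sup>2)))"
            by (intro ennreal_leI) (simp add: mult_ac)
          then show "ennreal ((U e j t x)\<^sup>2 * moll \<beta> 0 (gw \<beta> n R) x) \<le> ennreal C * (indicator {\<beta>..} x * ennreal (x ^ n * (U e j t x)\<^sup>2))"
            using C \<beta> by (auto simp: indicator_def ennreal_mult')
        qed
        also have "\<dots> = ennreal C * Wn \<beta> n (U e j t)"
          unfolding Wn_def by (rule nn_integral_cmult) measurable
        finally show ?thesis .
      qed
      have c1: "AE t in lborel. t \<in> {\<tau> / 2..T} \<longrightarrow> ennreal (gw.X e j t) \<le> ?q t + ?g t * ennreal (gw.E e j t)"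
        using lip
      proof eventually_elim
        case (elim t)
        show ?case
        proof
          assume "t \<in> {\<tau> / 2..T}"
          then have "\<forall>x y. \<bar>w t x - w t y\<bar> \<le> a t * \<bar>x - y\<bar>" using elim \<tau> by auto
          from gw.X_estimate[OF e(1) this less_imp_le[OF \<beta>] C \<kappa>, of n j] chiC[OF Rp]
          show "ennreal (gw.X e j t) \<le> ?q t + ?g t * ennreal (gw.E e j t)"
            by (simp add: Q_def m_def)
        qed
      qed
      have top': "(\<integral>\<^sup>+t. indicator {\<tau> / 2..T} t * Wn \<beta> n (U e j t) \<partial>lborel) \<le> ennreal K"
        by (rule order_trans[OF nn_integral_mono top[OF e(1,2)]]) (intro mult_left_mono WnW; simp)
      have c2: "(\<integral>\<^sup>+t. indicator {\<tau> / 2..T} t * ?q t \<partial>lborel) \<le> ennreal K1"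
      proof -
        have "(\<integral>\<^sup>+t. indicator {\<tau> / 2..T} t * ?q t \<partial>lborel) = (\<integral>\<^sup>+t. ennreal Q * (indicator {\<tau> / 2..T} t * Wn \<beta> n (U e j t))
           + ennreal (\<kappa> * C) * (indicator {\<tau> / 2..T} t * (ennreal (1 / (1 + a t) ^ 4) * Wn \<beta> n (Rm e j t))) \<partial>lborel)"
          by (intro nn_integral_cong) (simp add: distrib_left mult_ac)
        also have "\<dots> = ennreal Q * (\<integral>\<^sup>+t. indicator {\<tau> / 2..T} t * Wn \<beta> n (U e j t) \<partial>lborel)
           + ennreal (\<kappa> * C) * (\<integral>\<^sup>+t. indicator {\<tau> / 2..T} t * (ennreal (1 / (1 + a t) ^ 4) * Wn \<beta> n (Rm e j t)) \<partial>lborel)"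
          by (subst nn_integral_add) (auto simp: nn_integral_cmult)
        also have "\<dots> \<le> ennreal Q * ennreal K + ennreal (\<kappa> * C) * ennreal K'"
          by (intro add_mono mult_left_mono top' RK e) auto
        also have "\<dots> = ennreal K1" using Q K \<kappa> C K' by (simp add: K1_def ennreal_plus ennreal_mult)
        finally show ?thesis .
      qed
      have c3: "(\<integral>\<^sup>+t. indicator {\<tau> / 2..T} t * ?g t \<partial>lborel) \<le> ennreal (1 / 4)"
      proof -
        have "(\<integral>\<^sup>+t. indicator {\<tau> / 2..T} t * ?g t \<partial>lborel) \<le> (\<integral>\<^sup>+t. ennreal (m / \<kappa>) * (indicator {0..T} t * ennreal ((1 + a t) ^ 4)) \<partial>lborel)"
          using \<tau> by (intro nn_integral_mono) (auto simp: indicator_def)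
        also have "\<dots> = ennreal (m / \<kappa>) * ennreal Ia" by (subst nn_integral_cmult) (auto simp: Ia(2))
        also have "\<dots> = ennreal (m / \<kappa> * Ia)" by (rule ennreal_mult[symmetric]) (use m \<kappa> Ia in auto)
        also have "\<dots> \<le> ennreal (1 / 4)"
        proof (rule ennreal_leI)
          have "m / \<kappa> * Ia = Ia / (4 * (Ia + 1))" using m by (simp add: \<kappa>_def)
          also have "\<dots> \<le> 1 / 4" using Ia(1) by (simp add: divide_simps)
          finally show "m / \<kappa> * Ia \<le> 1 / 4" .
        qed
        finally show ?thesis .
      qed
      have c4: "(\<integral>\<^sup>+t. indicator {\<tau> / 2..\<tau>} t * ennreal (gw.E e j t) \<partial>lborel) \<le> ennreal (C * K)"
      proof -
        have "(\<integral>\<^sup>+t. indicator {\<tau> / 2..\<tau>} t * ennreal (gw.E e j t) \<partial>lborel) \<le> (\<integral>\<^sup>+t. ennreal C * (indicator {\<tau> / 2..T} t * Wn \<beta> n (U e j t)) \<partial>lborel)"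
          using EW \<tau> by (intro nn_integral_mono) (auto simp: indicator_def)
        also have "\<dots> \<le> ennreal C * ennreal K"
          by (subst nn_integral_cmult) (auto intro!: mult_left_mono top')
        finally show ?thesis using C K by (simp add: ennreal_mult)
      qed
      note ab = gw.energy_absorb[OF e(1) _ _ _ _ K1 _ _ c1 c2 c3 c4, folded L_def]
      have E1: "gw.E e j t \<le> L" if "t \<in> {\<tau>..T}" for t
        by (rule ab(1)[OF _ _ _ _ _ _ that]) (use \<tau> C K in auto)
      have E2: "(\<integral>\<^sup>+t. indicator {\<tau>..T} t * ennreal (gw.P e j t) \<partial>lborel) \<le> ennreal L"
        by (rule ab(2)) (use \<tau> C K in auto)
      show ?thesis
        unfolding gw.E_eq[OF e(1), symmetric] gw.P_eq[OF e(1), symmetric]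
        by (intro conjI ballI ennreal_leI E1 E2)
    qed
    have b4: "b = 4 * \<beta>" by (simp add: \<beta>_def)
    have "Wn b n (U e j t) \<le> ennreal (2 ^ n * L)" if "t \<in> {\<tau>..T}" for t
      unfolding b4 by (rule exhaust_energy[OF \<beta> zero_less_one _ L]) (use main that in auto)
    moreover have "(\<integral>\<^sup>+t. indicator {\<tau>..T} t * Wn b n' (U e (Suc j) t) \<partial>lborel) \<le> ennreal (2 ^ n * L)" if n: "n = Suc n'" for n'
    proof -
      have "(\<integral>\<^sup>+t. indicator {\<tau>..T} t * Wn b n' (U e (Suc j) t) \<partial>lborel) \<le> ennreal (2 ^ n' * L)"
        unfolding b4 by (rule exhaust_smoothing[OF \<beta> zero_less_one L]) (use main n in auto)
      also have "\<dots> \<le> ennreal (2 ^ n * L)" using L n by (intro ennreal_leI mult_right_mono) auto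
      finally show ?thesis .
    qed
    ultimately show "(\<forall>t\<in>{\<tau>..T}. Wn b n (U e j t) \<le> ennreal (2 ^ n * L)) \<and>
      (\<forall>n'. n = Suc n' \<longrightarrow> (\<integral>\<^sup>+t. indicator {\<tau>..T} t * Wn b n' (U e (Suc j) t) \<partial>lborel) \<le> ennreal (2 ^ n * L))"
      by blast
  qed
qed

text \<open>Bounds uniform for small e, pointwise in time here and integrated in time in
  \<open>Sb\<close>. Since every step loses in b and in \<tau>, both are quantified inside, and K
  and the threshold e0 may depend on them.\<close>

definition Pb :: "nat \<Rightarrow> nat \<Rightarrow> bool" where
  "Pb n j \<longleftrightarrow> (\<forall>b \<tau>. 0 < b \<longrightarrow> 0 < \<tau> \<longrightarrow> \<tau> < T \<longrightarrow> (\<exists>K\<ge>0. \<exists>e0>0. \<forall>e t. 0 < e \<longrightarrow> e < e0 \<longrightarrow> t \<in> {\<tau>..T} \<longrightarrow>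
     Wn b n (U e j t) \<le> ennreal K))"

definition Sb :: "nat \<Rightarrow> nat \<Rightarrow> bool" where
  "Sb n j \<longleftrightarrow> (\<forall>b \<tau>. 0 < b \<longrightarrow> 0 < \<tau> \<longrightarrow> \<tau> < T \<longrightarrow> (\<exists>K\<ge>0. \<exists>e0>0. \<forall>e. 0 < e \<longrightarrow> e < e0 \<longrightarrow>
     (\<integral>\<^sup>+t. indicator {\<tau>..T} t * Wn b n (U e j t) \<partial>lborel) \<le> ennreal K))"

lemma Pb_common:
  assumes "\<forall>i<j. Pb n i" "0 < b" "0 < \<tau>" "\<tau> < T"
  shows "\<exists>K\<ge>0. \<exists>e0>0. \<forall>i e t. i < j \<longrightarrow> 0 < e \<longrightarrow> e < e0 \<longrightarrow> t \<in> {\<tau>..T} \<longrightarrow> Wn b n (U e i t) \<le> ennreal K"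
  using assms(1)
proof (induction j)
  case 0
  show ?case by (intro exI[of _ 0] conjI exI[of _ 1]) auto
next
  case (Suc j)
  then obtain K e0 where 1: "K \<ge> 0" "e0 > 0" "\<And>i e t. i < j \<Longrightarrow> 0 < e \<Longrightarrow> e < e0 \<Longrightarrow> t \<in> {\<tau>..T} \<Longrightarrow> Wn b n (U e i t) \<le> ennreal K"
    by (metis less_SucI)
  have "Pb n j" using Suc.prems by simp
  from this[unfolded Pb_def, rule_format, OF assms(2-4)] obtain K' e0' where 2: "K' \<ge> 0" "e0' > 0" "\<And>e t. 0 < e \<Longrightarrow> e < e0' \<Longrightarrow> t \<in> {\<tau>..T} \<Longrightarrow> Wn b n (U e j t) \<le> ennreal K'"
    by auto
  have "Wn b n (U e i t) \<le> ennreal (max K K')" if "i < Suc j" "0 < e" "e < min e0 e0'" "t \<in> {\<tau>..T}" for i e t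
  proof (cases "i = j")
    case True
    then show ?thesis using 2(3)[of e t] that by (auto intro: order_trans[OF _ ennreal_leI])
  next
    case False
    then show ?thesis using 1(3)[of i e t] that by (auto intro: order_trans[OF _ ennreal_leI])
  qed
  then show ?case using 1 2 by (intro exI[of _ "max K K'"] conjI exI[of _ "min e0 e0'"]) auto
qed

lemma level_step:
  assumes j: "j \<ge> 1" and P: "\<forall>i<j. Pb n i" and S: "Sb n j"
  shows "Pb n j \<and> (\<forall>n'. n = Suc n' \<longrightarrow> Sb n' (Suc j))"
proof -
  have main: "\<exists>L\<ge>0. \<exists>e1>0. \<forall>e. 0 < e \<longrightarrow> e < e1 \<longrightarrow> (\<forall>t\<in>{\<tau>..T}. Wn b n (U e j t) \<le> ennreal L) \<and>
    (\<forall>n'. n = Suc n' \<longrightarrow> (\<integral>\<^sup>+t. indicator {\<tau>..T} t * Wn b n' (U e (Suc j) t) \<partial>lborel) \<le> ennreal L)"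
    if b: "0 < b" and \<tau>: "0 < \<tau>" "\<tau> < T" for b \<tau>
  proof -
    from Pb_common[OF P, of "b / 8" "\<tau> / 2"] b \<tau>
    obtain K e0 where 1: "K \<ge> 0" "e0 > 0" "\<And>i e t. i < j \<Longrightarrow> 0 < e \<Longrightarrow> e < e0 \<Longrightarrow> t \<in> {\<tau> / 2..T} \<Longrightarrow> Wn (b / 8) n (U e i t) \<le> ennreal K"
      by auto
    from S[unfolded Sb_def, rule_format, of "b / 8" "\<tau> / 2"] b \<tau>
    obtain K' e0' where 2: "K' \<ge> 0" "e0' > 0" "\<And>e. 0 < e \<Longrightarrow> e < e0' \<Longrightarrow>
       (\<integral>\<^sup>+t. indicator {\<tau> / 2..T} t * Wn (b / 8) n (U e j t) \<partial>lborel) \<le> ennreal K'"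
      by auto
    have "\<exists>L\<ge>0. \<forall>e. 0 < e \<and> e < min e0 e0' \<and> e \<le> b / 8 \<longrightarrow> (\<forall>t\<in>{\<tau>..T}. Wn b n (U e j t) \<le> ennreal L) \<and>
      (\<forall>n'. n = Suc n' \<longrightarrow> (\<integral>\<^sup>+t. indicator {\<tau>..T} t * Wn b n' (U e (Suc j) t) \<partial>lborel) \<le> ennreal L)"
    proof (rule level_core[OF j b \<tau>, of "max K K'"])
      show "Wn (b / 8) n (U d i t) \<le> ennreal (max K K')" if "i < j" "0 < d" "d < min e0 e0'" "t \<in> {\<tau> / 2..T}" for i d t
        using 1(3)[of i d t] that by (auto intro: order_trans[OF _ ennreal_leI])
      show "(\<integral>\<^sup>+t. indicator {\<tau> / 2..T} t * Wn (b / 8) n (U d j t) \<partial>lborel) \<le> ennreal (max K K')" if "0 < d" "d < min e0 e0'" for d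
        using 2(3)[of d] that by (auto intro: order_trans[OF _ ennreal_leI])
    qed (use 1 2 in auto)
    then obtain L where "L \<ge> 0" "\<forall>e. 0 < e \<and> e < min e0 e0' \<and> e \<le> b / 8 \<longrightarrow> (\<forall>t\<in>{\<tau>..T}. Wn b n (U e j t) \<le> ennreal L) \<and>
      (\<forall>n'. n = Suc n' \<longrightarrow> (\<integral>\<^sup>+t. indicator {\<tau>..T} t * Wn b n' (U e (Suc j) t) \<partial>lborel) \<le> ennreal L)"
      by blast
    then show ?thesis
      using 1 2 b by (intro exI[of _ L] conjI exI[of _ "min (min e0 e0') (b / 8)"]) auto
  qed
  show ?thesis
  proof (intro conjI allI impI)
    show "Pb n j"
      unfolding Pb_def
    proof (intro allI impI)
      fix b \<tau> :: real assume *: "0 < b" "0 < \<tau>" "\<tau> < T"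
      from main[OF *] obtain L e1 where "L \<ge> 0" "e1 > 0"
        "\<And>e. 0 < e \<Longrightarrow> e < e1 \<Longrightarrow> \<forall>t\<in>{\<tau>..T}. Wn b n (U e j t) \<le> ennreal L" by metis
      then show "\<exists>K\<ge>0. \<exists>e0>0. \<forall>e t. 0 < e \<longrightarrow> e < e0 \<longrightarrow> t \<in> {\<tau>..T} \<longrightarrow> Wn b n (U e j t) \<le> ennreal K"
        by (intro exI[of _ L] conjI exI[of _ e1]) auto
    qed
  next
    fix n' assume n: "n = Suc n'"
    show "Sb n' (Suc j)"
      unfolding Sb_def
    proof (intro allI impI)
      fix b \<tau> :: real assume *: "0 < b" "0 < \<tau>" "\<tau> < T"
      from main[OF *] obtain L e1 where "L \<ge> 0" "e1 > 0"
        "\<And>e. 0 < e \<Longrightarrow> e < e1 \<Longrightarrow> (\<integral>\<^sup>+t. indicator {\<tau>..T} t * Wn b n' (U e (Suc j) t) \<partial>lborel) \<le> ennreal L"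
        using n by metis
      then show "\<exists>K\<ge>0. \<exists>e0>0. \<forall>e. 0 < e \<longrightarrow> e < e0 \<longrightarrow> (\<integral>\<^sup>+t. indicator {\<tau>..T} t * Wn b n' (U e (Suc j) t) \<partial>lborel) \<le> ennreal K"
        by (intro exI[of _ L] conjI exI[of _ e1]) auto
    qed
  qed
qed

end

section \<open>The lowest order estimate\<close>

text \<open>Time is cut into pieces of length l on which the integral term takes at most half of the
  supremum, so a bound G at the start of a piece gives 2 C (1 + G) on it. The order of quantifiers
  matters: G must depend neither on f nor on B, because f will be an energy truncated at R.\<close>

lemma gronwall_pieces:
  fixes h :: "real \<Rightarrow> ennreal" and T C l f0 :: real
  assumes C: "C \<ge> 0" and l: "l > 0" and T: "T > 0" and f0: "f0 \<ge> 0"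
    and h [measurable]: "h \<in> borel_measurable borel"
    and small: "\<And>t1 t2. 0 \<le> t1 \<Longrightarrow> t1 \<le> t2 \<Longrightarrow> t2 \<le> T \<Longrightarrow> t2 - t1 \<le> l \<Longrightarrow>
      ennreal C * (\<integral>\<^sup>+s. indicator {t1..t2} s * h s \<partial>lborel) \<le> ennreal (1 / 2)"
  shows "\<exists>G\<ge>0. \<forall>f B. (\<forall>t. 0 \<le> f t \<and> f t \<le> B) \<and> f 0 \<le> f0 \<and>
    (\<forall>t1 t2. 0 \<le> t1 \<longrightarrow> t1 \<le> t2 \<longrightarrow> t2 \<le> T \<longrightarrow>
      ennreal (f t2) \<le> ennreal C * (ennreal (1 + f t1) + (\<integral>\<^sup>+s. indicator {t1..t2} s * (h s * ennreal (f s)) \<partial>lborel)))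
    \<longrightarrow> (\<forall>t\<in>{0..T}. f t \<le> G)"
proof -
  \<comment> \<open>The previous bound is added so that G increases and covers all earlier pieces as
    well.\<close>
  define G where "G = rec_nat f0 (\<lambda>_ g. g + 2 * C * (1 + g))"
  have G0: "G 0 = f0" and GS: "G (Suc m) = G m + 2 * C * (1 + G m)" for m by (auto simp: G_def)
  have Gn: "G m \<ge> 0" for m by (induction m) (use C f0 in \<open>auto simp: G0 GS\<close>)
  obtain m0 :: nat where m0: "T \<le> real m0 * l" using reals_Archimedean3[OF l] by (meson less_imp_le)
  show ?thesis
  proof (rule exI[of _ "G m0"], rule conjI[OF Gn], intro allI impI, elim conjE)
    fix f :: "real \<Rightarrow> real" and B
    assume fB: "\<forall>t. 0 \<le> f t \<and> f t \<le> B" and f00: "f 0 \<le> f0"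
      and step: "\<forall>t1 t2. 0 \<le> t1 \<longrightarrow> t1 \<le> t2 \<longrightarrow> t2 \<le> T \<longrightarrow>
      ennreal (f t2) \<le> ennreal C * (ennreal (1 + f t1) + (\<integral>\<^sup>+s. indicator {t1..t2} s * (h s * ennreal (f s)) \<partial>lborel))"
    have piece: "f t \<le> 2 * C * (1 + f t1)" if t1: "0 \<le> t1" "t1 \<le> t" "t \<le> T" "t - t1 \<le> l" for t1 t
    proof -
      define S where "S = (SUP s\<in>{t1..t}. f s)"
      have bdd: "bdd_above (f ` {t1..t})" using fB by (auto intro!: bdd_aboveI2)
      have fS: "f s \<le> S" if "s \<in> {t1..t}" for s unfolding S_def by (rule cSUP_upper[OF that bdd])
      have S0: "S \<ge> 0" using fS[of t1] fB t1 by (auto intro: order_trans)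
      have nn: "0 \<le> C * (1 + f t1)" using C fB by (simp add: add_nonneg_nonneg)
      have "f s \<le> C * (1 + f t1) + 1 / 2 * S" if s: "s \<in> {t1..t}" for s
      proof -
        have "ennreal (f s) \<le> ennreal C * (ennreal (1 + f t1) + (\<integral>\<^sup>+r. indicator {t1..s} r * (h r * ennreal (f r)) \<partial>lborel))"
          using step s t1 by auto
        also have "\<dots> \<le> ennreal C * (ennreal (1 + f t1) + (\<integral>\<^sup>+r. indicator {t1..s} r * h r * ennreal S \<partial>lborel))"
          using fS s by (intro mult_left_mono add_left_mono nn_integral_mono)
            (auto simp: indicator_def intro!: mult_left_mono ennreal_leI)
        also have "\<dots> = ennreal C * ennreal (1 + f t1) + ennreal C * (\<integral>\<^sup>+r. indicator {t1..s} r * h r \<partial>lborel) * ennreal S"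
          by (subst nn_integral_multc) (auto simp: distrib_left mult.assoc)
        also have "\<dots> \<le> ennreal C * ennreal (1 + f t1) + ennreal (1 / 2) * ennreal S"
          using s t1 by (intro add_left_mono mult_right_mono small) auto
        also have "\<dots> = ennreal (C * (1 + f t1) + 1 / 2 * S)"
        proof -
          have 1: "ennreal (C * (1 + f t1)) = ennreal C * ennreal (1 + f t1)"
            using C fB by (intro ennreal_mult) (auto intro: add_nonneg_nonneg)
          have 2: "ennreal (1 / 2 * S) = ennreal (1 / 2) * ennreal S"
            using S0 by (intro ennreal_mult) auto
          show ?thesis unfolding 1[symmetric] 2[symmetric] using nn S0 by (intro ennreal_plus[symmetric]) auto
        qed
        finally show ?thesis using nn S0 by (subst (asm) ennreal_le_iff) auto
      qed
      then have "S \<le> C * (1 + f t1) + 1 / 2 * S"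
        using t1 by (subst S_def) (intro cSUP_least, auto)
      then show ?thesis using fS[of t] t1 by simp
    qed
    have "\<forall>t\<in>{0..T}. t \<le> real m * l \<longrightarrow> f t \<le> G m" for m
    proof (induction m)
      case 0
      then show ?case using f00 by (auto simp: G0)
    next
      case (Suc m)
      show ?case
      proof (intro ballI impI)
        fix t assume t: "t \<in> {0..T}" "t \<le> real (Suc m) * l"
        have pos: "0 \<le> 2 * C * (1 + G m)" using C Gn[of m] by simp
        show "f t \<le> G (Suc m)"
        proof (cases "t \<le> real m * l")
          case True
          then show ?thesis using Suc t pos by (force simp: GS)
        next
          case False
          have "f t \<le> 2 * C * (1 + f (real m * l))"
            using False t l by (intro piece) (auto simp: algebra_simps)
          also have "\<dots> \<le> 2 * C * (1 + G m)"
            using C Suc[rule_format, of "real m * l"] False t l by (intro mult_left_mono add_left_mono) auto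
          finally show ?thesis using Gn[of m] by (simp add: GS)
        qed
      qed
    qed
    from this[of m0] m0 show "\<forall>t\<in>{0..T}. f t \<le> G m0" by auto
  qed
qed

text \<open>Gronwall's lemma needs the same quantity on both sides, so the half-line must not shrink
  at level 0. This weight lives on the whole line, is at least 1, and changes at most by the factor
  2^n under shifts of length at most 1, so that mollification reproduces it up to a
  constant.\<close>

definition Yw :: "nat \<Rightarrow> real \<Rightarrow> real \<Rightarrow> real" where
  "Yw n R x = (1 + min R (max 0 x)) ^ n"

lemma Yw_meas [measurable]: "Yw n R \<in> borel_measurable borel"
  unfolding Yw_def[abs_def] by measurable

lemma Yw_pos: "R > 0 \<Longrightarrow> Yw n R x \<ge> 1"
  by (simp add: Yw_def one_le_power)

lemma Yw_le: "R > 0 \<Longrightarrow> Yw n R x \<le> (1 + R) ^ n"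
  unfolding Yw_def by (intro power_mono) auto

lemma Yw_shift:
  assumes "R > 0" "\<bar>x - y\<bar> \<le> 1"
  shows "Yw n R x \<le> 2 ^ n * Yw n R y"
proof -
  have "1 + min R (max 0 x) \<le> 2 * (1 + min R (max 0 y))" using assms by (auto simp: min_def max_def)
  then have "Yw n R x \<le> (2 * (1 + min R (max 0 y))) ^ n"
    unfolding Yw_def using assms by (intro power_mono) auto
  then show ?thesis unfolding Yw_def power_mult_distrib .
qed

lemma abs_mult_unit: "\<bar>z\<bar> \<le> 1 \<Longrightarrow> 0 < e \<Longrightarrow> e \<le> 1 \<Longrightarrow> \<bar>e * z\<bar> \<le> (1::real)"
  by (simp add: abs_mult mult_le_one)

lemma chi_le_Yw:
  assumes b: "0 < b" "b \<le> 1" and R: "R > 0"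
  shows "\<bar>moll b i (gw b n R) x\<bar> \<le> rn i / b ^ i * 2 ^ n * Yw n R x"
proof -
  have "\<bar>moll b i (gw b n R) x\<bar> \<le> rn i / b ^ i * (2 ^ n * Yw n R x)"
  proof (rule chi_bound[OF b(1) R])
    fix z :: real assume z: "\<bar>z\<bar> \<le> 1"
    have "gw b n R (x - b * z) \<le> min R (max 0 (x - b * z)) ^ n" by (rule gw_le1[OF b(1) R])
    also have "\<dots> \<le> Yw n R (x - b * z)" unfolding Yw_def using R by (intro power_mono) auto
    also have "\<dots> \<le> 2 ^ n * Yw n R x"
      by (rule Yw_shift[OF R]) (use abs_mult_unit[OF z b] in simp)
    finally show "gw b n R (x - b * z) \<le> 2 ^ n * Yw n R x" .
  qed
  then show ?thesis by (simp add: mult_ac)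
qed

text \<open>For x \<le> 4 the summand 1 suffices, as 1 + x \<le> 5. Above 4,
  \<open>chi_lower\<close> applies because b \<le> 1, with 1 + y \<le> 5 y / 2; beyond R the left
  side is constant and the mollified weight is nondecreasing.\<close>

lemma Yw_le_chi:
  assumes b: "0 < b" "b \<le> 1" and R: "R \<ge> 4"
  shows "Yw n R x \<le> 5 ^ n * (1 + moll b 0 (gw b n R) x)"
proof -
  have Rp: "R > 0" using R by simp
  interpret weight "moll b 0 (gw b n R)" "moll b 1 (gw b n R)" "moll b 2 (gw b n R)" "moll b 3 (gw b n R)"
      "\<Sum>i<4. rn i / b ^ i * R ^ n"
    by (rule chi_weight[OF b(1) Rp])
  show ?thesis
  proof (cases "x \<le> 4")
    case True
    have "Yw n R x \<le> 5 ^ n * 1" unfolding Yw_def using True R by (simp, intro power_mono) auto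
    also have "\<dots> \<le> 5 ^ n * (1 + moll b 0 (gw b n R) x)" using c0_nonneg by (intro mult_left_mono) auto
    finally show ?thesis .
  next
    case False
    define y where "y = min R x"
    have y: "4 \<le> y" "y \<le> R" "y \<le> x" using R False by (auto simp: y_def)
    have "Yw n R x = (1 + y) ^ n" using False by (simp add: Yw_def y_def max_def)
    also have "\<dots> \<le> (5 * (y / 2)) ^ n" using y by (intro power_mono) auto
    also have "\<dots> = 5 ^ n * (y / 2) ^ n" by (simp only: power_mult_distrib)
    also have "\<dots> \<le> 5 ^ n * moll b 0 (gw b n R) y"
      using b y by (intro mult_left_mono chi_lower[OF b(1) Rp]) auto
    also have "\<dots> \<le> 5 ^ n * moll b 0 (gw b n R) x"
      using y by (intro mult_left_mono moll_0_mono gw_cont[OF b(1) Rp] monoD[OF gw_mono[OF b(1) Rp]]) auto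
    also have "\<dots> \<le> 5 ^ n * (1 + moll b 0 (gw b n R) x)" by simp
    finally show ?thesis .
  qed
qed

context gkdv_half
begin

definition EY :: "nat \<Rightarrow> real \<Rightarrow> real \<Rightarrow> real" where
  "EY n R t = enn2real (\<integral>\<^sup>+x. ennreal (Yw n R x) * ennreal ((w t x)\<^sup>2) \<partial>lborel)"

lemma EY:
  assumes "R > 0"
  shows "ennreal (EY n R t) = (\<integral>\<^sup>+x. ennreal (Yw n R x) * ennreal ((w t x)\<^sup>2) \<partial>lborel)"
    and "0 \<le> EY n R t" "EY n R t \<le> (1 + R) ^ n * K2"
proof -
  have "(\<integral>\<^sup>+x. ennreal (Yw n R x) * ennreal ((w t x)\<^sup>2) \<partial>lborel) \<le> (\<integral>\<^sup>+x. ennreal ((1 + R) ^ n) * ennreal ((w t x)\<^sup>2) \<partial>lborel)"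
    by (intro nn_integral_mono mult_right_mono ennreal_leI Yw_le assms) auto
  also have "\<dots> = ennreal ((1 + R) ^ n) * (\<integral>\<^sup>+x. ennreal ((w t x)\<^sup>2) \<partial>lborel)"
    by (rule nn_integral_cmult) measurable
  also have "\<dots> \<le> ennreal ((1 + R) ^ n) * ennreal K2" by (intro mult_left_mono w_L2) auto
  also have "\<dots> = ennreal ((1 + R) ^ n * K2)" using assms K2 by (simp add: ennreal_mult)
  finally have le: "(\<integral>\<^sup>+x. ennreal (Yw n R x) * ennreal ((w t x)\<^sup>2) \<partial>lborel) \<le> ennreal ((1 + R) ^ n * K2)" .
  then show eq: "ennreal (EY n R t) = (\<integral>\<^sup>+x. ennreal (Yw n R x) * ennreal ((w t x)\<^sup>2) \<partial>lborel)"
    unfolding EY_def by (intro ennreal_enn2real) (auto intro: le_less_trans)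
  show "0 \<le> EY n R t" by (simp add: EY_def)
  show "EY n R t \<le> (1 + R) ^ n * K2"
    using le unfolding eq[symmetric] using assms K2 by (simp add: ennreal_le_iff)
qed

lemma U0_Yw:
  assumes "0 < e" "e \<le> 1" "R > 0"
  shows "(\<integral>\<^sup>+x. ennreal (Yw n R x) * ennreal ((U e 0 t x)\<^sup>2) \<partial>lborel) \<le> ennreal (2 ^ n) * ennreal (EY n R t)"
proof -
  have "(\<integral>\<^sup>+x. ennreal (Yw n R x) * ennreal ((U e 0 t x)\<^sup>2) \<partial>lborel)
    \<le> ennreal ((rn 0 / e ^ 0)\<^sup>2) * (\<integral>\<^sup>+x. ennreal (2 ^ n * Yw n R x) * ennreal ((w t x)\<^sup>2) \<partial>lborel)"
    unfolding U_def
  proof (rule moll_weighted[OF w_cont1 assms(1)])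
    fix x z :: real assume z: "\<bar>z\<bar> \<le> 1"
    show "ennreal (Yw n R x) \<le> ennreal (2 ^ n * Yw n R (x - e * z))"
      by (intro ennreal_leI Yw_shift assms) (use abs_mult_unit[OF z assms(1,2)] in simp)
  qed measurable
  also have "\<dots> = ennreal (2 ^ n) * ennreal (EY n R t)"
    unfolding EY(1)[OF assms(3)] by (simp add: rn_0 ennreal_mult' mult.assoc nn_integral_cmult)
  finally show ?thesis .
qed

text \<open>The flux is the Lipschitz coefficient w^k / (k + 1) times w. The commutator estimate
  applied to this product bounds the mollified derivative of the flux by A times w and its
  convolution, without any derivative of w.\<close>

lemma N1_bound:
  assumes e: "e > 0" and lip: "\<forall>x y. \<bar>w t x - w t y\<bar> \<le> A * \<bar>x - y\<bar>"
  shows "ennreal ((N e 1 t x)\<^sup>2) \<le> 2 * (ennreal ((M ^ k * A)\<^sup>2) * (cv 1 e (\<lambda>y. ennreal \<bar>w t y\<bar>) x)\<^sup>2)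
     + 2 * ennreal ((M ^ k * A)\<^sup>2 * (w t x)\<^sup>2)"
proof -
  have A: "A \<ge> 0" using lip[rule_format, of 1 0] by simp
  let ?g = "\<lambda>y. w t y ^ k / real (Suc k)"
  have F: "(\<lambda>y. F (w t y)) = (\<lambda>y. ?g y * w t y)" by (simp add: F_def fun_eq_iff mult.commute)
  have gb: "\<bar>?g (x - e * z) - ?g x\<bar> \<le> M ^ k * A * e" if z: "\<bar>z\<bar> \<le> 1" for z
  proof -
    have "\<bar>w t (x - e * z) - w t x\<bar> \<le> A * \<bar>e * z\<bar>" using lip[rule_format, of "x - e * z" x] by simp
    also have "\<dots> \<le> A * e" using z e mult_left_mono[of "\<bar>z\<bar>" 1 e] A by (intro mult_left_mono) (auto simp: abs_mult)
    finally have 1: "\<bar>w t (x - e * z) - w t x\<bar> \<le> A * e" .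
    have "\<bar>w t (x - e * z) ^ k - w t x ^ k\<bar> \<le> real k * M ^ k * \<bar>w t (x - e * z) - w t x\<bar>"
      by (rule power_diff_bound[OF w_bound w_bound M])
    also have "\<dots> \<le> real (Suc k) * M ^ k * (A * e)"
      using M 1 by (intro mult_mono) auto
    finally have "\<bar>w t (x - e * z) ^ k - w t x ^ k\<bar> / real (Suc k) \<le> M ^ k * A * e"
      by (subst pos_divide_le_eq) (auto simp: mult_ac)
    then show ?thesis by (simp add: diff_divide_distrib[symmetric] abs_divide del: of_nat_Suc)
  qed
  have gc: "continuous_on UNIV ?g" by (intro continuous_intros w_cont1) auto
  have U1: "\<bar>U e 1 t x\<bar> \<le> A" unfolding U_def by (rule lipschitz_moll(2)[OF w_cont1 e]) (use lip in auto)
  have small: "\<bar>?g x * U e 1 t x\<bar> \<le> M ^ k * A * \<bar>w t x\<bar>"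
  proof -
    obtain k' where k': "k = Suc k'" using k by (cases k) auto
    have "\<bar>?g x\<bar> \<le> \<bar>w t x\<bar> ^ k"
      using mult_left_mono[of 1 "real (Suc k)" "\<bar>w t x\<bar> ^ k"] by (simp add: power_abs abs_mult field_simps)
    also have "\<dots> \<le> M ^ k' * \<bar>w t x\<bar>" unfolding k' power_Suc2 using w_bound by (intro mult_right_mono power_mono) auto
    also have "\<dots> \<le> M ^ k * \<bar>w t x\<bar>" using M by (intro mult_right_mono power_increasing) (auto simp: k')
    finally show ?thesis unfolding abs_mult[of "?g x"] using A mult_mono[OF _ U1, of "\<bar>?g x\<bar>" "M ^ k * \<bar>w t x\<bar>"] M
      by (simp add: mult_ac)
  qed
  have tri: "ennreal \<bar>p\<bar> \<le> ennreal \<bar>p - q\<bar> + ennreal \<bar>q\<bar>" for p q :: real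
    by (simp add: ennreal_leI flip: ennreal_plus)
  have "ennreal \<bar>N e 1 t x\<bar> \<le> ennreal \<bar>N e 1 t x - ?g x * U e 1 t x\<bar> + ennreal \<bar>?g x * U e 1 t x\<bar>"
    by (rule tri)
  also have "\<dots> \<le> ennreal (M ^ k * A) * cv 1 e (\<lambda>y. ennreal \<bar>w t y\<bar>) x + ennreal (M ^ k * A * \<bar>w t x\<bar>)"
    unfolding N_def U_def F
    by (intro add_mono commutator_bound w_cont1 gc e gb) (use small in \<open>auto simp: U_def intro: ennreal_leI\<close>)
  finally have "(ennreal \<bar>N e 1 t x\<bar>)\<^sup>2 \<le> (ennreal (M ^ k * A) * cv 1 e (\<lambda>y. ennreal \<bar>w t y\<bar>) x + ennreal (M ^ k * A * \<bar>w t x\<bar>))\<^sup>2"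
    by (intro power_mono) auto
  also note ennreal_sq_add_le
  finally show ?thesis using A M by (simp add: power_mult_distrib ennreal_power)
qed

lemma cv_Yw:
  assumes "0 < e" "e \<le> 1" "R > 0"
  shows "(\<integral>\<^sup>+x. ennreal (Yw n R x) * (cv i e (\<lambda>y. ennreal \<bar>w t y\<bar>) x)\<^sup>2 \<partial>lborel) \<le> ennreal ((rn i)\<^sup>2 * 2 ^ n) * ennreal (EY n R t)"
proof -
  have "(\<integral>\<^sup>+x. ennreal (Yw n R x) * (cv i e (\<lambda>y. ennreal \<bar>w t y\<bar>) x)\<^sup>2 \<partial>lborel)
    \<le> ennreal ((rn i)\<^sup>2) * (\<integral>\<^sup>+x. ennreal (2 ^ n * Yw n R x) * (ennreal \<bar>w t x\<bar>)\<^sup>2 \<partial>lborel)"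
  proof (rule cv_weighted_sq)
    fix x z :: real assume z: "\<bar>z\<bar> \<le> 1"
    show "ennreal (Yw n R x) \<le> ennreal (2 ^ n * Yw n R (x - e * z))"
      by (intro ennreal_leI Yw_shift assms) (use abs_mult_unit[OF z assms(1,2)] in simp)
  qed measurable
  also have "\<dots> = ennreal ((rn i)\<^sup>2 * 2 ^ n) * ennreal (EY n R t)"
    unfolding EY(1)[OF assms(3)] by (simp add: ennreal_mult' mult.assoc nn_integral_cmult ennreal_power)
  finally show ?thesis .
qed

end

context gkdv_weight
begin

text \<open>Young's inequality with the weights 1 + a and 1 / (1 + a): level 0 spends only the first
  power of 1 + a. All terms are controlled by the one functional \<open>EY\<close>, which lets
  Gronwall's lemma close the estimate.\<close>

lemma X0_estimate:
  assumes e: "0 < e" "e \<le> 1" and lip: "\<forall>x y. \<bar>w t x - w t y\<bar> \<le> a t * \<bar>x - y\<bar>" and C: "C \<ge> 0" and R: "R > 0"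
    and c: "\<And>x. \<bar>c0 x\<bar> \<le> C * Yw n R x" "\<And>x. \<bar>c3 x\<bar> \<le> C * Yw n R x"
  shows "ennreal (X e 0 t) \<le> ennreal (C * (2 * 2 ^ n + 2 * (M ^ k)\<^sup>2 * ((rn 1)\<^sup>2 * 2 ^ n) + 2 * (M ^ k)\<^sup>2)) * (ennreal (1 + a t) * ennreal (EY n R t))"
proof -
  define A where "A = a t"
  have A: "A \<ge> 0" using a_nonneg by (simp add: A_def)
  let ?V = "U e 0 t" and ?N = "N e 1 t" and ?Y = "Yw n R"
  let ?f = "\<lambda>x. (?V x)\<^sup>2 * c3 x - 2 * (?V x * ?N x * c0 x)"
  let ?cv = "\<lambda>x. cv 1 e (\<lambda>y. ennreal \<bar>w t y\<bar>) x"
  have i1: "integrable lborel (\<lambda>x. (?V x)\<^sup>2 * c3 x)" by (rule sq_weight_integrable[OF e(1) _ bounds(4)]) measurable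
  have i4: "integrable lborel (\<lambda>x. ?V x * ?N x * c0 x)"
    by (rule integrable_square_mult[OF _ _ _ U_sq_integrable[OF e(1)] N_sq_integrable[OF e(1)] bounds(1)]) auto
  have fi: "integrable lborel ?f"
    by (intro Bochner_Integration.integrable_diff integrable_mult_right i1 i4)
  have X: "X e 0 t = (LINT x|lborel. ?f x)"
    unfolding X_def by (subst Bochner_Integration.integral_diff[OF i1 integrable_mult_right[OF i4]]) simp
  have pt: "?f x \<le> C * (2 + A) * (?Y x * (?V x)\<^sup>2) + C / (1 + A) * (?Y x * (?N x)\<^sup>2)" for x
  proof -
    have Y: "?Y x \<ge> 1" by (rule Yw_pos[OF R])
    have "(?V x)\<^sup>2 * c3 x \<le> (?V x)\<^sup>2 * (C * ?Y x)" using c(2)[of x] by (intro mult_left_mono) auto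
    moreover have "- 2 * (?V x * ?N x * c0 x) \<le> ((1 + A) * (?V x)\<^sup>2 + 1 / (1 + A) * (?N x)\<^sup>2) * (C * ?Y x)"
    proof -
      have am: "- 2 * (v * r) \<le> (1 + A) * v\<^sup>2 + 1 / (1 + A) * r\<^sup>2" for v r :: real
      proof -
        have "0 \<le> ((1 + A) * v + r)\<^sup>2 / (1 + A)" using A by simp
        also have "\<dots> = (1 + A) * v\<^sup>2 + 1 / (1 + A) * r\<^sup>2 + 2 * (v * r)"
          using A by (simp add: divide_simps) (simp add: power2_eq_square algebra_simps)
        finally show ?thesis by linarith
      qed
      have "- 2 * (?V x * ?N x * c0 x) = - 2 * (?V x * ?N x) * c0 x" by simp
      also have "\<dots> \<le> ((1 + A) * (?V x)\<^sup>2 + 1 / (1 + A) * (?N x)\<^sup>2) * c0 x"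
        by (intro mult_right_mono am c0_nonneg)
      also have "\<dots> \<le> ((1 + A) * (?V x)\<^sup>2 + 1 / (1 + A) * (?N x)\<^sup>2) * (C * ?Y x)"
        using c(1)[of x] A by (intro mult_left_mono) auto
      finally show ?thesis .
    qed
    ultimately have "?f x \<le> (?V x)\<^sup>2 * (C * ?Y x) + ((1 + A) * (?V x)\<^sup>2 + 1 / (1 + A) * (?N x)\<^sup>2) * (C * ?Y x)" by linarith
    also have "\<dots> = C * (2 + A) * (?Y x * (?V x)\<^sup>2) + C / (1 + A) * (?Y x * (?N x)\<^sup>2)"
      by (simp add: algebra_simps add_divide_distrib)
    finally show ?thesis .
  qed
  have N2: "ennreal (1 / (1 + A)) * ennreal ((?N x)\<^sup>2) \<le> ennreal (2 * (M ^ k)\<^sup>2 * (1 + A)) * ((?cv x)\<^sup>2 + ennreal ((w t x)\<^sup>2))" for x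
  proof -
    have AA: "1 / (1 + A) * (M ^ k * A)\<^sup>2 \<le> (M ^ k)\<^sup>2 * (1 + A)"
    proof -
      have "A\<^sup>2 \<le> (1 + A)\<^sup>2" using A by (intro power_mono) auto
      then have "(M ^ k)\<^sup>2 * A\<^sup>2 \<le> (M ^ k)\<^sup>2 * (1 + A)\<^sup>2" by (intro mult_left_mono) auto
      then show ?thesis using A by (simp add: power_mult_distrib divide_simps) (simp add: power2_eq_square mult_ac)
    qed
    have "ennreal (1 / (1 + A)) * ennreal ((?N x)\<^sup>2) \<le> ennreal (1 / (1 + A)) * (2 * (ennreal ((M ^ k * A)\<^sup>2) * (?cv x)\<^sup>2)
     + 2 * ennreal ((M ^ k * A)\<^sup>2 * (w t x)\<^sup>2))"
      using N1_bound[OF e(1) lip] by (intro mult_left_mono) (auto simp: A_def)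
    also have "\<dots> = 2 * (ennreal (1 / (1 + A) * (M ^ k * A)\<^sup>2) * ((?cv x)\<^sup>2 + ennreal ((w t x)\<^sup>2)))"
      using A by (simp only: ennreal_mult' distrib_left zero_le_divide_1_iff add_nonneg_nonneg zero_le_one zero_le_power2 mult_ac)
    also have "\<dots> \<le> 2 * (ennreal ((M ^ k)\<^sup>2 * (1 + A)) * ((?cv x)\<^sup>2 + ennreal ((w t x)\<^sup>2)))"
      by (intro mult_left_mono mult_right_mono ennreal_leI AA) auto
    also have "\<dots> = ennreal (2 * (M ^ k)\<^sup>2 * (1 + A)) * ((?cv x)\<^sup>2 + ennreal ((w t x)\<^sup>2))"
      using A by (simp add: ennreal_mult mult.assoc)
    finally show ?thesis .
  qed
  define P1 where "P1 = C * (2 + A)"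
  define P2 where "P2 = C * (2 * (M ^ k)\<^sup>2 * (1 + A))"
  have P: "P1 \<ge> 0" "P2 \<ge> 0" using C A by (auto simp: P1_def P2_def)
  have Yn: "?Y x \<ge> 0" for x using Yw_pos[OF R, of n x] by simp
  have "ennreal (X e 0 t) \<le> (\<integral>\<^sup>+x. ennreal (?f x) \<partial>lborel)"
    unfolding X by (rule integral_le_nn_integral[OF fi])
  also have "\<dots> \<le> (\<integral>\<^sup>+x. ennreal P1 * (ennreal (?Y x) * ennreal ((?V x)\<^sup>2)) + (ennreal P2 * (ennreal (?Y x) * (?cv x)\<^sup>2)
      + ennreal P2 * (ennreal (?Y x) * ennreal ((w t x)\<^sup>2))) \<partial>lborel)"
  proof (rule nn_integral_mono)
    fix x
    have "ennreal (?f x) \<le> ennreal (C * (2 + A) * (?Y x * (?V x)\<^sup>2) + C / (1 + A) * (?Y x * (?N x)\<^sup>2))"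
      by (rule ennreal_leI[OF pt])
    also have "\<dots> = ennreal P1 * (ennreal (?Y x) * ennreal ((?V x)\<^sup>2)) + ennreal C * ennreal (?Y x) * (ennreal (1 / (1 + A)) * ennreal ((?N x)\<^sup>2))"
      using P C A Yn[of x] by (subst ennreal_plus) (auto simp: P1_def ennreal_mult'[symmetric] ennreal_mult''[symmetric] mult_ac)
    also have "\<dots> \<le> ennreal P1 * (ennreal (?Y x) * ennreal ((?V x)\<^sup>2)) + ennreal C * ennreal (?Y x) * (ennreal (2 * (M ^ k)\<^sup>2 * (1 + A)) * ((?cv x)\<^sup>2 + ennreal ((w t x)\<^sup>2)))"
      by (intro add_left_mono mult_left_mono N2) auto
    also have "\<dots> = ennreal P1 * (ennreal (?Y x) * ennreal ((?V x)\<^sup>2)) + (ennreal P2 * (ennreal (?Y x) * (?cv x)\<^sup>2)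
      + ennreal P2 * (ennreal (?Y x) * ennreal ((w t x)\<^sup>2)))"
      using C A by (simp add: P2_def ennreal_mult' distrib_left mult_ac)
    finally show "ennreal (?f x) \<le> ennreal P1 * (ennreal (?Y x) * ennreal ((?V x)\<^sup>2)) + (ennreal P2 * (ennreal (?Y x) * (?cv x)\<^sup>2)
      + ennreal P2 * (ennreal (?Y x) * ennreal ((w t x)\<^sup>2)))" .
  qed
  also have "\<dots> = ennreal P1 * (\<integral>\<^sup>+x. ennreal (?Y x) * ennreal ((?V x)\<^sup>2) \<partial>lborel) + (ennreal P2 * (\<integral>\<^sup>+x. ennreal (?Y x) * (?cv x)\<^sup>2 \<partial>lborel)
      + ennreal P2 * ennreal (EY n R t))"
    unfolding EY(1)[OF R] by (simp add: nn_integral_add nn_integral_cmult)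
  also have "\<dots> \<le> ennreal P1 * (ennreal (2 ^ n) * ennreal (EY n R t)) + (ennreal P2 * (ennreal ((rn 1)\<^sup>2 * 2 ^ n) * ennreal (EY n R t))
      + ennreal P2 * ennreal (EY n R t))"
    by (intro add_mono mult_left_mono U0_Yw cv_Yw e R) auto
  also have "\<dots> = ennreal ((P1 * 2 ^ n + P2 * ((rn 1)\<^sup>2 * 2 ^ n) + P2) * EY n R t)"
    using P EY(2)[OF R, of n t] by (simp add: ennreal_mult[symmetric] ennreal_plus[symmetric] algebra_simps del: ennreal_plus)
  also have "\<dots> \<le> ennreal ((C * (2 * 2 ^ n + 2 * (M ^ k)\<^sup>2 * ((rn 1)\<^sup>2 * 2 ^ n) + 2 * (M ^ k)\<^sup>2)) * (1 + A) * EY n R t)"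
  proof (intro ennreal_leI mult_right_mono)
    have "P1 * 2 ^ n \<le> C * (2 * 2 ^ n) * (1 + A)" using C A by (simp add: P1_def algebra_simps)
    then show "P1 * 2 ^ n + P2 * ((rn 1)\<^sup>2 * 2 ^ n) + P2 \<le> (C * (2 * 2 ^ n + 2 * (M ^ k)\<^sup>2 * ((rn 1)\<^sup>2 * 2 ^ n) + 2 * (M ^ k)\<^sup>2)) * (1 + A)"
      unfolding P2_def by (simp add: algebra_simps)
  qed (rule EY[OF R])
  also have "\<dots> = ennreal (C * (2 * 2 ^ n + 2 * (M ^ k)\<^sup>2 * ((rn 1)\<^sup>2 * 2 ^ n) + 2 * (M ^ k)\<^sup>2)) * (ennreal (1 + a t) * ennreal (EY n R t))"
  proof -
    have "0 \<le> C * (2 * 2 ^ n + 2 * (M ^ k)\<^sup>2 * ((rn 1)\<^sup>2 * 2 ^ n) + 2 * (M ^ k)\<^sup>2)" using C by simp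
    then show ?thesis
      unfolding A_def[symmetric] mult.assoc[of _ "1 + A"] using A EY(2)[OF R, of n t] by (simp only: ennreal_mult ennreal_mult' add_nonneg_nonneg zero_le_one)
  qed
  finally show ?thesis .
qed

end

context gkdv_half
begin

text \<open>The loop is this: the weighted energy of \<open>U\<close> is bounded by
  \<open>EY\<close> at an earlier time and by a time integral of \<open>EY\<close>; Fatou's lemma
  transfers this to w as e tends to 0; and \<open>EY\<close> is bounded by the L^2 norm plus that
  energy. The smoothing term, dropped in the loop, is read off at the end with t1 = 0 and t2 =
  T.\<close>

lemma level_0_core:
  assumes b: "b > 0" and init: "Wn 0 n (w 0) < \<infinity>"
  shows "\<exists>L\<ge>0. \<forall>e. 0 < e \<and> e \<le> 1 \<longrightarrow> (\<forall>t\<in>{0..T}. Wn b n (U e 0 t) \<le> ennreal L) \<and>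
    (\<forall>n'. n = Suc n' \<longrightarrow> (\<integral>\<^sup>+t. indicator {0..T} t * Wn b n' (U e 1 t) \<partial>lborel) \<le> ennreal L)"
proof -
  define \<beta> where "\<beta> = min 1 (b / 4)"
  have \<beta>: "0 < \<beta>" "\<beta> \<le> 1" "4 * \<beta> \<le> b" using b by (auto simp: \<beta>_def)
  define C where "C = (\<Sum>i<4. rn i / \<beta> ^ i * 2 ^ n)"
  have C: "C \<ge> 0" unfolding C_def using \<beta> rn_nonneg by (intro sum_nonneg) auto
  have chiC: "\<bar>moll \<beta> i (gw \<beta> n R) x\<bar> \<le> C * Yw n R x" if "R > 0" "i < 4" for i R x
  proof -
    have "rn i / \<beta> ^ i * 2 ^ n \<le> C"
      unfolding C_def using that \<beta> rn_nonneg by (intro member_le_sum) auto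
    then have "rn i / \<beta> ^ i * 2 ^ n * Yw n R x \<le> C * Yw n R x"
      using Yw_pos[OF that(1), of n x] by (intro mult_right_mono) auto
    with chi_le_Yw[OF \<beta>(1,2) that(1), of i n x] show ?thesis by linarith
  qed
  define C3 where "C3 = C * (2 * 2 ^ n + 2 * (M ^ k)\<^sup>2 * ((rn 1)\<^sup>2 * 2 ^ n) + 2 * (M ^ k)\<^sup>2)"
  have C3: "C3 \<ge> 0" using C by (simp add: C3_def)
  define C4 where "C4 = 5 ^ n * (K2 + C * 2 ^ n + C3)"
  have C4: "C4 \<ge> 0" using C C3 K2 by (simp add: C4_def)
  have ineq: "(\<integral>\<^sup>+x. ennreal ((U e 0 t2 x)\<^sup>2 * moll \<beta> 0 (gw \<beta> n R) x) \<partial>lborel)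
      + 3 * (\<integral>\<^sup>+t. indicator {t1..t2} t * (\<integral>\<^sup>+x. ennreal ((U e 1 t x)\<^sup>2 * moll \<beta> 1 (gw \<beta> n R) x) \<partial>lborel) \<partial>lborel)
      \<le> ennreal (C * 2 ^ n) * ennreal (EY n R t1) + ennreal C3 * (\<integral>\<^sup>+t. indicator {t1..t2} t * (ennreal (1 + a t) * ennreal (EY n R t)) \<partial>lborel)"
    and EYle: "(\<integral>\<^sup>+x. ennreal ((U e 0 t x)\<^sup>2 * moll \<beta> 0 (gw \<beta> n R) x) \<partial>lborel) \<le> ennreal (C * 2 ^ n) * ennreal (EY n R t)"
    if R: "R \<ge> 4" and e: "0 < e" "e \<le> 1" and t: "0 \<le> t1" "t1 \<le> t2" "t2 \<le> T" for R e t1 t2 t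
  proof -
    have Rp: "R > 0" using R by simp
    interpret we: weight "moll \<beta> 0 (gw \<beta> n R)" "moll \<beta> 1 (gw \<beta> n R)" "moll \<beta> 2 (gw \<beta> n R)" "moll \<beta> 3 (gw \<beta> n R)"
        "\<Sum>i<4. rn i / \<beta> ^ i * R ^ n"
      by (rule chi_weight[OF \<beta>(1) Rp])
    interpret gw: gkdv_weight k T M K2 w a "moll \<beta> 0 (gw \<beta> n R)" "moll \<beta> 1 (gw \<beta> n R)" "moll \<beta> 2 (gw \<beta> n R)" "moll \<beta> 3 (gw \<beta> n R)"
        "\<Sum>i<4. rn i / \<beta> ^ i * R ^ n" ..
    have EW: "ennreal (gw.E e 0 t) \<le> ennreal (C * 2 ^ n) * ennreal (EY n R t)" for t
    proof -
      have "ennreal (gw.E e 0 t) \<le> (\<integral>\<^sup>+x. ennreal C * (ennreal (Yw n R x) * ennreal ((U e 0 t x)\<^sup>2)) \<partial>lborel)"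
        unfolding gw.E_eq[OF e(1)]
      proof (rule nn_integral_mono)
        fix x
        have "(U e 0 t x)\<^sup>2 * moll \<beta> 0 (gw \<beta> n R) x \<le> (U e 0 t x)\<^sup>2 * (C * Yw n R x)"
          using chiC[OF Rp, of 0 x] by (intro mult_left_mono) auto
        then have "ennreal ((U e 0 t x)\<^sup>2 * moll \<beta> 0 (gw \<beta> n R) x) \<le> ennreal (C * (Yw n R x * (U e 0 t x)\<^sup>2))"
          by (intro ennreal_leI) (simp add: mult_ac)
        then show "ennreal ((U e 0 t x)\<^sup>2 * moll \<beta> 0 (gw \<beta> n R) x) \<le> ennreal C * (ennreal (Yw n R x) * ennreal ((U e 0 t x)\<^sup>2))"
          using C Yw_pos[OF Rp, of n x] by (simp add: ennreal_mult')
      qed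
      also have "\<dots> = ennreal C * (\<integral>\<^sup>+x. ennreal (Yw n R x) * ennreal ((U e 0 t x)\<^sup>2) \<partial>lborel)"
        by (rule nn_integral_cmult) measurable
      also have "\<dots> \<le> ennreal C * (ennreal (2 ^ n) * ennreal (EY n R t))"
        by (intro mult_left_mono U0_Yw e Rp) auto
      finally show ?thesis using C by (simp add: ennreal_mult mult.assoc)
    qed
    have Pe: "ennreal (gw.P e 0 t) = (\<integral>\<^sup>+x. ennreal ((U e 1 t x)\<^sup>2 * moll \<beta> 1 (gw \<beta> n R) x) \<partial>lborel)" for t
      using gw.P_eq[OF e(1), of 0 t] by simp
    have "ennreal (gw.E e 0 t2) + 3 * (\<integral>\<^sup>+t. indicator {t1..t2} t * ennreal (gw.P e 0 t) \<partial>lborel)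
      \<le> ennreal (gw.E e 0 t1) + (\<integral>\<^sup>+t. indicator {t1..t2} t * (ennreal C3 * (ennreal (1 + a t) * ennreal (EY n R t))) \<partial>lborel)"
    proof (rule gw.energy_inequality[OF e(1) t])
      show "AE t in lborel. t \<in> {t1..t2} \<longrightarrow> ennreal (gw.X e 0 t) \<le> ennreal C3 * (ennreal (1 + a t) * ennreal (EY n R t))"
        using lip
      proof eventually_elim
        case (elim s)
        show ?case
        proof
          assume "s \<in> {t1..t2}"
          then have "\<forall>x y. \<bar>w s x - w s y\<bar> \<le> a s * \<bar>x - y\<bar>" using elim t by auto
          from gw.X0_estimate[OF e this C Rp, of n] chiC[OF Rp]
          show "ennreal (gw.X e 0 s) \<le> ennreal C3 * (ennreal (1 + a s) * ennreal (EY n R s))"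
            by (simp add: C3_def)
        qed
      qed
    qed
    also have "\<dots> \<le> ennreal (C * 2 ^ n) * ennreal (EY n R t1) + (\<integral>\<^sup>+t. indicator {t1..t2} t * (ennreal C3 * (ennreal (1 + a t) * ennreal (EY n R t))) \<partial>lborel)"
      by (rule add_right_mono[OF EW])
    also have "(\<integral>\<^sup>+t. indicator {t1..t2} t * (ennreal C3 * (ennreal (1 + a t) * ennreal (EY n R t))) \<partial>lborel)
        = ennreal C3 * (\<integral>\<^sup>+t. indicator {t1..t2} t * (ennreal (1 + a t) * ennreal (EY n R t)) \<partial>lborel)"
      unfolding EY(1)[OF Rp] by (subst nn_integral_cmult[symmetric]) (auto simp: mult_ac)
    finally show "(\<integral>\<^sup>+x. ennreal ((U e 0 t2 x)\<^sup>2 * moll \<beta> 0 (gw \<beta> n R) x) \<partial>lborel)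
      + 3 * (\<integral>\<^sup>+t. indicator {t1..t2} t * (\<integral>\<^sup>+x. ennreal ((U e 1 t x)\<^sup>2 * moll \<beta> 1 (gw \<beta> n R) x) \<partial>lborel) \<partial>lborel)
      \<le> ennreal (C * 2 ^ n) * ennreal (EY n R t1) + ennreal C3 * (\<integral>\<^sup>+t. indicator {t1..t2} t * (ennreal (1 + a t) * ennreal (EY n R t)) \<partial>lborel)"
      unfolding gw.E_eq[OF e(1)] Pe .
    show "(\<integral>\<^sup>+x. ennreal ((U e 0 t x)\<^sup>2 * moll \<beta> 0 (gw \<beta> n R) x) \<partial>lborel) \<le> ennreal (C * 2 ^ n) * ennreal (EY n R t)"
      using EW[of t] unfolding gw.E_eq[OF e(1)] .
  qed
  have step: "ennreal (EY n R t2) \<le> ennreal C4 * (ennreal (1 + EY n R t1) + (\<integral>\<^sup>+s. indicator {t1..t2} s * (ennreal (1 + a s) * ennreal (EY n R s)) \<partial>lborel))"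
    if R: "R \<ge> 4" and t: "0 \<le> t1" "t1 \<le> t2" "t2 \<le> T" for R t1 t2
  proof -
    have Rp: "R > 0" using R by simp
    interpret we: weight "moll \<beta> 0 (gw \<beta> n R)" "moll \<beta> 1 (gw \<beta> n R)" "moll \<beta> 2 (gw \<beta> n R)" "moll \<beta> 3 (gw \<beta> n R)"
        "\<Sum>i<4. rn i / \<beta> ^ i * R ^ n"
      by (rule chi_weight[OF \<beta>(1) Rp])
    let ?\<chi> = "moll \<beta> 0 (gw \<beta> n R)"
    let ?I = "\<integral>\<^sup>+s. indicator {t1..t2} s * (ennreal (1 + a s) * ennreal (EY n R s)) \<partial>lborel"
    let ?B = "ennreal (C * 2 ^ n) * ennreal (EY n R t1) + ennreal C3 * ?I"
    define d where "d m = 1 / real (Suc m)" for m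
    have d: "d m > 0" "d m \<le> 1" for m by (auto simp: d_def divide_simps)
    have dlim: "d \<longlonglongrightarrow> 0" unfolding d_def by real_asymp
    have U0: "(\<lambda>m. U (d m) 0 t2 x) \<longlonglongrightarrow> w t2 x" for x
    proof -
      have "filterlim d (at_right 0) sequentially"
        using d dlim by (auto simp: filterlim_at less_imp_neq[symmetric])
      from filterlim_compose[OF moll_tendsto[OF w_cont1, of t2 x] this] show ?thesis by (simp add: U_def)
    qed
    have "(\<integral>\<^sup>+x. ennreal ((w t2 x)\<^sup>2 * ?\<chi> x) \<partial>lborel) = (\<integral>\<^sup>+x. liminf (\<lambda>m. ennreal ((U (d m) 0 t2 x)\<^sup>2 * ?\<chi> x)) \<partial>lborel)"
    proof (rule nn_integral_cong)
      fix x
      have "(\<lambda>m. ennreal ((U (d m) 0 t2 x)\<^sup>2 * ?\<chi> x)) \<longlonglongrightarrow> ennreal ((w t2 x)\<^sup>2 * ?\<chi> x)"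
        by (intro tendsto_ennrealI tendsto_intros U0)
      from lim_imp_Liminf[OF _ this] show "ennreal ((w t2 x)\<^sup>2 * ?\<chi> x) = liminf (\<lambda>m. ennreal ((U (d m) 0 t2 x)\<^sup>2 * ?\<chi> x))" by simp
    qed
    also have "\<dots> \<le> liminf (\<lambda>m. \<integral>\<^sup>+x. ennreal ((U (d m) 0 t2 x)\<^sup>2 * ?\<chi> x) \<partial>lborel)"
      by (rule nn_integral_liminf) measurable
    also have "\<dots> \<le> liminf (\<lambda>m::nat. ?B)"
    proof (rule Liminf_mono, rule eventuallyI)
      fix m
      show "(\<integral>\<^sup>+x. ennreal ((U (d m) 0 t2 x)\<^sup>2 * ?\<chi> x) \<partial>lborel) \<le> ?B"
        by (rule order_trans[OF _ ineq[OF R d[of m] t]]) simp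
    qed
    also have "\<dots> = ?B" by (simp add: Liminf_const)
    finally have wB: "(\<integral>\<^sup>+x. ennreal ((w t2 x)\<^sup>2 * ?\<chi> x) \<partial>lborel) \<le> ?B" .
    have "ennreal (EY n R t2) \<le> (\<integral>\<^sup>+x. ennreal (5 ^ n) * (ennreal ((w t2 x)\<^sup>2) + ennreal ((w t2 x)\<^sup>2 * ?\<chi> x)) \<partial>lborel)"
      unfolding EY(1)[OF Rp]
    proof (rule nn_integral_mono)
      fix x
      have "Yw n R x * (w t2 x)\<^sup>2 \<le> 5 ^ n * (1 + ?\<chi> x) * (w t2 x)\<^sup>2"
        by (intro mult_right_mono Yw_le_chi[OF \<beta>(1,2) R]) auto
      also have "\<dots> = 5 ^ n * ((w t2 x)\<^sup>2 + (w t2 x)\<^sup>2 * ?\<chi> x)" by (simp add: algebra_simps)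
      finally show "ennreal (Yw n R x) * ennreal ((w t2 x)\<^sup>2) \<le> ennreal (5 ^ n) * (ennreal ((w t2 x)\<^sup>2) + ennreal ((w t2 x)\<^sup>2 * ?\<chi> x))"
        using we.c0_nonneg[of x] by (simp add: ennreal_leI flip: ennreal_mult'' ennreal_plus ennreal_mult')
    qed
    also have "\<dots> = ennreal (5 ^ n) * ((\<integral>\<^sup>+x. ennreal ((w t2 x)\<^sup>2) \<partial>lborel) + (\<integral>\<^sup>+x. ennreal ((w t2 x)\<^sup>2 * ?\<chi> x) \<partial>lborel))"
      by (simp add: nn_integral_cmult nn_integral_add)
    also have "\<dots> \<le> ennreal (5 ^ n) * (ennreal K2 + ?B)"
      by (intro mult_left_mono add_mono w_L2 wB) auto
    also have "\<dots> \<le> ennreal (5 ^ n) * (ennreal (K2 + C * 2 ^ n) * ennreal (1 + EY n R t1) + ennreal C3 * ?I)"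
    proof (rule mult_left_mono)
      have "K2 + C * 2 ^ n * EY n R t1 \<le> (K2 + C * 2 ^ n) * (1 + EY n R t1)"
        using K2 C EY(2)[OF Rp, of n t1] by (simp add: algebra_simps)
      then have "ennreal (K2 + C * 2 ^ n * EY n R t1) \<le> ennreal ((K2 + C * 2 ^ n) * (1 + EY n R t1))" by (rule ennreal_leI)
      moreover have "ennreal (K2 + C * 2 ^ n * EY n R t1) = ennreal K2 + ennreal (C * 2 ^ n) * ennreal (EY n R t1)"
        using K2 C EY(2)[OF Rp, of n t1] by (subst ennreal_plus) (auto intro: ennreal_mult)
      moreover have "ennreal ((K2 + C * 2 ^ n) * (1 + EY n R t1)) = ennreal (K2 + C * 2 ^ n) * ennreal (1 + EY n R t1)"
        using K2 C EY(2)[OF Rp, of n t1] by (intro ennreal_mult) auto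
      ultimately have "ennreal K2 + ennreal (C * 2 ^ n) * ennreal (EY n R t1) \<le> ennreal (K2 + C * 2 ^ n) * ennreal (1 + EY n R t1)" by metis
      from add_right_mono[OF this, of "ennreal C3 * ?I"]
      show "ennreal K2 + ?B \<le> ennreal (K2 + C * 2 ^ n) * ennreal (1 + EY n R t1) + ennreal C3 * ?I" by (simp only: add.assoc)
    qed simp
    also have "\<dots> \<le> ennreal (5 ^ n) * (ennreal (K2 + C * 2 ^ n + C3) * ennreal (1 + EY n R t1) + ennreal (K2 + C * 2 ^ n + C3) * ?I)"
    proof -
      have "ennreal (K2 + C * 2 ^ n) \<le> ennreal (K2 + C * 2 ^ n + C3)" "ennreal C3 \<le> ennreal (K2 + C * 2 ^ n + C3)"
        using K2 C C3 by (intro ennreal_leI; simp)+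
      then show ?thesis by (intro mult_left_mono add_mono mult_right_mono) auto
    qed
    also have "\<dots> = ennreal C4 * (ennreal (1 + EY n R t1) + ?I)"
    proof -
      have "ennreal C4 = ennreal (5 ^ n) * ennreal (K2 + C * 2 ^ n + C3)"
        unfolding C4_def using K2 C C3 by (intro ennreal_mult) auto
      then show ?thesis by (simp only: distrib_left mult.assoc)
    qed
    finally show ?thesis .
  qed
  \<comment> \<open>1 + a \<le> 1 / \<mu> + \<mu> (1 + a)^4 turns the L^4 bound into
    equi-integrability. After multiplication by C4, \<mu> makes the second part at most 1/4, and
    then l makes the first part at most 1/4 on intervals of length l.\<close>
  define \<mu> where "\<mu> = 1 / (4 * (C4 + 1) * (Ia + 1))"
  define l where "l = \<mu> / (4 * (C4 + 1))"
  have \<mu>: "\<mu> > 0" and l: "l > 0" using C4 Ia(1) by (auto simp: \<mu>_def l_def)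
  have small: "ennreal C4 * (\<integral>\<^sup>+s. indicator {t1..t2} s * ennreal (1 + a s) \<partial>lborel) \<le> ennreal (1 / 2)"
    if t: "0 \<le> t1" "t1 \<le> t2" "t2 \<le> T" "t2 - t1 \<le> l" for t1 t2
  proof -
    have y: "1 + a s \<le> 1 / \<mu> + \<mu> * (1 + a s) ^ 4" for s
    proof (cases "1 + a s \<le> 1 / \<mu>")
      case True
      moreover have "0 \<le> \<mu> * (1 + a s) ^ 4" using \<mu> a_nonneg[of s] by simp
      ultimately show ?thesis by linarith
    next
      case False
      then have "1 \<le> \<mu> * (1 + a s)" using \<mu> by (simp add: field_simps)
      then have "1 * (1 + a s) \<le> \<mu> * (1 + a s) * (1 + a s) ^ 3"
        using a_nonneg[of s] self_le_power[of "1 + a s" 3] by (intro mult_mono) auto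
      also have "\<dots> = \<mu> * (1 + a s) ^ 4" by (simp add: power_numeral_reduce)
      finally show ?thesis using \<mu> by (simp add: add_increasing)
    qed
    have "(\<integral>\<^sup>+s. indicator {t1..t2} s * ennreal (1 + a s) \<partial>lborel)
      \<le> (\<integral>\<^sup>+s. ennreal (1 / \<mu>) * indicator {t1..t2} s + ennreal \<mu> * (indicator {0..T} s * ennreal ((1 + a s) ^ 4)) \<partial>lborel)"
    proof (rule nn_integral_mono)
      fix s
      have "ennreal (1 + a s) \<le> ennreal (1 / \<mu>) + ennreal \<mu> * ennreal ((1 + a s) ^ 4)"
        using ennreal_leI[OF y[of s]] \<mu> a_nonneg[of s] by (simp add: ennreal_plus ennreal_mult)
      then show "indicator {t1..t2} s * ennreal (1 + a s) \<le> ennreal (1 / \<mu>) * indicator {t1..t2} s + ennreal \<mu> * (indicator {0..T} s * ennreal ((1 + a s) ^ 4))"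
        using t by (auto simp: indicator_def)
    qed
    also have "\<dots> = ennreal (1 / \<mu>) * ennreal (t2 - t1) + ennreal \<mu> * ennreal Ia"
      using t by (simp add: nn_integral_add nn_integral_cmult Ia(2))
    also have "\<dots> = ennreal (1 / \<mu> * (t2 - t1) + \<mu> * Ia)"
    proof -
      have 1: "ennreal (1 / \<mu> * (t2 - t1)) = ennreal (1 / \<mu>) * ennreal (t2 - t1)" "ennreal (\<mu> * Ia) = ennreal \<mu> * ennreal Ia"
        by (rule ennreal_mult; use \<mu> t Ia(1) in simp)+
      show ?thesis unfolding 1[symmetric] using \<mu> t Ia(1) by (intro ennreal_plus[symmetric]) auto
    qed
    finally have "ennreal C4 * (\<integral>\<^sup>+s. indicator {t1..t2} s * ennreal (1 + a s) \<partial>lborel) \<le> ennreal C4 * ennreal (1 / \<mu> * (t2 - t1) + \<mu> * Ia)"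
      by (rule mult_left_mono) simp
    also have "\<dots> = ennreal (C4 * (1 / \<mu> * (t2 - t1) + \<mu> * Ia))" using C4 \<mu> t Ia(1) by (intro ennreal_mult[symmetric]) auto
    also have "\<dots> \<le> ennreal (1 / 2)"
    proof (rule ennreal_leI)
      have "1 / \<mu> * (t2 - t1) \<le> 1 / \<mu> * l" using \<mu> t by (intro mult_left_mono) auto
      also have "\<dots> = 1 / (4 * (C4 + 1))" using \<mu> by (simp add: l_def)
      finally have "C4 * (1 / \<mu> * (t2 - t1)) \<le> C4 * (1 / (4 * (C4 + 1)))" using C4 by (intro mult_left_mono) auto
      also have "\<dots> \<le> 1 / 4" using C4 by (simp add: divide_simps)
      finally have 1: "C4 * (1 / \<mu> * (t2 - t1)) \<le> 1 / 4" .
      have "\<mu> * Ia = 1 / (4 * (C4 + 1)) * (Ia / (Ia + 1))" by (simp add: \<mu>_def)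
      also have "\<dots> \<le> 1 / (4 * (C4 + 1)) * 1" using C4 Ia(1) by (intro mult_left_mono) (auto simp: divide_simps)
      finally have "C4 * (\<mu> * Ia) \<le> C4 * (1 / (4 * (C4 + 1)))" using C4 by (intro mult_left_mono) auto
      also have "\<dots> \<le> 1 / 4" using C4 by (simp add: divide_simps)
      finally show "C4 * (1 / \<mu> * (t2 - t1) + \<mu> * Ia) \<le> 1 / 2" unfolding distrib_left using 1 by linarith
    qed
    finally show ?thesis .
  qed
  obtain W0 where W0: "Wn 0 n (w 0) = ennreal W0" "W0 \<ge> 0" using init by (cases "Wn 0 n (w 0)") auto
  define f0 where "f0 = 2 ^ n * (K2 + W0)"
  have f0: "f0 \<ge> 0" using K2 W0 by (simp add: f0_def)
  have EY0: "EY n R 0 \<le> f0" if R: "R > 0" for R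
  proof -
    have "ennreal (EY n R 0) \<le> (\<integral>\<^sup>+x. ennreal (2 ^ n) * (ennreal ((w 0 x)\<^sup>2) + indicator {0..} x * ennreal (x ^ n * (w 0 x)\<^sup>2)) \<partial>lborel)"
      unfolding EY(1)[OF R]
    proof (rule nn_integral_mono)
      fix x :: real
      have "Yw n R x \<le> 2 ^ n * (1 + indicator {0..} x * x ^ n)"
      proof (cases "x \<ge> 1")
        case True
        have "Yw n R x \<le> (2 * x) ^ n" unfolding Yw_def using True R by (intro power_mono) auto
        then show ?thesis using True by (simp add: power_mult_distrib add_increasing algebra_simps)
      next
        case False
        have "Yw n R x \<le> 2 ^ n * 1" unfolding Yw_def using False R by (simp, intro power_mono) auto
        also have "\<dots> \<le> 2 ^ n * (1 + indicator {0..} x * x ^ n)" by (intro mult_left_mono) (auto simp: indicator_def)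
        finally show ?thesis .
      qed
      then have "Yw n R x * (w 0 x)\<^sup>2 \<le> 2 ^ n * (1 + indicator {0..} x * x ^ n) * (w 0 x)\<^sup>2" by (rule mult_right_mono) simp
      also have "\<dots> = 2 ^ n * ((w 0 x)\<^sup>2 + indicator {0..} x * (x ^ n * (w 0 x)\<^sup>2))" by (simp add: algebra_simps)
      finally have "ennreal (Yw n R x * (w 0 x)\<^sup>2) \<le> ennreal (2 ^ n * ((w 0 x)\<^sup>2 + indicator {0..} x * (x ^ n * (w 0 x)\<^sup>2)))" by (rule ennreal_leI)
      also have "\<dots> = ennreal (2 ^ n) * (ennreal ((w 0 x)\<^sup>2) + indicator {0..} x * ennreal (x ^ n * (w 0 x)\<^sup>2))"
        by (auto simp: indicator_def ennreal_mult' ennreal_plus)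
      finally show "ennreal (Yw n R x) * ennreal ((w 0 x)\<^sup>2) \<le> ennreal (2 ^ n) * (ennreal ((w 0 x)\<^sup>2) + indicator {0..} x * ennreal (x ^ n * (w 0 x)\<^sup>2))"
        by (simp add: ennreal_mult'')
    qed
    also have "\<dots> = ennreal (2 ^ n) * ((\<integral>\<^sup>+x. ennreal ((w 0 x)\<^sup>2) \<partial>lborel) + ennreal W0)"
      unfolding W0(1)[symmetric] Wn_def by (simp add: nn_integral_cmult nn_integral_add)
    also have "\<dots> \<le> ennreal (2 ^ n) * (ennreal K2 + ennreal W0)"
      by (intro mult_left_mono add_right_mono w_L2) auto
    also have "\<dots> = ennreal f0" using K2 W0 by (simp add: f0_def ennreal_mult ennreal_plus)
    finally show ?thesis using f0 by (simp add: ennreal_le_iff)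
  qed
  have "\<exists>G\<ge>0. \<forall>f B. (\<forall>t. 0 \<le> f t \<and> f t \<le> B) \<and> f 0 \<le> f0 \<and>
    (\<forall>t1 t2. 0 \<le> t1 \<longrightarrow> t1 \<le> t2 \<longrightarrow> t2 \<le> T \<longrightarrow>
      ennreal (f t2) \<le> ennreal C4 * (ennreal (1 + f t1) + (\<integral>\<^sup>+s. indicator {t1..t2} s * (ennreal (1 + a s) * ennreal (f s)) \<partial>lborel)))
    \<longrightarrow> (\<forall>t\<in>{0..T}. f t \<le> G)"
    by (rule gronwall_pieces[OF C4 l T f0 _ small]) auto
  then obtain G where G: "G \<ge> 0" and GG: "\<forall>f B. (\<forall>t. 0 \<le> f t \<and> f t \<le> B) \<and> f 0 \<le> f0 \<and>
    (\<forall>t1 t2. 0 \<le> t1 \<longrightarrow> t1 \<le> t2 \<longrightarrow> t2 \<le> T \<longrightarrow>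
      ennreal (f t2) \<le> ennreal C4 * (ennreal (1 + f t1) + (\<integral>\<^sup>+s. indicator {t1..t2} s * (ennreal (1 + a s) * ennreal (f s)) \<partial>lborel)))
    \<longrightarrow> (\<forall>t\<in>{0..T}. f t \<le> G)"
    by (elim exE conjE)
  have EG: "EY n R t \<le> G" if "R \<ge> 4" "t \<in> {0..T}" for R t
  proof -
    have Rp: "R > 0" using that by simp
    have "\<forall>t\<in>{0..T}. EY n R t \<le> G"
      by (rule GG[THEN spec, THEN spec, THEN mp, of _ "(1 + R) ^ n * K2"])
        (use EY[OF Rp] EY0[OF Rp] step[OF that(1)] in auto)
    then show ?thesis using that by blast
  qed
  define L where "L = C * 2 ^ n * G + C3 * (Ia * G)"
  have L: "L \<ge> 0" using C C3 G Ia(1) by (simp add: L_def)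
  have aI: "(\<integral>\<^sup>+t. indicator {0..T} t * (ennreal (1 + a t) * ennreal (EY n R t)) \<partial>lborel) \<le> ennreal (Ia * G)" if R: "R \<ge> 4" for R
  proof -
    have "(\<integral>\<^sup>+t. indicator {0..T} t * (ennreal (1 + a t) * ennreal (EY n R t)) \<partial>lborel) \<le> (\<integral>\<^sup>+t. indicator {0..T} t * ennreal ((1 + a t) ^ 4) * ennreal G \<partial>lborel)"
    proof (rule nn_integral_mono)
      fix t
      have "1 + a t \<le> (1 + a t) ^ 4" using a_nonneg[of t] by (intro self_le_power) auto
      then show "indicator {0..T} t * (ennreal (1 + a t) * ennreal (EY n R t)) \<le> indicator {0..T} t * ennreal ((1 + a t) ^ 4) * ennreal G"
        using EG[OF R, of t] by (auto simp: indicator_def simp del: ennreal_plus intro!: mult_mono ennreal_leI)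
    qed
    also have "\<dots> = ennreal (Ia * G)" using Ia G by (simp add: nn_integral_multc ennreal_mult)
    finally show ?thesis .
  qed
  have T0: "0 \<le> T" using T by simp
  show ?thesis
  proof (rule exI[of _ "2 ^ n * L"], rule conjI[OF _ allI[OF impI]])
    show "0 \<le> 2 ^ n * L" using L by simp
  next
    fix e :: real assume e: "0 < e \<and> e \<le> 1"
    have m1: "(\<integral>\<^sup>+x. ennreal ((U e 0 t x)\<^sup>2 * moll \<beta> 0 (gw \<beta> n R) x) \<partial>lborel) \<le> ennreal L" if "t \<in> {0..T}" "R \<ge> 4" for t R
    proof -
      have "(\<integral>\<^sup>+x. ennreal ((U e 0 t x)\<^sup>2 * moll \<beta> 0 (gw \<beta> n R) x) \<partial>lborel) \<le> ennreal (C * 2 ^ n) * ennreal (EY n R t)"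
        using EYle[OF that(2), of e 0 T t] e T0 by auto
      also have "\<dots> \<le> ennreal (C * 2 ^ n) * ennreal G" by (intro mult_left_mono ennreal_leI EG that) auto
      also have "\<dots> = ennreal (C * 2 ^ n * G)" using C G by (intro ennreal_mult[symmetric]) auto
      also have "\<dots> \<le> ennreal L" using C3 G Ia(1) by (intro ennreal_leI) (simp add: L_def)
      finally show ?thesis .
    qed
    have m2: "(\<integral>\<^sup>+t. indicator {0..T} t * (\<integral>\<^sup>+x. ennreal ((U e 1 t x)\<^sup>2 * moll \<beta> 1 (gw \<beta> n R) x) \<partial>lborel) \<partial>lborel) \<le> ennreal L" (is "?Q \<le> _") if R: "R \<ge> 4" for R
    proof -
      \<comment> \<open>The nonnegative energy at time T may be added, which brings the expression
        into the form of \<open>ineq\<close>.\<close>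
      have "?Q \<le> 3 * ?Q" using mult_right_mono[of 1 "3::ennreal" ?Q] by simp
      also have "\<dots> \<le> (\<integral>\<^sup>+x. ennreal ((U e 0 T x)\<^sup>2 * moll \<beta> 0 (gw \<beta> n R) x) \<partial>lborel) + 3 * ?Q" by simp
      also have "\<dots> \<le> ennreal (C * 2 ^ n) * ennreal (EY n R 0) + ennreal C3 * (\<integral>\<^sup>+t. indicator {0..T} t * (ennreal (1 + a t) * ennreal (EY n R t)) \<partial>lborel)"
        using e T0 by (intro ineq R) auto
      also have "\<dots> \<le> ennreal (C * 2 ^ n) * ennreal G + ennreal C3 * ennreal (Ia * G)"
        using T0 by (intro add_mono mult_left_mono aI R ennreal_leI EG) auto
      also have "\<dots> = ennreal L"
      proof -
        have 1: "ennreal (C * 2 ^ n * G) = ennreal (C * 2 ^ n) * ennreal G" "ennreal (C3 * (Ia * G)) = ennreal C3 * ennreal (Ia * G)"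
          using C C3 G Ia(1) by (auto intro!: ennreal_mult)
        show ?thesis unfolding 1[symmetric] L_def using C C3 G Ia(1) by (intro ennreal_plus[symmetric]) auto
      qed
      finally show ?thesis .
    qed
    show "(\<forall>t\<in>{0..T}. Wn b n (U e 0 t) \<le> ennreal (2 ^ n * L)) \<and>
      (\<forall>n'. n = Suc n' \<longrightarrow> (\<integral>\<^sup>+t. indicator {0..T} t * Wn b n' (U e 1 t) \<partial>lborel) \<le> ennreal (2 ^ n * L))"
    proof (intro conjI ballI allI impI)
      fix t assume t: "t \<in> {0..T}"
      have "Wn (4 * \<beta>) n (U e 0 t) \<le> ennreal (2 ^ n * L)"
        by (rule exhaust_energy[OF \<beta>(1) _ _ L m1[OF t], of 4]) auto
      then show "Wn b n (U e 0 t) \<le> ennreal (2 ^ n * L)"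
        using Wn_mono_base[OF \<beta>(3)] order_trans by blast
    next
      fix n' assume n: "n = Suc n'"
      have "(\<integral>\<^sup>+t. indicator {0..T} t * Wn b n' (U e 1 t) \<partial>lborel) \<le> (\<integral>\<^sup>+t. indicator {0..T} t * Wn (4 * \<beta>) n' (U e 1 t) \<partial>lborel)"
        by (intro nn_integral_mono mult_left_mono Wn_mono_base \<beta>) auto
      also have "\<dots> \<le> ennreal (2 ^ n' * L)"
        by (rule exhaust_smoothing[OF \<beta>(1) _ L m2[unfolded n], of 4]) auto
      also have "\<dots> \<le> ennreal (2 ^ n * L)" using L n by (intro ennreal_leI mult_right_mono) auto
      finally show "(\<integral>\<^sup>+t. indicator {0..T} t * Wn b n' (U e 1 t) \<partial>lborel) \<le> ennreal (2 ^ n * L)" .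
    qed
  qed
qed

lemma level_0:
  assumes "Wn 0 n (w 0) < \<infinity>"
  shows "Pb n 0 \<and> (\<forall>n'. n = Suc n' \<longrightarrow> Sb n' 1)"
proof (intro conjI allI impI)
  show "Pb n 0"
    unfolding Pb_def
  proof (intro allI impI)
    fix b \<tau> :: real assume *: "0 < b" "0 < \<tau>" "\<tau> < T"
    from level_0_core[OF *(1) assms] obtain L where "L \<ge> 0"
      "\<And>e. 0 < e \<and> e \<le> 1 \<Longrightarrow> \<forall>t\<in>{0..T}. Wn b n (U e 0 t) \<le> ennreal L" by metis
    then show "\<exists>K\<ge>0. \<exists>e0>0. \<forall>e t. 0 < e \<longrightarrow> e < e0 \<longrightarrow> t \<in> {\<tau>..T} \<longrightarrow> Wn b n (U e 0 t) \<le> ennreal K"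
      using * by (intro exI[of _ L] conjI exI[of _ 1]) auto
  qed
next
  fix n' assume n: "n = Suc n'"
  show "Sb n' 1"
    unfolding Sb_def
  proof (intro allI impI)
    fix b \<tau> :: real assume *: "0 < b" "0 < \<tau>" "\<tau> < T"
    from level_0_core[OF *(1) assms] obtain L where L: "L \<ge> 0"
      "\<And>e. 0 < e \<and> e \<le> 1 \<Longrightarrow> (\<integral>\<^sup>+t. indicator {0..T} t * Wn b n' (U e 1 t) \<partial>lborel) \<le> ennreal L"
      using n by metis
    have "(\<integral>\<^sup>+t. indicator {\<tau>..T} t * Wn b n' (U e 1 t) \<partial>lborel) \<le> ennreal L" if "0 < e \<and> e \<le> 1" for e
      by (rule order_trans[OF nn_integral_mono L(2)[OF that]]) (use * in \<open>auto simp: indicator_def\<close>)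
    then show "\<exists>K\<ge>0. \<exists>e0>0. \<forall>e. 0 < e \<longrightarrow> e < e0 \<longrightarrow> (\<integral>\<^sup>+t. indicator {\<tau>..T} t * Wn b n' (U e 1 t) \<partial>lborel) \<le> ennreal K"
      using L by (intro exI[of _ L] conjI exI[of _ 1]) auto
  qed
qed

section \<open>Induction over the levels\<close>

lemma Pb_mono: "Pb n' j \<Longrightarrow> n \<le> n' \<Longrightarrow> Pb n j"
  unfolding Pb_def
proof (intro allI impI)
  fix b \<tau> :: real
  assume P: "\<forall>b \<tau>. 0 < b \<longrightarrow> 0 < \<tau> \<longrightarrow> \<tau> < T \<longrightarrow> (\<exists>K\<ge>0. \<exists>e0>0. \<forall>e t. 0 < e \<longrightarrow> e < e0 \<longrightarrow> t \<in> {\<tau>..T} \<longrightarrow> Wn b n' (U e j t) \<le> ennreal K)"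
    and n: "n \<le> n'" and *: "0 < b" "0 < \<tau>" "\<tau> < T"
  from P[rule_format, OF *] obtain K e0 where K: "K \<ge> 0" "e0 > 0"
    "\<And>e t. 0 < e \<Longrightarrow> e < e0 \<Longrightarrow> t \<in> {\<tau>..T} \<Longrightarrow> Wn b n' (U e j t) \<le> ennreal K" by auto
  have "Wn b n (U e j t) \<le> ennreal (1 / b ^ (n' - n) * K)" if "0 < e" "e < e0" "t \<in> {\<tau>..T}" for e t
  proof -
    have "Wn b n (U e j t) \<le> ennreal (1 / b ^ (n' - n)) * Wn b n' (U e j t)"
      by (rule Wn_mono_exponent[OF *(1) n]) measurable
    also have "\<dots> \<le> ennreal (1 / b ^ (n' - n)) * ennreal K" by (intro mult_left_mono K that) auto
    also have "\<dots> = ennreal (1 / b ^ (n' - n) * K)" using K * by (intro ennreal_mult[symmetric]) auto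
    finally show ?thesis .
  qed
  then show "\<exists>K\<ge>0. \<exists>e0>0. \<forall>e t. 0 < e \<longrightarrow> e < e0 \<longrightarrow> t \<in> {\<tau>..T} \<longrightarrow> Wn b n (U e j t) \<le> ennreal K"
    using K * by (intro exI[of _ "1 / b ^ (n' - n) * K"] conjI exI[of _ e0]) auto
qed

text \<open>At level i the exponent is r - i. Level j + 1 needs the earlier levels with its own,
  smaller exponent, which \<open>Pb_mono\<close> provides. At level r no weight is left, which is
  the bound wanted.\<close>

lemma all_levels:
  assumes init: "Wn 0 r (w 0) < \<infinity>" and "j \<le> r"
  shows "(\<forall>i\<le>j. Pb (r - i) i) \<and> (j < r \<longrightarrow> Sb (r - Suc j) (Suc j))"
  using assms(2)
proof (induction j)
  case 0
  have "r - 0 = Suc (r - Suc 0)" if "0 < r" using that by simp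
  then show ?case using level_0[OF init] by auto
next
  case (Suc j)
  then have IH: "\<forall>i\<le>j. Pb (r - i) i" "Sb (r - Suc j) (Suc j)" by auto
  have "\<forall>i<Suc j. Pb (r - Suc j) i"
    using IH(1) Pb_mono by (metis diff_le_mono2 le_SucI less_Suc_eq_le)
  from level_step[OF _ this IH(2)]
  have 1: "Pb (r - Suc j) (Suc j)" "\<And>n'. r - Suc j = Suc n' \<Longrightarrow> Sb n' (Suc (Suc j))" by auto
  have "r - Suc j = Suc (r - Suc (Suc j))" if "Suc j < r" using that by simp
  with 1(2) have "Suc j < r \<Longrightarrow> Sb (r - Suc (Suc j)) (Suc (Suc j))" by blast
  then show ?case using IH(1) 1(1) by (auto simp: le_Suc_eq)
qed

text \<open>Dual form of an L^2 bound on the derivative of order r: as the derivatives stand on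
  \<phi>, the limit e to 0 involves only the bounded pointwise convergence of \<open>U e 0\<close>
  to w.\<close>

lemma weak_derivative_bound:
  assumes init: "Wn 0 r (w 0) < \<infinity>" and b: "b > 0" and t: "t \<in> {0<..T}"
  shows "\<exists>K\<ge>0. \<forall>\<phi>. test_function {b<..} \<phi> \<longrightarrow>
    \<bar>LINT x|lborel. w t x * D r \<phi> x\<bar> \<le> K * sqrt (LINT x|lborel. (\<phi> x)\<^sup>2)"
proof -
  have P: "Pb 0 r" using all_levels[OF init order_refl] by auto
  \<comment> \<open>t = T is allowed while \<open>Pb\<close> asks for \<tau> < T, hence \<tau> =
    t/2.\<close>
  have "0 < t / 2" "t / 2 < T" using t by auto
  from P[unfolded Pb_def, rule_format, OF b this] obtain K e0 where K: "K \<ge> 0" "e0 > 0"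
    "\<And>e s. 0 < e \<Longrightarrow> e < e0 \<Longrightarrow> s \<in> {t / 2..T} \<Longrightarrow> Wn b 0 (U e r s) \<le> ennreal K"
    by auto
  show ?thesis
  proof (intro exI[of _ "sqrt K"] conjI allI impI)
    show "0 \<le> sqrt K" using K by simp
    fix \<phi> assume "test_function {b<..} \<phi>"
    then obtain Kc where sm: "smooth \<phi>" and Kc: "compact Kc" "Kc \<subseteq> {b<..}" "\<And>x. x \<notin> Kc \<Longrightarrow> \<phi> x = 0"
      by (auto simp: test_function_def)
    have Dz: "D i \<phi> x = 0" if "x \<notin> Kc" for i x
      by (rule D_zero_outside[OF sm compact_imp_closed[OF Kc(1)] Kc(3) that])
    obtain c where c: "Kc \<subseteq> {-c..c}"
      using compact_imp_bounded[OF Kc(1)] by (auto simp: bounded_iff abs_le_iff subset_iff) (metis minus_le_iff)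
    have Dc: "continuous_on UNIV (D i \<phi>)" for i by (rule smooth_D_continuous[OF sm])
    have Dz': "D i \<phi> x = 0" if "x \<notin> {-c..c}" for i x using Dz c that by blast
    have int: "integrable lborel (\<lambda>x. f x * D i \<phi> x)" if "continuous_on UNIV f" for f i
      by (rule compact_support_integral(1)[of _ "-c" c]) (use that Dc Dz' in \<open>auto intro!: continuous_intros\<close>)
    have parts: "(LINT x|lborel. U e 0 t x * D r \<phi> x) = (-1) ^ r * (LINT x|lborel. U e r t x * \<phi> x)" if e: "e > 0" for e
    proof -
      have "(LINT x|lborel. U e 0 t x * D r \<phi> x) = (-1) ^ i * (LINT x|lborel. U e i t x * D (r - i) \<phi> x)" if "i \<le> r" for i
        using that
      proof (induction i)
        case (Suc i)
        let ?n = "r - Suc i"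
        have n: "r - i = Suc ?n" using Suc.prems by simp
        have "(LINT x|lborel. U e i t x * D (Suc ?n) \<phi> x + U e (Suc i) t x * D ?n \<phi> x) = 0"
        proof (rule integral_derivative_zero)
          show "((\<lambda>x. U e i t x * D ?n \<phi> x) has_real_derivative U e i t x * D (Suc ?n) \<phi> x + U e (Suc i) t x * D ?n \<phi> x) (at x)" for x
            by (rule derivative_eq_intros U_deriv[OF e] smooth_D_real[OF sm] refl)+ (simp add: mult.commute)
        qed (intro continuous_intros U_cont1 Dc Bochner_Integration.integrable_add int)+
        then have "(LINT x|lborel. U e i t x * D (Suc ?n) \<phi> x) = - (LINT x|lborel. U e (Suc i) t x * D ?n \<phi> x)"
          by (subst (asm) Bochner_Integration.integral_add) (auto intro!: int U_cont1 simp del: funpow.simps)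
        with Suc show ?case unfolding n by simp
      qed simp
      from this[of r] show ?thesis by simp
    qed
    have sq: "integrable lborel (\<lambda>x. (\<phi> x)\<^sup>2)"
      using int[OF Dc[of 0], of 0] by (simp add: power2_eq_square)
    have bound: "\<bar>LINT x|lborel. U e 0 t x * D r \<phi> x\<bar> \<le> sqrt K * sqrt (LINT x|lborel. (\<phi> x)\<^sup>2)" if e: "0 < e" "e < e0" for e
    proof -
      have m: "\<phi> \<in> borel_measurable borel" using Dc[of 0] by (intro borel_measurable_continuous_onI) simp
      have "ennreal \<bar>LINT x|lborel. U e r t x * \<phi> x\<bar> \<le> (\<integral>\<^sup>+x. ennreal (norm (U e r t x * \<phi> x)) \<partial>lborel)"
        using integral_norm_bound_ennreal[OF int[OF U_cont1, of e r t 0]] by simp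
      also have "\<dots> = (\<integral>\<^sup>+x. (indicator {b..} x * ennreal \<bar>U e r t x\<bar>) * ennreal \<bar>\<phi> x\<bar> \<partial>lborel)"
      proof (rule nn_integral_cong)
        fix x
        show "ennreal (norm (U e r t x * \<phi> x)) = (indicator {b..} x * ennreal \<bar>U e r t x\<bar>) * ennreal \<bar>\<phi> x\<bar>"
          using Kc(2) Kc(3)[of x] by (cases "x \<in> Kc") (auto simp: indicator_def abs_mult ennreal_mult)
      qed
      finally have 1: "ennreal \<bar>LINT x|lborel. U e r t x * \<phi> x\<bar> \<le> (\<integral>\<^sup>+x. (indicator {b..} x * ennreal \<bar>U e r t x\<bar>) * ennreal \<bar>\<phi> x\<bar> \<partial>lborel)" .
      have "(ennreal \<bar>LINT x|lborel. U e r t x * \<phi> x\<bar>)\<^sup>2 \<le> (\<integral>\<^sup>+x. (indicator {b..} x * ennreal \<bar>U e r t x\<bar>) * ennreal \<bar>\<phi> x\<bar> \<partial>lborel)\<^sup>2"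
        by (intro power_mono 1) simp
      also have "\<dots> \<le> (\<integral>\<^sup>+x. (indicator {b..} x * ennreal \<bar>U e r t x\<bar>)\<^sup>2 \<partial>lborel) * (\<integral>\<^sup>+x. (ennreal \<bar>\<phi> x\<bar>)\<^sup>2 \<partial>lborel)"
        using m by (intro Cauchy_Schwarz_nn_integral) measurable
      also have "(\<integral>\<^sup>+x. (indicator {b..} x * ennreal \<bar>U e r t x\<bar>)\<^sup>2 \<partial>lborel) = Wn b 0 (U e r t)"
        unfolding Wn_def by (intro nn_integral_cong) (auto simp: indicator_def ennreal_power)
      also have "\<dots> \<le> ennreal K" using K(3)[OF e, of t] t by auto
      also have "(\<integral>\<^sup>+x. (ennreal \<bar>\<phi> x\<bar>)\<^sup>2 \<partial>lborel) = ennreal (LINT x|lborel. (\<phi> x)\<^sup>2)"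
        using sq by (subst nn_integral_eq_integral[symmetric]) (auto simp: ennreal_power)
      finally have "(ennreal \<bar>LINT x|lborel. U e r t x * \<phi> x\<bar>)\<^sup>2 \<le> ennreal K * ennreal (LINT x|lborel. (\<phi> x)\<^sup>2)"
        by (simp add: mult_right_mono)
      also have "\<dots> = ennreal (K * (LINT x|lborel. (\<phi> x)\<^sup>2))" using K by (intro ennreal_mult[symmetric]) auto
      finally have "(LINT x|lborel. U e r t x * \<phi> x)\<^sup>2 \<le> K * (LINT x|lborel. (\<phi> x)\<^sup>2)"
        using K by (simp add: ennreal_power ennreal_le_iff)
      then have "\<bar>LINT x|lborel. U e r t x * \<phi> x\<bar> \<le> sqrt (K * (LINT x|lborel. (\<phi> x)\<^sup>2))"
        using real_sqrt_le_mono by fastforce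
      then show ?thesis unfolding parts[OF e(1)] by (simp add: abs_mult real_sqrt_mult)
    qed
    define d where "d m = e0 / (2 * real (Suc m))" for m
    have d: "d m > 0" "d m < e0" for m using K(2) by (auto simp: d_def divide_simps mult_less_cancel_left)
    have dlim: "d \<longlonglongrightarrow> 0" unfolding d_def by real_asymp
    have U0: "(\<lambda>m. U (d m) 0 t x) \<longlonglongrightarrow> w t x" for x
    proof -
      have "filterlim d (at_right 0) sequentially"
        using d(1) dlim by (auto simp: filterlim_at less_imp_neq[symmetric])
      from filterlim_compose[OF moll_tendsto[OF w_cont1, of t x] this] show ?thesis by (simp add: U_def)
    qed
    have "(\<lambda>m. LINT x|lborel. U (d m) 0 t x * D r \<phi> x) \<longlonglongrightarrow> (LINT x|lborel. w t x * D r \<phi> x)"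
    proof (rule integral_dominated_convergence)
      show "integrable lborel (\<lambda>x. M * \<bar>D r \<phi> x\<bar>)"
        using integrable_abs[OF int[of "\<lambda>_. 1" r]] by auto
      show "AE x in lborel. norm (U (d m) 0 t x * D r \<phi> x) \<le> M * \<bar>D r \<phi> x\<bar>" for m
        using U0_bound[OF d(1)] by (auto simp: abs_mult intro!: mult_right_mono)
      show "AE x in lborel. (\<lambda>m. U (d m) 0 t x * D r \<phi> x) \<longlonglongrightarrow> w t x * D r \<phi> x"
        by (auto intro!: tendsto_intros U0)
      show "(\<lambda>x. w t x * D r \<phi> x) \<in> borel_measurable lborel" "(\<lambda>x. U (d m) 0 t x * D r \<phi> x) \<in> borel_measurable lborel" for m
        using int[OF w_cont1] int[OF U_cont1] by auto
    qed
    then have "(\<lambda>m. \<bar>LINT x|lborel. U (d m) 0 t x * D r \<phi> x\<bar>) \<longlonglongrightarrow> \<bar>LINT x|lborel. w t x * D r \<phi> x\<bar>"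
      by (rule tendsto_rabs)
    then show "\<bar>LINT x|lborel. w t x * D r \<phi> x\<bar> \<le> sqrt K * sqrt (LINT x|lborel. (\<phi> x)\<^sup>2)"
      by (rule LIMSEQ_le_const2) (use bound d in auto)
  qed
qed

end

section \<open>Representation of bounded functionals\<close>

text \<open>The geometric rate leaves room for a factor 2^n: the sum of 2^n times the squared
  increments has finite integral, so almost everywhere the increments decay geometrically and the
  sequence converges. Fatou's lemma carries the rate over to the limit.\<close>

lemma L2_fast_limit:
  fixes \<phi> :: "nat \<Rightarrow> 'a \<Rightarrow> real"
  assumes meas [measurable]: "\<And>n. \<phi> n \<in> borel_measurable N"
    and cauchy: "\<And>n m. (\<integral>\<^sup>+x. ennreal ((\<phi> n x - \<phi> m x)\<^sup>2) \<partial>N) \<le> ennreal (4 * ((1 / 16) ^ n + (1 / 16) ^ m))"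
  shows "\<exists>g. g \<in> borel_measurable N \<and> (\<forall>n. (\<integral>\<^sup>+x. ennreal ((\<phi> n x - g x)\<^sup>2) \<partial>N) \<le> ennreal (4 * (1 / 16) ^ n))"
proof -
  define q where "q n x = ennreal (2 ^ n * (\<phi> (Suc n) x - \<phi> n x)\<^sup>2)" for n x
  have [measurable]: "\<And>n. q n \<in> borel_measurable N" unfolding q_def by measurable
  have "(\<integral>\<^sup>+x. (\<Sum>n. q n x) \<partial>N) = (\<Sum>n. \<integral>\<^sup>+x. q n x \<partial>N)" by (rule nn_integral_suminf) measurable
  also have "\<dots> \<le> (\<Sum>n. ennreal (8 * (1 / 8) ^ n))"
  proof (rule suminf_le)
    fix n
    have "(\<integral>\<^sup>+x. q n x \<partial>N) = ennreal (2 ^ n) * (\<integral>\<^sup>+x. ennreal ((\<phi> (Suc n) x - \<phi> n x)\<^sup>2) \<partial>N)"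
      unfolding q_def by (subst nn_integral_cmult[symmetric]) (auto simp: ennreal_mult)
    also have "\<dots> \<le> ennreal (2 ^ n) * ennreal (4 * ((1 / 16) ^ Suc n + (1 / 16) ^ n))"
      by (intro mult_left_mono cauchy) auto
    also have "\<dots> = ennreal (2 ^ n * (4 * ((1 / 16) ^ Suc n + (1 / 16) ^ n)))" by (rule ennreal_mult[symmetric]) auto
    also have "\<dots> \<le> ennreal (8 * (1 / 8) ^ n)"
    proof (rule ennreal_leI)
      have "2 ^ n * (1 / 16) ^ n = (1 / 8 :: real) ^ n" by (simp flip: power_mult_distrib)
      moreover have "2 ^ n * (4 * ((1 / 16) ^ Suc n + (1 / 16) ^ n)) = (17 / 4) * (2 ^ n * (1 / 16 :: real) ^ n)" by simp
      moreover have "(0::real) \<le> (1 / 8) ^ n" by simp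
      ultimately show "2 ^ n * (4 * ((1 / 16) ^ Suc n + (1 / 16) ^ n)) \<le> 8 * (1 / 8 :: real) ^ n" by linarith
    qed
    finally show "(\<integral>\<^sup>+x. q n x \<partial>N) \<le> ennreal (8 * (1 / 8) ^ n)" .
  qed auto
  also have "\<dots> = ennreal (\<Sum>n. 8 * (1 / 8) ^ n)"
    by (rule suminf_ennreal2) (auto intro!: summable_mult summable_geometric)
  also have "\<dots> < \<infinity>" by simp
  finally have "AE x in N. (\<Sum>n. q n x) \<noteq> \<infinity>"
    by (intro nn_integral_PInf_AE) auto
  then have conv: "AE x in N. convergent (\<lambda>n. \<phi> n x)"
  proof eventually_elim
    case (elim x)
    then obtain Q where Q: "(\<Sum>n. q n x) = ennreal Q" "Q \<ge> 0" by (cases "\<Sum>n. q n x") auto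
    have le: "\<bar>\<phi> (Suc n) x - \<phi> n x\<bar> \<le> sqrt Q * sqrt (1 / 2) ^ n" for n
    proof -
      have "q n x \<le> ennreal Q" using sum_le_suminf[of "\<lambda>n. q n x" "{n}"] unfolding Q(1)[symmetric] by simp
      then have "2 ^ n * (\<phi> (Suc n) x - \<phi> n x)\<^sup>2 \<le> Q" using Q by (simp add: q_def ennreal_le_iff)
      then have "(\<phi> (Suc n) x - \<phi> n x)\<^sup>2 \<le> Q * (1 / 2) ^ n" by (simp add: field_simps power_one_over)
      from real_sqrt_le_mono[OF this, unfolded real_sqrt_abs]
      show ?thesis by (simp only: real_sqrt_mult real_sqrt_power)
    qed
    have "summable (\<lambda>n. \<phi> (Suc n) x - \<phi> n x)"
      by (rule summable_comparison_test'[of "\<lambda>n. sqrt Q * sqrt (1 / 2) ^ n" 0])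
        (use le in \<open>auto intro!: summable_mult summable_geometric\<close>)
    from tendsto_add[OF summable_LIMSEQ[OF this] tendsto_const[of "\<phi> 0 x"]]
    have "(\<lambda>n. \<phi> n x) \<longlonglongrightarrow> (\<Sum>n. \<phi> (Suc n) x - \<phi> n x) + \<phi> 0 x"
      unfolding sum_lessThan_telescope[of "\<lambda>i. \<phi> i x"] by simp
    then show "convergent (\<lambda>n. \<phi> n x)" by (auto simp: convergent_def)
  qed
  define g where "g x = lim (\<lambda>n. \<phi> n x)" for x
  have gm: "g \<in> borel_measurable N" unfolding g_def by measurable
  have lim: "AE x in N. (\<lambda>n. \<phi> n x) \<longlonglongrightarrow> g x"
    using conv by eventually_elim (simp add: g_def convergent_LIMSEQ_iff)
  have "(\<integral>\<^sup>+x. ennreal ((\<phi> n x - g x)\<^sup>2) \<partial>N) \<le> ennreal (4 * (1 / 16) ^ n)" for n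
  proof -
    have "(\<integral>\<^sup>+x. ennreal ((\<phi> n x - g x)\<^sup>2) \<partial>N) = (\<integral>\<^sup>+x. liminf (\<lambda>m. ennreal ((\<phi> n x - \<phi> m x)\<^sup>2)) \<partial>N)"
      using lim
    proof (intro nn_integral_cong_AE, eventually_elim)
      case (elim x)
      then have "(\<lambda>m. ennreal ((\<phi> n x - \<phi> m x)\<^sup>2)) \<longlonglongrightarrow> ennreal ((\<phi> n x - g x)\<^sup>2)"
        by (intro tendsto_ennrealI tendsto_intros)
      from lim_imp_Liminf[OF _ this] show ?case by simp
    qed
    also have "\<dots> \<le> liminf (\<lambda>m. \<integral>\<^sup>+x. ennreal ((\<phi> n x - \<phi> m x)\<^sup>2) \<partial>N)"
      by (rule nn_integral_liminf) measurable
    also have "\<dots> \<le> liminf (\<lambda>m. ennreal (4 * ((1 / 16) ^ n + (1 / 16) ^ m)))"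
      by (rule Liminf_mono) (use cauchy in auto)
    also have "\<dots> = ennreal (4 * ((1 / 16) ^ n + 0))"
      by (intro lim_imp_Liminf tendsto_ennrealI tendsto_intros LIMSEQ_power_zero) auto
    finally show ?thesis by simp
  qed
  with gm show ?thesis by blast
qed

text \<open>V need not be complete, so g is not sought in V: it is the L^2 limit of a minimising
  sequence in V of J \<phi> = |\<phi>|^2 / 2 - l \<phi>, which is bounded below by -K^2 / 2. The
  Euler equation of the minimum is the representation of l.\<close>

lemma riesz_L2:
  fixes V :: "(real \<Rightarrow> real) set" and l :: "(real \<Rightarrow> real) \<Rightarrow> real"
  assumes V0: "V \<noteq> {}" and lin: "\<And>\<phi> \<psi> c. \<phi> \<in> V \<Longrightarrow> \<psi> \<in> V \<Longrightarrow> (\<lambda>x. \<phi> x + c * \<psi> x) \<in> V"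
    and meas: "\<And>\<phi>. \<phi> \<in> V \<Longrightarrow> \<phi> \<in> borel_measurable borel"
    and sq: "\<And>\<phi>. \<phi> \<in> V \<Longrightarrow> integrable lborel (\<lambda>x. (\<phi> x)\<^sup>2)"
    and llin: "\<And>\<phi> \<psi> c. \<phi> \<in> V \<Longrightarrow> \<psi> \<in> V \<Longrightarrow> l (\<lambda>x. \<phi> x + c * \<psi> x) = l \<phi> + c * l \<psi>"
    and bound: "\<And>\<phi>. \<phi> \<in> V \<Longrightarrow> \<bar>l \<phi>\<bar> \<le> K * sqrt (LINT x|lborel. (\<phi> x)\<^sup>2)" and K: "K \<ge> 0"
  shows "\<exists>g. g \<in> borel_measurable borel \<and> integrable lborel (\<lambda>x. (g x)\<^sup>2) \<and> (\<forall>\<psi>\<in>V. l \<psi> = (LINT x|lborel. g x * \<psi> x))"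
proof -
  define ip where "ip f g = (LINT x|lborel. f x * g x)" for f g :: "real \<Rightarrow> real"
  have prod: "integrable lborel (\<lambda>x. f x * h x)"
    if "f \<in> borel_measurable borel" "h \<in> borel_measurable borel" "integrable lborel (\<lambda>x. (f x)\<^sup>2)" "integrable lborel (\<lambda>x. (h x)\<^sup>2)"
    for f h :: "real \<Rightarrow> real"
    using integrable_square_mult[OF that(1,2) _ that(3,4), of "\<lambda>_. 1" 1] by simp
  have ipV: "integrable lborel (\<lambda>x. \<phi> x * \<psi> x)" if "\<phi> \<in> V" "\<psi> \<in> V" for \<phi> \<psi>
    by (intro prod meas sq that)
  define J where "J \<phi> = ip \<phi> \<phi> / 2 - l \<phi>" for \<phi>
  have exp_ip: "ip (\<lambda>x. \<phi> x + c * \<psi> x) (\<lambda>x. \<phi> x + c * \<psi> x) = ip \<phi> \<phi> + 2 * c * ip \<phi> \<psi> + c\<^sup>2 * ip \<psi> \<psi>"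
    if "\<phi> \<in> V" "\<psi> \<in> V" for \<phi> \<psi> c
  proof -
    have "ip (\<lambda>x. \<phi> x + c * \<psi> x) (\<lambda>x. \<phi> x + c * \<psi> x) = (LINT x|lborel. \<phi> x * \<phi> x + (2 * c) * (\<phi> x * \<psi> x) + c\<^sup>2 * (\<psi> x * \<psi> x))"
      unfolding ip_def by (rule Bochner_Integration.integral_cong) (auto simp: algebra_simps power2_eq_square)
    also have "\<dots> = ip \<phi> \<phi> + 2 * c * ip \<phi> \<psi> + c\<^sup>2 * ip \<psi> \<psi>"
      unfolding ip_def using ipV[OF that(1,1)] ipV[OF that] ipV[OF that(2,2)] by simp
    finally show ?thesis .
  qed
  have Jexp: "J (\<lambda>x. \<phi> x + c * \<psi> x) = J \<phi> + c * (ip \<phi> \<psi> - l \<psi>) + c\<^sup>2 / 2 * ip \<psi> \<psi>" if "\<phi> \<in> V" "\<psi> \<in> V" for \<phi> \<psi> c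
    unfolding J_def exp_ip[OF that] llin[OF that] by (simp add: field_simps)
  have ipnn: "ip \<phi> \<phi> \<ge> 0" for \<phi> by (simp add: ip_def)
  have Jlow: "J \<phi> \<ge> - K\<^sup>2 / 2" if "\<phi> \<in> V" for \<phi>
  proof -
    have "l \<phi> \<le> K * sqrt (ip \<phi> \<phi>)" using bound[OF that] by (simp add: ip_def power2_eq_square)
    moreover have "2 * (K * sqrt (ip \<phi> \<phi>)) \<le> K\<^sup>2 + ip \<phi> \<phi>"
      using sum_squares_bound[of K "sqrt (ip \<phi> \<phi>)"] ipnn[of \<phi>] by simp
    ultimately show ?thesis by (simp add: J_def)
  qed
  have bdd: "bdd_below (J ` V)" using Jlow by (auto intro!: bdd_belowI2)
  define I where "I = (INF \<phi>\<in>V. J \<phi>)"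
  have Ile: "I \<le> J \<phi>" if "\<phi> \<in> V" for \<phi> unfolding I_def by (rule cINF_lower[OF bdd that])
  have "\<exists>\<phi>\<in>V. J \<phi> < I + (1 / 16) ^ n" for n
    using cINF_less_iff[OF V0 bdd, of "I + (1 / 16) ^ n"] by (simp add: I_def)
  then obtain \<phi> where \<phi>: "\<And>n. \<phi> n \<in> V" "\<And>n. J (\<phi> n) < I + (1 / 16) ^ n" by metis
  have \<phi>m [measurable]: "\<And>n. \<phi> n \<in> borel_measurable borel" using meas \<phi> by blast
  have "\<exists>g. g \<in> borel_measurable lborel \<and> (\<forall>n. (\<integral>\<^sup>+x. ennreal ((\<phi> n x - g x)\<^sup>2) \<partial>lborel) \<le> ennreal (4 * (1 / 16) ^ n))"
  proof (rule L2_fast_limit)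
    \<comment> \<open>Parallelogram identity: s is the midpoint of \<open>\<phi> n\<close> and
      \<open>\<phi> m\<close>, and J s \<ge> I forces |d|^2 \<le> 4 (16^(-n) + 16^(-m)).\<close>
    fix n m
    define d where "d = (\<lambda>x. \<phi> n x + (-1) * \<phi> m x)"
    define s where "s = (\<lambda>x. \<phi> n x + (- 1 / 2) * d x)"
    have d: "d \<in> V" unfolding d_def by (intro lin \<phi>)
    have s: "s \<in> V" unfolding s_def by (intro lin \<phi> d)
    have "\<phi> m = (\<lambda>x. \<phi> n x + (-1) * d x)" by (simp add: fun_eq_iff d_def)
    then have 1: "J (\<phi> m) = J (\<phi> n) - (ip (\<phi> n) d - l d) + ip d d / 2"
      using Jexp[OF \<phi>(1)[of n] d, of "-1"] by simp
    have 2: "J s = J (\<phi> n) - 1 / 2 * (ip (\<phi> n) d - l d) + ip d d / 8"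
      using Jexp[OF \<phi>(1)[of n] d, of "-1/2"] by (simp add: s_def power2_eq_square)
    have le: "ip d d \<le> 4 * ((1 / 16) ^ n + (1 / 16) ^ m)"
      using 1 2 \<phi>(2)[of n] \<phi>(2)[of m] Ile[OF s] by argo
    have "(\<integral>\<^sup>+x. ennreal ((\<phi> n x - \<phi> m x)\<^sup>2) \<partial>lborel) = ennreal (LINT x|lborel. (d x)\<^sup>2)"
      using sq[OF d] by (subst nn_integral_eq_integral[symmetric]) (auto simp: d_def)
    also have "\<dots> = ennreal (ip d d)" by (simp add: ip_def power2_eq_square)
    also have "\<dots> \<le> ennreal (4 * ((1 / 16) ^ n + (1 / 16) ^ m))" by (rule ennreal_leI[OF le])
    finally show "(\<integral>\<^sup>+x. ennreal ((\<phi> n x - \<phi> m x)\<^sup>2) \<partial>lborel) \<le> ennreal (4 * ((1 / 16) ^ n + (1 / 16) ^ m))" .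
  qed simp
  then obtain g where g [measurable]: "g \<in> borel_measurable borel"
    and gl: "\<And>n. (\<integral>\<^sup>+x. ennreal ((\<phi> n x - g x)\<^sup>2) \<partial>lborel) \<le> ennreal (4 * (1 / 16) ^ n)" by auto
  have di: "integrable lborel (\<lambda>x. (\<phi> n x - g x)\<^sup>2)" for n
    by (rule integrableI_bounded) (use gl[of n] in \<open>auto intro: le_less_trans\<close>)
  have dl: "(LINT x|lborel. (\<phi> n x - g x)\<^sup>2) \<le> 4 * (1 / 16) ^ n" for n
  proof -
    have "ennreal (LINT x|lborel. (\<phi> n x - g x)\<^sup>2) \<le> ennreal (4 * (1 / 16) ^ n)"
      using gl[of n] by (subst nn_integral_eq_integral[symmetric]) (auto intro: di)
    then show ?thesis by (subst (asm) ennreal_le_iff) auto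
  qed
  have gi: "integrable lborel (\<lambda>x. (g x)\<^sup>2)"
  proof (rule Bochner_Integration.integrable_bound)
    show "integrable lborel (\<lambda>x. 2 * (\<phi> 0 x)\<^sup>2 + 2 * (\<phi> 0 x - g x)\<^sup>2)"
      by (intro Bochner_Integration.integrable_add integrable_mult_right di sq \<phi>)
    have "(g x)\<^sup>2 \<le> 2 * (\<phi> 0 x)\<^sup>2 + 2 * (\<phi> 0 x - g x)\<^sup>2" for x
      using zero_le_power2[of "2 * \<phi> 0 x - g x"] by (simp add: power2_diff power_mult_distrib algebra_simps)
    then show "AE x in lborel. norm ((g x)\<^sup>2) \<le> norm (2 * (\<phi> 0 x)\<^sup>2 + 2 * (\<phi> 0 x - g x)\<^sup>2)" by simp
  qed measurable
  have "l \<psi> = ip g \<psi>" if \<psi>: "\<psi> \<in> V" for \<psi>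
  proof -
    have [measurable]: "\<psi> \<in> borel_measurable borel" by (rule meas[OF \<psi>])
    have 1: "\<bar>ip (\<phi> n) \<psi> - l \<psi>\<bar> \<le> (1 / 4) ^ n * (1 + ip \<psi> \<psi> / 2)" for n
    proof -
      let ?s = "(1 / 4 :: real) ^ n"
      have ss: "?s * ?s = (1 / 16) ^ n" by (simp flip: power_mult_distrib)
      have pos: "?s > 0" by simp
      \<comment> \<open>\<open>\<phi> n\<close> is within 16^(-n) of the infimum, so J cannot
        decrease by more in the direction \<psi>. The values c = 4^(-n) and c = -4^(-n), used below,
        balance the linear and the quadratic term.\<close>
      have "- ((1 / 16 :: real) ^ n) \<le> c * (ip (\<phi> n) \<psi> - l \<psi>) + c\<^sup>2 / 2 * ip \<psi> \<psi>" for c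
        using Ile[OF lin[OF \<phi>(1)[of n] \<psi>, of c]] Jexp[OF \<phi>(1)[of n] \<psi>, of c] \<phi>(2)[of n] by linarith
      note low = this
      have "- ((1 / 16) ^ n) \<le> ?s * (ip (\<phi> n) \<psi> - l \<psi>) + (1 / 16) ^ n / 2 * ip \<psi> \<psi>"
        "- ((1 / 16) ^ n) \<le> - (?s * (ip (\<phi> n) \<psi> - l \<psi>)) + (1 / 16) ^ n / 2 * ip \<psi> \<psi>"
        using low[of ?s] low[of "- ?s"] unfolding power2_eq_square minus_mult_minus ss by simp_all
      then have "\<bar>?s * (ip (\<phi> n) \<psi> - l \<psi>)\<bar> \<le> (1 / 16) ^ n + (1 / 16) ^ n / 2 * ip \<psi> \<psi>" by linarith
      then have "?s * \<bar>ip (\<phi> n) \<psi> - l \<psi>\<bar> \<le> (1 / 16) ^ n + (1 / 16) ^ n / 2 * ip \<psi> \<psi>"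
        by (simp only: abs_mult abs_of_pos[OF pos])
      also have "\<dots> = ?s * (?s * (1 + ip \<psi> \<psi> / 2))" unfolding ss[symmetric] by (simp add: algebra_simps)
      finally show ?thesis using pos by (simp only: mult_le_cancel_left_pos)
    qed
    have 2: "\<bar>ip (\<phi> n) \<psi> - ip g \<psi>\<bar> \<le> (1 / 4) ^ n * (2 + ip \<psi> \<psi> / 2)" for n
    proof -
      let ?s = "(1 / 4 :: real) ^ n"
      have pos: "?s > 0" by simp
      have ss: "(1 / 16) ^ n = ?s * ?s" by (simp flip: power_mult_distrib)
      have i2: "integrable lborel (\<lambda>x. (\<phi> n x - g x) * \<psi> x)" by (rule prod[OF _ _ di sq[OF \<psi>]]) auto
      have eq: "ip (\<phi> n) \<psi> - ip g \<psi> = (LINT x|lborel. (\<phi> n x - g x) * \<psi> x)"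
        unfolding ip_def left_diff_distrib
        by (rule Bochner_Integration.integral_diff[symmetric, OF ipV[OF \<phi>(1) \<psi>] prod[OF g meas[OF \<psi>] gi sq[OF \<psi>]]])
      have "\<bar>ip (\<phi> n) \<psi> - ip g \<psi>\<bar> \<le> (LINT x|lborel. 1 / (2 * ?s) * (\<phi> n x - g x)\<^sup>2 + ?s / 2 * (\<psi> x)\<^sup>2)"
        unfolding eq
      proof (rule integral_abs_bound_integral[OF i2])
        show "integrable lborel (\<lambda>x. 1 / (2 * ?s) * (\<phi> n x - g x)\<^sup>2 + ?s / 2 * (\<psi> x)\<^sup>2)"
          by (intro Bochner_Integration.integrable_add integrable_mult_right di sq \<psi>)
        fix x
        \<comment> \<open>Young's inequality with parameter 4^(-n) does the work of Cauchy-Schwarz,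
          since the squared distance to g is at most 4 times 16^(-n).\<close>
        have "\<bar>p * q\<bar> \<le> 1 / (2 * ?s) * p\<^sup>2 + ?s / 2 * q\<^sup>2" for p q :: real
        proof -
          have "2 * (\<bar>p\<bar> * (?s * \<bar>q\<bar>)) \<le> p\<^sup>2 + (?s * q)\<^sup>2"
            using sum_squares_bound[of "\<bar>p\<bar>" "?s * \<bar>q\<bar>"] by (simp add: power_mult_distrib)
          then have "2 * ?s * \<bar>p * q\<bar> \<le> 2 * ?s * (1 / (2 * ?s) * p\<^sup>2 + ?s / 2 * q\<^sup>2)"
            using pos by (simp add: abs_mult distrib_left power2_eq_square mult_ac)
          then show ?thesis using pos by (subst (asm) mult_le_cancel_left_pos) auto
        qed
        then show "\<bar>(\<phi> n x - g x) * \<psi> x\<bar> \<le> 1 / (2 * ?s) * (\<phi> n x - g x)\<^sup>2 + ?s / 2 * (\<psi> x)\<^sup>2" .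
      qed
      also have "\<dots> = 1 / (2 * ?s) * (LINT x|lborel. (\<phi> n x - g x)\<^sup>2) + ?s / 2 * ip \<psi> \<psi>"
        unfolding ip_def power2_eq_square[symmetric]
        by (subst Bochner_Integration.integral_add) (auto intro!: integrable_mult_right di sq \<psi> simp del: power_one_over)
      also have "\<dots> \<le> 1 / (2 * ?s) * (4 * (?s * ?s)) + ?s / 2 * ip \<psi> \<psi>"
        using dl[of n] unfolding ss using pos by (intro add_mono mult_left_mono) auto
      also have "\<dots> = ?s * (2 + ip \<psi> \<psi> / 2)" using pos by (simp add: field_simps)
      finally show ?thesis .
    qed
    have "(\<lambda>n. (1 / 4 :: real) ^ n * (3 + ip \<psi> \<psi>)) \<longlonglongrightarrow> 0 * (3 + ip \<psi> \<psi>)"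
      by (intro tendsto_intros LIMSEQ_power_zero) auto
    moreover have "\<bar>l \<psi> - ip g \<psi>\<bar> \<le> (1 / 4) ^ n * (3 + ip \<psi> \<psi>)" for n
    proof -
      have "(1 / 4) ^ n * (3 + ip \<psi> \<psi>) = (1 / 4) ^ n * (1 + ip \<psi> \<psi> / 2) + (1 / 4) ^ n * (2 + ip \<psi> \<psi> / 2)"
        unfolding distrib_left[symmetric] by simp
      then show ?thesis using 1[of n] 2[of n] by linarith
    qed
    ultimately have "\<bar>l \<psi> - ip g \<psi>\<bar> \<le> 0" by (intro LIMSEQ_le_const[of _ 0]) auto
    then show ?thesis by simp
  qed
  then show ?thesis using g gi unfolding ip_def by (intro exI[of _ g]) auto
qed

section \<open>From the dual bound to the weak derivative\<close>

lemma D_lin: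
  fixes \<phi> \<psi> :: "real \<Rightarrow> real"
  assumes "smooth \<phi>" "smooth \<psi>"
  shows "smooth (\<lambda>x. \<phi> x + c * \<psi> x)" "D n (\<lambda>x. \<phi> x + c * \<psi> x) = (\<lambda>x. D n \<phi> x + c * D n \<psi> x)"
proof -
  let ?g = "\<lambda>n x. D n \<phi> x + c * D n \<psi> x"
  have "(?g n has_vector_derivative ?g (Suc n) x) (at x)" for n x
    unfolding has_real_derivative_iff_has_vector_derivative[symmetric]
    by (intro DERIV_add DERIV_cmult smooth_D_real assms)
  from smooth_sequence[of ?g, OF this]
  show "smooth (\<lambda>x. \<phi> x + c * \<psi> x)" "D n (\<lambda>x. \<phi> x + c * \<psi> x) = (\<lambda>x. D n \<phi> x + c * D n \<psi> x)" by simp_all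
qed

lemma test_function_interval:
  assumes "test_function S (\<phi> :: real \<Rightarrow> real)"
  obtains c where "smooth \<phi>" "\<And>i x. x \<notin> {-c..c} \<Longrightarrow> D i \<phi> x = 0" "\<And>i x. x \<notin> S \<Longrightarrow> D i \<phi> x = 0"
proof -
  from assms obtain Kc where sm: "smooth \<phi>" and Kc: "compact Kc" "Kc \<subseteq> S" "\<And>x. x \<notin> Kc \<Longrightarrow> \<phi> x = 0"
    by (auto simp: test_function_def)
  have Dz: "D i \<phi> x = 0" if "x \<notin> Kc" for i x
    by (rule D_zero_outside[OF sm compact_imp_closed[OF Kc(1)] Kc(3) that])
  obtain c where "Kc \<subseteq> {-c..c}"
    using compact_imp_bounded[OF Kc(1)] by (auto simp: bounded_iff abs_le_iff subset_iff) (metis minus_le_iff)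
  then show ?thesis using Dz Kc(2) sm by (intro that[of c]) blast+
qed

lemma test_function_integrable:
  assumes "test_function S \<phi>" "continuous_on UNIV f"
  shows "integrable lborel (\<lambda>x. f x * D i \<phi> x)"
proof -
  obtain c where c: "smooth \<phi>" "\<And>i x. x \<notin> {-c..c} \<Longrightarrow> D i \<phi> x = 0"
    using test_function_interval[OF assms(1)] by metis
  show ?thesis
    by (rule compact_support_integral(1)[of _ "-c" c])
      (use c assms(2) smooth_D_continuous[OF c(1)] in \<open>auto intro!: continuous_intros\<close>)
qed

lemma test_function_lin:
  fixes \<phi> \<psi> :: "real \<Rightarrow> real"
  assumes "test_function S \<phi>" "test_function S \<psi>"
  shows "test_function S (\<lambda>x. \<phi> x + c * \<psi> x)"
proof -
  from assms obtain K1 K2 where "compact K1" "K1 \<subseteq> S" "\<And>x. x \<notin> K1 \<Longrightarrow> \<phi> x = 0" "compact K2" "K2 \<subseteq> S" "\<And>x. x \<notin> K2 \<Longrightarrow> \<psi> x = 0"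
    by (auto simp: test_function_def)
  then show ?thesis
    using assms D_lin(1) unfolding test_function_def by (intro conjI exI[of _ "K1 \<union> K2"]) auto
qed

text \<open>The functional that sends \<phi> to (-1)^n times the integral of v D^n \<phi> is bounded
  in L^2 on test functions, and its Riesz representative is the weak derivative. The remaining work
  passes from the continuous v to the class of f and from Borel to Lebesgue measure.\<close>

lemma weak_derivI:
  assumes S: "open S" and v: "continuous_on UNIV v" and f: "AE x in lebesgue. v x = f x"
    and K: "K \<ge> 0" and bound: "\<And>\<phi>. test_function S \<phi> \<Longrightarrow> \<bar>LINT x|lborel. v x * D n \<phi> x\<bar> \<le> K * sqrt (LINT x|lborel. (\<phi> x)\<^sup>2)"
  shows "weak_deriv_sq_integrable_on S n f"
proof -
  define V where "V = {\<phi> :: real \<Rightarrow> real. test_function S \<phi>}"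
  define l where "l \<phi> = (-1) ^ n * (LINT x|lborel. v x * D n \<phi> x)" for \<phi> :: "real \<Rightarrow> real"
  have cont: "continuous_on UNIV \<phi>" if "\<phi> \<in> V" for \<phi>
    using smooth_D_continuous[of \<phi> UNIV 0] that by (auto simp: V_def test_function_def)
  have "\<exists>g. g \<in> borel_measurable borel \<and> integrable lborel (\<lambda>x. (g x)\<^sup>2) \<and> (\<forall>\<psi>\<in>V. l \<psi> = (LINT x|lborel. g x * \<psi> x))"
  proof (rule riesz_L2[where K=K])
    have "test_function S (\<lambda>_. 0)" unfolding test_function_def using smooth_const by (intro conjI exI[of _ "{}"]) auto
    then show "V \<noteq> {}" by (auto simp: V_def)
    show "(\<lambda>x. \<phi> x + c * \<psi> x) \<in> V" if "\<phi> \<in> V" "\<psi> \<in> V" for \<phi> \<psi> c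
      using that test_function_lin by (auto simp: V_def)
    show "\<phi> \<in> borel_measurable borel" if "\<phi> \<in> V" for \<phi> by (intro borel_measurable_continuous_onI cont that)
    show "integrable lborel (\<lambda>x. (\<phi> x)\<^sup>2)" if "\<phi> \<in> V" for \<phi>
      using test_function_integrable[OF _ cont[OF that], of S \<phi> 0] that by (simp add: V_def power2_eq_square)
    show "l (\<lambda>x. \<phi> x + c * \<psi> x) = l \<phi> + c * l \<psi>" if "\<phi> \<in> V" "\<psi> \<in> V" for \<phi> \<psi> c
    proof -
      have s: "smooth \<phi>" "smooth \<psi>" using that by (auto simp: V_def test_function_def)
      have "(LINT x|lborel. v x * D n (\<lambda>x. \<phi> x + c * \<psi> x) x) = (LINT x|lborel. v x * D n \<phi> x + c * (v x * D n \<psi> x))"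
        unfolding D_lin(2)[OF s] by (simp add: algebra_simps)
      also have "\<dots> = (LINT x|lborel. v x * D n \<phi> x) + c * (LINT x|lborel. v x * D n \<psi> x)"
        using that by (subst Bochner_Integration.integral_add)
          (auto intro!: integrable_mult_right test_function_integrable v simp: V_def)
      finally show ?thesis by (simp add: l_def algebra_simps)
    qed
    show "\<bar>l \<phi>\<bar> \<le> K * sqrt (LINT x|lborel. (\<phi> x)\<^sup>2)" if "\<phi> \<in> V" for \<phi>
      using bound[of \<phi>] that by (simp add: l_def V_def abs_mult)
  qed (rule K)
  then obtain g where g [measurable]: "g \<in> borel_measurable borel" and gi: "integrable lborel (\<lambda>x. (g x)\<^sup>2)"
    and gl: "\<And>\<phi>. test_function S \<phi> \<Longrightarrow> l \<phi> = (LINT x|lborel. g x * \<phi> x)" by (auto simp: V_def)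
  have vm [measurable]: "v \<in> borel_measurable borel" by (intro borel_measurable_continuous_onI v)
  have fm: "f \<in> borel_measurable lebesgue"
    by (rule borel_measurable_AE[OF _ f]) (use measurable_completion[of v lborel borel] vm in simp)
  have vL: "v \<in> borel_measurable lebesgue" using measurable_completion[of v lborel borel] vm by simp
  have vK: "set_integrable lebesgue Kc v" if "compact Kc" for Kc
  proof -
    have "integrable lborel (\<lambda>x. indicator Kc x *\<^sub>R v x)"
      by (rule borel_integrable_compact[OF that]) (rule continuous_on_subset[OF v], simp)
    then show ?thesis unfolding set_integrable_def by (subst integrable_completion) auto
  qed
  have "locally_integrable_on S f"
    unfolding locally_integrable_on_def
  proof (intro allI impI, elim conjE)
    fix Kc :: "real set" assume Kc: "compact Kc"
    have Kl: "Kc \<in> sets lebesgue" using Kc by (simp add: compact_imp_closed borel_closed)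
    have m: "(\<lambda>x. indicat_real Kc x *\<^sub>R h x) \<in> borel_measurable lebesgue" if "h \<in> borel_measurable lebesgue" for h :: "real \<Rightarrow> real"
      by (intro borel_measurable_scaleR borel_measurable_indicator Kl that)
    have "AE x in lebesgue. indicat_real Kc x *\<^sub>R f x = indicat_real Kc x *\<^sub>R v x"
      using f by eventually_elim simp
    from integrable_cong_AE[OF m[OF fm] m[OF vL] this]
    have "set_integrable lebesgue Kc f \<longleftrightarrow> set_integrable lebesgue Kc v"
      unfolding set_integrable_def .
    then show "set_integrable lebesgue Kc f" using vK[OF Kc] by simp
  qed
  moreover have "locally_integrable_on S g"
    unfolding locally_integrable_on_def
  proof (intro allI impI, elim conjE)
    fix Kc :: "real set" assume Kc: "compact Kc"
    have Km [measurable]: "Kc \<in> sets borel" using Kc by (simp add: compact_imp_closed borel_closed)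
    have "integrable lborel (\<lambda>x. indicator Kc x *\<^sub>R g x)"
    proof (rule Bochner_Integration.integrable_bound)
      show "integrable lborel (\<lambda>x. indicator Kc x + (g x)\<^sup>2)"
        using gi emeasure_bounded_finite[OF compact_imp_bounded[OF Kc]]
        by (intro Bochner_Integration.integrable_add integrable_real_indicator) auto
      have "\<bar>y\<bar> \<le> 1 + y\<^sup>2" for y :: real using sum_squares_bound[of 1 "\<bar>y\<bar>"] by simp
      then show "AE x in lborel. norm (indicator Kc x *\<^sub>R g x) \<le> norm (indicator Kc x + (g x)\<^sup>2)"
        by (auto simp: indicator_def)
    qed measurable
    then show "set_integrable lebesgue Kc g" unfolding set_integrable_def by (subst integrable_completion) auto
  qed
  moreover have "(LINT x|lebesgue. g x * \<phi> x) = (-1) ^ n * (LINT x|lebesgue. f x * D n \<phi> x)" if \<phi>: "test_function S \<phi>" for \<phi>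
  proof -
    have s: "smooth \<phi>" using \<phi> by (simp add: test_function_def)
    have [measurable]: "D i \<phi> \<in> borel_measurable borel" for i
      by (intro borel_measurable_continuous_onI smooth_D_continuous s)
    have [measurable]: "\<phi> \<in> borel_measurable borel" using \<open>D 0 \<phi> \<in> borel_measurable borel\<close> by simp
    have "(LINT x|lebesgue. f x * D n \<phi> x) = (LINT x|lebesgue. v x * D n \<phi> x)"
    proof (rule integral_cong_AE)
      have DL: "D n \<phi> \<in> borel_measurable lebesgue"
        using measurable_completion[of "D n \<phi>" lborel borel] by simp
      show "(\<lambda>x. f x * D n \<phi> x) \<in> borel_measurable lebesgue" "(\<lambda>x. v x * D n \<phi> x) \<in> borel_measurable lebesgue"
        by (intro borel_measurable_times fm vL DL)+
      show "AE x in lebesgue. f x * D n \<phi> x = v x * D n \<phi> x" using f by eventually_elim simp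
    qed
    also have "\<dots> = (LINT x|lborel. v x * D n \<phi> x)" by (rule integral_completion) measurable
    finally have 1: "(LINT x|lebesgue. f x * D n \<phi> x) = (LINT x|lborel. v x * D n \<phi> x)" .
    have "(LINT x|lebesgue. g x * \<phi> x) = (LINT x|lborel. g x * \<phi> x)" by (rule integral_completion) measurable
    then show ?thesis using gl[OF \<phi>] by (simp add: 1 l_def)
  qed
  moreover have "sq_integrable (lebesgue_on S) g"
  proof -
    have "integrable lebesgue (\<lambda>x. (g x)\<^sup>2)" using gi by (subst integrable_completion) auto
    then have "integrable (lebesgue_on S) (\<lambda>x. (g x)\<^sup>2)"
      using S by (subst integrable_restrict_space) (auto intro!: integrable_mult_indicator[where f="\<lambda>x. (g x)\<^sup>2", simplified])
    moreover have "g \<in> borel_measurable (lebesgue_on S)"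
      using measurable_completion[of g lborel borel] by (intro measurable_restrict_space1) simp
    ultimately show ?thesis by (simp add: sq_integrable_def)
  qed
  ultimately show ?thesis
    unfolding weak_deriv_sq_integrable_on_def has_weak_deriv_def by blast
qed

section \<open>Sobolev embedding\<close>

lemma pair_integrable:
  fixes f :: "real \<Rightarrow> real \<Rightarrow> complex"
  assumes [measurable]: "(\<lambda>(x, y). f x y) \<in> borel_measurable (lborel \<Otimes>\<^sub>M lborel)"
    and p: "integrable lborel p" "\<And>x. p x \<ge> 0" and q: "integrable lborel q" "\<And>x. q x \<ge> 0"
    and le: "\<And>x y. norm (f x y) \<le> p x * q y"
  shows "integrable (lborel \<Otimes>\<^sub>M lborel) (\<lambda>(x, y). f x y)"
proof (rule integrableI_bounded)
  have [measurable]: "p \<in> borel_measurable borel" "q \<in> borel_measurable borel" using p q by auto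
  have "(\<integral>\<^sup>+z. ennreal (norm (case z of (x, y) \<Rightarrow> f x y)) \<partial>(lborel \<Otimes>\<^sub>M lborel)) = (\<integral>\<^sup>+x. \<integral>\<^sup>+y. ennreal (norm (f x y)) \<partial>lborel \<partial>lborel)"
    by (subst lborel.nn_integral_fst[symmetric]) auto
  also have "\<dots> \<le> (\<integral>\<^sup>+x. \<integral>\<^sup>+y. ennreal (p x) * ennreal (q y) \<partial>lborel \<partial>lborel)"
    using le p q by (intro nn_integral_mono) (auto intro!: ennreal_leI simp flip: ennreal_mult)
  also have "\<dots> = (\<integral>\<^sup>+x. ennreal (p x) \<partial>lborel) * (\<integral>\<^sup>+y. ennreal (q y) \<partial>lborel)"
    by (simp add: nn_integral_cmult nn_integral_multc)
  also have "\<dots> < \<infinity>"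
    using p q by (simp add: nn_integral_eq_integral ennreal_mult_less_top)
  finally show "(\<integral>\<^sup>+z. ennreal (norm (case z of (x, y) \<Rightarrow> f x y)) \<partial>(lborel \<Otimes>\<^sub>M lborel)) < \<infinity>" .
qed measurable

text \<open>The characteristic function of the standard normal distribution, rescaled by a.\<close>

lemma gaussian_kernel:
  assumes a: "a > 0"
  shows "(LINT x|lborel. of_real (std_normal_density (a * x)) * iexp (\<zeta> * x)) = complex_of_real (sqrt (2 * pi) * std_normal_density (\<zeta> / a) / a)"
proof -
  have "(LINT y|lborel. std_normal_density y *\<^sub>R iexp (\<zeta> / a * y)) = char std_normal_distribution (\<zeta> / a)"
    unfolding char_def by (subst integral_density) auto
  also have "\<dots> = complex_of_real (exp (- (\<zeta> / a)\<^sup>2 / 2))" by (simp add: char_std_normal_distribution)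
  finally have "complex_of_real (exp (- (\<zeta> / a)\<^sup>2 / 2)) = (LINT y|lborel. std_normal_density y *\<^sub>R iexp (\<zeta> / a * y))" ..
  also have "\<dots> = \<bar>a\<bar> *\<^sub>R (LINT x|lborel. std_normal_density (0 + a * x) *\<^sub>R iexp (\<zeta> / a * (0 + a * x)))"
    by (rule lborel_integral_real_affine) (use a in simp)
  also have "\<dots> = of_real a * (LINT x|lborel. of_real (std_normal_density (a * x)) * iexp (\<zeta> * x))"
    using a by (simp add: scaleR_conv_of_real)
  finally show ?thesis
    using a by (simp add: std_normal_density_def field_simps)
qed

text \<open>Half of the Plancherel theorem suffices: insert a Gaussian, exchange the integrals and apply
  Fatou's lemma.\<close>

lemma plancherel_le:
  fixes h :: "real \<Rightarrow> complex"
  assumes h: "integrable lborel h"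
  shows "(\<integral>\<^sup>+x. ennreal ((norm (LINT \<xi>|lborel. h \<xi> * iexp (x * \<xi>)))\<^sup>2) \<partial>lborel) \<le> ennreal (2 * pi) * (\<integral>\<^sup>+\<xi>. ennreal ((norm (h \<xi>))\<^sup>2) \<partial>lborel)"
proof -
  have hm [measurable]: "h \<in> borel_measurable borel" using h by auto
  define H where "H x = (LINT \<xi>|lborel. h \<xi> * iexp (x * \<xi>))" for x
  have Hm [measurable]: "H \<in> borel_measurable borel" unfolding H_def by measurable
  define B where "B = (LINT \<xi>|lborel. norm (h \<xi>))"
  have B0: "B \<ge> 0" by (simp add: B_def)
  have HB: "norm (H x) \<le> B" for x
  proof -
    have "norm (H x) \<le> (LINT \<xi>|lborel. norm (h \<xi> * iexp (x * \<xi>)))" unfolding H_def by (rule integral_norm_bound)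
    then show ?thesis by (simp add: norm_mult B_def)
  qed
  let ?N = std_normal_density
  have Ni: "integrable lborel (\<lambda>x. ?N (a * x))" if "a > 0" for a
    using lborel_integrable_real_affine[of ?N a 0] integrable_normal_density[of 1 0] that by simp
  define Q where "Q = (\<integral>\<^sup>+\<xi>. ennreal ((norm (h \<xi>))\<^sup>2) \<partial>lborel)"
  have step: "(\<integral>\<^sup>+x. ennreal (?N (a * x) * (norm (H x))\<^sup>2) \<partial>lborel) \<le> ennreal (sqrt (2 * pi)) * Q" if a: "a > 0" for a
  proof -
    \<comment> \<open>The Fourier transform of the Gaussian factor: nonnegative and of mass sqrt(2
      pi) for every a, which makes the estimate uniform in a.\<close>
    define \<kappa> where "\<kappa> \<zeta> = sqrt (2 * pi) * ?N (\<zeta> / a) / a" for \<zeta>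
    have \<kappa>: "\<kappa> \<zeta> \<ge> 0" for \<zeta> using a by (simp add: \<kappa>_def)
    have [measurable]: "\<kappa> \<in> borel_measurable borel" unfolding \<kappa>_def by measurable
    have \<kappa>i: "(\<integral>\<^sup>+\<zeta>. ennreal (\<kappa> \<zeta>) \<partial>lborel) = ennreal (sqrt (2 * pi))"
    proof -
      have "(\<integral>\<^sup>+\<zeta>. ennreal (\<kappa> \<zeta>) \<partial>lborel) = ennreal \<bar>a\<bar> * (\<integral>\<^sup>+y. ennreal (\<kappa> (0 + a * y)) \<partial>lborel)"
        by (rule nn_integral_real_affine) (use a in auto)
      also have "\<dots> = ennreal a * (\<integral>\<^sup>+y. ennreal (sqrt (2 * pi) / a) * ennreal (?N y) \<partial>lborel)"
        using a by (simp add: \<kappa>_def ennreal_mult' [symmetric] field_simps)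
      also have "\<dots> = ennreal a * (ennreal (sqrt (2 * pi) / a) * (\<integral>\<^sup>+y. ennreal (?N y) \<partial>lborel))"
        by (subst nn_integral_cmult) auto
      also have "(\<integral>\<^sup>+y. ennreal (?N y) \<partial>lborel) = 1"
        using integrable_normal_density[of 1 0] integral_normal_density[of 1 0] by (subst nn_integral_eq_integral) auto
      also have "ennreal a * (ennreal (sqrt (2 * pi) / a) * 1) = ennreal (sqrt (2 * pi))"
        using a by (simp flip: ennreal_mult)
      finally show ?thesis .
    qed
    define I where "I = (LINT x|lborel. of_real (?N (a * x)) * H x * cnj (H x))"
    have cnjH: "cnj (H x) = (LINT \<eta>|lborel. cnj (h \<eta>) * iexp (- (x * \<eta>)))" for x
      unfolding H_def by (subst Bochner_Integration.integral_cnj[symmetric]) (simp add: exp_cnj)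
    have ex: "iexp (- (x * \<eta>)) * iexp (x * \<xi>) = iexp ((\<xi> - \<eta>) * x)" for x \<xi> \<eta> :: real
      by (simp add: exp_add[symmetric] algebra_simps)
    have [measurable]: "(\<lambda>\<eta>. cnj (h \<eta>)) \<in> borel_measurable borel" "iexp \<in> borel_measurable borel"
      by (rule borel_measurable_continuous_on[OF _ hm], auto intro!: continuous_intros borel_measurable_continuous_onI)
    have I1: "integrable (lborel \<Otimes>\<^sub>M lborel) (\<lambda>(x, \<eta>). of_real (?N (a * x)) * H x * (cnj (h \<eta>) * iexp (- (x * \<eta>))))"
    proof (rule pair_integrable[where p="\<lambda>x. ?N (a * x) * B" and q="\<lambda>\<eta>. norm (h \<eta>)"])
      show "norm (of_real (?N (a * x)) * H x * (cnj (h \<eta>) * iexp (- (x * \<eta>)))) \<le> ?N (a * x) * B * norm (h \<eta>)" for x \<eta>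
        using HB[of x] B0 by (auto simp: norm_mult intro!: mult_mono)
      show "(\<lambda>(x, \<eta>). of_real (?N (a * x)) * H x * (cnj (h \<eta>) * iexp (- (x * \<eta>)))) \<in> borel_measurable (lborel \<Otimes>\<^sub>M lborel)"
        by measurable
    qed (use Ni[OF a] h B0 in auto)
    have I2: "integrable (lborel \<Otimes>\<^sub>M lborel) (\<lambda>(x, \<xi>). of_real (?N (a * x)) * iexp (- (x * \<eta>)) * (h \<xi> * iexp (x * \<xi>)))" for \<eta>
    proof (rule pair_integrable[where p="\<lambda>x. ?N (a * x)" and q="\<lambda>\<eta>. norm (h \<eta>)"])
      show "norm (of_real (?N (a * x)) * iexp (- (x * \<eta>)) * (h \<xi> * iexp (x * \<xi>))) \<le> ?N (a * x) * norm (h \<xi>)" for x \<xi>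
        by (auto simp: norm_mult)
      show "(\<lambda>(x, \<xi>). of_real (?N (a * x)) * iexp (- (x * \<eta>)) * (h \<xi> * iexp (x * \<xi>))) \<in> borel_measurable (lborel \<Otimes>\<^sub>M lborel)"
        by measurable
    qed (use Ni[OF a] h in auto)
    have inner: "(LINT x|lborel. of_real (?N (a * x)) * H x * iexp (- (x * \<eta>))) = (LINT \<xi>|lborel. h \<xi> * of_real (\<kappa> (\<xi> - \<eta>)))" for \<eta>
    proof -
      have "(LINT x|lborel. of_real (?N (a * x)) * H x * iexp (- (x * \<eta>)))
        = (LINT x|lborel. LINT \<xi>|lborel. of_real (?N (a * x)) * iexp (- (x * \<eta>)) * (h \<xi> * iexp (x * \<xi>)))"
        unfolding H_def by (simp add: mult_ac flip: integral_mult_right_zero)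
      also have "\<dots> = (LINT \<xi>|lborel. LINT x|lborel. of_real (?N (a * x)) * iexp (- (x * \<eta>)) * (h \<xi> * iexp (x * \<xi>)))"
        using lborel_pair.Fubini_integral[OF I2[of \<eta>]] by simp
      also have "\<dots> = (LINT \<xi>|lborel. h \<xi> * (LINT x|lborel. of_real (?N (a * x)) * iexp ((\<xi> - \<eta>) * x)))"
      proof (rule Bochner_Integration.integral_cong[OF refl])
        fix \<xi>
        have "of_real (?N (a * x)) * iexp (- (x * \<eta>)) * (h \<xi> * iexp (x * \<xi>)) = h \<xi> * (of_real (?N (a * x)) * iexp ((\<xi> - \<eta>) * x))" for x
          unfolding ex[symmetric] by (simp only: mult_ac)
        then show "(LINT x|lborel. of_real (?N (a * x)) * iexp (- (x * \<eta>)) * (h \<xi> * iexp (x * \<xi>))) = h \<xi> * (LINT x|lborel. of_real (?N (a * x)) * iexp ((\<xi> - \<eta>) * x))"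
          by (simp only: integral_mult_right_zero)
      qed
      also have "\<dots> = (LINT \<xi>|lborel. h \<xi> * of_real (\<kappa> (\<xi> - \<eta>)))"
        unfolding gaussian_kernel[OF a] \<kappa>_def ..
      finally show ?thesis .
    qed
    have "I = (LINT x|lborel. LINT \<eta>|lborel. of_real (?N (a * x)) * H x * (cnj (h \<eta>) * iexp (- (x * \<eta>))))"
      unfolding I_def cnjH by simp
    also have "\<dots> = (LINT \<eta>|lborel. LINT x|lborel. of_real (?N (a * x)) * H x * (cnj (h \<eta>) * iexp (- (x * \<eta>))))"
      using lborel_pair.Fubini_integral[OF I1] by simp
    also have "\<dots> = (LINT \<eta>|lborel. cnj (h \<eta>) * (LINT x|lborel. of_real (?N (a * x)) * H x * iexp (- (x * \<eta>))))"
    proof (rule Bochner_Integration.integral_cong[OF refl])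
      fix \<eta>
      have "of_real (?N (a * x)) * H x * (cnj (h \<eta>) * iexp (- (x * \<eta>))) = cnj (h \<eta>) * (of_real (?N (a * x)) * H x * iexp (- (x * \<eta>)))" for x
        by (simp add: mult_ac)
      then show "(LINT x|lborel. of_real (?N (a * x)) * H x * (cnj (h \<eta>) * iexp (- (x * \<eta>)))) = cnj (h \<eta>) * (LINT x|lborel. of_real (?N (a * x)) * H x * iexp (- (x * \<eta>)))"
        by (simp only: integral_mult_right_zero)
    qed
    finally have I: "I = (LINT \<eta>|lborel. cnj (h \<eta>) * (LINT \<xi>|lborel. h \<xi> * of_real (\<kappa> (\<xi> - \<eta>))))" unfolding inner .
    have shift: "(\<integral>\<^sup>+\<xi>. ennreal (\<kappa> (\<xi> - \<eta>)) \<partial>lborel) = ennreal (sqrt (2 * pi))" for \<eta>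
      using nn_integral_real_affine[of "\<lambda>\<zeta>. ennreal (\<kappa> \<zeta>)" 1 "- \<eta>"] \<kappa>i by simp
    have shift': "(\<integral>\<^sup>+\<eta>. ennreal (\<kappa> (\<xi> - \<eta>)) \<partial>lborel) = ennreal (sqrt (2 * pi))" for \<xi>
      using nn_integral_real_affine[of "\<lambda>\<zeta>. ennreal (\<kappa> \<zeta>)" "-1" \<xi>] \<kappa>i by simp
    have "ennreal (norm I) \<le> (\<integral>\<^sup>+\<eta>. ennreal (norm (h \<eta>)) * (\<integral>\<^sup>+\<xi>. ennreal (norm (h \<xi>)) * ennreal (\<kappa> (\<xi> - \<eta>)) \<partial>lborel) \<partial>lborel)"
    \<comment> \<open>A function that is not integrable has integral 0 by convention, so that case
      is trivial.\<close>
    proof (cases "integrable lborel (\<lambda>\<eta>. cnj (h \<eta>) * (LINT \<xi>|lborel. h \<xi> * of_real (\<kappa> (\<xi> - \<eta>))))")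
      case True
      have "ennreal (norm I) \<le> (\<integral>\<^sup>+\<eta>. ennreal (norm (cnj (h \<eta>) * (LINT \<xi>|lborel. h \<xi> * of_real (\<kappa> (\<xi> - \<eta>))))) \<partial>lborel)"
        unfolding I by (rule integral_norm_bound_ennreal[OF True])
      also have "\<dots> \<le> (\<integral>\<^sup>+\<eta>. ennreal (norm (h \<eta>)) * (\<integral>\<^sup>+\<xi>. ennreal (norm (h \<xi>)) * ennreal (\<kappa> (\<xi> - \<eta>)) \<partial>lborel) \<partial>lborel)"
      proof (rule nn_integral_mono)
        fix \<eta>
        have "ennreal (norm (LINT \<xi>|lborel. h \<xi> * of_real (\<kappa> (\<xi> - \<eta>)))) \<le> (\<integral>\<^sup>+\<xi>. ennreal (norm (h \<xi>)) * ennreal (\<kappa> (\<xi> - \<eta>)) \<partial>lborel)"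
        proof (cases "integrable lborel (\<lambda>\<xi>. h \<xi> * of_real (\<kappa> (\<xi> - \<eta>)))")
          case True
          from integral_norm_bound_ennreal[OF this] show ?thesis using \<kappa> by (simp add: norm_mult ennreal_mult)
        qed (simp add: not_integrable_integral_eq)
        then show "ennreal (norm (cnj (h \<eta>) * (LINT \<xi>|lborel. h \<xi> * of_real (\<kappa> (\<xi> - \<eta>))))) \<le> ennreal (norm (h \<eta>)) * (\<integral>\<^sup>+\<xi>. ennreal (norm (h \<xi>)) * ennreal (\<kappa> (\<xi> - \<eta>)) \<partial>lborel)"
          by (simp add: norm_mult ennreal_mult mult_left_mono)
      qed
      finally show ?thesis .
    qed (simp add: I not_integrable_integral_eq)
    also have "\<dots> = (\<integral>\<^sup>+\<eta>. \<integral>\<^sup>+\<xi>. ennreal (norm (h \<eta>)) * (ennreal (norm (h \<xi>)) * ennreal (\<kappa> (\<xi> - \<eta>))) \<partial>lborel \<partial>lborel)"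
      by (intro nn_integral_cong nn_integral_cmult[symmetric]) measurable
    also have "\<dots> \<le> (\<integral>\<^sup>+\<eta>. \<integral>\<^sup>+\<xi>. ennreal (1 / 2 * (norm (h \<eta>))\<^sup>2) * ennreal (\<kappa> (\<xi> - \<eta>)) + ennreal (1 / 2 * (norm (h \<xi>))\<^sup>2) * ennreal (\<kappa> (\<xi> - \<eta>)) \<partial>lborel \<partial>lborel)"
    proof (intro nn_integral_mono)
      fix \<eta> \<xi>
      \<comment> \<open>Schur's test: each half of the sum of squares depends on one variable only,
        and the kernel has the same mass in the other.\<close>
      have "norm (h \<eta>) * norm (h \<xi>) \<le> 1 / 2 * (norm (h \<eta>))\<^sup>2 + 1 / 2 * (norm (h \<xi>))\<^sup>2"
        using sum_squares_bound[of "norm (h \<eta>)" "norm (h \<xi>)"] by simp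
      then have "norm (h \<eta>) * norm (h \<xi>) * \<kappa> (\<xi> - \<eta>) \<le> (1 / 2 * (norm (h \<eta>))\<^sup>2 + 1 / 2 * (norm (h \<xi>))\<^sup>2) * \<kappa> (\<xi> - \<eta>)"
        by (intro mult_right_mono \<kappa>)
      then have "ennreal (norm (h \<eta>) * (norm (h \<xi>) * \<kappa> (\<xi> - \<eta>))) \<le> ennreal (1 / 2 * (norm (h \<eta>))\<^sup>2 * \<kappa> (\<xi> - \<eta>) + 1 / 2 * (norm (h \<xi>))\<^sup>2 * \<kappa> (\<xi> - \<eta>))"
        by (intro ennreal_leI) (simp add: algebra_simps)
      then show "ennreal (norm (h \<eta>)) * (ennreal (norm (h \<xi>)) * ennreal (\<kappa> (\<xi> - \<eta>))) \<le> ennreal (1 / 2 * (norm (h \<eta>))\<^sup>2) * ennreal (\<kappa> (\<xi> - \<eta>)) + ennreal (1 / 2 * (norm (h \<xi>))\<^sup>2) * ennreal (\<kappa> (\<xi> - \<eta>))"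
        using \<kappa>[of "\<xi> - \<eta>"] by (simp only: ennreal_mult' ennreal_mult'' ennreal_plus mult_nonneg_nonneg norm_ge_zero zero_le_power2 zero_le_divide_1_iff zero_le_numeral)
    qed
    also have "\<dots> = (\<integral>\<^sup>+\<eta>. \<integral>\<^sup>+\<xi>. ennreal (1 / 2 * (norm (h \<eta>))\<^sup>2) * ennreal (\<kappa> (\<xi> - \<eta>)) \<partial>lborel \<partial>lborel)
       + (\<integral>\<^sup>+\<eta>. \<integral>\<^sup>+\<xi>. ennreal (1 / 2 * (norm (h \<xi>))\<^sup>2) * ennreal (\<kappa> (\<xi> - \<eta>)) \<partial>lborel \<partial>lborel)"
      by (simp add: nn_integral_add)
    also have "(\<integral>\<^sup>+\<eta>. \<integral>\<^sup>+\<xi>. ennreal (1 / 2 * (norm (h \<xi>))\<^sup>2) * ennreal (\<kappa> (\<xi> - \<eta>)) \<partial>lborel \<partial>lborel)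
       = (\<integral>\<^sup>+\<xi>. \<integral>\<^sup>+\<eta>. ennreal (1 / 2 * (norm (h \<xi>))\<^sup>2) * ennreal (\<kappa> (\<xi> - \<eta>)) \<partial>lborel \<partial>lborel)"
      by (rule lborel_pair.Fubini') measurable
    also have "(\<integral>\<^sup>+\<eta>. \<integral>\<^sup>+\<xi>. ennreal (1 / 2 * (norm (h \<eta>))\<^sup>2) * ennreal (\<kappa> (\<xi> - \<eta>)) \<partial>lborel \<partial>lborel)
       + (\<integral>\<^sup>+\<xi>. \<integral>\<^sup>+\<eta>. ennreal (1 / 2 * (norm (h \<xi>))\<^sup>2) * ennreal (\<kappa> (\<xi> - \<eta>)) \<partial>lborel \<partial>lborel)
       = (\<integral>\<^sup>+\<xi>. ennreal (1 / 2 * (norm (h \<xi>))\<^sup>2) \<partial>lborel) * ennreal (sqrt (2 * pi)) + (\<integral>\<^sup>+\<xi>. ennreal (1 / 2 * (norm (h \<xi>))\<^sup>2) \<partial>lborel) * ennreal (sqrt (2 * pi))"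
      by (simp add: nn_integral_cmult nn_integral_multc shift shift')
    also have "(\<integral>\<^sup>+\<xi>. ennreal (1 / 2 * (norm (h \<xi>))\<^sup>2) \<partial>lborel) = ennreal (1 / 2) * Q"
      unfolding Q_def by (subst nn_integral_cmult[symmetric]) (measurable, simp only: ennreal_mult' zero_le_divide_1_iff zero_le_numeral)
    also have "ennreal (1 / 2) * Q * ennreal (sqrt (2 * pi)) + ennreal (1 / 2) * Q * ennreal (sqrt (2 * pi)) = ennreal (sqrt (2 * pi)) * Q"
    proof -
      have "ennreal (1 / 2) + ennreal (1 / 2) = 1" by (subst ennreal_plus[symmetric]) auto
      then have "(ennreal (1 / 2) + ennreal (1 / 2)) * (Q * ennreal (sqrt (2 * pi))) = Q * ennreal (sqrt (2 * pi))" by simp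
      then show ?thesis by (simp only: distrib_right mult.assoc) (simp only: mult.commute)
    qed
    finally have nI: "ennreal (norm I) \<le> ennreal (sqrt (2 * pi)) * Q" .
    have Nint: "integrable lborel (\<lambda>x. ?N (a * x) * (norm (H x))\<^sup>2)"
    proof (rule Bochner_Integration.integrable_bound)
      show "integrable lborel (\<lambda>x. ?N (a * x) * B\<^sup>2)" using Ni[OF a] by simp
      show "AE x in lborel. norm (?N (a * x) * (norm (H x))\<^sup>2) \<le> norm (?N (a * x) * B\<^sup>2)"
        using HB by (auto simp: abs_mult intro!: mult_left_mono power_mono)
    qed measurable
    have "I = of_real (LINT x|lborel. ?N (a * x) * (norm (H x))\<^sup>2)"
    proof -
      have "I = (LINT x|lborel. complex_of_real (?N (a * x) * (norm (H x))\<^sup>2))"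
        unfolding I_def by (simp only: of_real_mult complex_norm_square mult.assoc)
      then show ?thesis by (simp only: integral_complex_of_real)
    qed
    then have "norm I = (LINT x|lborel. ?N (a * x) * (norm (H x))\<^sup>2)"
      by (simp only: norm_of_real) (simp add: integral_nonneg)
    moreover have "(\<integral>\<^sup>+x. ennreal (?N (a * x) * (norm (H x))\<^sup>2) \<partial>lborel) = ennreal (LINT x|lborel. ?N (a * x) * (norm (H x))\<^sup>2)"
      by (rule nn_integral_eq_integral[OF Nint]) simp
    ultimately show ?thesis using nI by simp
  qed
  \<comment> \<open>With a = d m tending to 0 the Gaussian factor tends to its value 1 / sqrt(2 pi)
    at 0; this and the constant of \<open>step\<close> combine to 2 pi.\<close>
  define d where "d m = 1 / real (Suc m)" for m
  have d: "d m > 0" for m by (simp add: d_def)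
  have dlim: "d \<longlonglongrightarrow> 0" unfolding d_def by real_asymp
  have "(\<integral>\<^sup>+x. ennreal (1 / sqrt (2 * pi) * (norm (H x))\<^sup>2) \<partial>lborel) = (\<integral>\<^sup>+x. liminf (\<lambda>m. ennreal (?N (d m * x) * (norm (H x))\<^sup>2)) \<partial>lborel)"
  proof (rule nn_integral_cong)
    fix x
    have "(\<lambda>m. ?N (d m * x)) \<longlonglongrightarrow> ?N (0 * x)"
      unfolding std_normal_density_def by (intro tendsto_intros dlim) auto
    then have "(\<lambda>m. ennreal (?N (d m * x) * (norm (H x))\<^sup>2)) \<longlonglongrightarrow> ennreal (?N (0 * x) * (norm (H x))\<^sup>2)"
      by (intro tendsto_ennrealI tendsto_mult_right)
    from lim_imp_Liminf[OF _ this]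
    show "ennreal (1 / sqrt (2 * pi) * (norm (H x))\<^sup>2) = liminf (\<lambda>m. ennreal (?N (d m * x) * (norm (H x))\<^sup>2))"
      by (simp add: std_normal_density_def)
  qed
  also have "\<dots> \<le> liminf (\<lambda>m. \<integral>\<^sup>+x. ennreal (?N (d m * x) * (norm (H x))\<^sup>2) \<partial>lborel)"
    by (rule nn_integral_liminf) measurable
  also have "\<dots> \<le> liminf (\<lambda>m::nat. ennreal (sqrt (2 * pi)) * Q)"
    by (rule Liminf_mono) (use step d in auto)
  also have "\<dots> = ennreal (sqrt (2 * pi)) * Q" by (simp add: Liminf_const)
  finally have fin: "(\<integral>\<^sup>+x. ennreal (1 / sqrt (2 * pi) * (norm (H x))\<^sup>2) \<partial>lborel) \<le> ennreal (sqrt (2 * pi)) * Q" .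
  have "(\<integral>\<^sup>+x. ennreal ((norm (H x))\<^sup>2) \<partial>lborel) = (\<integral>\<^sup>+x. ennreal (sqrt (2 * pi)) * ennreal (1 / sqrt (2 * pi) * (norm (H x))\<^sup>2) \<partial>lborel)"
    by (intro nn_integral_cong) (simp flip: ennreal_mult)
  also have "\<dots> = ennreal (sqrt (2 * pi)) * (\<integral>\<^sup>+x. ennreal (1 / sqrt (2 * pi) * (norm (H x))\<^sup>2) \<partial>lborel)"
    by (rule nn_integral_cmult) measurable
  also have "\<dots> \<le> ennreal (sqrt (2 * pi)) * (ennreal (sqrt (2 * pi)) * Q)" by (intro mult_left_mono fin) auto
  also have "\<dots> = ennreal (2 * pi) * Q" by (simp add: mult.assoc[symmetric] flip: ennreal_mult)
  finally show ?thesis by (simp add: H_def Q_def)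
qed

text \<open>Since s > 3/4, the integrand is at most |x|^(-3/2) for |x| \<ge> 1, and at most 1
  elsewhere.\<close>

lemma bessel_weight_integrable:
  assumes "s > 3/4"
  shows "(\<integral>\<^sup>+\<xi>. ennreal (((1 + \<xi>\<^sup>2) powr (- s / 2))\<^sup>2) \<partial>lborel) < \<infinity>"
proof -
  define p where "p x = ennreal (x powr (- (3 / 2))) * indicator {1..} x" for x :: real
  have [measurable]: "p \<in> borel_measurable borel" unfolding p_def by measurable
  have p: "(\<integral>\<^sup>+x. p x \<partial>lborel) < \<infinity>"
  proof -
    have "(\<integral>\<^sup>+x. p x \<partial>lborel) = ennreal (0 - (\<lambda>x. - 2 * x powr (- (1 / 2))) 1)"
      unfolding p_def
    proof (rule nn_integral_FTC_atLeast[where F="\<lambda>x. - 2 * x powr (- (1 / 2))"])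
      show "DERIV (\<lambda>x. - 2 * x powr (- (1 / 2))) x :> x powr (- (3 / 2))" if "1 \<le> x" for x :: real
        using that by (auto intro!: derivative_eq_intros)
      show "((\<lambda>x::real. - 2 * x powr (- (1 / 2))) \<longlongrightarrow> 0) at_top" by real_asymp
    qed auto
    then show ?thesis by simp
  qed
  have le: "((1 + x\<^sup>2) powr (- s / 2))\<^sup>2 \<le> (if \<bar>x\<bar> \<ge> 1 then \<bar>x\<bar> powr (- (3 / 2)) else 1)" for x :: real
  proof -
    have "((1 + x\<^sup>2) powr (- s / 2))\<^sup>2 = (1 + x\<^sup>2) powr (- s)"
      by (simp add: powr_powr flip: powr_realpow[of 2] powr_numeral)
    also have "\<dots> \<le> (1 + x\<^sup>2) powr (- (3 / 4))" using assms by (intro powr_mono) auto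
    finally have 1: "((1 + x\<^sup>2) powr (- s / 2))\<^sup>2 \<le> (1 + x\<^sup>2) powr (- (3 / 4))" .
    show ?thesis
    proof (cases "\<bar>x\<bar> \<ge> 1")
      case True
      have "(1 + x\<^sup>2) powr (- (3 / 4)) \<le> (\<bar>x\<bar> powr 2) powr (- (3 / 4))"
        using True by (intro powr_mono2') (auto simp: powr_numeral)
      also have "\<dots> = \<bar>x\<bar> powr (- (3 / 2))" unfolding powr_powr by simp
      finally have 2: "(1 + x\<^sup>2) powr (- (3 / 4)) \<le> \<bar>x\<bar> powr (- (3 / 2))" .
      show ?thesis using True 1 2 by (simp only: if_True)
    next
      case False
      have "(1 + x\<^sup>2) powr (- (3 / 4)) \<le> (1 + x\<^sup>2) powr 0" by (rule powr_mono) auto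
      then show ?thesis using 1 False by (auto simp: add_nonneg_eq_0_iff split: if_splits)
    qed
  qed
  have "(\<integral>\<^sup>+\<xi>. ennreal (((1 + \<xi>\<^sup>2) powr (- s / 2))\<^sup>2) \<partial>lborel) \<le> (\<integral>\<^sup>+x. indicator {-1..1} x + (p x + p (- x)) \<partial>lborel)"
  proof (rule nn_integral_mono)
    fix x :: real
    have "ennreal (((1 + x\<^sup>2) powr (- s / 2))\<^sup>2) \<le> ennreal (if \<bar>x\<bar> \<ge> 1 then \<bar>x\<bar> powr (- (3 / 2)) else 1)"
      by (intro ennreal_leI le)
    also have "\<dots> \<le> indicator {-1..1} x + (p x + p (- x))"
      by (auto simp: p_def indicator_def abs_if add_increasing2 add_increasing)
    finally show "ennreal (((1 + x\<^sup>2) powr (- s / 2))\<^sup>2) \<le> indicator {-1..1} x + (p x + p (- x))" .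
  qed
  also have "\<dots> = emeasure lborel {-1..1::real} + ((\<integral>\<^sup>+x. p x \<partial>lborel) + (\<integral>\<^sup>+x. p (- x) \<partial>lborel))"
    by (simp add: nn_integral_add)
  also have "(\<integral>\<^sup>+x. p (- x) \<partial>lborel) = (\<integral>\<^sup>+x. p x \<partial>lborel)"
    using nn_integral_real_affine[of p "-1" 0] by simp
  finally have "(\<integral>\<^sup>+\<xi>. ennreal (((1 + \<xi>\<^sup>2) powr (- s / 2))\<^sup>2) \<partial>lborel) \<le> emeasure lborel {-1..1::real} + ((\<integral>\<^sup>+x. p x \<partial>lborel) + (\<integral>\<^sup>+x. p x \<partial>lborel))" .
  moreover have "emeasure lborel {-1..1::real} + ((\<integral>\<^sup>+x. p x \<partial>lborel) + (\<integral>\<^sup>+x. p x \<partial>lborel)) < \<infinity>"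
    using p by auto
  ultimately show ?thesis by (rule le_less_trans)
qed

lemma fourier_bound:
  assumes [measurable]: "\<phi> \<in> borel_measurable borel"
  shows "fourier \<phi> \<in> borel_measurable borel" "norm (fourier \<phi> \<xi>) \<le> (LINT x|lborel. norm (\<phi> x))"
proof -
  have eq: "fourier \<phi> = (\<lambda>\<xi>. LINT x|lborel. \<phi> x * exp (- \<i> * of_real (x * \<xi>)))"
    unfolding fourier_def by (rule ext, rule integral_completion) measurable
  show "fourier \<phi> \<in> borel_measurable borel" unfolding eq by measurable
  have "norm (fourier \<phi> \<xi>) \<le> (LINT x|lborel. norm (\<phi> x * exp (- \<i> * of_real (x * \<xi>))))"
    unfolding eq by (rule integral_norm_bound)
  then show "norm (fourier \<phi> \<xi>) \<le> (LINT x|lborel. norm (\<phi> x))" by (simp add: norm_mult)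
qed

text \<open>An L^1 bound on \<phi> bounds its Fourier transform, and the symbol of J^(-s) is in L^2;
  \<open>plancherel_le\<close> then bounds the Bessel potential.\<close>

lemma bessel_L2:
  assumes s: "s > 3/4" and \<phi> [measurable]: "\<phi> \<in> borel_measurable borel"
    and A: "(LINT x|lborel. norm (\<phi> x)) \<le> A"
  shows "bessel (- s) \<phi> \<in> borel_measurable borel"
    "(\<integral>\<^sup>+x. ennreal ((norm (bessel (- s) \<phi> x))\<^sup>2) \<partial>lborel) \<le> ennreal (A\<^sup>2) * (\<integral>\<^sup>+\<xi>. ennreal (((1 + \<xi>\<^sup>2) powr (- s / 2))\<^sup>2) \<partial>lborel)"
proof -
  define h where "h \<xi> = of_real ((1 + \<xi>\<^sup>2) powr (- s / 2)) * fourier \<phi> \<xi>" for \<xi>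
  note fourier_bound(1)[OF \<phi>, measurable]
  have hm [measurable]: "h \<in> borel_measurable borel" unfolding h_def by measurable
  have eq: "bessel (- s) \<phi> = (\<lambda>x. 1 / of_real (2 * pi) * (LINT \<xi>|lborel. h \<xi> * iexp (x * \<xi>)))"
    unfolding bessel_def h_def by (intro ext arg_cong[where f="\<lambda>z. _ * z"] integral_completion) measurable
  show "bessel (- s) \<phi> \<in> borel_measurable borel" unfolding eq by measurable
  have hle: "(norm (h \<xi>))\<^sup>2 \<le> A\<^sup>2 * ((1 + \<xi>\<^sup>2) powr (- s / 2))\<^sup>2" for \<xi>
    using order_trans[OF fourier_bound(2)[OF \<phi>, of \<xi>] A]
    by (auto simp: h_def norm_mult power_mult_distrib mult.commute[of "A\<^sup>2"] intro!: mult_left_mono power_mono)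
  have "(\<integral>\<^sup>+x. ennreal ((norm (bessel (- s) \<phi> x))\<^sup>2) \<partial>lborel) \<le> (\<integral>\<^sup>+\<xi>. ennreal ((norm (h \<xi>))\<^sup>2) \<partial>lborel)"
  proof (cases "integrable lborel h")
    case True
    have "(\<integral>\<^sup>+x. ennreal ((norm (bessel (- s) \<phi> x))\<^sup>2) \<partial>lborel) = ennreal ((1 / (2 * pi))\<^sup>2) * (\<integral>\<^sup>+x. ennreal ((norm (LINT \<xi>|lborel. h \<xi> * iexp (x * \<xi>)))\<^sup>2) \<partial>lborel)"
    proof -
      have "ennreal ((norm (1 / of_real (2 * pi) * z))\<^sup>2) = ennreal ((1 / (2 * pi))\<^sup>2) * ennreal ((norm z)\<^sup>2)" for z :: complex
        by (subst ennreal_mult[symmetric]) (auto simp: norm_mult norm_divide power_mult_distrib power_divide)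
      then show ?thesis unfolding eq by (simp only:) (rule nn_integral_cmult, measurable)
    qed
    also have "\<dots> \<le> ennreal ((1 / (2 * pi))\<^sup>2) * (ennreal (2 * pi) * (\<integral>\<^sup>+\<xi>. ennreal ((norm (h \<xi>))\<^sup>2) \<partial>lborel))"
      by (intro mult_left_mono plancherel_le True) auto
    also have "\<dots> = ennreal (1 / (2 * pi)) * (\<integral>\<^sup>+\<xi>. ennreal ((norm (h \<xi>))\<^sup>2) \<partial>lborel)"
      by (simp add: mult.assoc[symmetric] power2_eq_square flip: ennreal_mult)
    also have "\<dots> \<le> ennreal 1 * (\<integral>\<^sup>+\<xi>. ennreal ((norm (h \<xi>))\<^sup>2) \<partial>lborel)"
      using pi_gt3 by (intro mult_right_mono ennreal_leI) auto
    finally show ?thesis by simp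
  next
    \<comment> \<open>The exponential has modulus 1, so none of the integrals in
      \<open>bessel\<close> converges and all are 0 by convention.\<close>
    case False
    have "\<not> integrable lborel (\<lambda>\<xi>. h \<xi> * iexp (x * \<xi>))" for x
    proof
      assume "integrable lborel (\<lambda>\<xi>. h \<xi> * iexp (x * \<xi>))"
      then have "integrable lborel h"
        by (rule Bochner_Integration.integrable_bound) (auto simp: norm_mult)
      with False show False ..
    qed
    then show ?thesis by (simp add: eq not_integrable_integral_eq)
  qed
  also have "\<dots> \<le> (\<integral>\<^sup>+\<xi>. ennreal (A\<^sup>2) * ennreal (((1 + \<xi>\<^sup>2) powr (- s / 2))\<^sup>2) \<partial>lborel)"
    using hle by (intro nn_integral_mono) (auto simp flip: ennreal_mult intro: ennreal_leI)
  also have "\<dots> = ennreal (A\<^sup>2) * (\<integral>\<^sup>+\<xi>. ennreal (((1 + \<xi>\<^sup>2) powr (- s / 2))\<^sup>2) \<partial>lborel)"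
    by (rule nn_integral_cmult) measurable
  finally show "(\<integral>\<^sup>+x. ennreal ((norm (bessel (- s) \<phi> x))\<^sup>2) \<partial>lborel) \<le> ennreal (A\<^sup>2) * (\<integral>\<^sup>+\<xi>. ennreal (((1 + \<xi>\<^sup>2) powr (- s / 2))\<^sup>2) \<partial>lborel)" .
qed

lemma L2_pairing:
  fixes g :: "real \<Rightarrow> real" and \<beta> :: "real \<Rightarrow> complex"
  assumes g: "sq_integrable lebesgue g" and \<beta>: "\<beta> \<in> borel_measurable borel"
    and Q: "(\<integral>\<^sup>+x. ennreal ((norm (\<beta> x))\<^sup>2) \<partial>lborel) \<le> ennreal (Q\<^sup>2)" and Q0: "Q \<ge> 0"
  shows "integrable lebesgue (\<lambda>x. g x *\<^sub>R \<beta> x)" "norm (LINT x|lebesgue. g x *\<^sub>R \<beta> x) \<le> Q * L2_norm lebesgue g"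
proof -
  have gm [measurable]: "g \<in> borel_measurable lebesgue" and gi: "integrable lebesgue (\<lambda>x. (g x)\<^sup>2)"
    using g by (auto simp: sq_integrable_def)
  have \<beta>m [measurable]: "\<beta> \<in> borel_measurable lebesgue" using measurable_completion[of \<beta> lborel borel] \<beta> by simp
  have "(\<integral>\<^sup>+x. ennreal \<bar>g x\<bar> * ennreal (norm (\<beta> x)) \<partial>lebesgue)\<^sup>2
    \<le> (\<integral>\<^sup>+x. (ennreal \<bar>g x\<bar>)\<^sup>2 \<partial>lebesgue) * (\<integral>\<^sup>+x. (ennreal (norm (\<beta> x)))\<^sup>2 \<partial>lebesgue)"
    by (rule Cauchy_Schwarz_nn_integral) measurable
  also have "(\<integral>\<^sup>+x. (ennreal \<bar>g x\<bar>)\<^sup>2 \<partial>lebesgue) = ennreal (LINT x|lebesgue. (g x)\<^sup>2)"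
    by (simp add: ennreal_power nn_integral_eq_integral gi)
  also have "(\<integral>\<^sup>+x. (ennreal (norm (\<beta> x)))\<^sup>2 \<partial>lebesgue) = (\<integral>\<^sup>+x. ennreal ((norm (\<beta> x))\<^sup>2) \<partial>lborel)"
    by (simp add: ennreal_power nn_integral_completion)
  also have "ennreal (LINT x|lebesgue. (g x)\<^sup>2) * (\<integral>\<^sup>+x. ennreal ((norm (\<beta> x))\<^sup>2) \<partial>lborel) \<le> ennreal (LINT x|lebesgue. (g x)\<^sup>2) * ennreal (Q\<^sup>2)"
    by (rule mult_left_mono[OF Q]) simp
  also have "\<dots> = (ennreal (Q * L2_norm lebesgue g))\<^sup>2"
    using Q0 by (simp add: ennreal_power L2_norm_def power_mult_distrib mult.commute flip: ennreal_mult)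
  finally have *: "(\<integral>\<^sup>+x. ennreal \<bar>g x\<bar> * ennreal (norm (\<beta> x)) \<partial>lebesgue)\<^sup>2 \<le> (ennreal (Q * L2_norm lebesgue g))\<^sup>2" .
  have X: "X \<le> ennreal c" if le: "X\<^sup>2 \<le> (ennreal c)\<^sup>2" and c: "c \<ge> 0" for X c
  proof (cases X)
    case (real r)
    then show ?thesis using le c by (simp add: ennreal_power power2_le_iff_abs_le abs_le_square_iff[symmetric])
  next
    case top
    then show ?thesis using le c by (simp add: ennreal_power top_unique)
  qed
  have "(\<integral>\<^sup>+x. ennreal \<bar>g x\<bar> * ennreal (norm (\<beta> x)) \<partial>lebesgue) \<le> ennreal (Q * L2_norm lebesgue g)"
    by (rule X[OF *]) (use Q0 in \<open>simp add: L2_norm_def\<close>)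
  then have le: "(\<integral>\<^sup>+x. ennreal (norm (g x *\<^sub>R \<beta> x)) \<partial>lebesgue) \<le> ennreal (Q * L2_norm lebesgue g)"
    by (simp add: ennreal_mult)
  show i: "integrable lebesgue (\<lambda>x. g x *\<^sub>R \<beta> x)"
    by (rule integrableI_bounded) (use le in \<open>auto simp: le_less_trans\<close>)
  have "ennreal (norm (LINT x|lebesgue. g x *\<^sub>R \<beta> x)) \<le> ennreal (Q * L2_norm lebesgue g)"
    by (rule order_trans[OF integral_norm_bound_ennreal[OF i] le])
  then show "norm (LINT x|lebesgue. g x *\<^sub>R \<beta> x) \<le> Q * L2_norm lebesgue g"
    using Q0 by (simp add: L2_norm_def ennreal_le_iff)
qed

lemma schwartz_of_real:
  assumes sm: "smooth \<phi>" and out: "\<And>x. x \<notin> {a..b} \<Longrightarrow> \<phi> x = 0"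
  shows "schwartz (\<lambda>x. complex_of_real (\<phi> x))"
proof -
  let ?f = "\<lambda>n x. complex_of_real (D n \<phi> x)"
  have "(?f n has_vector_derivative ?f (Suc n) x) (at x)" for n x
    by (rule has_vector_derivative_of_real[OF smooth_D_real[OF sm]])
  from smooth_sequence[of ?f, OF this]
  have s: "smooth (\<lambda>x. complex_of_real (\<phi> x))" and Dn: "D n (\<lambda>x. complex_of_real (\<phi> x)) = ?f n" for n by auto
  have "\<exists>C. \<forall>x. \<bar>x\<bar> ^ m * norm (?f n x) \<le> C" for m n
  proof -
    have "continuous_on {a..b} (\<lambda>x. \<bar>x\<bar> ^ m * norm (?f n x))"
      by (intro continuous_intros smooth_D_continuous sm)
    then have "compact ((\<lambda>x. \<bar>x\<bar> ^ m * norm (?f n x)) ` {a..b})" by (rule compact_continuous_image) simp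
    from compact_imp_bounded[OF this] obtain C where "\<forall>z\<in>(\<lambda>x. \<bar>x\<bar> ^ m * norm (?f n x)) ` {a..b}. norm z \<le> C"
      unfolding bounded_iff by blast
    then have C: "norm (\<bar>x\<bar> ^ m * norm (?f n x)) \<le> C" if "x \<in> {a..b}" for x using that by blast
    have "\<bar>x\<bar> ^ m * norm (?f n x) \<le> max C 0" for x
    proof (cases "x \<in> {a..b}")
      case True
      with C[of x] show ?thesis by simp
    next
      case False
      have "D n \<phi> x = 0" by (rule D_zero_outside[OF sm _ out False]) auto
      then show ?thesis by simp
    qed
    then show ?thesis by blast
  qed
  with s Dn show ?thesis by (simp add: schwartz_def)
qed

text \<open>The L^2 norm of the symbol of J^(-s): up to normalisation, the constant of the embedding
  of H^s into bounded functions.\<close>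

definition sobolev_const :: "real \<Rightarrow> real" where
  "sobolev_const s = sqrt (enn2real (\<integral>\<^sup>+\<xi>. ennreal (((1 + \<xi>\<^sup>2) powr (- s / 2))\<^sup>2) \<partial>lborel))"

lemma bessel_L2':
  assumes s: "s > 3/4" and \<phi>: "\<phi> \<in> borel_measurable borel" and A: "(LINT x|lborel. norm (\<phi> x)) \<le> A" "A \<ge> 0"
  shows "(\<integral>\<^sup>+x. ennreal ((norm (bessel (- s) \<phi> x))\<^sup>2) \<partial>lborel) \<le> ennreal ((A * sobolev_const s)\<^sup>2)"
  using bessel_L2(2)[OF s \<phi> A(1)] bessel_weight_integrable[OF s]
  by (simp add: sobolev_const_def power_mult_distrib ennreal_mult less_top)

text \<open>Test the Bessel potential against mollifiers, whose Fourier transforms are bounded by 1.\<close>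

lemma sobolev_sup:
  assumes s: "s > 3/4" and g: "sq_integrable lebesgue g" and eq: "bessel_deriv_eq (- s) 0 g f"
    and h: "continuous_on UNIV h" and ae: "AE x in lebesgue. h x = f x"
  shows "\<bar>h x\<bar> \<le> sobolev_const s * L2_norm lebesgue g"
proof -
  have "\<bar>moll e 0 h x\<bar> \<le> sobolev_const s * L2_norm lebesgue g" if e: "e > 0" for e
  proof -
    define \<phi> where "\<phi> y = complex_of_real (ker e x y)" for y
    have sch: "schwartz \<phi>" unfolding \<phi>_def by (rule schwartz_of_real[OF D_ker(1)[OF e] ker_outside[OF e]])
    have kc: "continuous_on UNIV (ker e x)" using smooth_D_continuous[OF D_ker(1)[OF e], of UNIV 0] by simp
    have \<phi>m: "\<phi> \<in> borel_measurable borel" unfolding \<phi>_def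
      by (intro borel_measurable_continuous_onI continuous_intros kc)
    have "(LINT y|lborel. norm (\<phi> y)) = (LINT y|lborel. rh 0 ((x - y) / e) / e ^ Suc 0 * 1)"
      unfolding \<phi>_def norm_of_real using e by (simp add: ker_def rh_0 rho_nonneg)
    also have "\<dots> = 1"
      using moll_eq_ker[OF e, of "\<lambda>_. 1" 0 x] rho_integral by (simp add: moll_def rh_0)
    finally have A: "(LINT y|lborel. norm (\<phi> y)) \<le> 1" by simp
    have L: "integrable lebesgue (\<lambda>y. f y *\<^sub>R \<phi> y)" "(LINT y|lebesgue. f y *\<^sub>R \<phi> y) = (LINT y|lebesgue. g y *\<^sub>R bessel (- s) \<phi> y)"
      using eq sch by (auto simp: bessel_deriv_eq_def)
    have hm: "(\<lambda>y. h y *\<^sub>R \<phi> y) \<in> borel_measurable borel"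
      unfolding \<phi>_def by (intro borel_measurable_continuous_onI continuous_intros kc h)
    have "(LINT y|lebesgue. f y *\<^sub>R \<phi> y) = (LINT y|lebesgue. h y *\<^sub>R \<phi> y)"
      by (rule integral_cong_AE) (use ae L(1) measurable_completion[of "\<lambda>y. h y *\<^sub>R \<phi> y" lborel borel] hm in auto)
    also have "\<dots> = (LINT y|lborel. h y *\<^sub>R \<phi> y)" by (rule integral_completion) (use hm in simp)
    also have "\<dots> = (LINT y|lborel. complex_of_real (D 0 (ker e x) y * h y))" by (simp add: \<phi>_def scaleR_conv_of_real mult.commute)
    also have "\<dots> = of_real (moll e 0 h x)"
      unfolding integral_complex_of_real moll_eq_D_ker[OF e h] by simp
    finally have "of_real (moll e 0 h x) = (LINT y|lebesgue. g y *\<^sub>R bessel (- s) \<phi> y)" using L(2) by simp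
    then have "\<bar>moll e 0 h x\<bar> = norm (LINT y|lebesgue. g y *\<^sub>R bessel (- s) \<phi> y)"
      by (metis norm_of_real)
    also have "\<dots> \<le> sobolev_const s * L2_norm lebesgue g"
      by (rule L2_pairing(2)[OF g bessel_L2(1)[OF s \<phi>m A]]) (use bessel_L2'[OF s \<phi>m A] in \<open>auto simp: sobolev_const_def\<close>)
    finally show ?thesis .
  qed
  then have "eventually (\<lambda>e. \<bar>moll e 0 h x\<bar> \<le> sobolev_const s * L2_norm lebesgue g) (at_right 0)"
    by (auto simp: eventually_at_right_field intro: exI[of _ 1])
  then show ?thesis
    by (rule tendsto_upperbound[OF tendsto_rabs[OF moll_tendsto[OF h]]]) simp
qed

text \<open>\<open>sobolev_sup\<close> holds for every admissible g, in particular for the one that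
  \<open>SOME\<close> selects in \<open>Hs_norm\<close>.\<close>

lemma Hs_sup:
  assumes "s > 3/4" "f \<in> Hs s" "continuous_on UNIV h" "AE x in lebesgue. h x = f x"
  shows "\<bar>h x\<bar> \<le> sobolev_const s * Hs_norm s f"
proof -
  define g where "g = (SOME g. sq_integrable lebesgue g \<and> bessel_deriv_eq (- s) 0 g f)"
  have "\<exists>g. sq_integrable lebesgue g \<and> bessel_deriv_eq (- s) 0 g f"
    using assms(2) by (simp add: Hs_def)
  from someI_ex[OF this] show ?thesis
    using sobolev_sup[OF assms(1) _ _ assms(3,4), of g x] by (simp add: Hs_norm_def g_def)
qed

text \<open>Allows \<open>Hs_sup\<close> to be applied to differences u(t') - u(t). For the pairings
  to be additive they must be integrable, which \<open>L2_pairing\<close> supplies for the Bessel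
  potential.\<close>

lemma Hs_diff:
  assumes s: "s > 3/4" and f1: "f1 \<in> Hs s" and f2: "f2 \<in> Hs s"
  shows "(\<lambda>x. f1 x - f2 x) \<in> Hs s"
proof -
  obtain g1 g2 where g1: "sq_integrable lebesgue g1" "bessel_deriv_eq (- s) 0 g1 f1"
    and g2: "sq_integrable lebesgue g2" "bessel_deriv_eq (- s) 0 g2 f2"
    using f1 f2 by (auto simp: Hs_def)
  have "sq_integrable lebesgue (\<lambda>x. g1 x - g2 x)"
    unfolding sq_integrable_def
  proof
    have m [measurable]: "g1 \<in> borel_measurable lebesgue" "g2 \<in> borel_measurable lebesgue" using g1 g2 by (auto simp: sq_integrable_def)
    show "(\<lambda>x. g1 x - g2 x) \<in> borel_measurable lebesgue" by measurable
    show "integrable lebesgue (\<lambda>x. (g1 x - g2 x)\<^sup>2)"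
    proof (rule Bochner_Integration.integrable_bound)
      show "integrable lebesgue (\<lambda>x. 2 * (g1 x)\<^sup>2 + 2 * (g2 x)\<^sup>2)" using g1 g2 by (simp add: sq_integrable_def)
      show "AE x in lebesgue. norm ((g1 x - g2 x)\<^sup>2) \<le> norm (2 * (g1 x)\<^sup>2 + 2 * (g2 x)\<^sup>2)"
      proof (rule AE_I2)
        fix x
        have "0 \<le> (g1 x + g2 x)\<^sup>2" by simp
        then show "norm ((g1 x - g2 x)\<^sup>2) \<le> norm (2 * (g1 x)\<^sup>2 + 2 * (g2 x)\<^sup>2)"
          unfolding real_norm_def abs_power2 by (subst abs_of_nonneg) (auto simp: power2_sum power2_diff)
      qed
    qed measurable
  qed
  moreover have "bessel_deriv_eq (- s) 0 (\<lambda>x. g1 x - g2 x) (\<lambda>x. f1 x - f2 x)"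
    unfolding bessel_deriv_eq_def
  proof (intro allI impI)
    fix \<phi> :: "real \<Rightarrow> complex" assume \<phi>: "schwartz \<phi>"
    have "continuous_on UNIV \<phi>" using \<phi> by (auto simp: schwartz_def smooth_def dest: spec[of _ 0])
    then have \<phi>m: "\<phi> \<in> borel_measurable borel" by (rule borel_measurable_continuous_onI)
    define A where "A = (LINT x|lborel. norm (\<phi> x))"
    have A0: "A \<ge> 0" by (simp add: A_def)
    note B = bessel_L2(1)[OF s \<phi>m, of A] bessel_L2'[OF s \<phi>m, of A]
    have i: "integrable lebesgue (\<lambda>x. g x *\<^sub>R bessel (- s) \<phi> x)" if "sq_integrable lebesgue g" for g
      by (rule L2_pairing(1)[OF that, where Q="A * sobolev_const s"]) (use B A0 in \<open>auto simp: A_def sobolev_const_def\<close>)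
    from g1(2) g2(2) \<phi>
    have "integrable lebesgue (\<lambda>x. g1 x *\<^sub>R \<phi> x)" "integrable lebesgue (\<lambda>x. g2 x *\<^sub>R \<phi> x)"
      "integrable lebesgue (\<lambda>x. f1 x *\<^sub>R \<phi> x)" "integrable lebesgue (\<lambda>x. f2 x *\<^sub>R \<phi> x)"
      "(LINT x|lebesgue. f1 x *\<^sub>R \<phi> x) = (LINT x|lebesgue. g1 x *\<^sub>R bessel (- s) \<phi> x)"
      "(LINT x|lebesgue. f2 x *\<^sub>R \<phi> x) = (LINT x|lebesgue. g2 x *\<^sub>R bessel (- s) \<phi> x)"
      by (auto simp: bessel_deriv_eq_def)
    then show "integrable lebesgue (\<lambda>x. (g1 x - g2 x) *\<^sub>R \<phi> x) \<and> integrable lebesgue (\<lambda>x. (f1 x - f2 x) *\<^sub>R \<phi> x) \<and>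
        (LINT x|lebesgue. (f1 x - f2 x) *\<^sub>R \<phi> x) = (-1) ^ 0 * (LINT x|lebesgue. (g1 x - g2 x) *\<^sub>R (pd 1 ^^ 0) (bessel (- s) \<phi>) x)"
      using i[OF g1(1)] i[OF g2(1)] by (simp add: scaleR_diff_left)
  qed
  ultimately show ?thesis unfolding Hs_def by blast
qed

section \<open>The continuous representative of the solution\<close>

text \<open>The Sobolev embedding of u(t') - u(t) makes w(t') close to w(t) uniformly in x, so
  continuity in x at fixed t gives joint continuity. Times are clamped to [-T, T] to obtain a
  function on the whole plane.\<close>

lemma curve_continuous:
  assumes s: "s > 3/4" and T: "T > 0" and u: "continuous_curve (Hs s) (Hs_norm s) T u"
    and w: "\<And>t. t \<in> {-T..T} \<Longrightarrow> continuous_on UNIV (w t)"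
    and ae: "\<And>t. t \<in> {-T..T} \<Longrightarrow> AE x in lebesgue. w t x = u t x"
  shows "continuous_on UNIV (\<lambda>(t, x). w (max (-T) (min T t)) x)"
    and "\<exists>M\<ge>1. \<forall>t\<in>{-T..T}. \<forall>x. \<bar>w t x\<bar> \<le> M"
proof -
  have uH: "u t \<in> Hs s" if "t \<in> {-T..T}" for t using u that by (simp add: continuous_curve_def)
  have ulim: "((\<lambda>t'. Hs_norm s (\<lambda>x. u t' x - u t x)) \<longlongrightarrow> 0) (at t within {-T..T})" if "t \<in> {-T..T}" for t
    using u that by (simp add: continuous_curve_def)
  have near: "\<exists>d>0. \<forall>t'\<in>{-T..T}. \<bar>t' - t\<bar> < d \<longrightarrow> (\<forall>x. \<bar>w t' x - w t x\<bar> < e)" if t: "t \<in> {-T..T}" and e: "e > 0" for t e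
  proof -
    have "((\<lambda>t'. sobolev_const s * Hs_norm s (\<lambda>x. u t' x - u t x)) \<longlongrightarrow> 0) (at t within {-T..T})"
      using tendsto_mult_right_zero[OF ulim[OF t]] .
    from tendstoD[OF this e] obtain d where d: "d > 0"
      "\<And>t'. t' \<in> {-T..T} \<Longrightarrow> t' \<noteq> t \<Longrightarrow> dist t' t < d \<Longrightarrow> \<bar>sobolev_const s * Hs_norm s (\<lambda>x. u t' x - u t x)\<bar> < e"
      unfolding eventually_at by (auto simp: dist_real_def)
    have "\<bar>w t' x - w t x\<bar> < e" if "t' \<in> {-T..T}" "\<bar>t' - t\<bar> < d" for t' x
    proof (cases "t' = t")
      case False
      have "\<bar>w t' x - w t x\<bar> \<le> sobolev_const s * Hs_norm s (\<lambda>x. u t' x - u t x)"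
      proof (rule Hs_sup[OF s Hs_diff[OF s uH[OF that(1)] uH[OF t]], where h="\<lambda>x. w t' x - w t x"])
        show "continuous_on UNIV (\<lambda>x. w t' x - w t x)" by (intro continuous_intros w that t)
        show "AE x in lebesgue. w t' x - w t x = u t' x - u t x"
          using ae[OF that(1)] ae[OF t] by eventually_elim simp
      qed
      also have "\<dots> < e" using d(2)[OF that(1) False] that(2) by (simp add: dist_real_def)
      finally show ?thesis .
    qed (use e in simp)
    with d(1) show ?thesis by blast
  qed
  have "continuous_on ({-T..T} \<times> UNIV) (\<lambda>p. w (fst p) (snd p))"
    unfolding continuous_on_iff
  proof (intro ballI allI impI)
    fix p :: "real \<times> real" and e :: real assume p: "p \<in> {-T..T} \<times> UNIV" and e: "e > 0"
    obtain t x where tx: "p = (t, x)" "t \<in> {-T..T}" using p by auto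
    obtain d1 where d1: "d1 > 0" "\<And>t' x. t' \<in> {-T..T} \<Longrightarrow> \<bar>t' - t\<bar> < d1 \<Longrightarrow> \<bar>w t' x - w t x\<bar> < e / 2"
      using near[OF tx(2), of "e / 2"] e by auto
    obtain d2 where d2: "d2 > 0" "\<And>x'. dist x' x < d2 \<Longrightarrow> dist (w t x') (w t x) < e / 2"
      using w[OF tx(2)] e unfolding continuous_on_iff by (metis UNIV_I half_gt_zero)
    have "dist (w (fst p') (snd p')) (w (fst p) (snd p)) < e" if p': "p' \<in> {-T..T} \<times> UNIV" "dist p' p < min d1 d2" for p'
    proof -
      have "\<bar>fst p' - t\<bar> < d1" using dist_fst_le[of p' p] that tx by (simp add: dist_real_def)
      then have 1: "\<bar>w (fst p') (snd p') - w t (snd p')\<bar> < e / 2" using d1(2) p'(1) by auto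
      have "dist (snd p') x < d2" using dist_snd_le[of p' p] that tx by simp
      from d2(2)[OF this] 1 show ?thesis unfolding tx dist_real_def fst_conv snd_conv by linarith
    qed
    then show "\<exists>d>0. \<forall>p'\<in>{-T..T} \<times> UNIV. dist p' p < d \<longrightarrow> dist (w (fst p') (snd p')) (w (fst p) (snd p)) < e"
      using d1(1) d2(1) by (intro exI[of _ "min d1 d2"]) auto
  qed
  moreover have "continuous_on UNIV (\<lambda>p::real \<times> real. (max (-T) (min T (fst p)), snd p))"
    by (intro continuous_intros)
  ultimately have "continuous_on UNIV (\<lambda>p. w (fst (max (-T) (min T (fst p)), snd p)) (snd (max (-T) (min T (fst p)), snd p)))"
    by (rule continuous_on_compose2) (use T in auto)
  then show "continuous_on UNIV (\<lambda>(t, x). w (max (-T) (min T t)) x)"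
    by (simp add: split_beta)
  define b where "b t = sobolev_const s * Hs_norm s (u t)" for t
  have b: "\<bar>w t x\<bar> \<le> b t" if "t \<in> {-T..T}" for t x
    unfolding b_def by (rule Hs_sup[OF s uH[OF that] w[OF that] ae[OF that]])
  define d where "d t = (SOME d. d > 0 \<and> (\<forall>t'\<in>{-T..T}. \<bar>t' - t\<bar> < d \<longrightarrow> (\<forall>x. \<bar>w t' x - w t x\<bar> < 1)))" for t
  have d: "d t > 0 \<and> (\<forall>t'\<in>{-T..T}. \<bar>t' - t\<bar> < d t \<longrightarrow> (\<forall>x. \<bar>w t' x - w t x\<bar> < 1))" if "t \<in> {-T..T}" for t
    unfolding d_def by (rule someI_ex) (use near[OF that zero_less_one] in blast)
  \<comment> \<open>Finitely many times c such that w stays within 1 of w(c) near c: compactness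
    yields a global bound without comparing norms of u at different times.\<close>
  obtain C where C: "C \<subseteq> {-T..T}" "finite C" "{-T..T} \<subseteq> (\<Union>c\<in>C. ball c (d c))"
  proof (rule compactE_image[of "{-T..T}" "{-T..T}" "\<lambda>c. ball c (d c)"])
    show "{-T..T} \<subseteq> (\<Union>c\<in>{-T..T}. ball c (d c))" using d by force
  qed auto
  have "\<bar>w t x\<bar> \<le> 1 + (\<Sum>c\<in>C. b c)" if t: "t \<in> {-T..T}" for t x
  proof -
    obtain c where c: "c \<in> C" "t \<in> ball c (d c)" using C(3) t by blast
    have cT: "c \<in> {-T..T}" using C(1) c(1) by auto
    have "\<bar>t - c\<bar> < d c" using c(2) by (simp add: dist_real_def abs_minus_commute)
    then have "\<bar>w t x - w c x\<bar> < 1" using d[OF cT] t by blast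
    moreover have "\<bar>w c x\<bar> \<le> b c" by (rule b[OF cT])
    moreover have "b c \<le> (\<Sum>c\<in>C. b c)"
      by (rule member_le_sum[OF c(1) _ C(2)]) (use b C(1) order_trans[OF abs_ge_zero] in blast)
    ultimately show ?thesis by linarith
  qed
  moreover have "(\<Sum>c\<in>C. b c) \<ge> 0"
    by (rule sum_nonneg) (use b C(1) order_trans[OF abs_ge_zero] in blast)
  ultimately show "\<exists>M\<ge>1. \<forall>t\<in>{-T..T}. \<forall>x. \<bar>w t x\<bar> \<le> M"
    by (intro exI[of _ "1 + (\<Sum>c\<in>C. b c)"]) auto
qed

section \<open>Time slices: Lipschitz functions with a bounded weak derivative\<close>

lemma weak_deriv_continuous:
  assumes wd: "has_weak_deriv UNIV 1 f v" and h: "continuous_on UNIV h" and ae: "AE x in lebesgue. h x = f x"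
    and v: "v \<in> borel_measurable borel" and \<phi>: "test_function UNIV \<phi>"
  shows "(LINT x|lborel. v x * \<phi> x) = - (LINT x|lborel. h x * D 1 \<phi> x)"
proof -
  have sm: "smooth \<phi>" using \<phi> by (simp add: test_function_def)
  have [measurable]: "h \<in> borel_measurable borel" "D n \<phi> \<in> borel_measurable borel" for n
    by (auto intro!: borel_measurable_continuous_onI h smooth_D_continuous[OF sm])
  note [measurable] = v
  have m: "\<phi> \<in> borel_measurable borel" using \<open>D 0 \<phi> \<in> borel_measurable borel\<close> by simp
  note [measurable] = m
  have hl: "h \<in> borel_measurable lebesgue" using measurable_completion[of h lborel borel] by simp
  have "f \<in> borel_measurable lebesgue"
    by (rule borel_measurable_AE[OF hl ae])
  moreover have "D 1 \<phi> \<in> borel_measurable lebesgue" by (rule measurable_completion) measurable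
  ultimately have mm: "(\<lambda>x. f x * D 1 \<phi> x) \<in> borel_measurable lebesgue" "(\<lambda>x. h x * D 1 \<phi> x) \<in> borel_measurable lebesgue"
    using hl by (auto intro: borel_measurable_times)
  have "(LINT x|lborel. v x * \<phi> x) = (LINT x|lebesgue. v x * \<phi> x)" by (rule integral_completion[symmetric]) measurable
  also have "\<dots> = - (LINT x|lebesgue. f x * D 1 \<phi> x)" using wd \<phi> by (auto simp: has_weak_deriv_def)
  also have "(LINT x|lebesgue. f x * D 1 \<phi> x) = (LINT x|lebesgue. h x * D 1 \<phi> x)"
    by (rule integral_cong_AE[OF mm]) (use ae in auto)
  also have "\<dots> = (LINT x|lborel. h x * D 1 \<phi> x)" by (rule integral_completion) measurable
  finally show ?thesis .
qed

locale lipschitz_weak_deriv =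
  fixes h v :: "real \<Rightarrow> real" and L :: real
  assumes h: "continuous_on UNIV h" and vm [measurable]: "v \<in> borel_measurable borel"
    and vL: "AE x in lborel. \<bar>v x\<bar> \<le> L" and L: "L \<ge> 0"
    and weak: "\<And>\<phi>. test_function UNIV \<phi> \<Longrightarrow> (LINT x|lborel. v x * \<phi> x) = - (LINT x|lborel. h x * D 1 \<phi> x)"
begin

lemma moll_1_bound:
  assumes e: "e > 0"
  shows "\<bar>moll e 1 h x\<bar> \<le> L"
proof -
  have t: "test_function UNIV (ker e x)"
    unfolding test_function_def using D_ker(1)[OF e] ker_outside[OF e] by (intro conjI exI[of _ "{x - e..x + e}"]) auto
  have kc: "continuous_on UNIV (ker e x)" using smooth_D_continuous[OF D_ker(1)[OF e], of UNIV 0] by simp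
  have ki: "integrable lborel (ker e x)" by (rule compact_support_integral(1)[OF kc ker_outside[OF e]])
  have [measurable]: "ker e x \<in> borel_measurable borel" by (rule borel_measurable_continuous_onI[OF kc])
  have k0: "ker e x y \<ge> 0" for y using e by (simp add: ker_def rho_nonneg)
  have k1: "(LINT y|lborel. ker e x y) = 1"
    using moll_eq_D_ker[OF e, of "\<lambda>_. 1" 0 x] rho_integral by (simp add: moll_def rh_0)
  have bd: "AE y in lborel. norm (v y * ker e x y) \<le> norm (L * ker e x y)"
    using vL by eventually_elim (use k0 L in \<open>auto simp: abs_mult intro!: mult_right_mono\<close>)
  have i: "integrable lborel (\<lambda>y. v y * ker e x y)"
    by (rule Bochner_Integration.integrable_bound[OF _ _ bd]) (use ki in auto)
  have "moll e 1 h x = - (LINT y|lborel. h y * D 1 (ker e x) y)"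
    using moll_eq_D_ker[OF e h, of 1 x] by (simp add: mult.commute)
  also have "\<dots> = (LINT y|lborel. v y * ker e x y)" using weak[OF t] by simp
  finally have "\<bar>moll e 1 h x\<bar> = norm (LINT y|lborel. v y * ker e x y)" by simp
  also have "\<dots> \<le> (LINT y|lborel. norm (v y * ker e x y))" by (rule integral_norm_bound)
  also have "\<dots> \<le> (LINT y|lborel. L * ker e x y)"
    by (rule integral_mono_AE[OF integrable_norm[OF i]]) (use ki bd k0 L in \<open>auto simp: abs_mult\<close>)
  also have "\<dots> = L" by (simp add: k1)
  finally show ?thesis .
qed

text \<open>The mean value theorem for the mollifications of h, whose derivatives are bounded by L
  because v may be tested with \<open>ker\<close>; then e tends to 0.\<close>

lemma lipschitz: "\<bar>h x - h y\<bar> \<le> L * \<bar>x - y\<bar>"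
proof -
  have "\<bar>moll e 0 h x - moll e 0 h y\<bar> \<le> L * \<bar>x - y\<bar>" if e: "e > 0" for e
  proof -
    have "norm (moll e 0 h x - moll e 0 h y) \<le> L * norm (x - y)"
    proof (rule field_differentiable_bound[of UNIV "moll e 0 h" "moll e 1 h"])
      fix z show "(moll e 0 h has_field_derivative moll e 1 h z) (at z within UNIV)"
        using moll_deriv[OF h, of e 0 z] e by simp
      show "norm (moll e 1 h z) \<le> L" using moll_1_bound[OF e] by simp
    qed auto
    then show ?thesis by simp
  qed
  then have "eventually (\<lambda>e. \<bar>moll e 0 h x - moll e 0 h y\<bar> \<le> L * \<bar>x - y\<bar>) (at_right 0)"
    by (auto simp: eventually_at_right_field intro: exI[of _ 1])
  then show ?thesis
    by (rule tendsto_upperbound[OF tendsto_rabs[OF tendsto_diff[OF moll_tendsto[OF h] moll_tendsto[OF h]]]]) simp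
qed

text \<open>h^k \<psi> need not be smooth, so it is replaced by \<psi> H^k with H a mollification of
  h. The identity A = -B - E + k/(k+1) G passes to the limit, where B and G have the same limit and
  -1 + k/(k+1) = -1/(k+1).\<close>

lemma chain_rule:
  assumes k: "k \<ge> 1" and M: "\<And>x. \<bar>h x\<bar> \<le> M" and \<psi>: "test_function UNIV \<psi>"
  shows "integrable lborel (\<lambda>x. h x ^ k * v x * \<psi> x)"
    "(LINT x|lborel. h x ^ k * v x * \<psi> x) = - (LINT x|lborel. D 1 \<psi> x * (h x ^ Suc k / real (Suc k)))"
proof -
  have sm: "smooth \<psi>" using \<psi> by (simp add: test_function_def)
  have M0: "M \<ge> 0" using M[of 0] by simp
  have ti: "integrable lborel (\<lambda>x. C * \<bar>D i \<psi> x\<bar>)" for i C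
    using test_function_integrable[OF \<psi>, of "\<lambda>_. 1" i] by simp
  have hm [measurable]: "h \<in> borel_measurable borel" by (rule borel_measurable_continuous_onI[OF h])
  have \<psi>c: "continuous_on A (D i \<psi>)" for i A by (rule smooth_D_continuous[OF sm])
  have \<psi>m' [measurable]: "D i \<psi> \<in> borel_measurable borel" for i by (rule borel_measurable_continuous_onI[OF \<psi>c])
  have \<psi>m [measurable]: "\<psi> \<in> borel_measurable borel" using \<psi>m'[of 0] by simp
  define d where "d n = 1 / real (Suc n)" for n
  have d: "d n > 0" for n by (simp add: d_def)
  have dlim: "d \<longlonglongrightarrow> 0" unfolding d_def by real_asymp
  define H where "H n = moll (d n) 0 h" for n
  define H' where "H' n = moll (d n) 1 h" for n
  have Hd: "(H n has_real_derivative H' n x) (at x)" for n x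
    unfolding H_def H'_def using moll_deriv[OF h, of "d n" 0 x] d[of n] by simp
  have Hc: "continuous_on A (H n)" "continuous_on A (H' n)" for n A unfolding H_def H'_def by (auto intro: moll_cont[OF h])
  have [measurable]: "H n \<in> borel_measurable borel" "H' n \<in> borel_measurable borel" for n
    by (auto intro: borel_measurable_continuous_onI Hc)
  have H'L: "\<bar>H' n x\<bar> \<le> L" for n x unfolding H'_def by (rule moll_1_bound[OF d])
  have HM: "\<bar>H n x\<bar> \<le> M" for n x
    using moll_0_near[OF h d, of x n 0 M] M by (simp add: H_def)
  have dn: "d n \<noteq> 0" for n using d[of n] by simp
  have Hlim: "(\<lambda>n. H n x) \<longlonglongrightarrow> h x" for x
    unfolding H_def by (rule filterlim_compose[OF moll_tendsto[OF h]])
      (use dlim d in \<open>auto simp: filterlim_at dn\<close>)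
  have dct: "(\<lambda>n. LINT x|lborel. g n x) \<longlonglongrightarrow> (LINT x|lborel. f x)"
    if "\<And>n. g n \<in> borel_measurable borel" "f \<in> borel_measurable borel" "AE x in lborel. (\<lambda>n. g n x) \<longlonglongrightarrow> f x"
      "\<And>n. AE x in lborel. \<bar>g n x\<bar> \<le> C * \<bar>D i \<psi> x\<bar>" for g f C i
    by (rule integral_dominated_convergence[where w="\<lambda>x. C * \<bar>D i \<psi> x\<bar>"]) (use that ti in auto)
  have smH: "smooth (\<lambda>x. \<psi> x * H n x ^ k)" for n
  proof (induction k)
    case (Suc j)
    have "smooth (H n)" unfolding H_def using smooth_moll[OF h] d[of n] by simp
    from smooth_mult[OF Suc this] show ?case by (simp add: mult_ac)
  qed (use sm in simp)
  have testH: "test_function UNIV (\<lambda>x. \<psi> x * H n x ^ k)" for n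
    using smH[of n] \<psi> unfolding test_function_def by fastforce
  have DH: "D 1 (\<lambda>x. \<psi> x * H n x ^ k) x = D 1 \<psi> x * H n x ^ k + \<psi> x * (real k * H n x ^ (k - 1) * H' n x)" for n x
  proof -
    have "((\<lambda>x. \<psi> x * H n x ^ k) has_real_derivative D 1 \<psi> x * H n x ^ k + \<psi> x * (real k * H n x ^ (k - 1) * H' n x)) (at x)"
      using smooth_D_real[OF sm, of 0 x] by (auto intro!: derivative_eq_intros Hd)
    then show ?thesis
      using DERIV_unique smooth_D_real[OF smH, of 0 n x] by auto
  qed
  have pw: "\<bar>y\<bar> ^ n \<le> M ^ n" if "\<bar>y\<bar> \<le> M" for y n using that by (intro power_mono) auto
  define A where "A n = (LINT x|lborel. H n x ^ k * v x * \<psi> x)" for n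
  define B where "B n = (LINT x|lborel. D 1 \<psi> x * (h x * H n x ^ k))" for n
  define E where "E n = (LINT x|lborel. \<psi> x * ((h x - H n x) * (real k * H n x ^ (k - 1) * H' n x)))" for n
  define G where "G n = (LINT x|lborel. D 1 \<psi> x * H n x ^ Suc k)" for n
  have ABEG: "A n = - B n - E n + real k / real (Suc k) * G n" for n
  proof -
    have ic: "integrable lborel (\<lambda>x. D i \<psi> x * f x)" "integrable lborel (\<lambda>x. \<psi> x * f x)" if "continuous_on UNIV f" for f i
      using test_function_integrable[OF \<psi> that, of i] test_function_integrable[OF \<psi> that, of 0] by (simp_all add: mult.commute)
    have i: "integrable lborel (\<lambda>x. D 1 \<psi> x * (h x * H n x ^ k))" "integrable lborel (\<lambda>x. \<psi> x * ((h x - H n x) * (real k * H n x ^ (k - 1) * H' n x)))"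
      "integrable lborel (\<lambda>x. \<psi> x * (c * H n x ^ k * H' n x))" "integrable lborel (\<lambda>x. D 1 \<psi> x * H n x ^ Suc k)"
      "integrable lborel (\<lambda>x. \<psi> x * H n x ^ Suc k)" for c
      by (intro ic continuous_intros Hc h)+
    have ci: "(LINT x|lborel. \<psi> x * (c * H n x ^ k * H' n x)) = c * (LINT x|lborel. \<psi> x * (H n x ^ k * H' n x))" for c
    proof -
      have "(\<lambda>x. \<psi> x * (c * H n x ^ k * H' n x)) = (\<lambda>x. c * (\<psi> x * (H n x ^ k * H' n x)))" by (simp add: mult_ac)
      then show ?thesis by (simp only: integral_mult_right_zero)
    qed
    have pk: "H n x * H n x ^ (k - 1) = H n x ^ k" for x using k by (simp add: power_eq_if)
    have "A n = (LINT x|lborel. v x * (\<psi> x * H n x ^ k))" unfolding A_def by (simp add: mult_ac)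
    also have "\<dots> = - (LINT x|lborel. h x * (D 1 \<psi> x * H n x ^ k + \<psi> x * (real k * H n x ^ (k - 1) * H' n x)))"
      unfolding weak[OF testH] DH ..
    also have "(\<lambda>x. h x * (D 1 \<psi> x * H n x ^ k + \<psi> x * (real k * H n x ^ (k - 1) * H' n x)))
      = (\<lambda>x. D 1 \<psi> x * (h x * H n x ^ k) + \<psi> x * ((h x - H n x) * (real k * H n x ^ (k - 1) * H' n x)) + \<psi> x * (real k * H n x ^ k * H' n x))"
      unfolding pk[symmetric] by (simp add: algebra_simps fun_eq_iff)
    also have "- (LINT x|lborel. D 1 \<psi> x * (h x * H n x ^ k) + \<psi> x * ((h x - H n x) * (real k * H n x ^ (k - 1) * H' n x)) + \<psi> x * (real k * H n x ^ k * H' n x))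
      = - B n - E n - (LINT x|lborel. \<psi> x * (real k * H n x ^ k * H' n x))"
      unfolding B_def E_def
      by (subst Bochner_Integration.integral_add[OF Bochner_Integration.integrable_add[OF i(1,2)] i(3)], subst Bochner_Integration.integral_add[OF i(1,2)]) simp
    also have "(LINT x|lborel. \<psi> x * (real k * H n x ^ k * H' n x)) = - (real k / real (Suc k) * G n)"
    proof -
      have i': "integrable lborel (\<lambda>x. D 1 \<psi> x * H n x ^ Suc k + \<psi> x * (real (Suc k) * H n x ^ k * H' n x))"
        by (rule Bochner_Integration.integrable_add[OF i(4,3)])
      have "(LINT x|lborel. D 1 \<psi> x * H n x ^ Suc k + \<psi> x * (real (Suc k) * H n x ^ k * H' n x)) = 0"
      proof (rule integral_derivative_zero[OF _ _ i(5) i'])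
        show "((\<lambda>x. \<psi> x * H n x ^ Suc k) has_real_derivative D 1 \<psi> x * H n x ^ Suc k + \<psi> x * (real (Suc k) * H n x ^ k * H' n x)) (at x)" for x
        proof -
          have "(\<psi> has_real_derivative D 1 \<psi> x) (at x)" using smooth_D_real[OF sm, of 0 x] by simp
          from DERIV_mult[OF this DERIV_power[OF Hd[of n x], of "Suc k"]] show ?thesis
            by (rule DERIV_cong) (simp only: diff_Suc_1 diff_Suc_Suc diff_zero mult_ac)
        qed
        show "continuous_on UNIV (\<lambda>x. D 1 \<psi> x * H n x ^ Suc k + \<psi> x * (real (Suc k) * H n x ^ k * H' n x))"
          using \<psi>c[of UNIV 0] by (intro continuous_intros \<psi>c Hc) simp
      qed
      then have "G n + real (Suc k) * (LINT x|lborel. \<psi> x * (H n x ^ k * H' n x)) = 0"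
        unfolding Bochner_Integration.integral_add[OF i(4,3)] ci G_def .
      then have "G n = - (real (Suc k) * (LINT x|lborel. \<psi> x * (H n x ^ k * H' n x)))" by linarith
      then show ?thesis unfolding ci by (simp del: of_nat_Suc)
    qed
    finally show ?thesis by simp
  qed
  have Alim: "A \<longlonglongrightarrow> (LINT x|lborel. h x ^ k * v x * \<psi> x)"
    unfolding A_def
  proof (rule dct[where C="M ^ k * L" and i=0])
    show "AE x in lborel. (\<lambda>n. H n x ^ k * v x * \<psi> x) \<longlonglongrightarrow> h x ^ k * v x * \<psi> x"
      by (intro AE_I2 tendsto_intros Hlim)
    show "AE x in lborel. \<bar>H n x ^ k * v x * \<psi> x\<bar> \<le> M ^ k * L * \<bar>D 0 \<psi> x\<bar>" for n
      using vL by eventually_elim (use pw HM M0 in \<open>auto simp: abs_mult power_abs intro!: mult_mono\<close>)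
  qed measurable
  have Blim: "B \<longlonglongrightarrow> (LINT x|lborel. D 1 \<psi> x * (h x * h x ^ k))"
    unfolding B_def
  proof (rule dct[where C="M * M ^ k" and i=1])
    show "AE x in lborel. (\<lambda>n. D 1 \<psi> x * (h x * H n x ^ k)) \<longlonglongrightarrow> D 1 \<psi> x * (h x * h x ^ k)"
      by (intro AE_I2 tendsto_intros Hlim)
    have "\<bar>h x\<bar> * \<bar>H n x\<bar> ^ k \<le> M * M ^ k" for n x using pw HM M M0 by (intro mult_mono) auto
    then show "AE x in lborel. \<bar>D 1 \<psi> x * (h x * H n x ^ k)\<bar> \<le> M * M ^ k * \<bar>D 1 \<psi> x\<bar>" for n
      unfolding abs_mult power_abs mult.commute[of "\<bar>D 1 \<psi> _\<bar>"] by (intro AE_I2 mult_right_mono) auto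
  qed measurable
  have Glim: "G \<longlonglongrightarrow> (LINT x|lborel. D 1 \<psi> x * h x ^ Suc k)"
    unfolding G_def
  proof (rule dct[where C="M ^ Suc k" and i=1])
    show "AE x in lborel. (\<lambda>n. D 1 \<psi> x * H n x ^ Suc k) \<longlonglongrightarrow> D 1 \<psi> x * h x ^ Suc k"
      by (intro AE_I2 tendsto_intros Hlim)
    show "AE x in lborel. \<bar>D 1 \<psi> x * H n x ^ Suc k\<bar> \<le> M ^ Suc k * \<bar>D 1 \<psi> x\<bar>" for n
      unfolding abs_mult power_abs mult.commute[of "\<bar>D 1 \<psi> _\<bar>"]
      by (intro AE_I2 mult_right_mono pw HM) auto
  qed measurable
  \<comment> \<open>H' is only known to be bounded by L; E tends to 0 because of the factor h -
    H.\<close>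
  have Elim: "E \<longlonglongrightarrow> (integral\<^sup>L lborel (\<lambda>x::real. 0::real))"
    unfolding E_def
  proof (rule dct[where C="2 * M * (real k * M ^ (k - 1) * L)" and i=0])
    have le: "\<bar>\<psi> x * ((h x - H n x) * (real k * H n x ^ (k - 1) * H' n x))\<bar> \<le> \<bar>h x - H n x\<bar> * (real k * M ^ (k - 1) * L * \<bar>\<psi> x\<bar>)" for n x
    proof -
      have "\<bar>H n x\<bar> ^ (k - 1) * \<bar>H' n x\<bar> \<le> M ^ (k - 1) * L" using pw HM H'L M0 by (intro mult_mono) auto
      then have "\<bar>h x - H n x\<bar> * real k * \<bar>\<psi> x\<bar> * (\<bar>H n x\<bar> ^ (k - 1) * \<bar>H' n x\<bar>) \<le> \<bar>h x - H n x\<bar> * real k * \<bar>\<psi> x\<bar> * (M ^ (k - 1) * L)"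
        by (intro mult_left_mono) auto
      then show ?thesis by (simp add: abs_mult power_abs mult_ac)
    qed
    have "(\<lambda>n. \<psi> x * ((h x - H n x) * (real k * H n x ^ (k - 1) * H' n x))) \<longlonglongrightarrow> 0" for x
    proof (rule Lim_null_comparison)
      have "(\<lambda>n. \<bar>h x - H n x\<bar> * (real k * M ^ (k - 1) * L * \<bar>\<psi> x\<bar>)) \<longlonglongrightarrow> \<bar>h x - h x\<bar> * (real k * M ^ (k - 1) * L * \<bar>\<psi> x\<bar>)"
        by (intro tendsto_intros Hlim)
      then show "(\<lambda>n. \<bar>h x - H n x\<bar> * (real k * M ^ (k - 1) * L * \<bar>\<psi> x\<bar>)) \<longlonglongrightarrow> 0" by simp
    qed (use le in auto)
    then show "AE x in lborel. (\<lambda>n. \<psi> x * ((h x - H n x) * (real k * H n x ^ (k - 1) * H' n x))) \<longlonglongrightarrow> 0" by simp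
    show "AE x in lborel. \<bar>\<psi> x * ((h x - H n x) * (real k * H n x ^ (k - 1) * H' n x))\<bar> \<le> 2 * M * (real k * M ^ (k - 1) * L) * \<bar>D 0 \<psi> x\<bar>" for n
    proof (rule AE_I2)
      fix x
      have "\<bar>h x - H n x\<bar> \<le> 2 * M" using M[of x] HM[of n x] by linarith
      then have "\<bar>h x - H n x\<bar> * (real k * M ^ (k - 1) * L * \<bar>\<psi> x\<bar>) \<le> 2 * M * (real k * M ^ (k - 1) * L * \<bar>\<psi> x\<bar>)"
        using M0 L by (intro mult_right_mono) auto
      with le[of x n] show "\<bar>\<psi> x * ((h x - H n x) * (real k * H n x ^ (k - 1) * H' n x))\<bar> \<le> 2 * M * (real k * M ^ (k - 1) * L) * \<bar>D 0 \<psi> x\<bar>"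
        by (simp add: mult.assoc)
    qed
  qed measurable
  show "integrable lborel (\<lambda>x. h x ^ k * v x * \<psi> x)"
  proof (rule Bochner_Integration.integrable_bound)
    show "integrable lborel (\<lambda>x. M ^ k * L * \<bar>D 0 \<psi> x\<bar>)" by (rule ti)
    show "AE x in lborel. norm (h x ^ k * v x * \<psi> x) \<le> norm (M ^ k * L * \<bar>D 0 \<psi> x\<bar>)"
      using vL by eventually_elim (use pw M M0 L in \<open>auto simp: abs_mult power_abs intro!: mult_mono\<close>)
  qed measurable
  have "A \<longlonglongrightarrow> - (LINT x|lborel. D 1 \<psi> x * (h x * h x ^ k)) - (integral\<^sup>L lborel (\<lambda>x::real. 0::real))
      + real k / real (Suc k) * (LINT x|lborel. D 1 \<psi> x * h x ^ Suc k)"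
  proof -
    have "A = (\<lambda>n. - B n - E n + real k / real (Suc k) * G n)" using ABEG by (rule ext)
    then show ?thesis by (simp only:) (intro tendsto_intros Blim Elim Glim)
  qed
  from LIMSEQ_unique[OF Alim this]
  show "(LINT x|lborel. h x ^ k * v x * \<psi> x) = - (LINT x|lborel. D 1 \<psi> x * (h x ^ Suc k / real (Suc k)))"
    by (simp add: field_simps)
qed

end

section \<open>The equation for spatial moments\<close>

lemma pd_product:
  fixes \<theta> \<psi> :: "real \<Rightarrow> real"
  assumes "smooth \<theta>" "smooth \<psi>"
  shows "pd (1, 0) (\<lambda>p. \<theta> (fst p) * \<psi> (snd p)) = (\<lambda>p. D 1 \<theta> (fst p) * \<psi> (snd p))"
    "pd (0, 1) (\<lambda>p. \<theta> (fst p) * \<psi> (snd p)) = (\<lambda>p. \<theta> (fst p) * D 1 \<psi> (snd p))"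
    "smooth (\<lambda>p. \<theta> (fst p) * \<psi> (snd p))"
proof -
  have d: "((\<lambda>p. \<theta> (fst p) * \<psi> (snd p)) has_derivative
      (\<lambda>v. \<theta> (fst p) * (snd v * D 1 \<psi> (snd p)) + fst v * D 1 \<theta> (fst p) * \<psi> (snd p))) (at p)" for p :: "real \<times> real"
    by (rule has_derivative_mult[OF pd_linear_comp[OF assms(1) bounded_linear_fst] pd_linear_comp[OF assms(2) bounded_linear_snd]])
  show "pd (1, 0) (\<lambda>p. \<theta> (fst p) * \<psi> (snd p)) = (\<lambda>p. D 1 \<theta> (fst p) * \<psi> (snd p))"
    "pd (0, 1) (\<lambda>p. \<theta> (fst p) * \<psi> (snd p)) = (\<lambda>p. \<theta> (fst p) * D 1 \<psi> (snd p))"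
    by (auto intro!: ext simp: pd_has_derivative[OF d])
  show "smooth (\<lambda>p. \<theta> (fst p) * \<psi> (snd p))"
    by (rule smooth_mult[OF smooth_linear_comp[OF assms(1) bounded_linear_fst] smooth_linear_comp[OF assms(2) bounded_linear_snd]])
qed

lemma pd_product_power:
  fixes \<theta> \<psi> :: "real \<Rightarrow> real"
  assumes "smooth \<theta>" "smooth \<psi>"
  shows "(pd (0, 1) ^^ n) (\<lambda>p. \<theta> (fst p) * \<psi> (snd p)) = (\<lambda>p. \<theta> (fst p) * D n \<psi> (snd p))"
proof (induction n)
  case (Suc n)
  have "smooth (D n \<psi>)" by (rule smooth_pd[OF assms(2)])
  from pd_product(2)[OF assms(1) this] Suc show ?case by simp
qed simp

lemma test_function_product:
  fixes \<theta> \<psi> :: "real \<Rightarrow> real"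
  assumes "test_function I \<theta>" "test_function UNIV \<psi>"
  shows "test_function (I \<times> UNIV) (\<lambda>p. \<theta> (fst p) * \<psi> (snd p))"
proof -
  from assms obtain K1 K2 where "compact K1" "K1 \<subseteq> I" "\<And>x. x \<notin> K1 \<Longrightarrow> \<theta> x = 0" "compact K2" "\<And>x. x \<notin> K2 \<Longrightarrow> \<psi> x = 0"
    and sm: "smooth \<theta>" "smooth \<psi>"
    by (auto simp: test_function_def)
  then show ?thesis
    unfolding test_function_def
    by (intro conjI pd_product(3)[OF sm] exI[of _ "K1 \<times> K2"] compact_Times) auto
qed

text \<open>The test functions are primitives of differences of mollifiers.\<close>

lemma du_Bois_Reymond:
  fixes A :: "real \<Rightarrow> real"
  assumes c: "continuous_on UNIV A"
    and z: "\<And>\<theta>. test_function {-T<..<T} \<theta> \<Longrightarrow> (LINT t|lborel. D 1 \<theta> t * A t) = 0"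
    and t: "t1 \<in> {-T<..<T}" "t2 \<in> {-T<..<T}"
  shows "A t1 = A t2"
proof -
  obtain Q where Q: "\<And>x. (Q has_real_derivative rho x) (at x)"
    using einterval_antiderivative[of "-\<infinity>" "\<infinity>" rho] smooth_D_continuous[OF smooth_rho, of UNIV 0]
    by (auto simp: continuous_on_eq_continuous_at has_real_derivative_iff_has_vector_derivative)
  have const: "Q x = Q y" if "x > 1 \<and> y > 1 \<or> x < -1 \<and> y < -1" for x y
  proof -
    have d: "(Q has_field_derivative 0) (at x within S)" if "x < -1 \<or> x > 1" for x S
    proof -
      have "rho x = 0" using rh_outside[of x 0] that by (auto simp: rh_0)
      then show ?thesis using has_field_derivative_at_within[OF Q[of x], of S] by simp
    qed
    have "\<exists>c. \<forall>x\<in>{1<..}. Q x = c" "\<exists>c. \<forall>x\<in>{..<-1}. Q x = c"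
      by (rule has_field_derivative_zero_constant, simp, rule d, simp)+
    then show ?thesis using that by fastforce
  qed
  \<comment> \<open>Half the distance of t1 and t2 to the ends, so that supports enlarged by
    \<delta> stay inside the open interval.\<close>
  define \<delta> where "\<delta> = min (min (T - t1) (T + t1)) (min (T - t2) (T + t2)) / 2"
  have \<delta>: "\<delta> > 0" using t by (auto simp: \<delta>_def)
  have eq: "moll e 0 A t1 = moll e 0 A t2" if e: "0 < e" "e < \<delta>" for e
  proof -
    \<comment> \<open>Q is constant on either side of [-1, 1], so \<open>f 0\<close> vanishes
      outside a compact set, and its derivative is the difference of the kernels at t1 and
      t2.\<close>
    define f where "f = (\<lambda>n t. case n of 0 \<Rightarrow> Q ((t2 - t) / e) - Q ((t1 - t) / e) | Suc m \<Rightarrow> D m (ker e t1) t - D m (ker e t2) t)"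
    have kc: "continuous_on UNIV (ker e x)" for x using smooth_D_continuous[OF D_ker(1)[OF e(1)], of UNIV 0] by simp
    have "(f n has_vector_derivative f (Suc n) t) (at t)" for n t
    proof (cases n)
      case 0
      show ?thesis
        unfolding 0 f_def has_real_derivative_iff_has_vector_derivative[symmetric]
        using e by (auto intro!: derivative_eq_intros DERIV_chain2[OF Q] simp: ker_def field_simps)
    next
      case (Suc m)
      show ?thesis
        unfolding Suc f_def has_real_derivative_iff_has_vector_derivative[symmetric]
        by (simp only: nat.case) (intro DERIV_diff smooth_D_real D_ker(1)[OF e(1)])
    qed
    then have sm: "smooth (f 0)" and D: "D 1 (f 0) = f 1" by (rule smooth_sequence)+
    define K where "K = {min t1 t2 - \<delta>..max t1 t2 + \<delta>}"
    have "f 0 t = 0" if "t \<notin> K" for t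
    proof -
      have "t < t1 - e \<and> t < t2 - e \<or> t > t1 + e \<and> t > t2 + e" using that e by (auto simp: K_def)
      then have "Q ((t2 - t) / e) = Q ((t1 - t) / e)"
        using e(1) by (intro const) (auto simp: field_simps)
      then show ?thesis by (simp add: f_def)
    qed
    moreover have "K \<subseteq> {-T<..<T}"
    proof -
      have "2 * \<delta> \<le> T - t1" "2 * \<delta> \<le> T - t2" "2 * \<delta> \<le> T + t1" "2 * \<delta> \<le> T + t2" by (simp_all add: \<delta>_def)
      then show ?thesis using \<delta> by (auto simp: K_def min_def max_def split: if_splits)
    qed
    ultimately have "test_function {-T<..<T} (f 0)"
      unfolding test_function_def using sm by (intro conjI exI[of _ K]) (auto simp: K_def)
    from z[OF this] have "(LINT t|lborel. ker e t1 t * A t - ker e t2 t * A t) = 0"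
      unfolding D by (simp add: f_def left_diff_distrib)
    moreover have "integrable lborel (\<lambda>t. ker e x t * A t)" for x
      by (rule compact_support_integral(1)[of _ "x - e" "x + e"])
        (auto intro!: continuous_intros kc c simp: ker_outside[OF e(1)])
    ultimately show ?thesis
      using moll_eq_D_ker[OF e(1) c, of 0 t1] moll_eq_D_ker[OF e(1) c, of 0 t2] by simp
  qed
  have "((\<lambda>e. moll e 0 A t2) \<longlongrightarrow> A t1) (at_right 0)"
    by (rule Lim_transform_eventually[OF moll_tendsto[OF c]])
      (use eq \<delta> in \<open>auto simp: eventually_at_right_field\<close>)
  from tendsto_unique[OF _ this moll_tendsto[OF c]] show ?thesis by simp
qed

lemma moment_continuous:
  fixes \<psi> :: "real \<Rightarrow> real"
  assumes \<psi>: "continuous_on UNIV \<psi>" "\<And>x. x \<notin> {-c..c} \<Longrightarrow> \<psi> x = 0"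
    and g: "continuous_on UNIV (\<lambda>(t::real, x). g t x :: real)"
  shows "continuous_on UNIV (\<lambda>t. LINT x|lborel. \<psi> x * g t x)"
proof -
  have g1: "continuous_on UNIV (g t)" for t
    using continuous_on_compose2[OF g, of UNIV "\<lambda>x. (t, x)"] by (simp add: continuous_on_Pair)
  have eq: "(LINT x|lborel. \<psi> x * g t x) = integral (cbox (-c) c) (\<lambda>x. \<psi> x * g t x)" for t
    using compact_support_integral(2)[of "\<lambda>x. \<psi> x * g t x" "-c" c] \<psi> g1 by (auto intro!: continuous_intros)
  have "continuous_on (UNIV \<times> cbox (-c) c) (\<lambda>p. \<psi> (snd p) * g (fst p) (snd p))"
    using g by (intro continuous_intros continuous_on_compose2[OF \<psi>(1)] continuous_on_subset[OF g[unfolded split_beta]]) auto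
  then show ?thesis
    unfolding eq by (intro integral_continuous_on_param) (simp add: split_beta)
qed

locale gkdv_curve =
  fixes k :: nat and T M :: real and w u v :: "real \<Rightarrow> real \<Rightarrow> real"
  assumes k: "k \<ge> 1" and T: "T > 0"
    and w_cont: "continuous_on UNIV (\<lambda>(t, x). w t x)" and w_bound: "\<And>t x. \<bar>w t x\<bar> \<le> M"
    and w_ae: "\<And>t. t \<in> {-T..T} \<Longrightarrow> AE x in lebesgue. w t x = u t x"
    and v_meas: "(\<lambda>(t, x). v t x) \<in> borel_measurable borel"
    and v_weak: "AE t in lebesgue. t \<in> {-T..T} \<longrightarrow> has_weak_deriv UNIV 1 (u t) (v t)"
    and v_L4: "(\<integral>\<^sup>+t\<in>{-T..T}. (esssup lebesgue (\<lambda>x. ennreal \<bar>v t x\<bar>)) ^ 4 \<partial>lebesgue) < \<infinity>"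
    and weak_eq: "gkdv_equation k T u v"
begin

lemma w_cont1: "continuous_on UNIV (w t)"
  using continuous_on_compose2[OF w_cont, of UNIV "\<lambda>x. (t, x)"] by (simp add: continuous_on_Pair)

lemma v_meas2 [measurable]: "(\<lambda>(t, x). v t x) \<in> borel_measurable (lborel \<Otimes>\<^sub>M lborel)"
  using v_meas by (simp add: borel_prod[symmetric] cong: measurable_cong_sets)

lemma v_meas1 [measurable]: "v t \<in> borel_measurable borel"
  using measurable_compose[OF measurable_Pair1' v_meas2, of t] by simp

definition ess :: "real \<Rightarrow> ennreal" where
  "ess t = esssup lebesgue (\<lambda>x. ennreal \<bar>v t x\<bar>)"

lemma v_leb [measurable]: "v t \<in> borel_measurable lebesgue"
  using measurable_completion[of "v t" lborel borel] by simp

text \<open>The condition ess t \<le> y says that a slice of a measurable set of the plane is null,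
  and the measure of slices depends measurably on t.\<close>

lemma ess_meas [measurable]: "ess \<in> borel_measurable borel"
proof (rule borel_measurableI_le)
  fix y :: ennreal
  have "ess t \<le> y \<longleftrightarrow> (\<integral>\<^sup>+x. indicator {p. ennreal \<bar>v (fst p) (snd p)\<bar> > y} (t, x) \<partial>lborel) = 0" for t
  proof -
    have "ess t \<le> y \<longleftrightarrow> (AE x in lebesgue. ennreal \<bar>v t x\<bar> \<le> y)"
    proof
      assume "ess t \<le> y"
      then show "AE x in lebesgue. ennreal \<bar>v t x\<bar> \<le> y"
        using esssup_AE[of "\<lambda>x. ennreal \<bar>v t x\<bar>" lebesgue] unfolding ess_def by (auto elim!: eventually_mono intro: order_trans)
    qed (auto simp: ess_def intro!: esssup_I)
    also have "\<dots> \<longleftrightarrow> (AE x in lborel. \<not> ennreal \<bar>v t x\<bar> > y)"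
      unfolding AE_completion_iff not_less ..
    also have "\<dots> \<longleftrightarrow> (\<integral>\<^sup>+x. indicator {p. ennreal \<bar>v (fst p) (snd p)\<bar> > y} (t, x) \<partial>lborel) = 0"
      by (subst nn_integral_0_iff_AE) (auto simp: indicator_def intro!: AE_cong)
    finally show ?thesis .
  qed
  then show "{t \<in> space borel. ess t \<le> y} \<in> sets borel" by simp
qed

text \<open>\<open>enn2real\<close> sends an infinite value to 0; by \<open>ess_finite\<close> this
  concerns only a null set of times in [-T, T].\<close>

definition slope :: "real \<Rightarrow> real" where "slope t = enn2real (ess t)"

lemma slope_meas [measurable]: "slope \<in> borel_measurable borel" unfolding slope_def by measurable

lemma slope_nonneg: "slope t \<ge> 0" by (simp add: slope_def)

lemma ess_L4: "(\<integral>\<^sup>+t. indicator {-T..T} t * ess t ^ 4 \<partial>lborel) < \<infinity>"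
  using v_L4 unfolding ess_def[symmetric] nn_integral_completion by (simp add: mult.commute)

lemma slope_L4: "(\<integral>\<^sup>+t. indicator {-T..T} t * ennreal ((1 + slope t) ^ 4) \<partial>lborel) < \<infinity>"
proof -
  have "ennreal ((1 + slope t) ^ 4) \<le> 8 + 8 * ess t ^ 4" for t
  proof -
    have p: "(1 + y) ^ 4 \<le> 8 + 8 * y ^ 4" for y :: real
    proof -
      have a: "(1 + z)\<^sup>2 \<le> 2 + 2 * z\<^sup>2" for z :: real using sum_squares_bound[of 1 z] by (simp add: power2_sum)
      have "(1 + y) ^ 4 = ((1 + y)\<^sup>2)\<^sup>2" by simp
      also have "\<dots> \<le> (2 + 2 * y\<^sup>2)\<^sup>2" by (intro power_mono a) simp
      also have "\<dots> = 4 * (1 + y\<^sup>2)\<^sup>2" by (simp add: power2_eq_square algebra_simps)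
      also have "\<dots> \<le> 4 * (2 + 2 * (y\<^sup>2)\<^sup>2)" using a[of "y\<^sup>2"] by simp
      finally show ?thesis by simp
    qed
    have "ennreal ((1 + slope t) ^ 4) \<le> ennreal (8 + 8 * slope t ^ 4)" by (rule ennreal_leI[OF p])
    also have "\<dots> = 8 + 8 * ennreal (slope t) ^ 4"
      using slope_nonneg by (simp add: ennreal_plus ennreal_mult ennreal_power)
    also have "\<dots> \<le> 8 + 8 * ess t ^ 4"
      by (intro add_left_mono mult_left_mono power_mono) (auto simp: slope_def ennreal_enn2real_if)
    finally show ?thesis .
  qed
  then have "(\<integral>\<^sup>+t. indicator {-T..T} t * ennreal ((1 + slope t) ^ 4) \<partial>lborel) \<le> (\<integral>\<^sup>+t. 8 * indicator {-T..T} t + 8 * (indicator {-T..T} t * ess t ^ 4) \<partial>lborel)"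
    by (intro nn_integral_mono) (auto simp: indicator_def)
  also have "\<dots> = 8 * emeasure lborel {-T..T} + 8 * (\<integral>\<^sup>+t. indicator {-T..T} t * ess t ^ 4 \<partial>lborel)"
    by (subst nn_integral_add) (auto simp: nn_integral_cmult)
  also have "\<dots> < \<infinity>" using ess_L4 T by (auto simp: ennreal_mult_less_top)
  finally show ?thesis .
qed

lemma ess_finite: "AE t in lborel. t \<in> {-T..T} \<longrightarrow> ess t \<noteq> \<infinity>"
proof -
  have "AE t in lborel. indicator {-T..T} t * ess t ^ 4 \<noteq> \<infinity>"
    by (rule nn_integral_PInf_AE) (use ess_L4 in auto)
  then show ?thesis by eventually_elim (auto simp: indicator_def)
qed

lemma slices: "AE t in lborel. t \<in> {-T..T} \<longrightarrow> lipschitz_weak_deriv (w t) (v t) (slope t)"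
  using ess_finite v_weak[unfolded AE_completion_iff]
proof eventually_elim
  case (elim t)
  show ?case
  proof
    assume t: "t \<in> {-T..T}"
    show "lipschitz_weak_deriv (w t) (v t) (slope t)"
    proof
      have "AE x in lborel. ennreal \<bar>v t x\<bar> \<le> ess t"
        using esssup_AE[of "\<lambda>x. ennreal \<bar>v t x\<bar>" lebesgue] unfolding ess_def AE_completion_iff .
      moreover have "ess t = ennreal (slope t)" using elim t by (auto simp: slope_def less_top)
      ultimately show "AE x in lborel. \<bar>v t x\<bar> \<le> slope t" using slope_nonneg by (simp add: ennreal_le_iff)
      show "(LINT x|lborel. v t x * \<phi> x) = - (LINT x|lborel. w t x * D 1 \<phi> x)" if "test_function UNIV \<phi>" for \<phi>
        by (rule weak_deriv_continuous[OF _ w_cont1 w_ae[OF t] v_meas1 that]) (use elim t in auto)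
    qed (use w_cont1 slope_nonneg in auto)
  qed
qed

lemma slope_lipschitz: "AE t in lborel. t \<in> {-T..T} \<longrightarrow> (\<forall>x y. \<bar>w t x - w t y\<bar> \<le> slope t * \<bar>x - y\<bar>)"
  using slices by eventually_elim (auto intro: lipschitz_weak_deriv.lipschitz)

context
  fixes \<psi> :: "real \<Rightarrow> real"
  assumes \<psi>: "test_function UNIV \<psi>"
begin

definition mom :: "real \<Rightarrow> real" where "mom t = (LINT x|lborel. \<psi> x * w t x)"

definition mom' :: "real \<Rightarrow> real" where
  "mom' t = (LINT x|lborel. D 3 \<psi> x * w t x) + (LINT x|lborel. D 1 \<psi> x * (w t x ^ Suc k / real (Suc k)))"

lemma mom_cont: "continuous_on UNIV mom" "continuous_on UNIV mom'"
proof -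
  obtain c where c: "smooth \<psi>" "\<And>i x. x \<notin> {-c..c} \<Longrightarrow> D i \<psi> x = 0"
    using test_function_interval[OF \<psi>] by metis
  have m: "continuous_on UNIV (\<lambda>t. LINT x|lborel. D i \<psi> x * g t x)" if "continuous_on UNIV (\<lambda>(t, x). g t x)"
    for i and g :: "real \<Rightarrow> real \<Rightarrow> real"
    by (rule moment_continuous[OF smooth_D_continuous[OF c(1)] c(2) that])
  have "continuous_on UNIV (\<lambda>(t, x). w t x ^ Suc k / real (Suc k))"
    using w_cont unfolding split_beta by (intro continuous_intros) auto
  from m[OF w_cont, of 0] m[OF w_cont, of 3] m[OF this, of 1]
  show "continuous_on UNIV mom" "continuous_on UNIV mom'"
    unfolding mom_def[abs_def] mom'_def[abs_def] by (auto intro!: continuous_intros)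
qed

text \<open>The equation is tested with \<theta>(t) \<psi>(x). Its inner integral G is computed for
  almost every t by \<open>chain_rule\<close> and agrees there with the continuous g, from which G
  also inherits measurability in t.\<close>

lemma mom_weak:
  assumes \<theta>: "test_function {-T<..<T} \<theta>"
  shows "(LINT t|lborel. D 1 \<theta> t * mom t + \<theta> t * mom' t) = 0"
proof -
  have sm: "smooth \<theta>" "smooth \<psi>" using \<theta> \<psi> by (auto simp: test_function_def)
  have \<theta>0: "D i \<theta> t = 0" if "t \<notin> {-T<..<T}" for i t using test_function_interval[OF \<theta>] that by metis
  define G where "G t = (LINT x|lebesgue. - u t x * pd (1, 0) (\<lambda>p. \<theta> (fst p) * \<psi> (snd p)) (t, x) - u t x * (pd (0, 1) ^^ 3) (\<lambda>p. \<theta> (fst p) * \<psi> (snd p)) (t, x)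
           + (u t x) ^ k * v t x * (\<theta> t * \<psi> x))" for t
  have G0: "(LINT t|lebesgue. G t) = 0"
    using weak_eq[unfolded gkdv_equation_def, rule_format, OF test_function_product[OF \<theta> \<psi>]] by (simp add: G_def)
  define g where "g t = - (D 1 \<theta> t * mom t + \<theta> t * mom' t)" for t
  have cont: "continuous_on UNIV g"
    unfolding g_def using smooth_D_continuous[OF sm(1), of UNIV 0] by (intro continuous_intros mom_cont smooth_D_continuous sm) simp
  then have gm: "g \<in> borel_measurable borel" by (rule borel_measurable_continuous_onI)
  then have gl: "g \<in> borel_measurable lebesgue" by (intro measurable_completion) simp
  have \<psi>c: "continuous_on A (D i \<psi>)" for i A by (rule smooth_D_continuous[OF sm(2)])
  have [measurable]: "D i \<psi> \<in> borel_measurable borel" for i by (rule borel_measurable_continuous_onI[OF \<psi>c])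
  have \<psi>m [measurable]: "\<psi> \<in> borel_measurable borel" using \<open>D 0 \<psi> \<in> borel_measurable borel\<close> by simp
  have wm [measurable]: "w t \<in> borel_measurable borel" for t by (rule borel_measurable_continuous_onI[OF w_cont1])
  have "AE t in lborel. g t = G t"
    using slices
  proof eventually_elim
    case (elim t)
    show "g t = G t"
    proof (cases "t \<in> {-T<..<T}")
      case False
      then show ?thesis
        using \<theta>0[OF False, of 0] \<theta>0[OF False, of 1] unfolding g_def G_def pd_product(1)[OF sm] pd_product_power[OF sm] by simp
    next
      case True
      then have tT: "t \<in> {-T..T}" by auto
      interpret lipschitz_weak_deriv "w t" "v t" "slope t" using elim tT by blast
      let ?f = "\<lambda>x. - w t x * (D 1 \<theta> t * \<psi> x) - w t x * (\<theta> t * D 3 \<psi> x) + (w t x) ^ k * v t x * (\<theta> t * \<psi> x)"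
      have "G t = (LINT x|lebesgue. ?f x)"
        unfolding G_def pd_product(1)[OF sm] pd_product_power[OF sm] fst_conv snd_conv
      proof (rule integral_cong_AE)
        show fm: "?f \<in> borel_measurable lebesgue" by (rule measurable_completion) measurable
        show ae: "AE x in lebesgue. - u t x * (D 1 \<theta> t * \<psi> x) - u t x * (\<theta> t * D 3 \<psi> x) + (u t x) ^ k * v t x * (\<theta> t * \<psi> x) = ?f x"
          using w_ae[OF tT] by eventually_elim simp
        show "(\<lambda>x. - u t x * (D 1 \<theta> t * \<psi> x) - u t x * (\<theta> t * D 3 \<psi> x) + (u t x) ^ k * v t x * (\<theta> t * \<psi> x)) \<in> borel_measurable lebesgue"
          by (rule borel_measurable_AE[OF fm]) (use ae in \<open>auto elim!: eventually_mono\<close>)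
      qed
      also have "\<dots> = (LINT x|lborel. ?f x)" by (rule integral_completion) measurable
      also have "?f = (\<lambda>x. - D 1 \<theta> t * (\<psi> x * w t x) - \<theta> t * (D 3 \<psi> x * w t x) + \<theta> t * ((w t x) ^ k * v t x * \<psi> x))"
        by (simp add: fun_eq_iff algebra_simps)
      also have "(LINT x|lborel. - D 1 \<theta> t * (\<psi> x * w t x) - \<theta> t * (D 3 \<psi> x * w t x) + \<theta> t * ((w t x) ^ k * v t x * \<psi> x))
        = - D 1 \<theta> t * mom t - \<theta> t * (LINT x|lborel. D 3 \<psi> x * w t x) + \<theta> t * (LINT x|lborel. (w t x) ^ k * v t x * \<psi> x)"
      proof -
        have i: "integrable lborel (\<lambda>x. \<psi> x * w t x)" "integrable lborel (\<lambda>x. D 3 \<psi> x * w t x)"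
          using test_function_integrable[OF \<psi> w_cont1, of t 0] test_function_integrable[OF \<psi> w_cont1, of t 3]
          by (simp_all add: mult.commute)
        show ?thesis
          using i chain_rule(1)[OF k w_bound \<psi>] by (simp add: mom_def del: mult_minus_left) 
      qed
      also have "(LINT x|lborel. (w t x) ^ k * v t x * \<psi> x) = - (LINT x|lborel. D 1 \<psi> x * (w t x ^ Suc k / real (Suc k)))"
        by (rule chain_rule(2)[OF k w_bound \<psi>])
      finally show ?thesis by (simp add: g_def mom'_def algebra_simps)
    qed
  qed
  then have ae: "AE t in lebesgue. g t = G t" unfolding AE_completion_iff .
  have "(LINT t|lebesgue. g t) = 0"
    unfolding G0[symmetric] by (rule integral_cong_AE[OF gl borel_measurable_AE[OF gl ae] ae])
  then have "(LINT t|lborel. g t) = 0" using integral_completion[of g lborel] gm by simp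
  then show ?thesis by (simp add: g_def del: minus_add_distrib)
qed

text \<open>With P a primitive of \<open>mom'\<close>, the difference mom - P has weak derivative 0
  on the open interval. It is constant there by du Bois-Reymond, and by continuity up to the end
  points.\<close>

lemma mom_equation:
  assumes t: "-T \<le> t1" "t1 \<le> t2" "t2 \<le> T"
  shows "mom t2 - mom t1 = integral {t1..t2} mom'"
proof -
  obtain P where P: "\<And>t. (P has_real_derivative mom' t) (at t)"
    using einterval_antiderivative[of "-\<infinity>" "\<infinity>" mom'] mom_cont(2)
    by (auto simp: continuous_on_eq_continuous_at has_real_derivative_iff_has_vector_derivative)
  have Pc: "continuous_on UNIV P" using P by (auto intro!: continuous_at_imp_continuous_on DERIV_isCont)
  have c: "continuous_on UNIV (\<lambda>t. mom t - P t)" by (intro continuous_intros mom_cont Pc)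
  have z: "(LINT t|lborel. D 1 \<theta> t * (mom t - P t)) = 0" if \<theta>: "test_function {-T<..<T} \<theta>" for \<theta>
  proof -
    have sm: "smooth \<theta>" using \<theta> by (simp add: test_function_def)
    have i: "integrable lborel (\<lambda>t. D 1 \<theta> t * mom t)" "integrable lborel (\<lambda>t. D 1 \<theta> t * P t)" "integrable lborel (\<lambda>t. \<theta> t * mom' t)" "integrable lborel (\<lambda>t. \<theta> t * P t)"
      using test_function_integrable[OF \<theta> mom_cont(1), of 1] test_function_integrable[OF \<theta> Pc, of 1]
        test_function_integrable[OF \<theta> mom_cont(2), of 0] test_function_integrable[OF \<theta> Pc, of 0]
      by (simp_all add: mult.commute)
    have "(LINT t|lborel. D 1 \<theta> t * P t + \<theta> t * mom' t) = 0"
    proof (rule integral_derivative_zero[OF _ _ i(4) Bochner_Integration.integrable_add[OF i(2,3)]])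
      fix t
      have "(\<theta> has_real_derivative D 1 \<theta> t) (at t)" using smooth_D_real[OF sm, of 0 t] by simp
      from DERIV_mult[OF this P[of t]]
      show "((\<lambda>t. \<theta> t * P t) has_real_derivative D 1 \<theta> t * P t + \<theta> t * mom' t) (at t)"
        by (rule DERIV_cong) (simp add: mult.commute)
      show "continuous_on UNIV (\<lambda>t. D 1 \<theta> t * P t + \<theta> t * mom' t)"
        using smooth_D_continuous[OF sm, of UNIV 0] by (intro continuous_intros smooth_D_continuous sm Pc mom_cont) simp
    qed
    with mom_weak[OF \<theta>] i show ?thesis by (simp add: right_diff_distrib)
  qed
  have "mom t - P t = mom 0 - P 0" if "t \<in> {-T..T}" for t
  proof (rule continuous_constant_on_closure[of "{-T<..<T}" "\<lambda>t. mom t - P t"])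
    show "continuous_on (closure {-T<..<T}) (\<lambda>t. mom t - P t)" by (rule continuous_on_subset[OF c]) simp
    show "mom t - P t = mom 0 - P 0" if "t \<in> {-T<..<T}" for t
      by (rule du_Bois_Reymond[OF c z that]) (use T in auto)
    show "t \<in> closure {-T<..<T}" using that T by simp
  qed
  from this[of t1] this[of t2] t have "mom t2 - mom t1 = P t2 - P t1" by simp
  moreover have "(mom' has_integral (P t2 - P t1)) {t1..t2}"
    by (rule fundamental_theorem_of_calculus[OF t(2)])
      (use P in \<open>auto simp: has_real_derivative_iff_has_vector_derivative intro: has_vector_derivative_at_within\<close>)
  ultimately show ?thesis by (simp add: integral_unique)
qed

end

end

section \<open>Both time directions\<close>

lemma lborel_integral_reflect: "(LINT x|lborel. f (- x)) = (LINT x::real|lborel. f x :: real)"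
  using lborel_integral_real_affine[of "-1" f 0] by simp

lemma nn_integral_lborel_reflect:
  fixes f :: "real \<Rightarrow> ennreal"
  shows "f \<in> borel_measurable borel \<Longrightarrow> (\<integral>\<^sup>+x. f (- x) \<partial>lborel) = (\<integral>\<^sup>+x. f x \<partial>lborel)"
  using nn_integral_real_affine[of f "-1" 0] by simp

lemma AE_lborel_reflect:
  assumes "AE x::real in lborel. P x"
  shows "AE x in lborel. P (- x)"
proof -
  obtain N where N: "{x \<in> space lborel. \<not> P x} \<subseteq> N" "emeasure lborel N = 0" "N \<in> sets lborel"
    using assms by (rule AE_E)
  have [measurable]: "N \<in> sets borel" using N(3) by simp
  have "AE x in lborel. x \<notin> N" using N by (intro AE_not_in) auto
  from AE_borel_affine[OF _ _ this, of "-1" 0] have "AE x in lborel. - x \<notin> N" by simp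
  then show ?thesis by eventually_elim (use N(1) in auto)
qed

lemma reflect_test:
  assumes "smooth (\<psi> :: real \<Rightarrow> real)"
  shows "smooth (\<lambda>x. \<psi> (- x))" "D n (\<lambda>x. \<psi> (- x)) x = (-1) ^ n * D n \<psi> (- x)"
  using D_affine(1)[OF assms, of "-1" 0] D_affine(2)[OF assms, of n "-1" 0] by simp_all

locale gkdv_curve_L2 = gkdv_curve +
  fixes K2 :: real
  assumes M: "M \<ge> 1" and K2: "K2 \<ge> 0" and w_L2: "\<And>t. (\<integral>\<^sup>+x. ennreal ((w t x)\<^sup>2) \<partial>lborel) \<le> ennreal K2"
begin

lemma test_function_UNIV:
  assumes "smooth (\<psi> :: real \<Rightarrow> real)" "\<exists>R. \<forall>x. \<bar>x\<bar> > R \<longrightarrow> \<psi> x = 0"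
  shows "test_function UNIV \<psi>"
proof -
  obtain R where "\<And>x. \<bar>x\<bar> > R \<Longrightarrow> \<psi> x = 0" using assms(2) by blast
  then show ?thesis
    unfolding test_function_def using assms(1) by (intro conjI exI[of _ "{-R..R}"]) (auto simp: not_le)
qed

sublocale forward: gkdv_half k T M K2 w slope
proof
  fix \<psi> :: "real \<Rightarrow> real" and t1 t2
  assume \<psi>: "smooth \<psi>" "\<exists>R. \<forall>x. \<bar>x\<bar> > R \<longrightarrow> \<psi> x = 0" and t: "0 \<le> t1" "t1 \<le> t2" "t2 \<le> T"
  note test = test_function_UNIV[OF \<psi>]
  show "(LINT x|lborel. \<psi> x * w t2 x) - (LINT x|lborel. \<psi> x * w t1 x) =
      integral {t1..t2} (\<lambda>t. (LINT x|lborel. D 3 \<psi> x * w t x) + (LINT x|lborel. D 1 \<psi> x * (w t x ^ Suc k / real (Suc k))))"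
    using mom_equation[OF test, of t1 t2] t T by (simp only: mom_def[OF test] mom'_def[OF test, abs_def])
next
  show "AE t in lborel. t \<in> {0..T} \<longrightarrow> (\<forall>x y. \<bar>w t x - w t y\<bar> \<le> slope t * \<bar>x - y\<bar>)"
    using slope_lipschitz by eventually_elim (use T in auto)
  have "(\<integral>\<^sup>+t. indicator {0..T} t * ennreal ((1 + slope t) ^ 4) \<partial>lborel) \<le> (\<integral>\<^sup>+t. indicator {-T..T} t * ennreal ((1 + slope t) ^ 4) \<partial>lborel)"
    by (intro nn_integral_mono mult_right_mono) (use T in \<open>auto simp: indicator_def\<close>)
  then show "(\<integral>\<^sup>+t. indicator {0..T} t * ennreal ((1 + slope t) ^ 4) \<partial>lborel) < \<infinity>"
    using slope_L4 by (rule le_less_trans)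
qed (use k T M K2 w_cont w_bound w_L2 slope_nonneg slope_meas in auto)

sublocale backward: gkdv_half k T M K2 "\<lambda>t x. w (- t) (- x)" "\<lambda>t. slope (- t)"
proof
  fix \<psi> :: "real \<Rightarrow> real" and t1 t2
  assume \<psi>: "smooth \<psi>" "\<exists>R. \<forall>x. \<bar>x\<bar> > R \<longrightarrow> \<psi> x = 0" and t: "0 \<le> t1" "t1 \<le> t2" "t2 \<le> T"
  have "\<exists>R. \<forall>x. \<bar>x\<bar> > R \<longrightarrow> \<psi> (- x) = 0" using \<psi>(2) by (metis abs_minus_cancel)
  note test = test_function_UNIV[OF reflect_test(1)[OF \<psi>(1)] this]
  let ?m = "mom (\<lambda>x. \<psi> (- x))" and ?m' = "mom' (\<lambda>x. \<psi> (- x))"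
  have m: "(LINT x|lborel. \<psi> x * w (- t) (- x)) = ?m (- t)" for t
    using lborel_integral_reflect[of "\<lambda>x. \<psi> (- x) * w (- t) x"] by (simp add: mom_def[OF test])
  \<comment> \<open>Both derivatives of \<psi> have odd order, so the reflection in x changes the
    sign, and the reversal of time changes it back.\<close>
  have m': "(LINT x|lborel. D 3 \<psi> x * w (- t) (- x)) + (LINT x|lborel. D 1 \<psi> x * (w (- t) (- x) ^ Suc k / real (Suc k))) = - ?m' (- t)" for t
    unfolding mom'_def[OF test] reflect_test(2)[OF \<psi>(1)]
    using lborel_integral_reflect[of "\<lambda>x. D 3 \<psi> (- x) * w (- t) x"]
      lborel_integral_reflect[of "\<lambda>x. D 1 \<psi> (- x) * (w (- t) x ^ Suc k / real (Suc k))"]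
    by (simp add: numeral_3_eq_3)
  have "?m (- t1) - ?m (- t2) = integral {-t2..-t1} ?m'"
    using mom_equation[OF test, of "- t2" "- t1"] t T by simp
  also have "\<dots> = integral {t1..t2} (\<lambda>t. ?m' (- t))"
    using Henstock_Kurzweil_Integration.integral_reflect_real[of t2 t1 "\<lambda>t. ?m' (- t)"] by simp
  finally have "?m (- t2) - ?m (- t1) = integral {t1..t2} (\<lambda>t. - ?m' (- t))" by simp
  then show "(LINT x|lborel. \<psi> x * w (- t2) (- x)) - (LINT x|lborel. \<psi> x * w (- t1) (- x)) =
      integral {t1..t2} (\<lambda>t. (LINT x|lborel. D 3 \<psi> x * w (- t) (- x)) + (LINT x|lborel. D 1 \<psi> x * (w (- t) (- x) ^ Suc k / real (Suc k))))"
    unfolding m m' .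
next
  have "continuous_on UNIV (\<lambda>p. (\<lambda>(t, x). w t x) (- fst p, - snd p))"
    by (rule continuous_on_compose2[OF w_cont]) (auto intro!: continuous_intros)
  then show "continuous_on UNIV (\<lambda>(t, x). w (- t) (- x))" by (simp add: split_beta)
  show "(\<integral>\<^sup>+x. ennreal ((w (- t) (- x))\<^sup>2) \<partial>lborel) \<le> ennreal K2" for t
  proof -
    have "(\<lambda>x. ennreal ((w (- t) x)\<^sup>2)) \<in> borel_measurable borel"
      by (intro measurable_compose[OF _ measurable_ennreal] borel_measurable_continuous_onI continuous_intros w_cont1)
    from nn_integral_lborel_reflect[OF this] w_L2[of "- t"] show ?thesis by simp
  qed
  show "AE t in lborel. t \<in> {0..T} \<longrightarrow> (\<forall>x y. \<bar>w (- t) (- x) - w (- t) (- y)\<bar> \<le> slope (- t) * \<bar>x - y\<bar>)"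
    using AE_lborel_reflect[OF slope_lipschitz]
  proof eventually_elim
    case (elim t)
    show ?case
    proof (intro impI allI)
      fix x y assume "t \<in> {0..T}"
      then have "- t \<in> {-T..T}" using T by auto
      with elim have "\<bar>w (- t) (- x) - w (- t) (- y)\<bar> \<le> slope (- t) * \<bar>- x - (- y)\<bar>" by blast
      then show "\<bar>w (- t) (- x) - w (- t) (- y)\<bar> \<le> slope (- t) * \<bar>x - y\<bar>" by (simp add: abs_minus_commute)
    qed
  qed
  have "(\<integral>\<^sup>+t. indicator {0..T} t * ennreal ((1 + slope (- t)) ^ 4) \<partial>lborel)
    \<le> (\<integral>\<^sup>+t. indicator {-T..T} (- t) * ennreal ((1 + slope (- t)) ^ 4) \<partial>lborel)"
    by (intro nn_integral_mono mult_right_mono) (use T in \<open>auto simp: indicator_def\<close>)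
  also have "\<dots> = (\<integral>\<^sup>+t. indicator {-T..T} t * ennreal ((1 + slope t) ^ 4) \<partial>lborel)"
    by (rule nn_integral_lborel_reflect) measurable
  finally show "(\<integral>\<^sup>+t. indicator {0..T} t * ennreal ((1 + slope (- t)) ^ 4) \<partial>lborel) < \<infinity>"
    using slope_L4 by (rule le_less_trans)
  show "(\<lambda>t. slope (- t)) \<in> borel_measurable borel" by measurable
qed (use k T M K2 w_bound slope_nonneg in auto)

lemma regularity:
  assumes r: "r \<ge> 1" and init: "(\<integral>\<^sup>+x. ennreal (\<bar>x\<bar> ^ r * (w 0 x)\<^sup>2) \<partial>lborel) < \<infinity>" and b: "b > 0"
  shows "t \<in> {0<..T} \<Longrightarrow> weak_deriv_sq_integrable_on {b<..} r (u t)"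
    and "t \<in> {-T..<0} \<Longrightarrow> weak_deriv_sq_integrable_on {..<-b} r (u t)"
proof -
  have Wn: "Wn 0 r f \<le> (\<integral>\<^sup>+x. ennreal (\<bar>x\<bar> ^ r * (f x)\<^sup>2) \<partial>lborel)" for f
    unfolding Wn_def by (intro nn_integral_mono) (auto simp: indicator_def)
  have init': "Wn 0 r (w 0) < \<infinity>" "Wn 0 r (\<lambda>x. w (- 0) (- x)) < \<infinity>"
  proof -
    show "Wn 0 r (w 0) < \<infinity>" using Wn init by (rule le_less_trans)
    have "(\<lambda>x. ennreal (\<bar>x\<bar> ^ r * (w 0 x)\<^sup>2)) \<in> borel_measurable borel"
      by (intro measurable_compose[OF _ measurable_ennreal] borel_measurable_continuous_onI continuous_intros w_cont1)
    from nn_integral_lborel_reflect[OF this] init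
    have "(\<integral>\<^sup>+x. ennreal (\<bar>x\<bar> ^ r * (w (- 0) (- x))\<^sup>2) \<partial>lborel) < \<infinity>" by simp
    with Wn show "Wn 0 r (\<lambda>x. w (- 0) (- x)) < \<infinity>" by (rule le_less_trans)
  qed
  {
    assume t: "t \<in> {0<..T}"
    obtain K where "K \<ge> 0" "\<And>\<phi>. test_function {b<..} \<phi> \<Longrightarrow> \<bar>LINT x|lborel. w t x * D r \<phi> x\<bar> \<le> K * sqrt (LINT x|lborel. (\<phi> x)\<^sup>2)"
      using forward.weak_derivative_bound[OF init'(1) b t] by auto
    then show "weak_deriv_sq_integrable_on {b<..} r (u t)"
      by (intro weak_derivI[OF _ w_cont1 w_ae]) (use t T in auto)
  next
    assume t: "t \<in> {-T..<0}"
    obtain K where K: "K \<ge> 0" "\<And>\<phi>. test_function {b<..} \<phi> \<Longrightarrow> \<bar>LINT x|lborel. w (- (- t)) (- x) * D r \<phi> x\<bar> \<le> K * sqrt (LINT x|lborel. (\<phi> x)\<^sup>2)"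
      using backward.weak_derivative_bound[OF init'(2) b, of "- t"] t by auto
    show "weak_deriv_sq_integrable_on {..<-b} r (u t)"
    proof (rule weak_derivI[OF _ w_cont1 w_ae K(1)])
      fix \<phi> :: "real \<Rightarrow> real" assume \<phi>: "test_function {..<-b} \<phi>"
      then obtain S where S: "compact S" "S \<subseteq> {..<-b}" "\<And>x. x \<notin> S \<Longrightarrow> \<phi> x = 0" and sm: "smooth \<phi>"
        by (auto simp: test_function_def)
      have "test_function {b<..} (\<lambda>x. \<phi> (- x))"
        unfolding test_function_def
      proof (intro conjI exI[of _ "uminus ` S"] allI impI)
        show "compact (uminus ` S)" by (intro compact_continuous_image continuous_intros S(1))
        show "\<phi> (- x) = 0" if "x \<notin> uminus ` S" for x
          by (rule S(3)) (use that in \<open>force simp: image_iff\<close>)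
      qed (use S(2) reflect_test(1)[OF sm] in auto)
      from K(2)[OF this]
      have "\<bar>LINT x|lborel. w t (- x) * ((-1) ^ r * D r \<phi> (- x))\<bar> \<le> K * sqrt (LINT x|lborel. (\<phi> (- x))\<^sup>2)"
        by (simp only: reflect_test(2)[OF sm] minus_minus)
      also have "(LINT x|lborel. (\<phi> (- x))\<^sup>2) = (LINT x|lborel. (\<phi> x)\<^sup>2)" by (rule lborel_integral_reflect)
      also have "(LINT x|lborel. w t (- x) * ((-1) ^ r * D r \<phi> (- x))) = (LINT x|lborel. w t x * ((-1) ^ r * D r \<phi> x))"
        by (rule lborel_integral_reflect)
      also have "(LINT x|lborel. w t x * ((-1) ^ r * D r \<phi> x)) = (-1) ^ r * (LINT x|lborel. w t x * D r \<phi> x)"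
        by (subst integral_mult_right_zero[symmetric]) (simp add: mult_ac)
      finally show "\<bar>LINT x|lborel. w t x * D r \<phi> x\<bar> \<le> K * sqrt (LINT x|lborel. (\<phi> x)\<^sup>2)"
        by (simp add: abs_mult power_abs)
    qed (use t T in auto)
  }
qed

end

theorem corollary1p7:
  fixes k r :: nat and s0 s T :: real
    and u0 :: "real \<Rightarrow> real" and u :: "real \<Rightarrow> real \<Rightarrow> real"
  assumes "k \<ge> 1" and "s0 > 3/4" and "s > s0" and "r \<ge> 1" and "real r > s"
    and "u0 \<in> Z s (real r)"
    and "T > 0"
    and "gkdv_solution k s0 T u0 u"
    and "continuous_curve (Z s s) (Z_norm s s) T u"
  shows "\<forall>b>0. (\<forall>t\<in>{0<..T}. weak_deriv_sq_integrable_on {b<..} r (u t)) \<and>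
               (\<forall>t\<in>{-T..<0}. weak_deriv_sq_integrable_on {..<-b} r (u t))"
proof -
  note sol = assms(8)[unfolded gkdv_solution_def]
  have u_init: "AE x in lebesgue. u 0 x = u0 x" and curve: "continuous_curve (Hs s0) (Hs_norm s0) T u"
    using sol by blast+
  obtain v where v: "(\<lambda>(t, x). v t x) \<in> borel_measurable borel"
    "AE t in lebesgue. t \<in> {-T..T} \<longrightarrow> has_weak_deriv UNIV 1 (u t) (v t)"
    "(\<integral>\<^sup>+t\<in>{-T..T}. (esssup lebesgue (\<lambda>x. ennreal \<bar>v t x\<bar>)) ^ 4 \<partial>lebesgue) < \<infinity>"
    "gkdv_equation k T u v"
    using sol by blast
  obtain w where w: "\<And>t. t \<in> {-T..T} \<Longrightarrow> continuous_on UNIV (w t)" "\<And>t. t \<in> {-T..T} \<Longrightarrow> AE x in lebesgue. w t x = u t x"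
    and w_sup: "(\<integral>\<^sup>+x. (SUP t\<in>{-T..T}. ennreal ((w t x)\<^sup>2)) \<partial>lebesgue) < \<infinity>"
    using sol by blast
  \<comment> \<open>The assumptions concern times in [-T, T] only; clamping produces a function that
    is bounded and continuous for all times.\<close>
  define c where "c t = max (-T) (min T t)" for t
  have c: "c t \<in> {-T..T}" "t \<in> {-T..T} \<Longrightarrow> c t = t" for t using \<open>T > 0\<close> by (auto simp: c_def)
  obtain M where M: "M \<ge> 1" "\<And>t x. t \<in> {-T..T} \<Longrightarrow> \<bar>w t x\<bar> \<le> M"
    using curve_continuous(2)[OF \<open>s0 > 3/4\<close> \<open>T > 0\<close> curve w] by auto
  \<comment> \<open>The integral of the supremum over t dominates every time slice and so gives an
    L^2 bound uniform in t.\<close>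
  define K2 where "K2 = enn2real (\<integral>\<^sup>+x. (SUP t\<in>{-T..T}. ennreal ((w t x)\<^sup>2)) \<partial>lebesgue)"
  interpret gkdv_curve_L2 k T M "\<lambda>t. w (c t)" u v K2
  proof
    show "continuous_on UNIV (\<lambda>(t, x). w (c t) x)"
      unfolding c_def by (rule curve_continuous(1)[OF \<open>s0 > 3/4\<close> \<open>T > 0\<close> curve w])
    fix t
    have "(\<integral>\<^sup>+x. ennreal ((w (c t) x)\<^sup>2) \<partial>lebesgue) \<le> (\<integral>\<^sup>+x. (SUP t\<in>{-T..T}. ennreal ((w t x)\<^sup>2)) \<partial>lebesgue)"
      by (intro nn_integral_mono SUP_upper c)
    also have "\<dots> = ennreal K2" using w_sup by (simp add: K2_def)
    finally show "(\<integral>\<^sup>+x. ennreal ((w (c t) x)\<^sup>2) \<partial>lborel) \<le> ennreal K2" by (simp add: nn_integral_completion)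
  qed (use assms(1,7) v w(2) M c in \<open>auto simp: K2_def\<close>)
  have "AE x in lborel. w (c 0) x = u0 x"
    using w(2)[of 0] u_init c(2)[of 0] \<open>T > 0\<close> unfolding AE_completion_iff by (auto elim: eventually_elim2)
  then have "(\<integral>\<^sup>+x. ennreal (\<bar>x\<bar> ^ r * (w (c 0) x)\<^sup>2) \<partial>lborel) = (\<integral>\<^sup>+x. ennreal (\<bar>x\<bar> powr real r * (u0 x)\<^sup>2) \<partial>lborel)"
  proof (intro nn_integral_cong_AE, eventually_elim)
    case (elim x)
    \<comment> \<open>At x = 0 both sides are 0, because r \<ge> 1.\<close>
    have "\<bar>x\<bar> powr real r = \<bar>x\<bar> ^ r" using \<open>r \<ge> 1\<close> by (cases "x = 0") (auto simp: powr_realpow)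
    with elim show ?case by simp
  qed
  also have "\<dots> = (\<integral>\<^sup>+x. ennreal (norm (\<bar>x\<bar> powr real r * (u0 x)\<^sup>2)) \<partial>lebesgue)"
    by (simp add: nn_integral_completion abs_mult)
  also have "\<dots> < \<infinity>"
    using \<open>u0 \<in> Z s (real r)\<close> by (simp add: Z_def integrable_iff_bounded)
  finally show ?thesis using regularity[OF \<open>r \<ge> 1\<close>] by blast
qed

end
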